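(* Let $\tau$ be a point of the upper half-plane $\mathfrak h$ and set $$Z_{\mathbb Q}(\tau,s)=\frac{\widehat E(\tau,s)}{\Lambda_{\mathbb Q}(s)},\qquad Z^\vee_{\mathbb Q}(\tau,s)=\frac{\Lambda_{\mathbb Q}(2s)\Lambda_{\mathbb Q}(2s-1)}{\widehat E(\tau,s)}.$$ The functions $$h_{\mathbb Q}(\tau,x)=f_{Z_{\mathbb Q}(\tau,\cdot)}(x)-x^{-1}f_{Z_{\mathbb Q}(\tau,\cdot)}(x^{-1}),\qquad h^\vee_{\mathbb Q}(\tau,x)=f_{Z^\vee_{\mathbb Q}(\tau,\cdot)}(x)-x^{-1}f_{Z^\vee_{\mathbb Q}(\tau,\cdot)}(x^{-1})$$ are (as functions of $x$) $\mathcal C^\infty_{\rm poly}(\mathbb R_+^\times)$-mean-periodic and $\mathbf S(\mathbb R_+^\times)^*$-mean-periodic. Moreover, if $x\mapsto h_{\mathbb Q}(\tau,x)$ does not vanish identically, then the single sign property for $h_{\mathbb Q}(\tau,x)$ (there is $t_0$ such that $h_{\mathbb Q}(\tau,e^{-t})$ is of constant sign for $t\in(t_0,+\infty)$) implies that all the poles of $Z_{\mathbb Q}(\tau,s)$ lie on the critical line $\mathrm{Re}(s)=1/2$.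
   Context: $\Lambda_{\mathbb Q}(s)=\pi^{-s/2}\Gamma(s/2)\zeta(s)$. $\widehat E(\tau,s)=\Lambda_{\mathbb Q}(2s)E(\tau,s)$, where $E(\tau,s)=\sum\frac{y^s}{|c\tau+d|^{2s}}$, the sum running over $\left(\begin{smallmatrix}*&*\\c&d\end{smallmatrix}\right)\in\Gamma_\infty\backslash\Gamma$, $\Gamma=PSL(2,\mathbb Z)$, $\Gamma_\infty$ the subgroup of upper triangular elements, $y=\mathrm{Im}\,\tau$, $\mathrm{Re}(s)>1$; $\widehat E(\tau,s)$ continues meromorphically to $\mathbb C$ with simple poles at $s=0,1$ and $\widehat E(\tau,s)=\widehat E(\tau,1-s)$. Inverse Mellin transform: $f_Z(x)=\frac1{2\pi i}\int_{(c)}Z(s)x^{-s}ds$ over $\mathrm{Re}(s)=c$, with $c>1/2+w$ where $w>0$ (depending on $\tau$) is such that all poles of $Z$ lie in $|\mathrm{Re}(s)-1/2|\le w$. $\mathbb R_+^\times=(0,\infty)$. $\mathcal C^\infty_{\exp}(\mathbb R)=\bigcup_{m\ge1}F_m$, where $F_m$ is the Fréchet space of smooth $f:\mathbb R\to\mathbb C$ with $\sup_x|f^{(n)}(x)|e^{-m|x|}<\infty$ for all $n\ge0$, with the inductive limit topology. $\mathcal C^\infty_{\rm poly}(\mathbb R_+^\times)$ is the space of functions $h$ on $\mathbb R_+^\times$ such that $t\mapsto h(e^{-t})$ is in $\mathcal C^\infty_{\exp}(\mathbb R)$, with the transported topology. $\mathbf S(\mathbb R_+^\times)$ is the Fréchet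 space of smooth $f$ on $\mathbb R_+^\times$ with $\sup_{x>0}|x^mf^{(n)}(x)|<\infty$ for all $m\in\mathbb Z$, $n\ge0$. $X^*$ denotes the topological dual; the dual of $\mathbf S(\mathbb R_+^\times)^*$ (weak-$*$ topology) is identified with $\mathbf S(\mathbb R_+^\times)$. A locally integrable function $h$ of at most polynomial growth at $0^+$ and $+\infty$ is viewed as an element of $\mathbf S(\mathbb R_+^\times)^*$ via $g\mapsto\int_0^\infty g(x)h(x)\frac{dx}x$. Convolution: $(f\ast_\times\varphi)(x)=\langle f(x/\cdot),\varphi\rangle$; for functions $(f\ast_\times h)(x)=\int_0^\infty f(x/y)h(y)\frac{dy}y$. For $X=\mathcal C^\infty_{\rm poly}(\mathbb R_+^\times)$ or $\mathbf S(\mathbb R_+^\times)^*$, $h\in X$ is $X$-mean-periodic if there is a nonzero $\varphi\in X^*$ with $h\ast_\times\varphi=0$. *)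

theory Defs
  imports "HOL-Complex_Analysis.Complex_Analysis" "HOL-Library.Landau_Symbols"
begin

subsection \<open>The meromorphic functions\<close>

text \<open>
  Meromorphic continuation to the whole plane of a function given on \<open>Re s > 1\<close>. It is unique
  because a nicely meromorphic function has no removable singularities and is \<open>0\<close> at its poles.
  Below, \<open>remove_sings\<close> is wrapped around products and quotients of meromorphic functions for the
  same reason: pointwise they have wrong values at finitely or countably many points
  (e.g. \<open>Gamma\<close> and division return \<open>0\<close> at poles).
\<close>
definition meromorphic_continuation :: "(complex \<Rightarrow> complex) \<Rightarrow> complex \<Rightarrow> complex" where
  "meromorphic_continuation f =
     (THE g. g nicely_meromorphic_on UNIV \<and> (\<forall>s. Re s > 1 \<longrightarrow> g s = f s))"

definition riemann_zeta :: "complex \<Rightarrow> complex" where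
  "riemann_zeta = meromorphic_continuation (\<lambda>s. \<Sum>n. 1 / of_nat (Suc n) powr s)"

definition Lambda_Q :: "complex \<Rightarrow> complex" where
  "Lambda_Q = remove_sings (\<lambda>s. of_real pi powr (- s / 2) * Gamma (s / 2) * riemann_zeta s)"

definition SL2Z :: "(int ^ 2 ^ 2) set" where
  "SL2Z = {A. det A = 1}"

text \<open>
  The upper triangular subgroup of \<open>SL2Z\<close> contains \<open>-1\<close>, so \<open>cosets_inf\<close> is at the same time the
  set of (right) cosets of the upper triangular subgroup in \<open>PSL(2,Z)\<close>.
\<close>
definition SL2Z_inf :: "(int ^ 2 ^ 2) set" where
  "SL2Z_inf = {A \<in> SL2Z. A $ 2 $ 1 = 0}"

definition cosets_inf :: "(int ^ 2 ^ 2) set set" where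
  "cosets_inf = SL2Z // {(A, B). A \<in> SL2Z \<and> B \<in> SL2Z \<and> (\<exists>P\<in>SL2Z_inf. B = P ** A)}"

text \<open>
  The summand depends on the bottom row of the representative only up to sign, hence not on the
  choice of the representative.
\<close>
definition eisenstein_series :: "complex \<Rightarrow> complex \<Rightarrow> complex" where
  "eisenstein_series \<tau> s =
     (\<Sum>\<^sub>\<infinity>K\<in>cosets_inf. let A = (SOME A. A \<in> K) in
        of_real (Im \<tau>) powr s /
        of_real (cmod (of_int (A $ 2 $ 1) * \<tau> + of_int (A $ 2 $ 2))) powr (2 * s))"

definition E_hat :: "complex \<Rightarrow> complex \<Rightarrow> complex" where
  "E_hat \<tau> = meromorphic_continuation (\<lambda>s. Lambda_Q (2 * s) * eisenstein_series \<tau> s)"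

definition Z_Q :: "complex \<Rightarrow> complex \<Rightarrow> complex" where
  "Z_Q \<tau> = remove_sings (\<lambda>s. E_hat \<tau> s / Lambda_Q s)"

definition Z_Q_dual :: "complex \<Rightarrow> complex \<Rightarrow> complex" where
  "Z_Q_dual \<tau> = remove_sings (\<lambda>s. Lambda_Q (2 * s) * Lambda_Q (2 * s - 1) / E_hat \<tau> s)"

definition poles_in_strip :: "(complex \<Rightarrow> complex) \<Rightarrow> real \<Rightarrow> bool" where
  "poles_in_strip Z w \<longleftrightarrow> (\<forall>s. is_pole Z s \<longrightarrow> \<bar>Re s - 1 / 2\<bar> \<le> w)"


subsection \<open>Inverse Mellin transform and boundary terms\<close>

text \<open>The line \<open>Re s = c\<close> is parametrised by \<open>s = c + it\<close>, \<open>ds = i dt\<close>.\<close>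
definition mellin_integrand ::
    "(complex \<Rightarrow> complex) \<Rightarrow> real \<Rightarrow> real \<Rightarrow> real \<Rightarrow> complex" where
  "mellin_integrand Z c x t = Z (Complex c t) * of_real x powr (- Complex c t) * \<i>"

definition inverse_mellin :: "(complex \<Rightarrow> complex) \<Rightarrow> real \<Rightarrow> real \<Rightarrow> complex" where
  "inverse_mellin Z c x = 1 / (2 * of_real pi * \<i>) * (LINT t|lborel. mellin_integrand Z c x t)"

definition boundary_fun :: "(complex \<Rightarrow> complex) \<Rightarrow> real \<Rightarrow> real \<Rightarrow> complex" where
  "boundary_fun Z c x = inverse_mellin Z c x - inverse (of_real x) * inverse_mellin Z c (inverse x)"

definition single_sign :: "(real \<Rightarrow> complex) \<Rightarrow> bool" where
  "single_sign h \<longleftrightarrow>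
     (\<exists>t0. (\<forall>t>t0. h (exp (- t)) \<in> \<real>\<^sub>\<ge>\<^sub>0) \<or> (\<forall>t>t0. h (exp (- t)) \<in> \<real>\<^sub>\<le>\<^sub>0))"


subsection \<open>Locally convex spaces of complex-valued functions\<close>

text \<open>
  Vector spaces are given by carriers in some function type \<open>'a \<Rightarrow> complex\<close> with pointwise
  operations. Functions on the positive reals are represented by functions on \<open>real\<close> whose values
  on the nonpositive reals are irrelevant: the topologies below do not distinguish
  functions that agree on \<open>{0<..}\<close>, and therefore neither do continuous functionals. Likewise,
  functionals on such a space are irrelevant outside its carrier.
\<close>

definition seminorm_on :: "('a \<Rightarrow> complex) set \<Rightarrow> (('a \<Rightarrow> complex) \<Rightarrow> real) \<Rightarrow> bool" where
  "seminorm_on E p \<longleftrightarrow>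
     (\<forall>f\<in>E. \<forall>g\<in>E. p (\<lambda>x. f x + g x) \<le> p f + p g) \<and>
     (\<forall>f\<in>E. \<forall>a. p (\<lambda>x. a * f x) = cmod a * p f)"

definition seminorm_topology ::
    "('a \<Rightarrow> complex) set \<Rightarrow> (('a \<Rightarrow> complex) \<Rightarrow> real) set \<Rightarrow> ('a \<Rightarrow> complex) topology" where
  "seminorm_topology E P =
     topology_generated_by {{g \<in> E. p (\<lambda>x. g x - f x) < \<epsilon>} | f p \<epsilon>. f \<in> E \<and> p \<in> P \<and> \<epsilon> > 0}"

definition dual_space :: "('a \<Rightarrow> complex) topology \<Rightarrow> (('a \<Rightarrow> complex) \<Rightarrow> complex) set" where
  "dual_space T =
     {\<phi>. (\<forall>f\<in>topspace T. \<forall>g\<in>topspace T. \<forall>a b. \<phi> (\<lambda>x. a * f x + b * g x) = a * \<phi> f + b * \<phi> g) \<and>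
         continuous_map T euclidean \<phi>}"

definition weak_star_topology ::
    "('a \<Rightarrow> complex) topology \<Rightarrow> (('a \<Rightarrow> complex) \<Rightarrow> complex) topology" where
  "weak_star_topology T = seminorm_topology (dual_space T) {\<lambda>H. cmod (H g) | g. g \<in> topspace T}"


subsection \<open>The spaces of smooth functions\<close>

definition nth_deriv :: "nat \<Rightarrow> (real \<Rightarrow> complex) \<Rightarrow> real \<Rightarrow> complex" where
  "nth_deriv n = (\<lambda>f x. vector_derivative f (at x)) ^^ n"

definition smooth_fun_on :: "real set \<Rightarrow> (real \<Rightarrow> complex) \<Rightarrow> bool" where
  "smooth_fun_on U f \<longleftrightarrow> (\<forall>n. \<forall>x\<in>U. nth_deriv n f differentiable (at x))"

definition F_space :: "nat \<Rightarrow> (real \<Rightarrow> complex) set" where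
  "F_space m = {f. smooth_fun_on UNIV f \<and>
     (\<forall>n. bdd_above (range (\<lambda>x. cmod (nth_deriv n f x) * exp (- real m * \<bar>x\<bar>))))}"

definition F_topology :: "nat \<Rightarrow> (real \<Rightarrow> complex) topology" where
  "F_topology m = seminorm_topology (F_space m)
     {\<lambda>f. SUP x. cmod (nth_deriv n f x) * exp (- real m * \<bar>x\<bar>) | n. True}"

definition C_exp :: "(real \<Rightarrow> complex) set" where
  "C_exp = (\<Union>m\<in>{1..}. F_space m)"

text \<open>
  Inductive limit in the category of locally convex spaces: the finest locally convex topology for
  which all inclusions of the \<open>F_space m\<close> are continuous, i.e. the one generated by all seminorms
  whose restriction to each \<open>F_space m\<close> is continuous.
\<close>
definition C_exp_topology :: "(real \<Rightarrow> complex) topology" where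
  "C_exp_topology = seminorm_topology C_exp
     {q. seminorm_on C_exp q \<and> (\<forall>m\<ge>1. continuous_map (F_topology m) euclideanreal q)}"

definition C_poly_topology :: "(real \<Rightarrow> complex) topology" where
  "C_poly_topology = pullback_topology UNIV (\<lambda>h t. h (exp (- t))) C_exp_topology"

definition S_space :: "(real \<Rightarrow> complex) set" where
  "S_space = {f. smooth_fun_on {0<..} f \<and>
     (\<forall>(m::int) n. bdd_above ((\<lambda>x. cmod (of_real x powi m * nth_deriv n f x)) ` {0<..}))}"

definition S_topology :: "(real \<Rightarrow> complex) topology" where
  "S_topology = seminorm_topology S_space
     {\<lambda>f. SUP x\<in>{0<..}. cmod (of_real x powi m * nth_deriv n f x) | (m::int) n. True}"


subsection \<open>Mean-periodicity\<close>

text \<open>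
  \<open>flip x h\<close> stands for \<open>h(x/\<cdot>)\<close>, so that \<open>\<phi> (flip x h)\<close> is the value at \<open>x\<close> of the
  convolution of \<open>h\<close> and \<open>\<phi>\<close>.
\<close>
definition mean_periodic ::
    "('a \<Rightarrow> complex) topology \<Rightarrow> (real \<Rightarrow> ('a \<Rightarrow> complex) \<Rightarrow> ('a \<Rightarrow> complex)) \<Rightarrow>
     ('a \<Rightarrow> complex) \<Rightarrow> bool" where
  "mean_periodic T flip h \<longleftrightarrow> h \<in> topspace T \<and>
     (\<exists>\<phi>\<in>dual_space T. (\<exists>g\<in>topspace T. \<phi> g \<noteq> 0) \<and> (\<forall>x>0. \<phi> (flip x h) = 0))"

definition flip_fun :: "real \<Rightarrow> (real \<Rightarrow> complex) \<Rightarrow> (real \<Rightarrow> complex)" where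
  "flip_fun x h = (\<lambda>y. h (x / y))"

text \<open>
  The extension of \<open>flip_fun\<close> to functionals; \<open>dy/y\<close> is invariant under \<open>y \<mapsto> x/y\<close>, so it
  is given by duality. The dual of \<open>weak_star_topology S_topology\<close> consists of the evaluations at
  elements \<open>g\<close> of \<open>S_space\<close>, for which the convolution reads \<open>H (\<lambda>y. g (x / y))\<close>.
\<close>
definition flip_dist ::
    "real \<Rightarrow> ((real \<Rightarrow> complex) \<Rightarrow> complex) \<Rightarrow> ((real \<Rightarrow> complex) \<Rightarrow> complex)" where
  "flip_dist x H = (\<lambda>g. H (flip_fun x g))"

definition C_poly_mean_periodic :: "(real \<Rightarrow> complex) \<Rightarrow> bool" where
  "C_poly_mean_periodic h \<longleftrightarrow> mean_periodic C_poly_topology flip_fun h"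

definition dist_of_fun :: "(real \<Rightarrow> complex) \<Rightarrow> (real \<Rightarrow> complex) \<Rightarrow> complex" where
  "dist_of_fun h = (\<lambda>g. LINT x:{0<..}|lborel. g x * h x / of_real x)"

text \<open>
  The first two conditions are those under which a function is regarded as an element of the dual
  of \<open>S_space\<close>.
\<close>
definition S_dual_mean_periodic :: "(real \<Rightarrow> complex) \<Rightarrow> bool" where
  "S_dual_mean_periodic h \<longleftrightarrow>
     (\<forall>K. compact K \<and> K \<subseteq> {0<..} \<longrightarrow> set_integrable lborel K h) \<and>
     (\<exists>N. h \<in> O[at_top](\<lambda>x. of_real x ^ N) \<and> h \<in> O[at_right 0](\<lambda>x. inverse (of_real x) ^ N)) \<and>
     mean_periodic (weak_star_topology S_topology) flip_dist (dist_of_fun h)"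

end

theory Submission
  imports Defs "HOL-Probability.Probability"
begin

text \<open>
  Write \<open>Z = P / V\<close> with entire functions \<open>P\<close>, \<open>V\<close> built from Mellin transforms of theta series: \<open>2 s (s - 1) E_hat s\<close> is the
  Mellin transform of \<open>(x d/dx)\<^sup>2 + x d/dx\<close> applied to the theta series of a binary quadratic form, and
  \<open>s (s - 1) Lambda_Q s\<close> arises in the same way from the Jacobi theta series. Poisson summation makes these kernels
  decay faster than any power at both ends, in a whole sector around the positive axis, and gives
  \<open>P (1 - s) = P s\<close> and \<open>V (1 - s) = V s\<close>. Convolving the boundary term with the kernel of \<open>V\<close> gives the difference
  of the integrals of \<open>P s x powr (- s)\<close> over the lines \<open>Re s = c\<close> and \<open>Re s = 1 - c\<close>, which is \<open>0\<close> as \<open>P\<close> is entire.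
  So the kernel of \<open>V\<close> annihilates the boundary term.

  The exponential decay of \<open>Z\<close> on vertical lines, near which \<open>V\<close> has no known lower bound, comes from that of \<open>P\<close> being
  faster than that of \<open>V\<close>: on a disc centred far to the right, where \<open>V\<close> is bounded below, the zeros of \<open>V\<close>
  are divided out by Blaschke factors and Harnack's inequality is applied to what remains.

  The Mellin transform of the boundary term over \<open>x < 1\<close> equals \<open>Z\<close> up to functions holomorphic near
  \<open>1 - c \<le> Re s \<le> c\<close>. If the boundary term has constant sign near \<open>0\<close>, Landau's theorem continues \<open>Z\<close>
  holomorphically to this strip, since \<open>V\<close> is the transform of a positive kernel and has no real zeros.
  Hence \<open>Z\<close> then has no poles at all.
\<close>

text \<open>The line \<open>Re s = c\<close> is only known to lie to the right of the poles of
  \<open>Z\<close>. It may run through the critical strip, near zeros of \<open>V\<close> that zeros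
  of \<open>P\<close> cancel, so \<open>Z\<close> cannot be estimated through a lower bound for
  \<open>V\<close> on it. What helps is a gap between exponential rates. On vertical lines numerator
  and denominator decay, up to small losses in the rate, like exp (- pi |t| / 2) and exp (- pi |t| /
  4) for \<open>Z_Q\<close>, and like exp (- pi |t|) and exp (- pi |t| / 2) for
  \<open>Z_Q_dual\<close>. Harnack's inequality costs exp (\<epsilon> |t|) with \<epsilon> as small
  as desired, so any positive gap suffices.

  The rates come from the theta kernels: in \<open>x = exp w\<close> they are holomorphic for |Im w|
  < pi / 2, and the half-width of this strip is the decay rate of the transform; passing to
  \<open>s / 2\<close> halves it.

  The factor \<open>s (s - 1)\<close> both clears the poles of the completed functions and makes the
  kernels decay at both ends, as membership in \<open>S_space\<close> and pairing with functions of
  exponential growth require.\<close>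

section \<open>Laplace transforms of rapidly decaying holomorphic functions\<close>

lemma integrable_exp_abs:
  fixes d :: real
  assumes "d > 0"
  shows "integrable lborel (\<lambda>t. exp (- d * \<bar>t\<bar>))"
proof -
  have "((\<lambda>x. exp (- d * x)) has_integral exp (- d * 0) / d) {0..}"
    using assms by (rule has_integral_exp_minus_to_infinity)
  hence "(\<lambda>x. exp (- d * x)) absolutely_integrable_on {0..}"
    by (intro nonnegative_absolutely_integrable_1) (auto simp: integrable_on_def)
  hence "integrable lebesgue (\<lambda>x. indicator {0..} x *\<^sub>R exp (- d * x))"
    by (simp add: set_integrable_def)
  hence 1: "integrable lborel (\<lambda>x. indicator {0..} x *\<^sub>R exp (- d * x))"
    by (subst (asm) integrable_completion) auto
  have 2: "integrable lborel (\<lambda>x. indicator {0..} (0 + (-1) * x) *\<^sub>R exp (- d * (0 + (-1) * x)))"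
    using lborel_integrable_real_affine[OF 1, of "-1" 0] by simp
  show ?thesis
    by (rule Bochner_Integration.integrable_bound[OF Bochner_Integration.integrable_add[OF 1 2]])
       (auto simp: indicator_def)
qed

lemma integrable_exp_bound:
  fixes f :: "real \<Rightarrow> 'a :: {banach, second_countable_topology}"
  assumes "f \<in> borel_measurable borel" "d > 0" "\<And>t. norm (f t) \<le> C * exp (- d * \<bar>t\<bar>)"
  shows "integrable lborel f"
proof (rule Bochner_Integration.integrable_bound)
  show "integrable lborel (\<lambda>t. C * exp (- d * \<bar>t\<bar>))"
    using integrable_exp_abs[OF assms(2)] by simp
  show "AE t in lborel. norm (f t) \<le> norm (C * exp (- d * \<bar>t\<bar>))"
    using assms(3) by (auto intro: order_trans abs_ge_self)
qed (use assms in simp)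

lemma integral_symmetric_interval_tendsto:
  fixes g :: "real \<Rightarrow> complex"
  assumes "continuous_on UNIV g" "d > 0" "\<And>t. norm (g t) \<le> C * exp (- d * \<bar>t\<bar>)"
  shows "((\<lambda>T. integral {-T..T} g) \<longlongrightarrow> (LINT t|lborel. g t)) at_top"
proof -
  have meas: "g \<in> borel_measurable borel"
    using assms(1) by (rule borel_measurable_continuous_onI)
  have int: "integrable lborel g"
    by (rule integrable_exp_bound[OF meas assms(2,3)])
  have "((\<lambda>T. LINT t|lborel. indicator {-T..T} t *\<^sub>R g t) \<longlongrightarrow> (LINT t|lborel. g t)) at_top"
  proof (rule integral_dominated_convergence_at_top[where w = "\<lambda>t. norm (g t)"])
    show "AE t in lborel. ((\<lambda>T. indicator {-T..T} t *\<^sub>R g t) \<longlongrightarrow> g t) at_top"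
    proof (rule AE_I2)
      fix t :: real
      have "\<forall>\<^sub>F T in at_top. T \<ge> \<bar>t\<bar>" by (rule eventually_ge_at_top)
      hence "\<forall>\<^sub>F T in at_top. indicator {-T..T} t *\<^sub>R g t = g t"
        by eventually_elim (auto simp: indicator_def)
      thus "((\<lambda>T. indicator {-T..T} t *\<^sub>R g t) \<longlongrightarrow> g t) at_top"
        by (rule tendsto_eventually)
    qed
  qed (use int meas in \<open>auto simp: indicator_def\<close>)
  moreover have "(LINT t|lborel. indicator {-T..T} t *\<^sub>R g t) = integral {-T..T} g" for T
  proof -
    have "set_integrable lborel {-T..T} g"
      unfolding set_integrable_def using int by (intro integrable_mult_indicator) auto
    from set_borel_integral_eq_integral(2)[OF this] show ?thesis
      by (simp add: set_lebesgue_integral_def)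
  qed
  ultimately show ?thesis by simp
qed

text \<open>Cauchy's formula for rectangles of height \<open>2 * T\<close>, with \<open>T\<close>
  going to infinity: the decay of \<open>F\<close> kills the horizontal sides. Since
  \<open>ds = \<i> dt\<close> on the vertical sides, 2 pi i becomes 2 pi.\<close>

lemma strip_cauchy:
  fixes F :: "complex \<Rightarrow> complex"
  assumes holo: "F holomorphic_on {z. a \<le> Re z \<and> Re z \<le> b}"
    and d: "d > 0"
    and bd: "\<And>z. a \<le> Re z \<Longrightarrow> Re z \<le> b \<Longrightarrow> norm (F z) \<le> C * exp (- d * \<bar>Im z\<bar>)"
    and s: "a < Re s" "Re s < b"
  shows "(LINT t|lborel. F (Complex b t) / (Complex b t - s)) -
         (LINT t|lborel. F (Complex a t) / (Complex a t - s)) = 2 * of_real pi * F s"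
proof -
  define S where "S = {z. a \<le> Re z \<and> Re z \<le> b}"
  define g where "g = (\<lambda>z. F z / (z - s))"
  have ab: "a < b" using s by simp
  have C0: "C \<ge> 0"
  proof -
    have "0 \<le> C * exp (- d * \<bar>Im (Complex a 0)\<bar>)"
      using bd[of "Complex a 0"] ab by (intro order_trans[OF norm_ge_zero]) auto
    thus ?thesis by simp
  qed
  have convS: "convex S"
  proof -
    have "S = {z. a \<le> Re z} \<inter> {z. Re z \<le> b}" by (auto simp: S_def)
    thus ?thesis by (simp add: convex_Int convex_halfspace_Re_ge convex_halfspace_Re_le)
  qed
  have sint: "s \<in> interior S"
  proof (rule interiorI)
    show "open ({z. a < Re z} \<inter> {z. Re z < b})"
      by (intro open_Int open_halfspace_Re_gt open_halfspace_Re_lt)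
  qed (use s in \<open>auto simp: S_def\<close>)
  have holS: "F holomorphic_on S" using holo by (simp add: S_def)
  have gcont: "continuous_on (S - {s}) g"
    unfolding g_def
    by (intro continuous_intros holomorphic_on_imp_continuous_on[OF holomorphic_on_subset[OF holS]]) auto
  have main: "\<i> * integral {-T..T} (\<lambda>t. g (Complex b t)) - \<i> * integral {-T..T} (\<lambda>t. g (Complex a t))
      + contour_integral (linepath (Complex a (-T)) (Complex b (-T))) g
      + contour_integral (linepath (Complex b T) (Complex a T)) g = 2 * of_real pi * \<i> * F s"
    and bnd1: "norm (contour_integral (linepath (Complex a (-T)) (Complex b (-T))) g) \<le> C * exp (- d * T) * (b - a)"
    and bnd2: "norm (contour_integral (linepath (Complex b T) (Complex a T)) g) \<le> C * exp (- d * T) * (b - a)"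
    if T: "T \<ge> \<bar>Im s\<bar> + 1" for T
  proof -
    define a1 a2 a3 a4 where "a1 = Complex a (-T)" and "a2 = Complex b (-T)"
      and "a3 = Complex b T" and "a4 = Complex a T"
    have rp: "rectpath a1 a3 = linepath a1 a2 +++ linepath a2 a3 +++ linepath a3 a4 +++ linepath a4 a1"
      by (simp add: rectpath_def a1_def a2_def a3_def a4_def Let_def)
    have sbox: "s \<in> box a1 a3"
      using s T by (auto simp: in_box_complex_iff a1_def a3_def)
    have seg: "closed_segment a1 a2 \<subseteq> S - {s}" "closed_segment a2 a3 \<subseteq> S - {s}"
      "closed_segment a3 a4 \<subseteq> S - {s}" "closed_segment a4 a1 \<subseteq> S - {s}" "closed_segment a1 a4 \<subseteq> S - {s}"
      using s T ab
      by (auto simp: a1_def a2_def a3_def a4_def S_def closed_segment_same_Re closed_segment_same_Im closed_segment_eq_real_ivl split: if_splits)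
    have pimg: "path_image (rectpath a1 a3) \<subseteq> S - {s}"
      using seg by (simp add: rp path_image_join)
    have "(g has_contour_integral (2*pi * \<i> * winding_number (rectpath a1 a3) s * F s)) (rectpath a1 a3)"
      unfolding g_def
      by (rule Cauchy_integral_formula_convex_simple[OF convS holS sint]) (use pimg in auto)
    hence ci: "contour_integral (rectpath a1 a3) g = 2*pi * \<i> * F s"
      using winding_number_rectpath[OF sbox] by (simp add: contour_integral_unique)
    have cont: "g contour_integrable_on linepath a1 a2" "g contour_integrable_on linepath a2 a3"
      "g contour_integrable_on linepath a3 a4" "g contour_integrable_on linepath a4 a1"
      using seg by (auto intro!: contour_integrable_continuous_linepath continuous_on_subset[OF gcont])
    have "contour_integral (rectpath a1 a3) g =
      contour_integral (linepath a1 a2) g + contour_integral (linepath a2 a3) g +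
      contour_integral (linepath a3 a4) g + contour_integral (linepath a4 a1) g"
      unfolding rp using cont by (simp add: contour_integrable_joinI)
    moreover have "contour_integral (linepath a2 a3) g = \<i> * integral {-T..T} (\<lambda>t. g (Complex b t))"
      by (rule contour_integral_linepath_same_Re) (use T in \<open>auto simp: a2_def a3_def\<close>)
    moreover have "contour_integral (linepath a4 a1) g = - contour_integral (linepath a1 a4) g"
      by (rule contour_integral_reverse_linepath) (use seg in \<open>auto intro!: continuous_on_subset[OF gcont]\<close>)
    moreover have "contour_integral (linepath a1 a4) g = \<i> * integral {-T..T} (\<lambda>t. g (Complex a t))"
      by (rule contour_integral_linepath_same_Re) (use T in \<open>auto simp: a1_def a4_def\<close>)
    ultimately show "\<i> * integral {-T..T} (\<lambda>t. g (Complex b t)) - \<i> * integral {-T..T} (\<lambda>t. g (Complex a t))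
      + contour_integral (linepath (Complex a (-T)) (Complex b (-T))) g
      + contour_integral (linepath (Complex b T) (Complex a T)) g = 2 * of_real pi * \<i> * F s"
      using ci by (simp add: a1_def a2_def a3_def a4_def algebra_simps)
    \<comment> \<open>The margin 1 in \<open>T \<ge> \<bar>Im s\<bar> + 1\<close> keeps the
      horizontal sides at distance at least 1 from \<open>s\<close>, so the denominator
      \<open>z - s\<close> costs nothing there.\<close>
    have gb: "norm (g z) \<le> C * exp (- d * T)" if z: "a \<le> Re z" "Re z \<le> b" "\<bar>Im z\<bar> = T" for z
    proof -
      have "1 \<le> \<bar>Im (z - s)\<bar>" using z T by auto
      also have "\<dots> \<le> norm (z - s)" by (rule abs_Im_le_cmod)
      finally have n: "1 \<le> norm (z - s)" .
      have "norm (g z) = norm (F z) / norm (z - s)" by (simp add: g_def norm_divide)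
      also have "\<dots> \<le> norm (F z) / 1" using n by (intro divide_left_mono) auto
      finally show ?thesis using bd[OF z(1,2)] z(3) by simp
    qed
    have nz: "0 \<le> C * exp (- d * T)" using C0 by simp
    show "norm (contour_integral (linepath (Complex a (-T)) (Complex b (-T))) g) \<le> C * exp (- d * T) * (b - a)"
    proof -
      have "norm (contour_integral (linepath a1 a2) g) \<le> C * exp (- d * T) * norm (a2 - a1)"
        using T ab by (intro contour_integral_bound_linepath cont nz gb)
           (auto simp: a1_def a2_def closed_segment_same_Im closed_segment_eq_real_ivl split: if_splits)
      also have "norm (a2 - a1) = b - a" using ab by (simp add: a1_def a2_def cmod_def)
      finally show ?thesis by (simp add: a1_def a2_def)
    qed
    show "norm (contour_integral (linepath (Complex b T) (Complex a T)) g) \<le> C * exp (- d * T) * (b - a)"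
    proof -
      have "norm (contour_integral (linepath a3 a4) g) \<le> C * exp (- d * T) * norm (a4 - a3)"
        using T ab by (intro contour_integral_bound_linepath cont nz gb)
           (auto simp: a3_def a4_def closed_segment_same_Im closed_segment_eq_real_ivl split: if_splits)
      also have "norm (a4 - a3) = b - a" using ab by (simp add: a3_def a4_def cmod_def)
      finally show ?thesis by (simp add: a3_def a4_def)
    qed
  qed
  have z0: "((\<lambda>T. C * exp (- d * T) * (b - a)) \<longlongrightarrow> 0) at_top"
    using d by real_asymp
  have line: "((\<lambda>T. integral {-T..T} (\<lambda>t. g (Complex c t))) \<longlongrightarrow> (LINT t|lborel. g (Complex c t))) at_top"
    if c: "c = a \<or> c = b" for c
  proof (rule integral_symmetric_interval_tendsto[OF _ d])
    have cS: "Complex c t \<in> S - {s}" for t using c s ab by (auto simp: S_def)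
    have "continuous_on UNIV (\<lambda>t. Complex c t)"
      by (simp add: Complex_eq) (intro continuous_intros)
    thus "continuous_on UNIV (\<lambda>t. g (Complex c t))"
      using continuous_on_compose2[OF gcont, of UNIV "\<lambda>t. Complex c t"] cS by auto
    fix t
    have "\<bar>c - Re s\<bar> \<le> norm (Complex c t - s)"
      using abs_Re_le_cmod[of "Complex c t - s"] by simp
    moreover have "\<bar>c - Re s\<bar> > 0" using c s by auto
    ultimately have "norm (F (Complex c t)) / norm (Complex c t - s) \<le> norm (F (Complex c t)) / \<bar>c - Re s\<bar>"
      by (intro divide_left_mono mult_pos_pos) auto
    also have "\<dots> \<le> C * exp (- d * \<bar>t\<bar>) / \<bar>c - Re s\<bar>"
      using bd[of "Complex c t"] c ab by (intro divide_right_mono) auto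
    finally show "norm (g (Complex c t)) \<le> (C / \<bar>c - Re s\<bar>) * exp (- d * \<bar>t\<bar>)"
      by (simp add: g_def norm_divide)
  qed
  have t1: "((\<lambda>T. contour_integral (linepath (Complex a (-T)) (Complex b (-T))) g) \<longlongrightarrow> 0) at_top"
    by (rule Lim_null_comparison[OF _ z0])
       (use bnd1 in \<open>auto intro!: eventually_at_top_linorderI[of "\<bar>Im s\<bar> + 1"]\<close>)
  have t2: "((\<lambda>T. contour_integral (linepath (Complex b T) (Complex a T)) g) \<longlongrightarrow> 0) at_top"
    by (rule Lim_null_comparison[OF _ z0])
       (use bnd2 in \<open>auto intro!: eventually_at_top_linorderI[of "\<bar>Im s\<bar> + 1"]\<close>)
  have "((\<lambda>T. \<i> * integral {-T..T} (\<lambda>t. g (Complex b t)) - \<i> * integral {-T..T} (\<lambda>t. g (Complex a t))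
      + contour_integral (linepath (Complex a (-T)) (Complex b (-T))) g
      + contour_integral (linepath (Complex b T) (Complex a T)) g) \<longlongrightarrow>
     \<i> * (LINT t|lborel. g (Complex b t)) - \<i> * (LINT t|lborel. g (Complex a t)) + 0 + 0) at_top"
    by (intro tendsto_intros line t1 t2) auto
  moreover have "\<forall>\<^sub>F T in at_top. \<i> * integral {-T..T} (\<lambda>t. g (Complex b t)) - \<i> * integral {-T..T} (\<lambda>t. g (Complex a t))
      + contour_integral (linepath (Complex a (-T)) (Complex b (-T))) g
      + contour_integral (linepath (Complex b T) (Complex a T)) g = 2 * of_real pi * \<i> * F s"
    using main by (auto intro!: eventually_at_top_linorderI[of "\<bar>Im s\<bar> + 1"])
  ultimately have "((\<lambda>T::real. 2 * of_real pi * \<i> * F s) \<longlongrightarrow>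
      \<i> * (LINT t|lborel. g (Complex b t)) - \<i> * (LINT t|lborel. g (Complex a t)) + 0 + 0) at_top"
    by (rule Lim_transform_eventually)
  hence "2 * of_real pi * \<i> * F s = \<i> * (LINT t|lborel. g (Complex b t)) - \<i> * (LINT t|lborel. g (Complex a t))"
    by (simp add: tendsto_const_iff)
  hence "\<i> * (2 * of_real pi * F s) = \<i> * ((LINT t|lborel. g (Complex b t)) - (LINT t|lborel. g (Complex a t)))"
    by (simp add: algebra_simps)
  thus ?thesis by (simp add: g_def)
qed

text \<open>In \<open>strip_cauchy\<close> for \<open>F z * (z - s)\<close> the right-hand side is
  0, because this function vanishes at \<open>s\<close>, and the quotient by \<open>z - s\<close> is
  \<open>F\<close> again. This yields Cauchy's theorem for the strip; the proof takes the real
  midpoint as \<open>s\<close>.\<close>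

lemma strip_shift:
  fixes F :: "complex \<Rightarrow> complex"
  assumes holo: "F holomorphic_on {z. a \<le> Re z \<and> Re z \<le> b}"
    and d: "d > 0"
    and bd: "\<And>z. a \<le> Re z \<Longrightarrow> Re z \<le> b \<Longrightarrow> norm (F z) \<le> C * exp (- d * \<bar>Im z\<bar>)"
    and ab: "a < b"
  shows "(LINT t|lborel. F (Complex b t)) = (LINT t|lborel. F (Complex a t))"
proof -
  define s where "s = complex_of_real ((a + b) / 2)"
  define G where "G = (\<lambda>z. F z * (z - s))"
  have s: "a < Re s" "Re s < b" "Im s = 0" using ab by (auto simp: s_def)
  have C0: "C \<ge> 0"
  proof -
    have "0 \<le> C * exp (- d * \<bar>Im (Complex a 0)\<bar>)"
      using bd[of "Complex a 0"] ab by (intro order_trans[OF norm_ge_zero]) auto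
    thus ?thesis by simp
  qed
  \<comment> \<open>The linear factor \<open>z - s\<close> is paid for with half of the decay
    rate.\<close>
  have Gb: "norm (G z) \<le> (C * ((b - a) + 2 / d)) * exp (- (d/2) * \<bar>Im z\<bar>)"
    if z: "a \<le> Re z" "Re z \<le> b" for z
  proof -
    have "norm (z - s) \<le> \<bar>Re (z - s)\<bar> + \<bar>Im (z - s)\<bar>" by (rule cmod_le)
    also have "\<dots> \<le> (b - a) + \<bar>Im z\<bar>" using z s by auto
    finally have 1: "norm (z - s) \<le> (b - a) + \<bar>Im z\<bar>" .
    have 2: "\<bar>Im z\<bar> \<le> 2 / d * exp (d / 2 * \<bar>Im z\<bar>)"
    proof -
      have "d / 2 * \<bar>Im z\<bar> \<le> exp (d / 2 * \<bar>Im z\<bar>)"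
        using exp_ge_add_one_self[of "d / 2 * \<bar>Im z\<bar>"] by linarith
      thus ?thesis using d by (simp add: field_simps)
    qed
    have 3: "(b - a) \<le> (b - a) * exp (d / 2 * \<bar>Im z\<bar>)"
      using ab d by (simp add: mult_le_cancel_left1)
    have "norm (G z) = norm (F z) * norm (z - s)" by (simp add: G_def norm_mult)
    also have "\<dots> \<le> (C * exp (- d * \<bar>Im z\<bar>)) * (((b - a) + 2 / d) * exp (d / 2 * \<bar>Im z\<bar>))"
      using 1 2 3 C0 bd[OF z] by (intro mult_mono) (auto simp: algebra_simps)
    also have "\<dots> = (C * ((b - a) + 2 / d)) * (exp (- d * \<bar>Im z\<bar>) * exp (d / 2 * \<bar>Im z\<bar>))"
      by simp
    also have "exp (- d * \<bar>Im z\<bar>) * exp (d / 2 * \<bar>Im z\<bar>) = exp (- (d/2) * \<bar>Im z\<bar>)"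
      by (simp add: exp_add[symmetric])
    finally show ?thesis .
  qed
  have "(LINT t|lborel. G (Complex b t) / (Complex b t - s)) -
         (LINT t|lborel. G (Complex a t) / (Complex a t - s)) = 2 * of_real pi * G s"
  proof (rule strip_cauchy[where d = "d/2"])
    show "G holomorphic_on {z. a \<le> Re z \<and> Re z \<le> b}"
      unfolding G_def by (intro holomorphic_intros holo)
    show "norm (G z) \<le> (C * ((b - a) + 2 / d)) * exp (- (d/2) * \<bar>Im z\<bar>)"
      if "a \<le> Re z" "Re z \<le> b" for z using Gb that by blast
  qed (use d s in auto)
  moreover have "Complex b t - s \<noteq> 0" "Complex a t - s \<noteq> 0" for t
    using s by (auto simp: complex_eq_iff)
  ultimately show ?thesis by (simp add: G_def)
qed

text \<open>With \<open>x = exp t\<close> this is a Mellin transform: the integral of \<phi> (ln x)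
  x^s dx / x. The sign in the exponent is chosen for that.\<close>

definition laplace :: "(real \<Rightarrow> complex) \<Rightarrow> complex \<Rightarrow> complex" where
  "laplace \<phi> s = (LINT t|lborel. \<phi> t * exp (s * of_real t))"

text \<open>The exponential series of \<open>exp ((w - w0) * t)\<close> may be integrated termwise
  because its absolute values sum to at most \<open>exp (\<rho> * \<bar>t\<bar>)\<close>. The
  coefficients are spelled out for \<open>landau_laplace\<close>, where they are integrals of
  nonnegative functions.\<close>

lemma laplace_power_series:
  fixes \<phi> :: "real \<Rightarrow> complex"
  assumes meas [measurable]: "\<phi> \<in> borel_measurable borel"
    and int: "integrable lborel (\<lambda>t. norm (\<phi> t) * exp (Re w0 * t + \<rho> * \<bar>t\<bar>))"
    and w: "norm (w - w0) \<le> \<rho>"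
  shows "(\<lambda>k. (LINT t|lborel. \<phi> t * of_real t ^ k * exp (w0 * of_real t)) / fact k * (w - w0) ^ k)
           sums laplace \<phi> w"
proof -
  define f where "f = (\<lambda>k t. \<phi> t * of_real t ^ k * exp (w0 * of_real t) / fact k * (w - w0) ^ k)"
  have f_eq: "f k t = \<phi> t * exp (w0 * of_real t) * (((w - w0) * of_real t) ^ k /\<^sub>R fact k)" for k t
    by (simp add: f_def power_mult_distrib scaleR_conv_of_real divide_inverse mult_ac)
  have sums_f: "(\<lambda>k. f k t) sums (\<phi> t * exp (w * of_real t))" for t
  proof -
    have "(\<lambda>k. f k t) sums (\<phi> t * exp (w0 * of_real t) * exp ((w - w0) * of_real t))"
      unfolding f_eq by (intro sums_mult exp_converges)
    also have "\<phi> t * exp (w0 * of_real t) * exp ((w - w0) * of_real t) = \<phi> t * exp (w * of_real t)"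
      by (simp add: mult.assoc exp_add[symmetric] algebra_simps)
    finally show ?thesis .
  qed
  have nf: "norm (f k t) = norm (\<phi> t) * exp (Re w0 * t) * ((norm (w - w0) * \<bar>t\<bar>) ^ k /\<^sub>R fact k)" for k t
    by (simp add: f_eq norm_mult norm_power power_mult_distrib)
  have sumn: "(\<lambda>k. norm (f k t)) sums (norm (\<phi> t) * exp (Re w0 * t) * exp (norm (w - w0) * \<bar>t\<bar>))" for t
    unfolding nf by (intro sums_mult exp_converges)
  have le: "norm (\<phi> t) * exp (Re w0 * t) * exp (norm (w - w0) * \<bar>t\<bar>)
       \<le> norm (\<phi> t) * exp (Re w0 * t + \<rho> * \<bar>t\<bar>)" for t
    using w by (simp add: exp_add mult.assoc mult_left_mono mult_right_mono)
  have part: "(\<Sum>k<n. norm (f k t)) \<le> norm (\<phi> t) * exp (Re w0 * t + \<rho> * \<bar>t\<bar>)" for n t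
    using sum_le_suminf[OF sums_summable[OF sumn[of t]], of "{..<n}"] sums_unique[OF sumn[of t]] le[of t]
    by auto
  have fm [measurable]: "f k \<in> borel_measurable borel" for k
    unfolding f_def by measurable
  have fint: "integrable lborel (f k)" for k
  proof (rule Bochner_Integration.integrable_bound[OF int])
    show "AE t in lborel. norm (f k t) \<le> norm (norm (\<phi> t) * exp (Re w0 * t + \<rho> * \<bar>t\<bar>))"
    proof (rule AE_I2)
      fix t
      have "norm (f k t) \<le> (\<Sum>j<Suc k. norm (f j t))"
        by (rule member_le_sum) auto
      thus "norm (f k t) \<le> norm (norm (\<phi> t) * exp (Re w0 * t + \<rho> * \<bar>t\<bar>))"
        using part[of t "Suc k"] by (auto intro: order_trans abs_ge_self)
    qed
  qed simp
  have "(\<lambda>k. integral\<^sup>L lborel (f k)) sums (LINT t|lborel. (\<Sum>k. f k t))"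
  proof (rule sums_integral[OF fint])
    show "AE t in lborel. summable (\<lambda>k. norm (f k t))"
      using sumn by (auto simp: sums_iff)
    show "summable (\<lambda>k. LINT t|lborel. norm (f k t))"
    proof (rule summableI_nonneg_bounded)
      fix n
      have "(\<Sum>k<n. LINT t|lborel. norm (f k t)) = (LINT t|lborel. (\<Sum>k<n. norm (f k t)))"
        by (intro Bochner_Integration.integral_sum[symmetric] integrable_norm fint)
      also have "\<dots> \<le> (LINT t|lborel. norm (\<phi> t) * exp (Re w0 * t + \<rho> * \<bar>t\<bar>))"
        by (intro integral_mono int part Bochner_Integration.integrable_sum integrable_norm fint)
      finally show "(\<Sum>k<n. LINT t|lborel. norm (f k t)) \<le> \<dots>" .
    qed auto
  qed
  moreover have "(LINT t|lborel. (\<Sum>k. f k t)) = laplace \<phi> w"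
    unfolding laplace_def using sums_f by (intro Bochner_Integration.integral_cong) (auto simp: sums_iff)
  moreover have "integral\<^sup>L lborel (f k) = (LINT t|lborel. \<phi> t * of_real t ^ k * exp (w0 * of_real t)) / fact k * (w - w0) ^ k" for k
    by (simp add: f_def divide_inverse)
  ultimately show ?thesis by simp
qed

lemma laplace_integrable_ball:
  fixes \<phi> :: "real \<Rightarrow> complex"
  assumes meas [measurable]: "\<phi> \<in> borel_measurable borel"
    and 1: "integrable lborel (\<lambda>t. norm (\<phi> t) * exp ((x - \<rho>) * t))"
    and 2: "integrable lborel (\<lambda>t. norm (\<phi> t) * exp ((x + \<rho>) * t))"
  shows "integrable lborel (\<lambda>t. norm (\<phi> t) * exp (x * t + \<rho> * \<bar>t\<bar>))"
proof (rule Bochner_Integration.integrable_bound[OF Bochner_Integration.integrable_add[OF 1 2]])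
  show "AE t in lborel. norm (norm (\<phi> t) * exp (x * t + \<rho> * \<bar>t\<bar>))
     \<le> norm (norm (\<phi> t) * exp ((x - \<rho>) * t) + norm (\<phi> t) * exp ((x + \<rho>) * t))"
  proof (rule AE_I2)
    fix t :: real
    have "exp (x * t + \<rho> * \<bar>t\<bar>) \<le> exp ((x - \<rho>) * t) + exp ((x + \<rho>) * t)"
      by (cases "t \<ge> 0") (auto simp: algebra_simps)
    hence "norm (\<phi> t) * exp (x * t + \<rho> * \<bar>t\<bar>) \<le> norm (\<phi> t) * (exp ((x - \<rho>) * t) + exp ((x + \<rho>) * t))"
      by (rule mult_left_mono) auto
    thus "norm (norm (\<phi> t) * exp (x * t + \<rho> * \<bar>t\<bar>))
     \<le> norm (norm (\<phi> t) * exp ((x - \<rho>) * t) + norm (\<phi> t) * exp ((x + \<rho>) * t))"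
      by (simp add: distrib_left)
  qed
qed simp

lemma laplace_holomorphic:
  fixes \<phi> :: "real \<Rightarrow> complex"
  assumes meas [measurable]: "\<phi> \<in> borel_measurable borel"
    and I: "open I"
    and int: "\<And>r. r \<in> I \<Longrightarrow> integrable lborel (\<lambda>t. norm (\<phi> t) * exp (r * t))"
  shows "laplace \<phi> holomorphic_on {s. Re s \<in> I}"
proof (rule analytic_imp_holomorphic, subst analytic_on_analytic_at, safe)
  fix w0 assume "Re w0 \<in> I"
  with I obtain e where e: "e > 0" "ball (Re w0) e \<subseteq> I"
    using open_contains_ball by blast
  define \<rho> where "\<rho> = e / 2"
  have \<rho>: "\<rho> > 0" using e by (simp add: \<rho>_def)
  have "Re w0 - \<rho> \<in> ball (Re w0) e" "Re w0 + \<rho> \<in> ball (Re w0) e"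
    using e by (auto simp: \<rho>_def dist_real_def)
  hence I': "integrable lborel (\<lambda>t. norm (\<phi> t) * exp (Re w0 * t + \<rho> * \<bar>t\<bar>))"
    using e by (intro laplace_integrable_ball int) auto
  have "laplace \<phi> analytic_on ball w0 \<rho>"
    by (rule power_series_analytic, rule laplace_power_series[OF meas I'])
       (auto simp: dist_norm norm_minus_commute)
  thus "laplace \<phi> analytic_on {w0}"
    by (rule analytic_on_subset) (use \<rho> in auto)
qed

text \<open>In \<open>x = exp w\<close> the strip is a sector about the positive axis, and the bound
  means decay faster than any power of \<open>x\<close> at 0 and at infinity, uniformly on smaller
  closed sectors. Such functions restrict to elements of \<open>S_space\<close> on the positive
  axis, and the opening of the sector gives the exponential decay of their transforms.\<close>

definition rapid_on_strip :: "real \<Rightarrow> (complex \<Rightarrow> complex) \<Rightarrow> bool" where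
  "rapid_on_strip \<alpha> f \<longleftrightarrow> f holomorphic_on {w. \<bar>Im w\<bar> < \<alpha>} \<and>
     (\<forall>\<beta><\<alpha>. \<forall>N::nat. \<exists>C. \<forall>w. \<bar>Im w\<bar> \<le> \<beta> \<longrightarrow> norm (f w) \<le> C * exp (- real N * \<bar>Re w\<bar>))"

lemma open_Im_strip: "open {w. \<bar>Im w\<bar> < \<alpha>}"
proof -
  have "{w. \<bar>Im w\<bar> < \<alpha>} = {w. Im w < \<alpha>} \<inter> {w. Im w > -\<alpha>}" by auto
  thus ?thesis by (simp add: open_Int open_halfspace_Im_lt open_halfspace_Im_gt)
qed

lemma rapid_on_stripD:
  assumes "rapid_on_strip \<alpha> f" "\<beta> < \<alpha>"
  obtains C where "C \<ge> 0" "\<And>w. \<bar>Im w\<bar> \<le> \<beta> \<Longrightarrow> norm (f w) \<le> C * exp (- real N * \<bar>Re w\<bar>)"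
proof -
  from assms obtain C where C: "\<And>w. \<bar>Im w\<bar> \<le> \<beta> \<Longrightarrow> norm (f w) \<le> C * exp (- real N * \<bar>Re w\<bar>)"
    unfolding rapid_on_strip_def by meson
  show ?thesis
    by (rule that[of "\<bar>C\<bar>"]) (auto intro!: order_trans[OF C] mult_right_mono)
qed

lemma rapid_on_strip_add:
  assumes "rapid_on_strip \<alpha> f" "rapid_on_strip \<alpha> g"
  shows "rapid_on_strip \<alpha> (\<lambda>w. f w + g w)"
  unfolding rapid_on_strip_def
proof (intro conjI allI impI)
  show "(\<lambda>w. f w + g w) holomorphic_on {w. \<bar>Im w\<bar> < \<alpha>}"
    using assms by (auto simp: rapid_on_strip_def intro: holomorphic_intros)
  fix \<beta> N assume \<beta>: "\<beta> < \<alpha>"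
  obtain C where C: "\<And>w. \<bar>Im w\<bar> \<le> \<beta> \<Longrightarrow> norm (f w) \<le> C * exp (- real N * \<bar>Re w\<bar>)"
    using rapid_on_stripD[OF assms(1) \<beta>] by blast
  obtain D where D: "\<And>w. \<bar>Im w\<bar> \<le> \<beta> \<Longrightarrow> norm (g w) \<le> D * exp (- real N * \<bar>Re w\<bar>)"
    using rapid_on_stripD[OF assms(2) \<beta>] by blast
  show "\<exists>C. \<forall>w. \<bar>Im w\<bar> \<le> \<beta> \<longrightarrow> norm (f w + g w) \<le> C * exp (- real N * \<bar>Re w\<bar>)"
    by (rule exI[of _ "C + D"]) (auto simp: distrib_right intro!: norm_triangle_le add_mono C[simplified] D[simplified])
qed

lemma rapid_on_strip_cmult:
  assumes "rapid_on_strip \<alpha> f"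
  shows "rapid_on_strip \<alpha> (\<lambda>w. c * f w)"
  unfolding rapid_on_strip_def
proof (intro conjI allI impI)
  show "(\<lambda>w. c * f w) holomorphic_on {w. \<bar>Im w\<bar> < \<alpha>}"
    using assms by (auto simp: rapid_on_strip_def intro: holomorphic_intros)
  fix \<beta> N assume \<beta>: "\<beta> < \<alpha>"
  obtain C where C: "\<And>w. \<bar>Im w\<bar> \<le> \<beta> \<Longrightarrow> norm (f w) \<le> C * exp (- real N * \<bar>Re w\<bar>)"
    using rapid_on_stripD[OF assms(1) \<beta>] by blast
  show "\<exists>C. \<forall>w. \<bar>Im w\<bar> \<le> \<beta> \<longrightarrow> norm (c * f w) \<le> C * exp (- real N * \<bar>Re w\<bar>)"
    by (rule exI[of _ "norm c * C"]) (auto simp: norm_mult mult.assoc intro!: mult_left_mono C[simplified])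
qed

lemma rapid_on_strip_double:
  assumes "rapid_on_strip \<alpha> f"
  shows "rapid_on_strip (\<alpha> / 2) (\<lambda>w. f (2 * w))"
  unfolding rapid_on_strip_def
proof (intro conjI allI impI)
  have "f \<circ> (\<lambda>w. 2 * w) holomorphic_on {w. \<bar>Im w\<bar> < \<alpha> / 2}"
    by (rule holomorphic_on_compose_gen[of _ _ _ "{w. \<bar>Im w\<bar> < \<alpha>}"])
       (use assms in \<open>auto simp: rapid_on_strip_def intro!: holomorphic_intros\<close>)
  thus "(\<lambda>w. f (2 * w)) holomorphic_on {w. \<bar>Im w\<bar> < \<alpha> / 2}" by (simp add: o_def)
  fix \<beta> N assume \<beta>: "\<beta> < \<alpha> / 2"
  obtain C where C: "C \<ge> 0" "\<And>w. \<bar>Im w\<bar> \<le> 2 * \<beta> \<Longrightarrow> norm (f w) \<le> C * exp (- real N * \<bar>Re w\<bar>)"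
    using rapid_on_stripD[OF assms(1), of "2 * \<beta>" N] \<beta> by auto
  have "norm (f (2 * w)) \<le> C * exp (- real N * \<bar>Re w\<bar>)" if "\<bar>Im w\<bar> \<le> \<beta>" for w
  proof -
    have "norm (f (2 * w)) \<le> C * exp (- real N * \<bar>Re (2 * w)\<bar>)"
      by (rule C) (use that in auto)
    also have "\<dots> \<le> C * exp (- real N * \<bar>Re w\<bar>)"
      using C(1) by (intro mult_left_mono) (auto intro!: mult_left_mono)
    finally show ?thesis .
  qed
  thus "\<exists>C. \<forall>w. \<bar>Im w\<bar> \<le> \<beta> \<longrightarrow> norm (f (2 * w)) \<le> C * exp (- real N * \<bar>Re w\<bar>)" by blast
qed

lemma rapid_on_strip_deriv:
  assumes "rapid_on_strip \<alpha> f"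
  shows "rapid_on_strip \<alpha> (deriv f)"
  unfolding rapid_on_strip_def
proof (intro conjI allI impI)
  have holo: "f holomorphic_on {w. \<bar>Im w\<bar> < \<alpha>}" using assms by (simp add: rapid_on_strip_def)
  show "deriv f holomorphic_on {w. \<bar>Im w\<bar> < \<alpha>}"
    by (intro holomorphic_deriv holo open_Im_strip)
  fix \<beta> and N :: nat assume \<beta>: "\<beta> < \<alpha>"
  \<comment> \<open>Half the distance between the two strips: discs of this radius about points of
    the smaller one stay where \<open>f\<close> is controlled.\<close>
  define r where "r = (\<alpha> - \<beta>) / 2"
  have r: "r > 0" "\<beta> + r < \<alpha>" using \<beta> by (auto simp: r_def field_simps)
  obtain C where C: "C \<ge> 0" "\<And>w. \<bar>Im w\<bar> \<le> \<beta> + r \<Longrightarrow> norm (f w) \<le> C * exp (- real N * \<bar>Re w\<bar>)"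
    using rapid_on_stripD[OF assms(1) r(2), of N] by auto
  have "norm (deriv f w) \<le> (C * exp (N * r) / r) * exp (- real N * \<bar>Re w\<bar>)" if w: "\<bar>Im w\<bar> \<le> \<beta>" for w
  proof -
    have sub: "cball w r \<subseteq> {w. \<bar>Im w\<bar> < \<alpha>}"
    proof safe
      fix x assume "x \<in> cball w r"
      hence "\<bar>Im (w - x)\<bar> \<le> r" using abs_Im_le_cmod[of "w - x"] by (simp add: dist_norm)
      thus "\<bar>Im x\<bar> < \<alpha>" using w r by auto
    qed
    have "norm ((deriv ^^ 1) f w) \<le> fact 1 * (C * exp (N * r) * exp (- real N * \<bar>Re w\<bar>)) / r ^ 1"
    proof (rule Cauchy_inequality)
      show "f holomorphic_on ball w r" "continuous_on (cball w r) f"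
        by (rule holomorphic_on_subset[OF holo order_trans[OF ball_subset_cball sub]])
           (rule holomorphic_on_imp_continuous_on[OF holomorphic_on_subset[OF holo sub]])
      fix x assume x: "norm (w - x) = r"
      have 1: "\<bar>Im (w - x)\<bar> \<le> r" "\<bar>Re (w - x)\<bar> \<le> r"
        using abs_Im_le_cmod[of "w - x"] abs_Re_le_cmod[of "w - x"] x by auto
      have "norm (f x) \<le> C * exp (- real N * \<bar>Re x\<bar>)"
        by (rule C) (use 1 w in auto)
      also have "- real N * \<bar>Re x\<bar> \<le> N * r + - real N * \<bar>Re w\<bar>"
      proof -
        have "real N * \<bar>Re w\<bar> \<le> real N * (r + \<bar>Re x\<bar>)" using 1 by (intro mult_left_mono) auto
        thus ?thesis by (simp add: distrib_left)
      qed
      finally have "norm (f x) \<le> C * exp (N * r + - real N * \<bar>Re w\<bar>)"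
        using C(1) by (simp add: mult_left_mono)
      thus "norm (f x) \<le> C * exp (N * r) * exp (- real N * \<bar>Re w\<bar>)"
        by (simp only: exp_add mult.assoc)
    qed (use r in auto)
    thus ?thesis by simp
  qed
  thus "\<exists>C. \<forall>w. \<bar>Im w\<bar> \<le> \<beta> \<longrightarrow> norm (deriv f w) \<le> C * exp (- real N * \<bar>Re w\<bar>)" by blast
qed

lemma rapid_on_strip_continuous:
  assumes "rapid_on_strip \<alpha> f" "\<alpha> > 0"
  shows "continuous_on UNIV (\<lambda>t. f (complex_of_real t))"
proof -
  have "continuous_on {w. \<bar>Im w\<bar> < \<alpha>} f"
    using assms by (auto simp: rapid_on_strip_def intro: holomorphic_on_imp_continuous_on)
  thus ?thesis
    by (rule continuous_on_compose2) (use assms in \<open>auto intro!: continuous_intros\<close>)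
qed

lemma rapid_on_strip_measurable:
  assumes "rapid_on_strip \<alpha> f" "\<alpha> > 0"
  shows "(\<lambda>t. f (complex_of_real t)) \<in> borel_measurable borel"
  using rapid_on_strip_continuous[OF assms] by (rule borel_measurable_continuous_onI)

lemma rapid_on_strip_exp_bound:
  assumes "rapid_on_strip \<alpha> f" "\<beta> < \<alpha>"
  shows "\<exists>C\<ge>0. \<forall>w s. \<bar>Im w\<bar> \<le> \<beta> \<longrightarrow> \<bar>Re s\<bar> \<le> M \<longrightarrow>
            norm (f w * exp (s * w)) \<le> C * exp (- \<bar>Re w\<bar>) * exp (- Im s * Im w)"
proof -
  \<comment> \<open>An amount \<open>M\<close> of the decay is spent on \<open>exp (s * w)\<close>;
    the remaining 1 leaves an integrable factor.\<close>
  obtain N :: nat where N: "real N \<ge> M + 1" using real_arch_simple by blast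
  obtain C where C: "C \<ge> 0" "\<And>w. \<bar>Im w\<bar> \<le> \<beta> \<Longrightarrow> norm (f w) \<le> C * exp (- real N * \<bar>Re w\<bar>)"
    using rapid_on_stripD[OF assms, of N] by auto
  have "norm (f w * exp (s * w)) \<le> C * exp (- \<bar>Re w\<bar>) * exp (- Im s * Im w)"
    if w: "\<bar>Im w\<bar> \<le> \<beta>" and s: "\<bar>Re s\<bar> \<le> M" for w s
  proof -
    have "Re s * Re w \<le> \<bar>Re s\<bar> * \<bar>Re w\<bar>" by (simp add: abs_mult[symmetric])
    also have "\<dots> \<le> (real N - 1) * \<bar>Re w\<bar>" using s N by (intro mult_right_mono) auto
    finally have 1: "- real N * \<bar>Re w\<bar> + Re s * Re w \<le> - \<bar>Re w\<bar>" by (simp add: algebra_simps)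
    have "norm (f w * exp (s * w)) = norm (f w) * (exp (Re s * Re w) * exp (- Im s * Im w))"
      by (simp add: norm_mult exp_add[symmetric])
    also have "\<dots> \<le> (C * exp (- real N * \<bar>Re w\<bar>)) * (exp (Re s * Re w) * exp (- Im s * Im w))"
      by (intro mult_right_mono C w) auto
    also have "\<dots> = C * exp (- real N * \<bar>Re w\<bar> + Re s * Re w) * exp (- Im s * Im w)"
      by (simp only: exp_add mult.assoc)
    also have "\<dots> \<le> C * exp (- \<bar>Re w\<bar>) * exp (- Im s * Im w)"
      using C(1) 1 by (intro mult_right_mono mult_left_mono) auto
    finally show ?thesis .
  qed
  thus ?thesis using C(1) by blast
qed

lemma rapid_on_strip_integrable:
  assumes "rapid_on_strip \<alpha> f" "\<alpha> > 0"
  shows "integrable lborel (\<lambda>t. f (of_real t) * exp (s * of_real t))"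
    "integrable lborel (\<lambda>t. norm (f (of_real t)) * exp (r * t))"
proof -
  have [measurable]: "(\<lambda>t. f (complex_of_real t)) \<in> borel_measurable borel"
    using assms by (rule rapid_on_strip_measurable)
  have *: "integrable lborel (\<lambda>t. f (of_real t) * exp (s * of_real t))" for s
  proof -
    obtain C where C: "\<And>w. \<bar>Im w\<bar> \<le> 0 \<Longrightarrow> norm (f w * exp (s * w)) \<le> C * exp (- \<bar>Re w\<bar>) * exp (- Im s * Im w)"
      using rapid_on_strip_exp_bound[OF assms, of "\<bar>Re s\<bar>"] by auto
    show ?thesis
      by (rule integrable_exp_bound[of _ 1 C]) (use C[of "of_real _"] in auto)
  qed
  show "integrable lborel (\<lambda>t. f (of_real t) * exp (s * of_real t))" by (rule *)
  have "integrable lborel (\<lambda>t. norm (f (of_real t) * exp (of_real r * of_real t)))"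
    by (rule integrable_norm) (rule *)
  thus "integrable lborel (\<lambda>t. norm (f (of_real t)) * exp (r * t))"
    by (simp add: norm_mult)
qed

lemma laplace_rapid_entire:
  assumes "rapid_on_strip \<alpha> f" "\<alpha> > 0"
  shows "laplace (\<lambda>t. f (of_real t)) holomorphic_on UNIV"
  using laplace_holomorphic[OF rapid_on_strip_measurable[OF assms] open_UNIV]
    rapid_on_strip_integrable(2)[OF assms] by simp

lemma laplace_rapid_shift:
  assumes f: "rapid_on_strip \<alpha> f" and y: "\<bar>y\<bar> < \<alpha>"
  shows "laplace (\<lambda>t. f (of_real t)) s = (LINT t|lborel. f (Complex t y) * exp (s * Complex t y))"
proof -
  \<comment> \<open>Multiplication by \<open>- \<i>\<close> carries vertical lines to horizontal
    ones, so that \<open>strip_shift\<close> can move the path of integration from height 0 to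
    height \<open>y\<close>.\<close>
  define F where "F = (\<lambda>z. f (- \<i> * z) * exp (s * (- \<i> * z)))"
  obtain C where C: "C \<ge> 0" "\<And>w. \<bar>Im w\<bar> \<le> \<bar>y\<bar> \<Longrightarrow> norm (f w * exp (s * w)) \<le> C * exp (- \<bar>Re w\<bar>) * exp (- Im s * Im w)"
    using rapid_on_strip_exp_bound[OF f y, of "\<bar>Re s\<bar>"] by auto
  have FI: "F (Complex c t) = f (Complex t (-c)) * exp (s * Complex t (-c))" for c t
  proof -
    have "- \<i> * Complex c t = Complex t (-c)" by (simp add: complex_eq_iff)
    thus ?thesis unfolding F_def by (simp only:)
  qed
  have bd: "norm (F z) \<le> (C * exp (\<bar>Im s\<bar> * \<bar>y\<bar>)) * exp (- 1 * \<bar>Im z\<bar>)" if z: "\<bar>Re z\<bar> \<le> \<bar>y\<bar>" for z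
  proof -
    have "norm (F z) \<le> C * exp (- \<bar>Re (- \<i> * z)\<bar>) * exp (- Im s * Im (- \<i> * z))"
      unfolding F_def by (rule C) (use z in auto)
    also have "- Im s * Im (- \<i> * z) \<le> \<bar>Im s\<bar> * \<bar>y\<bar>"
    proof -
      have "- Im s * Im (- \<i> * z) \<le> \<bar>Im s\<bar> * \<bar>Re z\<bar>" by (simp add: abs_mult[symmetric])
      also have "\<dots> \<le> \<bar>Im s\<bar> * \<bar>y\<bar>" using z by (intro mult_left_mono) auto
      finally show ?thesis .
    qed
    finally show ?thesis using C(1) by (simp add: mult.commute mult.left_commute mult_left_mono)
  qed
  have hol: "F holomorphic_on {z. \<bar>Re z\<bar> \<le> \<bar>y\<bar>}"
  proof -
    have "f \<circ> (\<lambda>z. - \<i> * z) holomorphic_on {z. \<bar>Re z\<bar> \<le> \<bar>y\<bar>}"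
      by (rule holomorphic_on_compose_gen[of _ _ _ "{w. \<bar>Im w\<bar> < \<alpha>}"])
         (use f y in \<open>auto simp: rapid_on_strip_def intro!: holomorphic_intros\<close>)
    thus ?thesis unfolding F_def by (auto simp: o_def intro!: holomorphic_intros)
  qed
  have "(LINT t|lborel. F (Complex 0 t)) = (LINT t|lborel. F (Complex (-y) t))"
  proof (cases y "0 :: real" rule: linorder_cases)
    case less
    show ?thesis
      by (rule strip_shift[symmetric, of _ _ _ 1 "C * exp (\<bar>Im s\<bar> * \<bar>y\<bar>)"])
         (use less in \<open>auto intro!: order_trans[OF bd] holomorphic_on_subset[OF hol]\<close>)
  next
    case greater
    show ?thesis
      by (rule strip_shift[of _ _ _ 1 "C * exp (\<bar>Im s\<bar> * \<bar>y\<bar>)"])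
         (use greater in \<open>auto intro!: order_trans[OF bd] holomorphic_on_subset[OF hol]\<close>)
  qed simp
  thus ?thesis by (simp add: FI laplace_def complex_of_real_def)
qed

text \<open>On the line \<open>Im w = y\<close> the factor \<open>exp (s * w)\<close> contributes
  \<open>exp (- Im s * y)\<close>. Taking \<open>\<beta>\<close> or \<open>- \<beta>\<close> for
  \<open>y\<close>, by the sign of \<open>Im s\<close>, makes this
  \<open>exp (- \<beta> * \<bar>Im s\<bar>)\<close>.\<close>

lemma laplace_rapid_decay:
  assumes f: "rapid_on_strip \<alpha> f" and \<beta>: "0 \<le> \<beta>" "\<beta> < \<alpha>"
  shows "\<exists>C\<ge>0. \<forall>s. \<bar>Re s\<bar> \<le> M \<longrightarrow> norm (laplace (\<lambda>t. f (of_real t)) s) \<le> C * exp (- \<beta> * \<bar>Im s\<bar>)"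
proof -
  obtain C where C: "C \<ge> 0" "\<And>w s. \<bar>Im w\<bar> \<le> \<beta> \<Longrightarrow> \<bar>Re s\<bar> \<le> M \<Longrightarrow> 
      norm (f w * exp (s * w)) \<le> C * exp (- \<bar>Re w\<bar>) * exp (- Im s * Im w)"
    using rapid_on_strip_exp_bound[OF f \<beta>(2), of M] by auto
  define D where "D = (LINT t|lborel. C * exp (- 1 * \<bar>t::real\<bar>))"
  have D0: "D \<ge> 0" unfolding D_def using C(1) by (intro integral_nonneg_AE) auto
  have "norm (laplace (\<lambda>t. f (of_real t)) s) \<le> D * exp (- \<beta> * \<bar>Im s\<bar>)" if s: "\<bar>Re s\<bar> \<le> M" for s
  proof -
    define y where "y = (if Im s \<ge> 0 then \<beta> else - \<beta>)"
    have y: "\<bar>y\<bar> = \<beta>" "Im s * y = \<bar>Im s\<bar> * \<beta>" using \<beta> by (auto simp: y_def)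
    have "norm (laplace (\<lambda>t. f (of_real t)) s) = norm (LINT t|lborel. f (Complex t y) * exp (s * Complex t y))"
      using laplace_rapid_shift[OF f, of y s] y \<beta> by simp
    also have "\<dots> \<le> (LINT t|lborel. C * exp (- 1 * \<bar>t\<bar>) * exp (- \<beta> * \<bar>Im s\<bar>))"
    proof (rule Bochner_Integration.integral_norm_bound_integral)
      have 1: "norm (f (Complex t y) * exp (s * Complex t y)) \<le> C * exp (- 1 * \<bar>t\<bar>) * exp (- \<beta> * \<bar>Im s\<bar>)" for t
        using C(2)[of "Complex t y" s] s y by (simp add: mult.commute)
      have cont: "continuous_on UNIV (\<lambda>t. f (Complex t y))"
      proof (rule continuous_on_compose2[of "{w. \<bar>Im w\<bar> < \<alpha>}" f])
        show "continuous_on {w. \<bar>Im w\<bar> < \<alpha>} f"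
          using f by (auto simp: rapid_on_strip_def intro: holomorphic_on_imp_continuous_on)
        show "continuous_on UNIV (\<lambda>t. Complex t y)" by (simp add: Complex_eq) (intro continuous_intros)
      qed (use y \<beta> in auto)
      have [measurable]: "(\<lambda>t. f (Complex t y) * exp (s * Complex t y)) \<in> borel_measurable borel"
        by (intro borel_measurable_continuous_onI continuous_intros cont)
      show "integrable lborel (\<lambda>t. f (Complex t y) * exp (s * Complex t y))"
        by (rule integrable_exp_bound[of _ 1 "C * exp (- \<beta> * \<bar>Im s\<bar>)"]) (use 1 in \<open>auto simp: mult_ac\<close>)
      show "integrable lborel (\<lambda>t. C * exp (- 1 * \<bar>t\<bar>) * exp (- \<beta> * \<bar>Im s\<bar>))"
        using integrable_exp_abs[of 1] by auto
      show "norm (f (Complex t y) * exp (s * Complex t y)) \<le> C * exp (- 1 * \<bar>t\<bar>) * exp (- \<beta> * \<bar>Im s\<bar>)" for t by (rule 1)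
    qed
    also have "\<dots> = D * exp (- \<beta> * \<bar>Im s\<bar>)" by (simp add: D_def)
    finally show ?thesis .
  qed
  thus ?thesis using D0 by blast
qed

lemma laplace_rapid_deriv:
  assumes f: "rapid_on_strip \<alpha> f" and \<alpha>: "\<alpha> > 0"
  shows "laplace (\<lambda>t. deriv f (of_real t)) s = - s * laplace (\<lambda>t. f (of_real t)) s"
proof -
  have f': "rapid_on_strip \<alpha> (deriv f)" by (rule rapid_on_strip_deriv[OF f])
  define h where "h = (\<lambda>t::real. f (of_real t) * exp (s * of_real t))"
  define h' where "h' = (\<lambda>t::real. deriv f (of_real t) * exp (s * of_real t) + s * (f (of_real t) * exp (s * of_real t)))"
  have holo: "f holomorphic_on {w. \<bar>Im w\<bar> < \<alpha>}" using f by (simp add: rapid_on_strip_def)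
  have der: "(h has_vector_derivative h' t) (at t)" for t
  proof -
    have "(f has_field_derivative deriv f (of_real t)) (at (of_real t))"
      by (rule holomorphic_derivI[OF holo open_Im_strip]) (use \<alpha> in auto)
    hence "((\<lambda>w. f w * exp (s * w)) has_field_derivative
        (deriv f (of_real t) * exp (s * of_real t) + s * (f (of_real t) * exp (s * of_real t)))) (at (of_real t))"
      by (auto intro!: derivative_eq_intros simp: algebra_simps)
    thus ?thesis
      unfolding h_def h'_def by (rule has_vector_derivative_real_field)
  qed
  obtain C where C: "C \<ge> 0" "\<And>w. \<bar>Im w\<bar> \<le> 0 \<Longrightarrow> norm (f w * exp (s * w)) \<le> C * exp (- \<bar>Re w\<bar>) * exp (- Im s * Im w)"
    using rapid_on_strip_exp_bound[OF f \<alpha>, of "\<bar>Re s\<bar>"] by auto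
  obtain D where D: "D \<ge> 0" "\<And>w. \<bar>Im w\<bar> \<le> 0 \<Longrightarrow> norm (deriv f w * exp (s * w)) \<le> D * exp (- \<bar>Re w\<bar>) * exp (- Im s * Im w)"
    using rapid_on_strip_exp_bound[OF f' \<alpha>, of "\<bar>Re s\<bar>"] by auto
  have hb: "norm (h t) \<le> C * exp (- 1 * \<bar>t\<bar>)" for t
    using C(2)[of "of_real t"] by (simp add: h_def)
  have h'b: "norm (h' t) \<le> (D + norm s * C) * exp (- 1 * \<bar>t\<bar>)" for t
  proof -
    have "norm (h' t) \<le> norm (deriv f (of_real t) * exp (s * of_real t)) + norm s * norm (h t)"
      by (simp add: h'_def h_def norm_triangle_le flip: norm_mult)
    also have "\<dots> \<le> D * exp (- 1 * \<bar>t\<bar>) + norm s * (C * exp (- 1 * \<bar>t\<bar>))"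
      by (intro add_mono mult_left_mono hb) (use D(2)[of "of_real t"] in auto)
    finally show ?thesis by (simp add: algebra_simps)
  qed
  have "continuous_on UNIV h'"
    unfolding h'_def by (intro continuous_intros rapid_on_strip_continuous[OF f \<alpha>] rapid_on_strip_continuous[OF f' \<alpha>])
  hence "((\<lambda>T. integral {-T..T} h') \<longlongrightarrow> (LINT t|lborel. h' t)) at_top"
    by (rule integral_symmetric_interval_tendsto[of _ 1]) (use h'b in auto)
  moreover have "\<forall>\<^sub>F T in at_top. integral {-T..T} h' = h T - h (-T)"
  proof (rule eventually_mono[OF eventually_ge_at_top[of 0]])
    fix T :: real assume "0 \<le> T"
    hence "(h' has_integral h T - h (-T)) {-T..T}"
      by (intro fundamental_theorem_of_calculus has_vector_derivative_at_within[OF der]) auto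
    thus "integral {-T..T} h' = h T - h (-T)" by (rule integral_unique)
  qed
  ultimately have 1: "((\<lambda>T. h T - h (-T)) \<longlongrightarrow> (LINT t|lborel. h' t)) at_top"
    by (rule Lim_transform_eventually)
  have "(h \<longlongrightarrow> 0) at_top"
  proof (rule Lim_null_comparison)
    show "\<forall>\<^sub>F t in at_top. norm (h t) \<le> C * exp (- 1 * \<bar>t\<bar>)" using hb by auto
    show "((\<lambda>t::real. C * exp (- 1 * \<bar>t\<bar>)) \<longlongrightarrow> 0) at_top" by real_asymp
  qed
  moreover have "((\<lambda>t. h (-t)) \<longlongrightarrow> 0) at_top"
  proof (rule Lim_null_comparison)
    show "\<forall>\<^sub>F t in at_top. norm (h (-t)) \<le> C * exp (- 1 * \<bar>t\<bar>)" using hb[of "- _"] by auto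
    show "((\<lambda>t::real. C * exp (- 1 * \<bar>t\<bar>)) \<longlongrightarrow> 0) at_top" by real_asymp
  qed
  ultimately have "((\<lambda>T. h T - h (-T)) \<longlongrightarrow> 0 - 0) at_top" by (rule tendsto_diff)
  with 1 have "(LINT t|lborel. h' t) = 0"
    using tendsto_unique[OF trivial_limit_at_top_linorder] by fastforce
  moreover have "(LINT t|lborel. h' t) = laplace (\<lambda>t. deriv f (of_real t)) s + s * laplace (\<lambda>t. f (of_real t)) s"
    unfolding h'_def laplace_def
    by (subst Bochner_Integration.integral_add)
       (use rapid_on_strip_integrable(1)[OF f \<alpha>] rapid_on_strip_integrable(1)[OF f' \<alpha>] in auto)
  ultimately show ?thesis by (simp add: add_eq_0_iff)
qed

section \<open>Growth of meromorphic quotients on vertical strips\<close>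

text \<open>Harnack's inequality for the positive harmonic function ln (M |g z0| / |g|): its value
  at the centre is ln M, so at distance \<open>r\<close> it is at most (R + r) / (R - r) times that.
  It is derived from the Schwarz lemma by way of a Cayley transform.\<close>

lemma harnack_nonvanishing:
  fixes g :: "complex \<Rightarrow> complex"
  assumes holo: "g holomorphic_on ball z0 R" and nz: "\<And>z. z \<in> ball z0 R \<Longrightarrow> g z \<noteq> 0"
    and bd: "\<And>z. z \<in> ball z0 R \<Longrightarrow> norm (g z) < M * norm (g z0)"
    and z: "norm (z - z0) \<le> r" and r: "0 < r" "r < R"
  shows "norm (g z0) \<le> norm (g z) * M powr ((R + r) / (R - r))"
proof -
  have R: "R > 0" using r by simp
  have z0: "z0 \<in> ball z0 R" using R by simp
  have M: "M > 1" using bd[OF z0] nz[OF z0] by simp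
  define m where "m = ln M"
  have m: "m > 0" using M by (simp add: m_def)
  obtain L where L: "L holomorphic_on ball z0 R" "\<And>x. x \<in> ball z0 R \<Longrightarrow> exp (L x) = g x"
    using holomorphic_logarithm_exists[OF convex_ball open_ball holo nz z0] by metis
  have ng: "norm (g x) = exp (Re (L x))" if "x \<in> ball z0 R" for x
    using L(2)[OF that] by (metis norm_exp_eq_Re)
  \<comment> \<open>The real part of \<open>\<phi>\<close> is that harmonic function, and
    \<open>\<phi> z0 = m\<close>.\<close>
  define \<phi> where "\<phi> = (\<lambda>x. of_real m - (L x - L z0))"
  have Re\<phi>: "Re (\<phi> x) > 0" if x: "x \<in> ball z0 R" for x
  proof -
    have "exp (Re (L x)) < M * exp (Re (L z0))" using bd[OF x] ng[OF x] ng[OF z0] by simp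
    also have "\<dots> = exp (m + Re (L z0))" using M by (simp add: m_def exp_add)
    finally show ?thesis by (simp add: \<phi>_def)
  qed
  define S where "S = (\<lambda>\<xi>. z0 + of_real R * \<xi>)"
  have S: "S \<xi> \<in> ball z0 R" if "norm \<xi> < 1" for \<xi>
    using that R by (simp add: S_def dist_norm norm_mult)
  \<comment> \<open>The Cayley transform maps the right half-plane to the unit disc and
    \<open>m\<close>, the value at the centre, to 0.\<close>
  define \<psi> where "\<psi> = (\<lambda>\<xi>. (\<phi> (S \<xi>) - of_real m) / (\<phi> (S \<xi>) + of_real m))"
  have den: "\<phi> (S \<xi>) + of_real m \<noteq> 0" if "norm \<xi> < 1" for \<xi>
    using Re\<phi>[OF S[OF that]] m by (auto simp: complex_eq_iff)
  define \<xi> where "\<xi> = (z - z0) / of_real R"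
  have n\<xi>: "norm \<xi> \<le> r / R" using z R by (simp add: \<xi>_def norm_divide divide_right_mono)
  have n\<xi>1: "norm \<xi> < 1" using n\<xi> r R by (meson divide_less_eq_1_pos le_less_trans)
  have S\<xi>: "S \<xi> = z" using R by (simp add: S_def \<xi>_def)
  have "norm (\<psi> \<xi>) \<le> norm \<xi>"
  proof (rule Schwarz_Lemma(1)[OF _ _ _ n\<xi>1])
    have "L \<circ> S holomorphic_on ball 0 1"
      by (rule holomorphic_on_compose_gen[OF _ L(1)]) (use S in \<open>auto simp: S_def[abs_def] intro!: holomorphic_intros\<close>)
    hence "(\<lambda>\<xi>. L (S \<xi>)) holomorphic_on ball 0 1" by (simp add: o_def)
    thus "\<psi> holomorphic_on ball 0 1"
      unfolding \<psi>_def \<phi>_def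
      by (intro holomorphic_intros) (use den in \<open>auto simp: \<phi>_def\<close>)
    show "\<psi> 0 = 0" by (simp add: \<psi>_def \<phi>_def S_def)
    fix w :: complex assume w: "norm w < 1"
    define p where "p = \<phi> (S w)"
    have p: "Re p > 0" unfolding p_def by (rule Re\<phi>[OF S[OF w]])
    have "norm (p - of_real m) < norm (p + of_real m)"
    proof (rule power2_less_imp_less)
      have "(norm (p + of_real m))\<^sup>2 - (norm (p - of_real m))\<^sup>2 = 4 * m * Re p"
        unfolding cmod_power2 by (simp add: power2_eq_square algebra_simps)
      moreover have "4 * m * Re p > 0" using m p by simp
      ultimately show "(norm (p - of_real m))\<^sup>2 < (norm (p + of_real m))\<^sup>2" by simp
    qed simp
    moreover have "norm (p + of_real m) > 0" using den[OF w] by (simp add: p_def)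
    ultimately show "norm (\<psi> w) < 1" by (simp add: \<psi>_def p_def norm_divide)
  qed
  hence n\<psi>: "norm (\<psi> \<xi>) \<le> r / R" using n\<xi> by simp
  have eq: "\<phi> z * (1 - \<psi> \<xi>) = of_real m * (1 + \<psi> \<xi>)"
    using den[OF n\<xi>1] by (simp add: \<psi>_def S\<xi> field_simps)
  have "norm (\<phi> z) * (1 - r / R) \<le> norm (\<phi> z) * norm (1 - \<psi> \<xi>)"
    using norm_triangle_ineq2[of 1 "\<psi> \<xi>"] n\<psi> by (intro mult_left_mono) auto
  also have "\<dots> = m * norm (1 + \<psi> \<xi>)" using eq m by (metis norm_mult norm_of_real abs_of_pos)
  also have "\<dots> \<le> m * (1 + r / R)"
    using norm_triangle_ineq[of 1 "\<psi> \<xi>"] n\<psi> m by (intro mult_left_mono) auto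
  finally have "norm (\<phi> z) * (1 - r / R) * R \<le> m * (1 + r / R) * R"
    using R by (intro mult_right_mono) auto
  moreover have "(1 - r / R) * R = R - r" "(1 + r / R) * R = R + r" using R by (simp_all add: field_simps)
  ultimately have "norm (\<phi> z) * (R - r) \<le> m * (R + r)" by (simp only: mult.assoc)
  hence "norm (\<phi> z) \<le> m * ((R + r) / (R - r))" using r by (simp add: field_simps)
  hence "Re (\<phi> z) \<le> m * ((R + r) / (R - r))" using complex_Re_le_cmod order_trans by blast
  hence "Re (L z0) \<le> Re (L z) + m * ((R + r) / (R - r))" using m by (simp add: \<phi>_def)
  hence "exp (Re (L z0)) \<le> exp (Re (L z)) * exp (m * ((R + r) / (R - r)))"
    by (simp flip: exp_add)
  also have "exp (m * ((R + r) / (R - r))) = M powr ((R + r) / (R - r))"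
    using M by (simp add: m_def powr_def mult.commute)
  finally show ?thesis
    using ng[OF z0] ng[of z] z r by (simp add: dist_norm norm_minus_commute)
qed

text \<open>On the circle \<open>R\<^sup>2\<close> equals \<open>cnj (z - z0) * (z - z0)\<close>, so
  the expression factors as \<open>cnj (z - a) * (z - z0)\<close>. This is the fact that a Blaschke
  factor has modulus 1 on the boundary.\<close>

lemma blaschke_norm_circle:
  assumes "norm (z - z0) = R" "R > 0" "z \<noteq> a" "norm (a - z0) < R"
  shows "norm (of_real (R\<^sup>2) - cnj (a - z0) * (z - z0)) = R * norm (z - a)"
proof -
  have "of_real (R\<^sup>2) = cnj (z - z0) * (z - z0)"
    using assms by (metis complex_norm_square mult.commute)
  hence "of_real (R\<^sup>2) - cnj (a - z0) * (z - z0) = cnj (z - a) * (z - z0)"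
    by (simp add: algebra_simps)
  thus ?thesis using assms by (simp only: norm_mult complex_mod_cnj) (simp add: mult.commute)
qed

text \<open>
  Each Blaschke factor for a zero of \<open>g\<close> in the middle disc shrinks \<open>M\<close> by \<open>R' / R\<close>; since \<open>M \<ge> 1\<close> always,
  there are at most \<open>n\<close> of them.
\<close>
lemma quotient_bound_aux:
  fixes z0 :: complex
  assumes r: "0 < r" "r < R'" "R' < R" and S: "open S" "cball z0 R \<subseteq> S"
  defines "K \<equiv> (R' + r) / (R' - r)"
  shows "g holomorphic_on S \<Longrightarrow> F holomorphic_on S \<Longrightarrow> g z0 \<noteq> 0 \<Longrightarrow>
    (\<And>z. z \<in> cball z0 R \<Longrightarrow> norm (g z) \<le> M * norm (g z0)) \<Longrightarrow>
    (\<And>z. z \<in> cball z0 R \<Longrightarrow> norm (F z * g z) \<le> H) \<Longrightarrow> M \<le> (R / R') ^ n \<Longrightarrow>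
    norm (z - z0) \<le> r \<Longrightarrow> norm (F z) \<le> H / norm (g z0) * (M + 1) powr K"
proof (induction n arbitrary: g M)
  have K: "K > 0" using r by (simp add: K_def)
  have step: "norm (F z) \<le> H / norm (g z0) * (M + 1) powr K"
    if g: "g holomorphic_on S" and F: "F holomorphic_on S" and nz0: "g z0 \<noteq> 0"
      and gM: "\<And>z. z \<in> cball z0 R \<Longrightarrow> norm (g z) \<le> M * norm (g z0)"
      and FH: "\<And>z. z \<in> cball z0 R \<Longrightarrow> norm (F z * g z) \<le> H"
      and z: "norm (z - z0) \<le> r"
      and IH: "\<And>g2. g2 holomorphic_on S \<Longrightarrow> g2 z0 \<noteq> 0 \<Longrightarrow> 
        (\<And>z. z \<in> cball z0 R \<Longrightarrow> norm (g2 z) \<le> (M * (R' / R)) * norm (g2 z0)) \<Longrightarrow>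
        (\<And>z. z \<in> cball z0 R \<Longrightarrow> norm (F z * g2 z) \<le> H) \<Longrightarrow> 
        norm (F z) \<le> H / norm (g2 z0) * (M * (R' / R) + 1) powr K"
    for g M
  proof -
    have M1: "M \<ge> 1" using gM[of z0] nz0 r by simp
    have H0: "H \<ge> 0" using FH[of z0] r order_trans[OF norm_ge_zero] by auto
    show ?thesis
    proof (cases "\<exists>a\<in>ball z0 R'. g a = 0")
      case False
      \<comment> \<open>\<open>M + 1\<close> in place of \<open>M\<close> because
        \<open>harnack_nonvanishing\<close> asks for a strict bound, which fails at the centre if
        \<open>M = 1\<close>.\<close>
      have "norm (g z0) \<le> norm (g z) * (M + 1) powr K"
        unfolding K_def
      proof (rule harnack_nonvanishing[OF _ _ _ z])
        show "g holomorphic_on ball z0 R'"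
          using S r by (intro holomorphic_on_subset[OF g]) auto
        fix x assume x: "x \<in> ball z0 R'"
        show "g x \<noteq> 0" using False x by auto
        have "norm (g x) \<le> M * norm (g z0)" using x r by (intro gM) auto
        also have "\<dots> < (M + 1) * norm (g z0)" using nz0 by (intro mult_strict_right_mono) auto
        finally show "norm (g x) < (M + 1) * norm (g z0)" .
      qed (use r in auto)
      hence "norm (F z) * norm (g z0) \<le> norm (F z) * (norm (g z) * (M + 1) powr K)"
        by (rule mult_left_mono) simp
      also have "\<dots> = norm (F z * g z) * (M + 1) powr K" by (simp add: norm_mult)
      also have "\<dots> \<le> H * (M + 1) powr K"
        using z r by (intro mult_right_mono FH) (auto simp: dist_norm norm_minus_commute)
      finally show ?thesis using nz0 by (simp add: field_simps)
    next
      case True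
      then obtain a where a: "norm (a - z0) < R'" "g a = 0" by (auto simp: dist_norm norm_minus_commute)
      have az0: "a \<noteq> z0" using a nz0 by auto
      define g1 where "g1 = (\<lambda>x. if x = a then deriv g a else (g x - g a) / (x - a))"
      have g1: "g1 holomorphic_on S" unfolding g1_def by (rule pole_lemma_open[OF g S(1)])
      have gg1: "g x = (x - a) * g1 x" for x using a by (simp add: g1_def)
      \<comment> \<open>\<open>g2\<close> is \<open>g\<close> with the zero \<open>a\<close>
        replaced by its mirror image in the circle of radius \<open>R\<close>. Its modulus on that
        circle is unchanged, so by the maximum principle the bounds survive, while the modulus at
        \<open>z0\<close> grows at least by the factor \<open>R / R'\<close>.\<close>
      define g2 where "g2 = (\<lambda>x. g1 x * (of_real (R\<^sup>2) - cnj (a - z0) * (x - z0)) / of_real R)"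
      have R: "R > 0" using r by simp
      have g2: "g2 holomorphic_on S" unfolding g2_def using R by (intro holomorphic_intros g1) auto
      have circ: "norm (g2 x) = norm (g x)" if x: "norm (x - z0) = R" for x
      proof -
        have "x \<noteq> a" using x a r by auto
        thus ?thesis using blaschke_norm_circle[OF x R, of a] a r R
          by (simp add: g2_def gg1 norm_mult norm_divide)
      qed
      have g2z0: "norm (g z0) = norm (g2 z0) * (norm (a - z0) / R)"
        using R by (simp add: g2_def gg1 norm_mult norm_divide norm_power norm_minus_commute power2_eq_square)
      have nz2: "g2 z0 \<noteq> 0" using g2z0 nz0 by auto
      have le: "norm (g z0) \<le> norm (g2 z0) * (R' / R)"
        unfolding g2z0 using a R by (intro mult_left_mono divide_right_mono) auto
      have le': "norm (g z0) \<le> norm (g2 z0)"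
        unfolding g2z0 using a R r by (intro mult_right_le_one_le) auto
      have maxm: "norm (f x) \<le> B" if f: "f holomorphic_on S" and x: "x \<in> cball z0 R"
          and B: "\<And>x. norm (x - z0) = R \<Longrightarrow> norm (f x) \<le> B" for f B x
      proof (rule maximum_modulus_frontier[OF _ _ _ _ x])
        show "f holomorphic_on interior (cball z0 R)"
          by (rule holomorphic_on_subset[OF f]) (use S ball_subset_cball in \<open>auto simp: interior_cball\<close>)
        show "continuous_on (closure (cball z0 R)) f"
          using S by (auto intro!: holomorphic_on_imp_continuous_on holomorphic_on_subset[OF f])
      qed (use B in \<open>auto simp: frontier_cball dist_norm norm_minus_commute\<close>)
      have b1: "norm (g2 x) \<le> (M * (R' / R)) * norm (g2 z0)" if x: "x \<in> cball z0 R" for x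
      proof (rule maxm[OF g2 x])
        fix y assume y: "norm (y - z0) = R"
        have "norm (g2 y) \<le> M * norm (g z0)"
          using circ[OF y] y by (auto intro!: gM simp: dist_norm norm_minus_commute)
        also have "\<dots> \<le> M * (norm (g2 z0) * (R' / R))" using le M1 by (intro mult_left_mono) auto
        finally show "norm (g2 y) \<le> (M * (R' / R)) * norm (g2 z0)" by (simp add: mult_ac)
      qed
      have b2: "norm (F x * g2 x) \<le> H" if x: "x \<in> cball z0 R" for x
      proof (rule maxm[OF _ x])
        show "(\<lambda>x. F x * g2 x) holomorphic_on S" by (intro holomorphic_intros F g2)
        fix y assume y: "norm (y - z0) = R"
        show "norm (F y * g2 y) \<le> H"
          using FH[of y] circ[OF y] y by (auto simp: dist_norm norm_minus_commute norm_mult)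
      qed
      have "norm (F z) \<le> H / norm (g2 z0) * (M * (R' / R) + 1) powr K"
        by (rule IH[OF g2 nz2 b1 b2])
      also have "\<dots> \<le> H / norm (g z0) * (M + 1) powr K"
      proof (intro mult_mono)
        show "H / norm (g2 z0) \<le> H / norm (g z0)"
          using le' H0 nz0 nz2 by (intro divide_left_mono) auto
        have "M * (R' / R) \<le> M * 1" using M1 r R by (intro mult_left_mono) auto
        thus "(M * (R' / R) + 1) powr K \<le> (M + 1) powr K"
          using K M1 r R by (intro powr_mono2) auto
      qed (use H0 in auto)
      finally show ?thesis .
    qed
  qed
  { case (0 g M)
    \<comment> \<open>With \<open>M \<le> 1\<close> there is no zero to remove: \<open>g2\<close>
      would be bounded on the disc by less than its own value at the centre.\<close>
    show ?case
    proof (rule step[OF 0(1-5) 0(7)])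
      fix g2 assume g2: "g2 z0 \<noteq> 0" "\<And>z. z \<in> cball z0 R \<Longrightarrow> norm (g2 z) \<le> (M * (R' / R)) * norm (g2 z0)"
      have "norm (g2 z0) \<le> (M * (R' / R)) * norm (g2 z0)" using r by (intro g2) auto
      hence "1 * norm (g2 z0) \<le> (M * (R' / R)) * norm (g2 z0)" by simp
      hence "1 \<le> M * (R' / R)" using g2(1) by (subst (asm) mult_le_cancel_right) auto
      also have "\<dots> \<le> 1 * (R' / R)" using 0(6) r by (intro mult_right_mono) auto
      also have "\<dots> < 1" using r by simp
      finally show "norm (F z) \<le> H / norm (g2 z0) * (M * (R' / R) + 1) powr K" by simp
    qed
  next
    case (Suc n g M)
    show ?case
    proof (rule step[OF Suc(2-6) Suc(8)])
      fix g2 assume g2: "g2 holomorphic_on S" "g2 z0 \<noteq> 0" "\<And>z. z \<in> cball z0 R \<Longrightarrow> norm (g2 z) \<le> (M * (R' / R)) * norm (g2 z0)"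
        "\<And>z. z \<in> cball z0 R \<Longrightarrow> norm (F z * g2 z) \<le> H"
      have "M * (R' / R) \<le> (R / R') ^ Suc n * (R' / R)" using Suc(7) r by (intro mult_right_mono) auto
      also have "\<dots> = (R / R') ^ n" using r by simp
      finally have "M * (R' / R) \<le> (R / R') ^ n" .
      thus "norm (F z) \<le> H / norm (g2 z0) * (M * (R' / R) + 1) powr K"
        using Suc(1)[OF g2(1) Suc(3) g2(2-4) _ Suc(8)] by simp
    qed
  }
qed

lemma quotient_bound:
  fixes z0 :: complex
  assumes r: "0 < r" "r < R'" "R' < R" and S: "open S" "cball z0 R \<subseteq> S"
    and "g holomorphic_on S" "F holomorphic_on S" "g z0 \<noteq> 0"
    and "\<And>z. z \<in> cball z0 R \<Longrightarrow> norm (g z) \<le> M * norm (g z0)"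
    and "\<And>z. z \<in> cball z0 R \<Longrightarrow> norm (F z * g z) \<le> H" "norm (z - z0) \<le> r"
  shows "norm (F z) \<le> H / norm (g z0) * (M + 1) powr ((R' + r) / (R' - r))"
proof -
  obtain n where "M < (R / R') ^ n"
    using real_arch_pow[of "R / R'" M] r by auto
  thus ?thesis
    using quotient_bound_aux[OF r S assms(6-10) _ assms(11), of n] by simp
qed

text \<open>The upper and the lower exponential rate of \<open>g\<close> agree up to \<epsilon>, so
  on a disc about \<open>z0 = Complex a T\<close> the ratio of \<open>g\<close> to
  \<open>g z0\<close> is O(exp (\<epsilon> |T|)). \<open>quotient_bound\<close> turns this into a
  loss of exp (K \<epsilon> |T|) against the gain exp (- (\<gamma> - \<alpha>) |T|) from the product
  \<open>F * g\<close>.\<close>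

lemma quotient_decay:
  fixes g F :: "complex \<Rightarrow> complex"
  assumes F: "F holomorphic_on {z. b0 < Re z}" and g: "g holomorphic_on {z. b0 < Re z}"
    and \<alpha>: "0 < \<alpha>" "\<alpha> < \<gamma>"
    and low: "\<And>a0. \<exists>a\<ge>a0. \<exists>c0>0. \<forall>T. c0 * exp (- \<alpha> * \<bar>T\<bar>) \<le> norm (g (Complex a T))"
    and up: "\<And>\<beta> M. 0 \<le> \<beta> \<Longrightarrow> \<beta> < \<alpha> \<Longrightarrow> \<exists>C\<ge>0. \<forall>s. \<bar>Re s\<bar> \<le> M \<longrightarrow> norm (g s) \<le> C * exp (- \<beta> * \<bar>Im s\<bar>)"
    and prd: "\<And>M. \<exists>C\<ge>0. \<forall>s. b0 < Re s \<longrightarrow> \<bar>Re s\<bar> \<le> M \<longrightarrow> norm (F s * g s) \<le> C * exp (- \<gamma> * \<bar>Im s\<bar>)"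
    and c: "b0 < c"
  shows "\<exists>C. \<exists>d>0. \<forall>z. c \<le> Re z \<and> Re z \<le> c2 \<longrightarrow> norm (F z) \<le> C * exp (- d * \<bar>Im z\<bar>)"
proof -
  obtain a c0 where a: "a \<ge> max c2 (c + 1)" and c0: "c0 > 0"
      and low': "\<And>T. c0 * exp (- \<alpha> * \<bar>T\<bar>) \<le> norm (g (Complex a T))"
    using low by meson
  \<comment> \<open>The disc of radius \<open>r\<close> about a point with real part
    \<open>a\<close> just reaches the line \<open>Re z = c\<close>; the one of radius
    \<open>R\<close> stops halfway between \<open>b0\<close> and \<open>c\<close>, still inside the
    domain.\<close>
  define r R where "r = a - c" and "R = a - (b0 + c) / 2"
  define R' where "R' = (r + R) / 2"
  have r: "0 < r" "r < R'" "R' < R" using a c by (auto simp: r_def R_def R'_def field_simps)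
  define K where "K = (R' + r) / (R' - r)"
  have K: "K > 0" using r by (simp add: K_def)
  \<comment> \<open>The second entry limits the Harnack loss to half of the gap, the first keeps
    \<open>\<beta> = \<alpha> - \<epsilon>\<close> nonnegative.\<close>
  define \<epsilon> where "\<epsilon> = min \<alpha> ((\<gamma> - \<alpha>) / (2 * K))"
  have \<epsilon>: "\<epsilon> > 0" "\<epsilon> \<le> \<alpha>" "K * \<epsilon> \<le> (\<gamma> - \<alpha>) / 2"
  proof -
    show "\<epsilon> > 0" "\<epsilon> \<le> \<alpha>" using \<alpha> K by (auto simp: \<epsilon>_def)
    have "K * \<epsilon> \<le> K * ((\<gamma> - \<alpha>) / (2 * K))" using K by (intro mult_left_mono) (auto simp: \<epsilon>_def)
    thus "K * \<epsilon> \<le> (\<gamma> - \<alpha>) / 2" using K by simp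
  qed
  define \<beta> where "\<beta> = \<alpha> - \<epsilon>"
  have \<beta>: "0 \<le> \<beta>" "\<beta> < \<alpha>" using \<epsilon> by (auto simp: \<beta>_def)
  define M where "M = \<bar>a\<bar> + R"
  obtain C1 where C1: "C1 \<ge> 0" "\<And>s. \<bar>Re s\<bar> \<le> M \<Longrightarrow> norm (g s) \<le> C1 * exp (- \<beta> * \<bar>Im s\<bar>)"
    using up[OF \<beta>, of M] by auto
  obtain C2 where C2: "C2 \<ge> 0" "\<And>s. b0 < Re s \<Longrightarrow> \<bar>Re s\<bar> \<le> M \<Longrightarrow> norm (F s * g s) \<le> C2 * exp (- \<gamma> * \<bar>Im s\<bar>)"
    using prd[of M] by auto
  define Q where "Q = C1 * exp (\<beta> * R) / c0"
  have Q: "Q \<ge> 0" using C1 c0 by (simp add: Q_def)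
  define d where "d = (\<gamma> - \<alpha>) / 2"
  have d: "d > 0" using \<alpha> by (simp add: d_def)
  define C where "C = C2 * exp (\<gamma> * R) / c0 * (Q + 1) powr K"
  have "norm (F z) \<le> C * exp (- d * \<bar>Im z\<bar>)" if z: "c \<le> Re z" "Re z \<le> c2" for z
  proof -
    define T where "T = Im z"
    define z0 where "z0 = Complex a T"
    have low0: "c0 * exp (- \<alpha> * \<bar>T\<bar>) \<le> norm (g z0)" unfolding z0_def by (rule low')
    have pos0: "c0 * exp (- \<alpha> * \<bar>T\<bar>) > 0" using c0 by simp
    have in_cball: "b0 < Re w" "\<bar>Re w\<bar> \<le> M" "\<bar>T\<bar> - R \<le> \<bar>Im w\<bar>" if w: "w \<in> cball z0 R" for w
    proof -
      have "\<bar>Re (z0 - w)\<bar> \<le> R" "\<bar>Im (z0 - w)\<bar> \<le> R"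
        using w abs_Re_le_cmod[of "z0 - w"] abs_Im_le_cmod[of "z0 - w"] by (auto simp: dist_norm)
      hence 1: "\<bar>a - Re w\<bar> \<le> R" "\<bar>T - Im w\<bar> \<le> R" by (auto simp: z0_def)
      have "a - Re w \<le> a - (b0 + c) / 2" using 1(1) unfolding R_def by linarith
      moreover have "b0 < (b0 + c) / 2" using c by simp
      ultimately show "b0 < Re w" by (simp only: diff_le_eq le_diff_eq)
      show "\<bar>Re w\<bar> \<le> M" "\<bar>T\<bar> - R \<le> \<bar>Im w\<bar>" using 1 by (auto simp: M_def)
    qed
    have expb: "exp (- \<delta> * \<bar>Im w\<bar>) \<le> exp (\<delta> * R) * exp (- \<delta> * \<bar>T\<bar>)" if w: "w \<in> cball z0 R" and "\<delta> \<ge> 0" for w \<delta>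
    proof -
      have "\<delta> * (\<bar>T\<bar> - R) \<le> \<delta> * \<bar>Im w\<bar>" using in_cball(3)[OF w] that by (intro mult_left_mono) auto
      thus ?thesis by (simp add: algebra_simps flip: exp_add)
    qed
    have "norm (F z) \<le> (C2 * exp (\<gamma> * R) * exp (- \<gamma> * \<bar>T\<bar>)) / norm (g z0) * (Q * exp (\<epsilon> * \<bar>T\<bar>) + 1) powr K"
      unfolding K_def
    proof (rule quotient_bound[OF r, where S = "{z. b0 < Re z}" and g = g and F = F and ?z0.0 = z0])
      show "open {z. b0 < Re z}" by (rule open_halfspace_Re_gt)
      show "cball z0 R \<subseteq> {z. b0 < Re z}" using in_cball by auto
      show "g z0 \<noteq> 0" using low0 pos0 by auto
      show "norm (z - z0) \<le> r"
      proof -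
        have "z - z0 = of_real (Re z - a)" by (simp add: z0_def T_def complex_eq_iff)
        thus ?thesis using z a by (simp only: norm_of_real) (auto simp: r_def)
      qed
      fix w assume w: "w \<in> cball z0 R"
      have "norm (g w) \<le> C1 * exp (- \<beta> * \<bar>Im w\<bar>)" by (rule C1) (rule in_cball[OF w])
      also have "\<dots> \<le> C1 * (exp (\<beta> * R) * exp (- \<beta> * \<bar>T\<bar>))"
        by (intro mult_left_mono expb w \<beta> C1)
      also have "\<dots> = Q * exp (\<epsilon> * \<bar>T\<bar>) * (c0 * exp (- \<alpha> * \<bar>T\<bar>))"
        using c0 by (simp add: Q_def \<beta>_def algebra_simps flip: exp_add)
      also have "\<dots> \<le> Q * exp (\<epsilon> * \<bar>T\<bar>) * norm (g z0)"
        by (intro mult_left_mono low0) (use Q in auto)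
      finally show "norm (g w) \<le> (Q * exp (\<epsilon> * \<bar>T\<bar>)) * norm (g z0)" by simp
      have "norm (F w * g w) \<le> C2 * exp (- \<gamma> * \<bar>Im w\<bar>)" by (rule C2) (use in_cball[OF w] in auto)
      also have "\<dots> \<le> C2 * (exp (\<gamma> * R) * exp (- \<gamma> * \<bar>T\<bar>))"
        by (intro mult_left_mono expb w C2) (use \<alpha> in auto)
      finally show "norm (F w * g w) \<le> C2 * exp (\<gamma> * R) * exp (- \<gamma> * \<bar>T\<bar>)" by (simp add: mult.assoc)
    qed (rule g F)+
    also have "\<dots> \<le> (C2 * exp (\<gamma> * R) * exp (- \<gamma> * \<bar>T\<bar>)) / (c0 * exp (- \<alpha> * \<bar>T\<bar>)) * ((Q + 1) * exp (\<epsilon> * \<bar>T\<bar>)) powr K"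
    proof (intro mult_mono)
      show "(C2 * exp (\<gamma> * R) * exp (- \<gamma> * \<bar>T\<bar>)) / norm (g z0) \<le> (C2 * exp (\<gamma> * R) * exp (- \<gamma> * \<bar>T\<bar>)) / (c0 * exp (- \<alpha> * \<bar>T\<bar>))"
        using low0 pos0 C2(1) c0 less_le_trans[OF pos0 low0] by (intro divide_left_mono mult_pos_pos) simp_all
      show "(Q * exp (\<epsilon> * \<bar>T\<bar>) + 1) powr K \<le> ((Q + 1) * exp (\<epsilon> * \<bar>T\<bar>)) powr K"
        using K Q \<epsilon> by (intro powr_mono2) (auto simp: distrib_right)
    qed (use C2(1) c0 in auto)
    also have "((Q + 1) * exp (\<epsilon> * \<bar>T\<bar>)) powr K = (Q + 1) powr K * exp (K * \<epsilon> * \<bar>T\<bar>)"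
      using Q by (simp add: powr_mult exp_powr_real mult_ac)
    also have "(C2 * exp (\<gamma> * R) * exp (- \<gamma> * \<bar>T\<bar>)) / (c0 * exp (- \<alpha> * \<bar>T\<bar>)) * ((Q + 1) powr K * exp (K * \<epsilon> * \<bar>T\<bar>)) =
       C * exp (- (\<gamma> - \<alpha> - K * \<epsilon>) * \<bar>T\<bar>)"
    proof -
      have "exp (- \<gamma> * \<bar>T\<bar>) / exp (- \<alpha> * \<bar>T\<bar>) * exp (K * \<epsilon> * \<bar>T\<bar>) = exp (- (\<gamma> - \<alpha> - K * \<epsilon>) * \<bar>T\<bar>)"
        by (simp add: algebra_simps flip: exp_add exp_diff)
      moreover have "(C2 * exp (\<gamma> * R) * exp (- \<gamma> * \<bar>T\<bar>)) / (c0 * exp (- \<alpha> * \<bar>T\<bar>)) * ((Q + 1) powr K * exp (K * \<epsilon> * \<bar>T\<bar>))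
         = C * (exp (- \<gamma> * \<bar>T\<bar>) / exp (- \<alpha> * \<bar>T\<bar>) * exp (K * \<epsilon> * \<bar>T\<bar>))"
        by (simp add: C_def)
      ultimately show ?thesis by simp
    qed
    also have "\<dots> \<le> C * exp (- d * \<bar>T\<bar>)"
    proof -
      have "d * \<bar>T\<bar> \<le> (\<gamma> - \<alpha> - K * \<epsilon>) * \<bar>T\<bar>" using \<epsilon>(3) by (intro mult_right_mono) (auto simp: d_def)
      moreover have "C \<ge> 0" using C2(1) c0 by (simp add: C_def)
      ultimately show ?thesis
        by (intro mult_left_mono) (simp_all only: exp_le_cancel_iff mult_minus_left neg_le_iff_le)
    qed
    finally show ?thesis by (simp add: T_def)
  qed
  thus ?thesis using d by blast
qed

section \<open>Landau's theorem\<close>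

lemma power_series_coeff_eq_higher_deriv:
  fixes G :: "complex \<Rightarrow> complex"
  assumes "\<eta> > 0" "\<And>u. u \<in> ball 0 \<eta> \<Longrightarrow> (\<lambda>k. c k * u ^ k) sums G u"
  shows "c k = (deriv ^^ k) G 0 / fact k"
proof -
  have "\<forall>\<^sub>F u in nhds 0. u \<in> ball (0::complex) \<eta>"
    by (rule eventually_nhds_in_open) (use assms in auto)
  hence "G has_fps_expansion Abs_fps c"
    by (intro has_fps_expansionI, eventually_elim) (use assms in auto)
  from fps_nth_fps_expansion[OF this, of k] show ?thesis by simp
qed

text \<open>If the abscissa of convergence \<open>\<sigma>s\<close> were larger than
  \<open>b\<close>, then \<open>G\<close> would be holomorphic in a disc about a point
  \<open>a\<close> to the right of \<open>\<sigma>s\<close> that reaches beyond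
  \<open>\<sigma>s\<close>. At a real point of this disc to the left of \<open>\<sigma>s\<close> the
  Taylor series of \<open>G\<close> is a convergent sum of integrals of nonnegative functions;
  exchanging sum and integral shows that the Laplace integral converges there. Only real points are
  involved, so a thin rectangle of holomorphy is enough.\<close>

lemma landau_laplace:
  fixes \<phi> :: "real \<Rightarrow> real"
  assumes meas [measurable]: "\<phi> \<in> borel_measurable borel"
    and nn: "\<And>t. \<phi> t \<ge> 0" and supp: "\<And>t. t < 0 \<Longrightarrow> \<phi> t = 0"
    and bcd: "b < c" "c < d" and \<delta>: "\<delta> > 0"
    and G: "G holomorphic_on {s. b < Re s \<and> Re s < d \<and> \<bar>Im s\<bar> < \<delta>}"
    and int: "\<And>\<sigma>. c < \<sigma> \<Longrightarrow> integrable lborel (\<lambda>t. \<phi> t * exp (- \<sigma> * t))"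
    and eq: "\<And>s. c < Re s \<Longrightarrow> Re s < d \<Longrightarrow> \<bar>Im s\<bar> < \<delta> \<Longrightarrow> G s = laplace (\<lambda>t. of_real (\<phi> t)) (- s)"
    and \<sigma>: "b < \<sigma>"
  shows "integrable lborel (\<lambda>t. \<phi> t * exp (- \<sigma> * t))"
proof -
  define I where "I = {\<sigma>. integrable lborel (\<lambda>t. \<phi> t * exp (- \<sigma> * t))}"
  have up: "y \<in> I" if "x \<in> I" "x \<le> y" for x y
  proof -
    have "integrable lborel (\<lambda>t. \<phi> t * exp (- x * t))" using that by (simp add: I_def)
    hence "integrable lborel (\<lambda>t. \<phi> t * exp (- y * t))"
    proof (rule Bochner_Integration.integrable_bound)
      show "AE t in lborel. norm (\<phi> t * exp (- y * t)) \<le> norm (\<phi> t * exp (- x * t))"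
      proof (rule AE_I2)
        fix t show "norm (\<phi> t * exp (- y * t)) \<le> norm (\<phi> t * exp (- x * t))"
        proof (cases "t < 0")
          case False
          hence "x * t \<le> y * t" using that by (intro mult_right_mono) auto
          thus ?thesis using nn[of t] by (simp add: abs_mult mult_left_mono)
        qed (use supp in simp)
      qed
    qed simp
    thus ?thesis by (simp add: I_def)
  qed
  have "\<sigma>1 \<in> I" if \<sigma>1: "b < \<sigma>1" for \<sigma>1
  proof (rule ccontr)
    assume notI: "\<sigma>1 \<notin> I"
    have lb: "\<sigma>1 \<le> x" if "x \<in> I" for x using up[OF that, of \<sigma>1] notI by (cases "x \<le> \<sigma>1") auto
    have bdd: "bdd_below I" using lb by (auto simp: bdd_below_def)
    have cI: "x \<in> I" if "x > c" for x using int[OF that] by (simp add: I_def)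
    have ne: "I \<noteq> {}" using cI[of "c + 1"] by auto
    define \<sigma>s where "\<sigma>s = Inf I"
    have s1: "b < \<sigma>s" using cInf_greatest[OF ne lb] \<sigma>1 by (auto simp: \<sigma>s_def intro: less_le_trans)
    have s2: "\<sigma>s \<le> c"
    proof (rule field_le_epsilon)
      fix e :: real assume "e > 0"
      thus "\<sigma>s \<le> c + e" unfolding \<sigma>s_def by (intro cInf_lower cI bdd) auto
    qed
    have inI: "x \<in> I" if "x > \<sigma>s" for x
      using that cInf_less_iff[OF ne bdd, of x] up unfolding \<sigma>s_def by (meson less_imp_le)
    have notinI: "x \<notin> I" if "x < \<sigma>s" for x
      using that cInf_lower[OF _ bdd, of x] unfolding \<sigma>s_def by auto
    define mm where "mm = min \<delta> (d - \<sigma>s)"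
    have IE: "integrable lborel (\<lambda>t. norm (complex_of_real (\<phi> t)) * exp (x * t))" if "x < - \<sigma>s" for x
      using inI[of "- x"] that nn by (simp add: I_def)
    \<comment> \<open>A third of \<open>mm\<close> makes \<open>\<eta>\<close> smaller than
      \<open>\<delta>\<close> and than \<open>d - a\<close>. Since also
      \<open>b < \<sigma>s\<close>, the radius \<open>r\<close> of holomorphy about \<open>a\<close>
      exceeds \<open>\<eta>\<close>, the distance from \<open>a\<close> to
      \<open>\<sigma>s\<close>.\<close>
    define \<eta> where "\<eta> = mm / 3"
    have \<eta>: "\<eta> > 0" "\<eta> < \<delta>" "\<eta> < d - \<sigma>s - \<eta>" 
    proof -
      have *: "mm \<le> \<delta>" "mm \<le> d - \<sigma>s" "mm > 0"
        using s2 bcd \<delta> by (auto simp: mm_def)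
      show "\<eta> > 0" unfolding \<eta>_def using * by (simp add: field_simps)
      show "\<eta> < \<delta>" unfolding \<eta>_def using * by (simp add: field_simps)
      show "\<eta> < d - \<sigma>s - \<eta>" unfolding \<eta>_def using * by (simp add: field_simps)
    qed
    define a where "a = \<sigma>s + \<eta>"
    define r where "r = min \<delta> (min (a - b) (d - a))"
    have r: "r > \<eta>" using \<eta> s1 by (auto simp: r_def a_def)
    define F where "F = (\<lambda>s. laplace (\<lambda>t. of_real (\<phi> t)) (- s))"
    have mc [measurable]: "(\<lambda>t. complex_of_real (\<phi> t)) \<in> borel_measurable borel" by measurable
    have "laplace (\<lambda>t. of_real (\<phi> t)) holomorphic_on {s. Re s \<in> {..<-\<sigma>s}}"
    proof (rule laplace_holomorphic)
      fix x assume "x \<in> {..<-\<sigma>s}"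
      hence "- x \<in> I" by (intro inI) auto
      thus "integrable lborel (\<lambda>t. norm (complex_of_real (\<phi> t)) * exp (x * t))"
        using nn by (simp add: I_def)
    qed auto
    hence "laplace (\<lambda>t. of_real (\<phi> t)) \<circ> uminus holomorphic_on {s. \<sigma>s < Re s}"
      by (intro holomorphic_on_compose_gen[of uminus _ _ "{s. Re s \<in> {..<-\<sigma>s}}"]) (auto intro!: holomorphic_intros)
    hence Fh: "F holomorphic_on {s. \<sigma>s < Re s}" by (simp add: F_def o_def)
    have FG: "G s = F s" if s: "\<sigma>s < Re s" "Re s < d" "\<bar>Im s\<bar> < \<delta>" for s
    proof (rule analytic_continuation_open[where f = G and g = F and s = "{s. c < Re s} \<inter> {s. Re s < d} \<inter> {s. Im s < \<delta>} \<inter> {s. Im s > -\<delta>}"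
            and s' = "{s. \<sigma>s < Re s} \<inter> {s. Re s < d} \<inter> {s. Im s < \<delta>} \<inter> {s. Im s > -\<delta>}"])
      show "open ({s. c < Re s} \<inter> {s. Re s < d} \<inter> {s. Im s < \<delta>} \<inter> {s. Im s > -\<delta>})"
        "open ({s. \<sigma>s < Re s} \<inter> {s. Re s < d} \<inter> {s. Im s < \<delta>} \<inter> {s. Im s > -\<delta>})"
        by (intro open_Int open_halfspace_Re_gt open_halfspace_Re_lt open_halfspace_Im_lt open_halfspace_Im_gt)+
      show "connected ({s. \<sigma>s < Re s} \<inter> {s. Re s < d} \<inter> {s. Im s < \<delta>} \<inter> {s. Im s > -\<delta>})"
        by (intro convex_connected convex_Int convex_halfspace_Re_gt convex_halfspace_Re_lt convex_halfspace_Im_lt convex_halfspace_Im_gt)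
      have "of_real ((c + d) / 2) \<in> {s. c < Re s} \<inter> {s. Re s < d} \<inter> {s. Im s < \<delta>} \<inter> {s. Im s > -\<delta>}"
        using bcd \<delta> by auto
      thus "{s. c < Re s} \<inter> {s. Re s < d} \<inter> {s. Im s < \<delta>} \<inter> {s. Im s > -\<delta>} \<noteq> {}" by blast
      show "G holomorphic_on {s. \<sigma>s < Re s} \<inter> {s. Re s < d} \<inter> {s. Im s < \<delta>} \<inter> {s. Im s > -\<delta>}"
        by (rule holomorphic_on_subset[OF G]) (use s1 in auto)
      show "F holomorphic_on {s. \<sigma>s < Re s} \<inter> {s. Re s < d} \<inter> {s. Im s < \<delta>} \<inter> {s. Im s > -\<delta>}"
        by (rule holomorphic_on_subset[OF Fh]) auto
    qed (use s s2 eq in \<open>auto simp: F_def\<close>)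
    define ck where "ck = (\<lambda>k. (LINT t|lborel. of_real (\<phi> t) * of_real t ^ k * exp (- of_real a * complex_of_real t)) / fact k)"
    define H where "H = (\<lambda>u. G (of_real a - u))"
    have in_reg: "b < Re (of_real a - u) \<and> Re (of_real a - u) < d \<and> \<bar>Im (of_real a - u)\<bar> < \<delta>"
      if u: "norm u < r" for u
      using u abs_Re_le_cmod[of u] abs_Im_le_cmod[of u] by (auto simp: r_def)
    have Hh: "H holomorphic_on ball 0 r"
    proof -
      have "G \<circ> (\<lambda>u. of_real a - u) holomorphic_on ball 0 r"
        by (rule holomorphic_on_compose_gen[OF _ G]) (use in_reg in \<open>auto intro!: holomorphic_intros\<close>)
      thus ?thesis by (simp add: H_def o_def)
    qed
    have Hsums: "(\<lambda>k. ck k * u ^ k) sums H u" if u: "u \<in> ball 0 \<eta>" for u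
    proof -
      define \<rho> where "\<rho> = norm u"
      have \<rho>: "\<rho> < \<eta>" using u by (simp add: \<rho>_def)
      have i: "integrable lborel (\<lambda>t. norm (complex_of_real (\<phi> t)) * exp (Re (- of_real a) * t + \<rho> * \<bar>t\<bar>))"
        using \<rho> \<eta> order_less_le_trans[of "- \<eta>" 0 "norm u"]
        by (intro laplace_integrable_ball IE) (auto simp: a_def \<rho>_def)
      have "(\<lambda>k. (LINT t|lborel. of_real (\<phi> t) * of_real t ^ k * exp (- of_real a * of_real t)) / fact k *
          ((- of_real a + u) - (- of_real a)) ^ k) sums laplace (\<lambda>t. of_real (\<phi> t)) (- of_real a + u)"
        by (rule laplace_power_series[OF mc i]) (simp add: \<rho>_def)
      moreover have "laplace (\<lambda>t. of_real (\<phi> t)) (- of_real a + u) = H u"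
      proof -
        have "\<sigma>s < Re (of_real a - u)" using \<rho> abs_Re_le_cmod[of u] by (auto simp: a_def \<rho>_def)
        moreover have "Re (of_real a - u) < d" "\<bar>Im (of_real a - u)\<bar> < \<delta>" using in_reg[of u] \<rho> r by (auto simp: \<rho>_def)
        ultimately have "H u = F (of_real a - u)" unfolding H_def by (rule FG)
        thus ?thesis by (simp add: F_def)
      qed
      ultimately show ?thesis by (simp add: ck_def)
    qed
    have ck_eq: "ck k = (deriv ^^ k) H 0 / fact k" for k
      by (rule power_series_coeff_eq_higher_deriv[OF \<eta>(1)]) (rule Hsums)
    \<comment> \<open>\<open>a - x\<close> lies to the left of \<open>\<sigma>s\<close> but still
      inside the disc of radius \<open>r\<close> about \<open>a\<close>.\<close>
    define x where "x = (\<eta> + r) / 2"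
    have x: "\<eta> < x" "x < r" "x > 0" using r \<eta> by (auto simp: x_def)
    have "(\<lambda>k. (deriv ^^ k) H 0 / fact k * (of_real x - 0) ^ k) sums H (of_real x)"
      by (rule holomorphic_power_series[OF Hh]) (use x in auto)
    hence "summable (\<lambda>k. ck k * of_real x ^ k)" by (simp add: ck_eq sums_iff)
    define f where "f = (\<lambda>k t. \<phi> t * t ^ k * exp (- a * t) / fact k * x ^ k)"
    have ai: "integrable lborel (\<lambda>t. norm (complex_of_real (\<phi> t)) * exp (- a * t + (\<eta>/2) * \<bar>t\<bar>))"
      using \<eta> by (intro laplace_integrable_ball IE) (auto simp: a_def)
    have fm [measurable]: "f k \<in> borel_measurable borel" for k unfolding f_def by measurable
    have fnn: "f k t \<ge> 0" for k t
    proof (cases "t < 0")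
      case False thus ?thesis using nn[of t] x by (simp add: f_def)
    qed (simp add: f_def supp)
    have fint: "integrable lborel (f k)" for k
    proof (rule Bochner_Integration.integrable_bound)
      show "integrable lborel (\<lambda>t. (x / (\<eta>/2)) ^ k * (norm (complex_of_real (\<phi> t)) * exp (- a * t + (\<eta>/2) * \<bar>t\<bar>)))"
        using ai by simp
      show "AE t in lborel. norm (f k t) \<le> norm ((x / (\<eta>/2)) ^ k * (norm (complex_of_real (\<phi> t)) * exp (- a * t + (\<eta>/2) * \<bar>t\<bar>)))"
      proof (rule AE_I2)
        fix t
        show "norm (f k t) \<le> norm ((x / (\<eta>/2)) ^ k * (norm (complex_of_real (\<phi> t)) * exp (- a * t + (\<eta>/2) * \<bar>t\<bar>)))"
        proof (cases "t < 0")
          case False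
          hence t: "t \<ge> 0" by simp
          have "(\<eta> / 2 * t) ^ k / fact k \<le> exp (\<eta> / 2 * t)"
          proof -
            have e: "(\<lambda>n. (\<eta> / 2 * t) ^ n /\<^sub>R fact n) sums exp (\<eta> / 2 * t)" by (rule exp_converges)
            have "sum (\<lambda>n. (\<eta> / 2 * t) ^ n /\<^sub>R fact n) {k} \<le> (\<Sum>n. (\<eta> / 2 * t) ^ n /\<^sub>R fact n)"
              using t \<eta> by (intro sum_le_suminf sums_summable[OF e]) auto
            also have "\<dots> = exp (\<eta> / 2 * t)" using e by (rule sums_unique[symmetric])
            finally have "sum (\<lambda>n. (\<eta> / 2 * t) ^ n /\<^sub>R fact n) {k} \<le> exp (\<eta> / 2 * t)" .
            thus ?thesis by (simp only: sum.insert[OF finite.emptyI] sum.empty empty_iff not_False_eq_True add_0_right real_scaleR_def divide_inverse_commute)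
          qed
          hence "(x / (\<eta>/2)) ^ k * (\<phi> t * exp (- a * t)) * ((\<eta> / 2 * t) ^ k / fact k) \<le> (x / (\<eta>/2)) ^ k * (\<phi> t * exp (- a * t)) * exp (\<eta> / 2 * t)"
            using x \<eta> nn by (intro mult_left_mono) auto
          moreover have "(x / (\<eta>/2)) ^ k * (\<phi> t * exp (- a * t)) * ((\<eta> / 2 * t) ^ k / fact k) = f k t"
          proof -
            have "(x / (\<eta>/2)) ^ k * (\<eta> / 2 * t) ^ k = (x * t) ^ k"
              using \<eta> by (simp flip: power_mult_distrib)
            moreover have "(x / (\<eta>/2)) ^ k * (\<phi> t * exp (- a * t)) * ((\<eta> / 2 * t) ^ k / fact k) =
                ((x / (\<eta>/2)) ^ k * (\<eta> / 2 * t) ^ k) * (\<phi> t * exp (- a * t)) / fact k"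
              by (simp only: times_divide_eq_right mult.assoc mult.commute mult.left_commute)
            ultimately show ?thesis by (simp only:) (simp add: f_def power_mult_distrib)
          qed
          moreover have "(x / (\<eta>/2)) ^ k * (\<phi> t * exp (- a * t)) * exp (\<eta> / 2 * t) = (x / (\<eta>/2)) ^ k * (norm (complex_of_real (\<phi> t)) * exp (- a * t + (\<eta>/2) * \<bar>t\<bar>))"
            using t nn[of t] by (simp only: norm_of_real abs_of_nonneg exp_add mult.assoc)
          ultimately have "f k t \<le> (x / (\<eta>/2)) ^ k * (norm (complex_of_real (\<phi> t)) * exp (- a * t + (\<eta>/2) * \<bar>t\<bar>))"
            by (simp only:)
          moreover have "norm (f k t) = f k t" using fnn[of k t] by simp
          ultimately show ?thesis unfolding real_norm_def by (simp only:)
        qed (simp add: f_def supp)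
      qed
    qed simp
    have ck_real: "ck k * of_real x ^ k = of_real (integral\<^sup>L lborel (f k))" for k
    proof -
      have "ck k * of_real x ^ k = (LINT t|lborel. of_real (\<phi> t) * of_real t ^ k * exp (- of_real a * complex_of_real t) / fact k * of_real x ^ k)"
        unfolding ck_def by (simp add: divide_inverse)
      also have "\<dots> = (LINT t|lborel. complex_of_real (f k t))"
        unfolding f_def by (intro Bochner_Integration.integral_cong) (simp_all flip: exp_of_real)
      finally show ?thesis by simp
    qed
    have "summable (\<lambda>k. Re (ck k * of_real x ^ k))"
      using \<open>summable (\<lambda>k. ck k * of_real x ^ k)\<close> by (rule summable_Re)
    hence summ: "summable (\<lambda>k. integral\<^sup>L lborel (f k))" unfolding ck_real by simp
    have fsum: "(\<lambda>k. f k t) sums (\<phi> t * exp (- (a - x) * t))" for t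
    proof -
      have "(\<lambda>k. \<phi> t * exp (- a * t) * ((x * t) ^ k /\<^sub>R fact k)) sums (\<phi> t * exp (- a * t) * exp (x * t))"
        by (intro sums_mult exp_converges)
      moreover have "\<phi> t * exp (- a * t) * ((x * t) ^ k /\<^sub>R fact k) = f k t" for k
        by (simp add: f_def power_mult_distrib divide_inverse)
      moreover have "\<phi> t * exp (- a * t) * exp (x * t) = \<phi> t * exp (- (a - x) * t)"
        by (simp add: mult.assoc algebra_simps flip: exp_add)
      ultimately show ?thesis by (simp only:)
    qed
    have fi: "integrable lborel (\<lambda>t. \<Sum>k. f k t)"
    proof (rule integrable_suminf[OF fint])
      have nf: "norm (f k t) = f k t" for k t using fnn[of k t] by simp
      show "AE t in lborel. summable (\<lambda>k. norm (f k t))"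
        unfolding nf using sums_summable[OF fsum] by (intro AE_I2)
      show "summable (\<lambda>k. LINT t|lborel. norm (f k t))" unfolding nf by (rule summ)
    qed
    have e: "(\<lambda>t. \<Sum>k. f k t) = (\<lambda>t. \<phi> t * exp (- (a - x) * t))"
      by (rule ext, rule sums_unique[OF fsum, symmetric])
    have "a - x \<in> I" unfolding I_def mem_Collect_eq using fi unfolding e .
    moreover have "a - x < \<sigma>s" using x by (simp add: a_def)
    ultimately show False using notinI by blast
  qed
  thus ?thesis using \<sigma> by (simp add: I_def)
qed

section \<open>Function spaces and their duals\<close>

lemma openin_seminorm_ball:
  assumes "f \<in> E" "p \<in> P" "\<epsilon> > 0"
  shows "openin (seminorm_topology E P) {g \<in> E. p (\<lambda>x. g x - f x) < \<epsilon>}"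
  unfolding seminorm_topology_def by (rule topology_generated_by_Basis) (use assms in blast)

lemma topspace_seminorm_topology_subset: "topspace (seminorm_topology E P) \<subseteq> E"
  unfolding seminorm_topology_def by auto

lemma topspace_seminorm_topology:
  assumes "p \<in> P" "\<And>f. f \<in> E \<Longrightarrow> p (\<lambda>x. f x - f x) = 0"
  shows "topspace (seminorm_topology E P) = E"
proof (intro subset_antisym topspace_seminorm_topology_subset subsetI)
  fix f assume f: "f \<in> E"
  have "openin (seminorm_topology E P) {g \<in> E. p (\<lambda>x. g x - f x) < 1}"
    by (rule openin_seminorm_ball) (use f assms in auto)
  moreover have "f \<in> {g \<in> E. p (\<lambda>x. g x - f x) < 1}" using f assms(2)[OF f] by simp
  ultimately show "f \<in> topspace (seminorm_topology E P)"
    using openin_subset by blast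
qed

text \<open>The balls form only a subbase, hence the finite sets \<open>Q\<close> of members of
  \<open>P\<close>. Since the members of \<open>P\<close> are arbitrary functions here,
  \<open>zero\<close> is what puts the centre into its ball; \<open>Q \<noteq> {}\<close> keeps the
  intersection of balls inside \<open>E\<close>.\<close>

lemma continuous_map_seminorm_topology:
  fixes \<psi> :: "('a \<Rightarrow> complex) \<Rightarrow> 'b :: metric_space"
  assumes zero: "\<And>p f. p \<in> P \<Longrightarrow> f \<in> E \<Longrightarrow> p (\<lambda>x. f x - f x) = 0"
    and cont: "\<And>f \<epsilon>. f \<in> E \<Longrightarrow> \<epsilon> > 0 \<Longrightarrow>
       \<exists>Q\<subseteq>P. finite Q \<and> Q \<noteq> {} \<and> (\<exists>\<delta>>0. \<forall>g\<in>E. (\<forall>p\<in>Q. p (\<lambda>x. g x - f x) < \<delta>) \<longrightarrow> dist (\<psi> g) (\<psi> f) < \<epsilon>)"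
  shows "continuous_map (seminorm_topology E P) euclidean \<psi>"
  unfolding continuous_map_def
proof (intro conjI allI impI)
  fix U :: "'b set" assume U: "openin euclidean U"
  show "openin (seminorm_topology E P) {x \<in> topspace (seminorm_topology E P). \<psi> x \<in> U}"
  proof (subst openin_subopen, safe)
    fix f assume f: "f \<in> topspace (seminorm_topology E P)" "\<psi> f \<in> U"
    have fE: "f \<in> E" using f(1) topspace_seminorm_topology_subset by blast
    obtain \<epsilon> where \<epsilon>: "\<epsilon> > 0" "ball (\<psi> f) \<epsilon> \<subseteq> U"
      using U f(2) open_contains_ball by (metis open_openin)
    obtain Q \<delta> where Q: "Q \<subseteq> P" "finite Q" "Q \<noteq> {}" and \<delta>: "\<delta> > 0"
      and d: "\<forall>g\<in>E. (\<forall>p\<in>Q. p (\<lambda>x. g x - f x) < \<delta>) \<longrightarrow> dist (\<psi> g) (\<psi> f) < \<epsilon>"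
      using cont[OF fE \<epsilon>(1)] by (elim exE conjE) (rule that)
    define T where "T = (\<Inter>p\<in>Q. {g \<in> E. p (\<lambda>x. g x - f x) < \<delta>})"
    have "openin (seminorm_topology E P) T"
      unfolding T_def using Q \<delta> fE by (intro openin_INT2 openin_seminorm_ball) auto
    moreover have "f \<in> T"
      unfolding T_def
    proof (intro INT_I CollectI conjI fE)
      fix p assume "p \<in> Q"
      hence "p (\<lambda>x. f x - f x) = 0" using Q(1) fE by (intro zero) auto
      thus "p (\<lambda>x. f x - f x) < \<delta>" using \<delta> by (simp only:)
    qed
    moreover have "T \<subseteq> {x \<in> topspace (seminorm_topology E P). \<psi> x \<in> U}"
    proof
      fix g assume g: "g \<in> T"
      have "g \<in> E" using g Q(3) by (auto simp: T_def)
      hence "dist (\<psi> g) (\<psi> f) < \<epsilon>" using g d unfolding T_def by blast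
      hence "\<psi> g \<in> U" using \<epsilon> by (auto simp: dist_commute)
      moreover have "g \<in> topspace (seminorm_topology E P)"
        using g openin_subset[OF \<open>openin (seminorm_topology E P) T\<close>] by auto
      ultimately show "g \<in> {x \<in> topspace (seminorm_topology E P). \<psi> x \<in> U}" by simp
    qed
    ultimately show "\<exists>T. openin (seminorm_topology E P) T \<and> f \<in> T \<and> T \<subseteq> {x \<in> topspace (seminorm_topology E P). \<psi> x \<in> U}"
      by blast
  qed
qed auto

section \<open>Smooth functions from holomorphic functions on strips and sectors\<close>

lemma nth_deriv_Suc: "nth_deriv (Suc n) f = (\<lambda>x. vector_derivative (nth_deriv n f) (at x))"
  by (simp add: nth_deriv_def)

lemma nth_deriv_0 [simp]: "nth_deriv 0 f = f"
  by (simp add: nth_deriv_def)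

lemma higher_deriv_restrict_real:
  assumes f: "f holomorphic_on {w. \<bar>Im w\<bar> < \<delta>}" and \<delta>: "\<delta> > 0"
  shows "((\<lambda>t. (deriv ^^ n) f (complex_of_real t)) has_vector_derivative (deriv ^^ Suc n) f (of_real t)) (at t)"
proof -
  have "(deriv ^^ n) f holomorphic_on {w. \<bar>Im w\<bar> < \<delta>}"
    by (rule holomorphic_higher_deriv[OF f open_Im_strip])
  hence "((deriv ^^ n) f has_field_derivative deriv ((deriv ^^ n) f) (of_real t)) (at (of_real t))"
    by (rule holomorphic_derivI[OF _ open_Im_strip]) (use \<delta> in auto)
  thus ?thesis using has_vector_derivative_real_field by fastforce
qed

lemma nth_deriv_restrict_real:
  assumes f: "f holomorphic_on {w. \<bar>Im w\<bar> < \<delta>}" and \<delta>: "\<delta> > 0"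
  shows "nth_deriv n (\<lambda>t. f (complex_of_real t)) = (\<lambda>t. (deriv ^^ n) f (of_real t))"
proof (induction n)
  case (Suc n)
  show ?case
    unfolding nth_deriv_Suc Suc
    by (rule ext, rule vector_derivative_at, rule higher_deriv_restrict_real[OF f \<delta>])
qed simp

text \<open>Cauchy's estimates on discs of the fixed radius \<open>\<delta> / 2\<close> bound every
  derivative by the same exponential up to a constant, so that a single \<open>m\<close> serves for
  all orders.\<close>

lemma holomorphic_strip_F_space:
  assumes f: "f holomorphic_on {w. \<bar>Im w\<bar> < \<delta>}" and \<delta>: "\<delta> > 0"
    and bd: "\<And>w. \<bar>Im w\<bar> < \<delta> \<Longrightarrow> norm (f w) \<le> C * exp (real m * \<bar>Re w\<bar>)"
  shows "(\<lambda>t. f (complex_of_real t)) \<in> F_space m"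
  unfolding F_space_def smooth_fun_on_def mem_Collect_eq nth_deriv_restrict_real[OF f \<delta>]
proof (intro conjI allI ballI)
  fix n x
  show "(\<lambda>t. (deriv ^^ n) f (complex_of_real t)) differentiable at x"
    using higher_deriv_restrict_real[OF f \<delta>] by (rule differentiableI_vector)
next
  fix n
  have C: "C \<ge> 0"
    using order_trans[OF norm_ge_zero bd[of 0]] \<delta> by simp
  define r where "r = \<delta> / 2"
  have r: "r > 0" "r < \<delta>" using \<delta> by (auto simp: r_def)
  show "bdd_above (range (\<lambda>x. cmod ((deriv ^^ n) f (complex_of_real x)) * exp (- real m * \<bar>x\<bar>)))"
  proof (rule bdd_aboveI2)
    fix x :: real
    have sub: "cball (of_real x) r \<subseteq> {w. \<bar>Im w\<bar> < \<delta>}"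
    proof safe
      fix w :: complex assume "w \<in> cball (of_real x) r"
      thus "\<bar>Im w\<bar> < \<delta>" using abs_Im_le_cmod[of "of_real x - w"] r by (auto simp: dist_norm)
    qed
    have "norm ((deriv ^^ n) f (of_real x)) \<le> fact n * (C * exp (m * r) * exp (real m * \<bar>x\<bar>)) / r ^ n"
    proof (rule Cauchy_inequality)
      show "f holomorphic_on ball (of_real x) r"
        by (rule holomorphic_on_subset[OF f order_trans[OF ball_subset_cball sub]])
      show "continuous_on (cball (of_real x) r) f"
        by (rule holomorphic_on_imp_continuous_on[OF holomorphic_on_subset[OF f sub]])
      fix w :: complex assume w: "norm (of_real x - w) = r"
      have "\<bar>Im w\<bar> < \<delta>" using sub w by (auto simp: dist_norm)
      hence "norm (f w) \<le> C * exp (real m * \<bar>Re w\<bar>)" by (rule bd)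
      also have "real m * \<bar>Re w\<bar> \<le> m * r + real m * \<bar>x\<bar>"
      proof -
        have "\<bar>x - Re w\<bar> \<le> r" using abs_Re_le_cmod[of "of_real x - w"] w by simp
        hence "real m * \<bar>Re w\<bar> \<le> real m * (r + \<bar>x\<bar>)" by (intro mult_left_mono) auto
        thus ?thesis by (simp add: distrib_left)
      qed
      finally have "norm (f w) \<le> C * exp (m * r + real m * \<bar>x\<bar>)" using C by (simp add: mult_left_mono)
      thus "norm (f w) \<le> C * exp (m * r) * exp (real m * \<bar>x\<bar>)" by (simp only: exp_add mult.assoc)
    qed (use r in auto)
    hence "norm ((deriv ^^ n) f (of_real x)) * exp (- real m * \<bar>x\<bar>) \<le>
       fact n * (C * exp (m * r) * exp (real m * \<bar>x\<bar>)) / r ^ n * exp (- real m * \<bar>x\<bar>)"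
      by (rule mult_right_mono) auto
    also have "\<dots> = fact n * (C * exp (m * r)) / r ^ n * (exp (real m * \<bar>x\<bar>) * exp (- real m * \<bar>x\<bar>))"
      by (simp only: times_divide_eq_left mult.assoc)
    also have "exp (real m * \<bar>x\<bar>) * exp (- real m * \<bar>x\<bar>) = 1" by (simp flip: exp_add)
    finally show "cmod ((deriv ^^ n) f (complex_of_real x)) * exp (- real m * \<bar>x\<bar>) \<le> fact n * (C * exp (m * r)) / r ^ n"
      by simp
  qed
qed

text \<open>Differentiating \<open>g (ln x) / x ^ n\<close> gives the function
  \<open>deriv g - n * g\<close> at \<open>ln x\<close>, divided by \<open>x ^ Suc n\<close>, and
  this function is again rapidly decaying on the strip. So all derivatives keep one shape.\<close>

lemma nth_deriv_log:
  assumes f: "rapid_on_strip \<alpha> f" and \<alpha>: "\<alpha> > 0"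
  shows "\<exists>g. rapid_on_strip \<alpha> g \<and>
     (\<forall>x>0. nth_deriv n (\<lambda>x. f (complex_of_real (ln x))) x = g (of_real (ln x)) / of_real x ^ n) \<and>
     (\<forall>x>0. nth_deriv n (\<lambda>x. f (complex_of_real (ln x))) differentiable at x)"
proof -
  have step: "(F has_vector_derivative (deriv g (of_real (ln x)) + (- of_nat n) * g (of_real (ln x))) / of_real x ^ Suc n) (at x)"
    if g: "rapid_on_strip \<alpha> g" and x: "x > 0"
      and F: "\<And>x. x > 0 \<Longrightarrow> F x = g (of_real (ln x)) / of_real x ^ n" for g F n x
  proof -
    have holo: "g holomorphic_on {w. \<bar>Im w\<bar> < \<alpha>}" using g by (simp add: rapid_on_strip_def)
    have Ln: "Ln (complex_of_real x) = of_real (ln x)" if "x > 0" for x using that by (simp add: Ln_of_real)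
    have "(g has_field_derivative deriv g (of_real (ln x))) (at (Ln (of_real x)))"
      unfolding Ln[OF x] by (rule holomorphic_derivI[OF holo open_Im_strip]) (use \<alpha> in auto)
    moreover have "(Ln has_field_derivative inverse (of_real x)) (at (complex_of_real x))"
      by (rule has_field_derivative_Ln) (use x in auto)
    ultimately have "(g \<circ> Ln has_field_derivative deriv g (of_real (ln x)) * inverse (of_real x)) (at (complex_of_real x))"
      by (rule DERIV_chain)
    hence d1: "((\<lambda>z. g (Ln z)) has_field_derivative deriv g (of_real (ln x)) * inverse (of_real x)) (at (complex_of_real x))"
      by (simp add: o_def)
    have "((\<lambda>z. z ^ n) has_field_derivative of_nat n * of_real x ^ (n - 1)) (at (complex_of_real x))"
      by (auto intro!: derivative_eq_intros)
    from DERIV_divide[OF d1 this] have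
      "((\<lambda>z. g (Ln z) / z ^ n) has_field_derivative
         (deriv g (of_real (ln x)) * inverse (of_real x) * of_real x ^ n - g (of_real (ln x)) * (of_nat n * of_real x ^ (n - 1))) /
         (of_real x ^ n * of_real x ^ n)) (at (complex_of_real x))"
      using x by (simp add: Ln)
    moreover have "(deriv g (of_real (ln x)) * inverse (of_real x) * of_real x ^ n - g (of_real (ln x)) * (of_nat n * of_real x ^ (n - 1))) /
         (of_real x ^ n * of_real x ^ n) = (deriv g (of_real (ln x)) + (- of_nat n) * g (of_real (ln x))) / complex_of_real x ^ Suc n"
      using x by (cases n) (auto simp: field_simps)
    ultimately have "((\<lambda>z. g (Ln z) / z ^ n) has_field_derivative
         (deriv g (of_real (ln x)) + (- of_nat n) * g (of_real (ln x))) / complex_of_real x ^ Suc n) (at (complex_of_real x))"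
      by simp
    hence "((\<lambda>x. g (Ln (of_real x)) / of_real x ^ n) has_vector_derivative
         (deriv g (of_real (ln x)) + (- of_nat n) * g (of_real (ln x))) / complex_of_real x ^ Suc n) (at x)"
      by (rule has_vector_derivative_real_field)
    thus ?thesis
      by (rule has_vector_derivative_transform_within_open[of _ _ _ "{0<..}"]) (use x F Ln in auto)
  qed
  have *: "\<exists>g. rapid_on_strip \<alpha> g \<and>
     (\<forall>x>0. nth_deriv n (\<lambda>x. f (complex_of_real (ln x))) x = g (of_real (ln x)) / of_real x ^ n)" for n
  proof (induction n)
    case 0
    thus ?case using f by auto
  next
    case (Suc n)
    then obtain g where g: "rapid_on_strip \<alpha> g"
      and eq: "\<And>x. x > 0 \<Longrightarrow> nth_deriv n (\<lambda>x. f (complex_of_real (ln x))) x = g (of_real (ln x)) / of_real x ^ n"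
      by blast
    show ?case
    proof (intro exI conjI allI impI)
      show "rapid_on_strip \<alpha> (\<lambda>w. deriv g w + (- of_nat n) * g w)"
        by (intro rapid_on_strip_add rapid_on_strip_deriv rapid_on_strip_cmult g)
      fix x :: real assume x: "x > 0"
      show "nth_deriv (Suc n) (\<lambda>x. f (complex_of_real (ln x))) x =
         (deriv g (of_real (ln x)) + (- of_nat n) * g (of_real (ln x))) / of_real x ^ Suc n"
        unfolding nth_deriv_Suc by (rule vector_derivative_at) (rule step[OF g x eq])
    qed
  qed
  from *[of n] obtain g where g: "rapid_on_strip \<alpha> g"
      and eq: "\<And>x. x > 0 \<Longrightarrow> nth_deriv n (\<lambda>x. f (complex_of_real (ln x))) x = g (of_real (ln x)) / of_real x ^ n"
    by blast
  thus ?thesis using step[OF g _ eq] by (blast intro: differentiableI_vector)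
qed

lemma rapid_log_S_space:
  assumes f: "rapid_on_strip \<alpha> f" and \<alpha>: "\<alpha> > 0"
  shows "(\<lambda>x. f (complex_of_real (ln x))) \<in> S_space"
  unfolding S_space_def smooth_fun_on_def mem_Collect_eq
proof (intro conjI allI ballI)
  fix n and x :: real assume "x \<in> {0<..}"
  thus "nth_deriv n (\<lambda>x. f (complex_of_real (ln x))) differentiable at x"
    using nth_deriv_log[OF f \<alpha>, of n] by auto
next
  fix m :: int and n
  obtain g where g: "rapid_on_strip \<alpha> g"
    and eq: "\<And>x. x > 0 \<Longrightarrow> nth_deriv n (\<lambda>x. f (complex_of_real (ln x))) x = g (of_real (ln x)) / of_real x ^ n"
    using nth_deriv_log[OF f \<alpha>, of n] by blast
  define k where "k = real_of_int m - real n"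
  obtain N :: nat where N: "real N \<ge> \<bar>k\<bar>" using real_arch_simple by blast
  obtain C where C: "C \<ge> 0" "\<And>w. \<bar>Im w\<bar> \<le> 0 \<Longrightarrow> norm (g w) \<le> C * exp (- real N * \<bar>Re w\<bar>)"
    using rapid_on_stripD[OF g \<alpha>, of N] by auto
  show "bdd_above ((\<lambda>x. cmod (of_real x powi m * nth_deriv n (\<lambda>x. f (complex_of_real (ln x))) x)) ` {0<..})"
  proof (rule bdd_aboveI2)
    fix x :: real assume "x \<in> {0<..}"
    hence x: "x > 0" by simp
    have "norm (of_real x powi m * (g (of_real (ln x)) / of_real x ^ n)) = x powi m / x ^ n * norm (g (of_real (ln x)))"
      using x by (simp add: norm_mult norm_divide norm_power norm_power_int)
    also have "x powi m / x ^ n = exp (k * ln x)"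
    proof -
      have "x powi m = x powr (real_of_int m)" using x by (simp add: powr_real_of_int')
      moreover have "x ^ n = x powr (real n)" using x by (simp add: powr_realpow)
      ultimately show ?thesis using x by (simp add: powr_def k_def left_diff_distrib exp_diff)
    qed
    also have "exp (k * ln x) * norm (g (of_real (ln x))) \<le> exp (real N * \<bar>ln x\<bar>) * (C * exp (- real N * \<bar>ln x\<bar>))"
    proof (intro mult_mono)
      have "k * ln x \<le> \<bar>k\<bar> * \<bar>ln x\<bar>" by (simp add: abs_mult[symmetric])
      also have "\<dots> \<le> real N * \<bar>ln x\<bar>" using N by (intro mult_right_mono) auto
      finally show "exp (k * ln x) \<le> exp (real N * \<bar>ln x\<bar>)" by simp
      show "norm (g (of_real (ln x))) \<le> C * exp (- real N * \<bar>ln x\<bar>)" using C(2)[of "of_real (ln x)"] by simp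
    qed auto
    also have "\<dots> = C" by (simp add: exp_minus)
    finally show "cmod (of_real x powi m * nth_deriv n (\<lambda>x. f (complex_of_real (ln x))) x) \<le> C"
      by (simp add: eq[OF x])
  qed
qed

section \<open>Inverse Mellin transforms\<close>

lemma log_substitution:
  fixes F :: "real \<Rightarrow> complex"
  assumes cont: "continuous_on {0<..} F" and int: "integrable lborel (\<lambda>t. F (exp t))"
  shows "set_integrable lborel {0<..} (\<lambda>x. F x / of_real x)"
    "(LINT x:{0<..}|lborel. F x / of_real x) = (LINT t|lborel. F (exp t))"
proof -
  have A: "((ereal \<circ> exp \<circ> real_of_ereal) \<longlongrightarrow> 0) (at_right (-\<infinity>))"
    unfolding ereal_tendsto_simps zero_ereal_def by (rule exp_at_bot)
  have B: "((ereal \<circ> exp \<circ> real_of_ereal) \<longlongrightarrow> \<infinity>) (at_left \<infinity>)"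
    unfolding ereal_tendsto_simps by (rule exp_at_top)
  have e0: "einterval 0 \<infinity> = {0<..}" using einterval_eq_Ici[of 0] by (simp add: zero_ereal_def)
  have cF: "isCont F x" if "x > 0" for x
    using cont that by (simp add: continuous_on_eq_continuous_at)
  have nint: "set_integrable lborel (einterval (-\<infinity>) \<infinity>) (\<lambda>x. norm (F (exp x)) / exp x * exp x)"
    using integrable_norm[OF int] by (simp add: set_integrable_def)
  \<comment> \<open>The substitution rule for nonnegative functions, applied to the norm, derives
    integrability in \<open>x\<close> from integrability in \<open>t\<close>; the complex rule used
    afterwards presupposes both.\<close>
  have 1: "set_integrable lborel (einterval 0 \<infinity>) (\<lambda>x. norm (F x) / x)"
    by (rule interval_integral_substitution_nonneg(1)[OF _ _ _ _ _ _ A B nint])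
       (auto intro!: derivative_eq_intros continuous_intros cF)
  have meas: "set_borel_measurable borel {0<..} (\<lambda>x. F x / of_real x)"
    unfolding set_borel_measurable_def
    by (rule borel_measurable_continuous_on_indicator) (auto intro!: continuous_intros cont)
  show si: "set_integrable lborel {0<..} (\<lambda>x. F x / of_real x)"
    unfolding set_integrable_def
  proof (rule Bochner_Integration.integrable_bound)
    show "integrable lborel (\<lambda>x. indicator {0<..} x *\<^sub>R (norm (F x) / x))"
      using 1 by (simp add: e0 set_integrable_def)
    show "(\<lambda>x. indicat_real {0<..} x *\<^sub>R (F x / complex_of_real x)) \<in> borel_measurable lborel"
      using meas by (simp add: set_borel_measurable_def)
    show "AE x in lborel. norm (indicat_real {0<..} x *\<^sub>R (F x / complex_of_real x)) \<le> norm (indicator {0<..} x *\<^sub>R (norm (F x) / x))"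
      by (rule AE_I2) (auto simp: norm_divide indicator_def)
  qed
  have "(LBINT x=0..\<infinity>. F x / of_real x) = (LBINT x=-\<infinity>..\<infinity>. exp x *\<^sub>R (F (exp x) / of_real (exp x)))"
    by (rule interval_integral_substitution_integrable[OF _ _ _ _ _ A B])
       (use int si in \<open>auto intro!: derivative_eq_intros continuous_intros cF simp: e0 set_integrable_def scaleR_conv_of_real\<close>)
  thus "(LINT x:{0<..}|lborel. F x / of_real x) = (LINT t|lborel. F (exp t))"
    by (simp add: interval_lebesgue_integral_def e0 set_lebesgue_integral_def scaleR_conv_of_real)
qed

text \<open>Along a vertical line \<open>Re (\<kappa> \<tau>)\<close> is constant, so the modulus of
  the kernel \<open>exp (\<kappa> \<tau> * (r + t))\<close> does not depend on
  \<open>\<tau>\<close>, and Fubini reduces to one integrability condition in each variable. It is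
  used with \<open>Complex c \<tau>\<close>, \<open>1 - Complex c \<tau>\<close> and
  \<open>- Complex c \<tau>\<close> as \<open>\<kappa> \<tau>\<close>.\<close>

lemma fubini_kernel:
  fixes A \<kappa> \<phi> :: "real \<Rightarrow> complex"
  assumes [measurable]: "A \<in> borel_measurable borel" "\<kappa> \<in> borel_measurable borel" "\<phi> \<in> borel_measurable borel"
    and k: "\<And>\<tau>. Re (\<kappa> \<tau>) = k"
    and A: "integrable lborel A" and \<phi>: "integrable lborel (\<lambda>t. norm (\<phi> t) * exp (k * t))"
  shows "(LINT t|lborel. (LINT \<tau>|lborel. A \<tau> * exp (\<kappa> \<tau> * of_real (r + t))) * \<phi> t) =
         (LINT \<tau>|lborel. A \<tau> * exp (\<kappa> \<tau> * of_real r) * laplace \<phi> (\<kappa> \<tau>))" (is ?th1)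
    and "integrable lborel (\<lambda>t. (LINT \<tau>|lborel. A \<tau> * exp (\<kappa> \<tau> * of_real (r + t))) * \<phi> t)" (is ?th2)
    and "integrable lborel (\<lambda>\<tau>. A \<tau> * exp (\<kappa> \<tau> * of_real r) * laplace \<phi> (\<kappa> \<tau>))" (is ?th3)
proof -
  define f where "f = (\<lambda>\<tau> t. A \<tau> * exp (\<kappa> \<tau> * of_real (r + t)) * \<phi> t)"
  have nf: "norm (f \<tau> t) = norm (A \<tau>) * exp (k * r) * (norm (\<phi> t) * exp (k * t))" for \<tau> t
    by (simp add: f_def norm_mult k distrib_left exp_add)
  have fm [measurable]: "case_prod f \<in> borel_measurable (lborel \<Otimes>\<^sub>M lborel)"
    unfolding f_def by measurable
  have fi: "integrable (lborel \<Otimes>\<^sub>M lborel) (case_prod f)"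
  proof (rule lborel_pair.Fubini_integrable)
    show "integrable lborel (\<lambda>x. LINT y|lborel. norm (case (x, y) of (x, y) \<Rightarrow> f x y))"
      using integrable_norm[OF A] by (simp add: nf)
    show "AE x in lborel. integrable lborel (\<lambda>y. case (x, y) of (x, y) \<Rightarrow> f x y)"
    proof (rule AE_I2)
      fix x
      have "integrable lborel (f x)"
      proof (rule Bochner_Integration.integrable_bound)
        show "integrable lborel (\<lambda>t. norm (A x) * exp (k * r) * (norm (\<phi> t) * exp (k * t)))"
          using \<phi> by simp
        show "f x \<in> borel_measurable lborel" unfolding f_def by measurable
      qed (simp add: nf)
      thus "integrable lborel (\<lambda>y. case (x, y) of (x, y) \<Rightarrow> f x y)" by simp
    qed
  qed simp
  have e1: "(LINT \<tau>|lborel. f \<tau> t) = (LINT \<tau>|lborel. A \<tau> * exp (\<kappa> \<tau> * of_real (r + t))) * \<phi> t" for t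
    unfolding f_def by simp
  have e2: "(LINT t|lborel. f \<tau> t) = A \<tau> * exp (\<kappa> \<tau> * of_real r) * laplace \<phi> (\<kappa> \<tau>)" for \<tau>
  proof -
    have "f \<tau> t = A \<tau> * exp (\<kappa> \<tau> * of_real r) * (\<phi> t * exp (\<kappa> \<tau> * of_real t))" for t
      by (simp add: f_def distrib_left exp_add)
    thus ?thesis by (simp add: laplace_def)
  qed
  show ?th1 using lborel_pair.Fubini_integral[OF fi] by (simp only: e1 e2)
  show ?th2 using lborel_pair.integrable_snd[OF fi] by (simp only: e1)
  show ?th3 using lborel_pair.integrable_fst[OF fi] by (simp only: e2)
qed

locale mellin_line =
  fixes Z :: "complex \<Rightarrow> complex" and c d C :: real
  assumes Zcont: "continuous_on UNIV (\<lambda>t. Z (Complex c t))"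
    and Zbound: "\<And>t. norm (Z (Complex c t)) \<le> C * exp (- d * \<bar>t\<bar>)"
    and d: "d > 0"
begin

text \<open>The inverse Mellin transform in the coordinate \<open>x = exp (- w)\<close>, for complex
  \<open>w\<close>: the decay of \<open>Z\<close> makes it holomorphic in a strip, from which the
  smoothness of the boundary term \<open>hl\<close> and the bounds for its derivatives
  follow.\<close>

definition fz :: "complex \<Rightarrow> complex" where
  "fz w = 1 / (2 * of_real pi) * (LINT t|lborel. Z (Complex c t) * exp (Complex c t * w))"

definition hl :: "complex \<Rightarrow> complex" where
  "hl w = fz w - exp w * fz (- w)"

lemma Z_measurable [measurable]: "(\<lambda>t. Z (Complex c t)) \<in> borel_measurable borel"
  using Zcont by (rule borel_measurable_continuous_onI)

lemma Z_integrable: "integrable lborel (\<lambda>t. Z (Complex c t))"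
  by (rule integrable_exp_bound[OF _ d Zbound]) measurable

lemma Z_integrable_exp:
  assumes "\<bar>r\<bar> < d"
  shows "integrable lborel (\<lambda>t. norm (Z (Complex c t)) * exp (r * t))"
proof (rule integrable_exp_bound)
  show "norm (norm (Z (Complex c t)) * exp (r * t)) \<le> C * exp (- (d - \<bar>r\<bar>) * \<bar>t\<bar>)" for t
  proof -
    have "r * t \<le> \<bar>r\<bar> * \<bar>t\<bar>" by (simp add: abs_mult[symmetric])
    hence "norm (Z (Complex c t)) * exp (r * t) \<le> (C * exp (- d * \<bar>t\<bar>)) * exp (\<bar>r\<bar> * \<bar>t\<bar>)"
      using order_trans[OF norm_ge_zero Zbound[of t]] by (intro mult_mono Zbound) auto
    also have "\<dots> = C * (exp (- d * \<bar>t\<bar>) * exp (\<bar>r\<bar> * \<bar>t\<bar>))" by (simp only: mult.assoc)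
    also have "exp (- d * \<bar>t\<bar>) * exp (\<bar>r\<bar> * \<bar>t\<bar>) = exp (- (d - \<bar>r\<bar>) * \<bar>t\<bar>)"
      by (simp add: left_diff_distrib flip: exp_add)
    finally show ?thesis by simp
  qed
qed (use assms in auto)

lemma fz_conv_laplace: "fz w = 1 / (2 * of_real pi) * (exp (of_real c * w) * laplace (\<lambda>t. Z (Complex c t)) (\<i> * w))"
proof -
  have "Z (Complex c t) * exp (Complex c t * w) = exp (of_real c * w) * (Z (Complex c t) * exp (\<i> * w * of_real t))" for t
    by (simp add: Complex_eq distrib_left distrib_right exp_add mult_ac)
  note eq = this
  show ?thesis unfolding fz_def laplace_def eq by simp
qed

lemma fz_holomorphic: "fz holomorphic_on {w. \<bar>Im w\<bar> < d}"
proof -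
  have "laplace (\<lambda>t. Z (Complex c t)) holomorphic_on {s. Re s \<in> {-d<..<d}}"
    by (rule laplace_holomorphic) (auto intro!: Z_integrable_exp)
  hence "laplace (\<lambda>t. Z (Complex c t)) \<circ> (\<lambda>w. \<i> * w) holomorphic_on {w. \<bar>Im w\<bar> < d}"
    by (intro holomorphic_on_compose_gen[of _ _ _ "{s. Re s \<in> {-d<..<d}}"]) (auto intro!: holomorphic_intros)
  thus ?thesis unfolding fz_conv_laplace[abs_def] by (auto simp: o_def intro!: holomorphic_intros)
qed

lemma fz_bound: "\<exists>B\<ge>0. \<forall>w. \<bar>Im w\<bar> \<le> d / 2 \<longrightarrow> norm (fz w) \<le> B * exp (c * Re w)"
proof -
  define B where "B = 1 / (2 * pi) * (LINT t|lborel. C * exp (- (d/2) * \<bar>t\<bar>))"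
  have C0: "C \<ge> 0" using order_trans[OF norm_ge_zero Zbound[of 0]] by simp
  have "norm (fz w) \<le> B * exp (c * Re w)" if w: "\<bar>Im w\<bar> \<le> d / 2" for w
  proof -
    have b: "norm (Z (Complex c t) * exp (Complex c t * w)) \<le> exp (c * Re w) * (C * exp (- (d/2) * \<bar>t\<bar>))" for t
    proof -
      have "- t * Im w \<le> \<bar>t\<bar> * \<bar>Im w\<bar>" using abs_ge_self[of "- t * Im w"] by (simp add: abs_mult)
      also have "\<dots> \<le> \<bar>t\<bar> * (d / 2)" using w by (intro mult_left_mono) auto
      finally have 1: "- t * Im w \<le> (d/2) * \<bar>t\<bar>" by (simp add: mult.commute)
      have "norm (Z (Complex c t) * exp (Complex c t * w)) = norm (Z (Complex c t)) * (exp (c * Re w) * exp (- t * Im w))"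
        by (simp add: norm_mult flip: exp_add)
      also have "\<dots> \<le> (C * exp (- d * \<bar>t\<bar>)) * (exp (c * Re w) * exp ((d/2) * \<bar>t\<bar>))"
        using C0 1 by (intro mult_mono Zbound) auto
      also have "\<dots> = exp (c * Re w) * (C * (exp (- d * \<bar>t\<bar>) * exp ((d/2) * \<bar>t\<bar>)))" by (simp only: mult_ac)
      also have "exp (- d * \<bar>t\<bar>) * exp ((d/2) * \<bar>t\<bar>) = exp (- (d/2) * \<bar>t\<bar>)" by (simp flip: exp_add)
      finally show ?thesis .
    qed
    have i: "integrable lborel (\<lambda>t. exp (c * Re w) * (C * exp (- (d/2) * \<bar>t\<bar>)))"
      using integrable_exp_abs[of "d/2"] d by simp
    have "norm (LINT t|lborel. Z (Complex c t) * exp (Complex c t * w)) \<le> (LINT t|lborel. exp (c * Re w) * (C * exp (- (d/2) * \<bar>t\<bar>)))"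
    proof (rule Bochner_Integration.integral_norm_bound_integral[OF _ i b])
      have [measurable]: "(\<lambda>t. Complex c t) \<in> borel_measurable borel"
        by (intro borel_measurable_continuous_onI) (simp add: Complex_eq, intro continuous_intros)
      show "integrable lborel (\<lambda>t. Z (Complex c t) * exp (Complex c t * w))"
        by (rule Bochner_Integration.integrable_bound[OF i]) (use b in \<open>auto intro: order_trans abs_ge_self\<close>)
    qed
    thus ?thesis by (simp add: fz_def norm_mult norm_divide B_def field_simps)
  qed
  moreover have "B \<ge> 0" unfolding B_def using C0 by (intro mult_nonneg_nonneg integral_nonneg_AE) auto
  ultimately show ?thesis by blast
qed

lemma hl_holomorphic: "hl holomorphic_on {w. \<bar>Im w\<bar> < d}"
proof -
  have "fz \<circ> uminus holomorphic_on {w. \<bar>Im w\<bar> < d}"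
    by (rule holomorphic_on_compose_gen[OF _ fz_holomorphic]) (auto intro!: holomorphic_intros)
  thus ?thesis unfolding hl_def[abs_def] by (auto simp: o_def intro!: holomorphic_intros fz_holomorphic)
qed

lemma hl_bound: "\<exists>B\<ge>0. \<exists>m::nat. m \<ge> 1 \<and> (\<forall>w. \<bar>Im w\<bar> \<le> d / 2 \<longrightarrow> norm (hl w) \<le> B * exp (real m * \<bar>Re w\<bar>))"
proof -
  obtain B where B: "B \<ge> 0" "\<And>w. \<bar>Im w\<bar> \<le> d / 2 \<Longrightarrow> norm (fz w) \<le> B * exp (c * Re w)"
    using fz_bound by auto
  obtain m :: nat where m: "real m \<ge> \<bar>c\<bar> + 1" using real_arch_simple by blast
  have "norm (hl w) \<le> (B + B) * exp (real m * \<bar>Re w\<bar>)" if w: "\<bar>Im w\<bar> \<le> d / 2" for w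
  proof -
    have c1: "c * Re w \<le> \<bar>c\<bar> * \<bar>Re w\<bar>" "(1 - c) * Re w \<le> (\<bar>c\<bar> + 1) * \<bar>Re w\<bar>"
    proof -
      show "c * Re w \<le> \<bar>c\<bar> * \<bar>Re w\<bar>" by (simp add: abs_mult[symmetric])
      have "(1 - c) * Re w \<le> \<bar>1 - c\<bar> * \<bar>Re w\<bar>" by (simp add: abs_mult[symmetric])
      also have "\<dots> \<le> (\<bar>c\<bar> + 1) * \<bar>Re w\<bar>" by (intro mult_right_mono) auto
      finally show "(1 - c) * Re w \<le> (\<bar>c\<bar> + 1) * \<bar>Re w\<bar>" .
    qed
    have c2: "\<bar>c\<bar> * \<bar>Re w\<bar> \<le> m * \<bar>Re w\<bar>" "(\<bar>c\<bar> + 1) * \<bar>Re w\<bar> \<le> m * \<bar>Re w\<bar>"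
      using m by (auto intro!: mult_right_mono)
    have 1: "norm (fz w) \<le> B * exp (real m * \<bar>Re w\<bar>)"
      using B(2)[OF w] c1(1) c2(1) B(1) by (elim order_trans) (auto intro!: mult_left_mono)
    have "norm (exp w * fz (- w)) \<le> exp (Re w) * (B * exp (c * Re (- w)))"
      unfolding norm_mult using w by (intro mult_mono B) auto
    also have "\<dots> = B * exp ((1 - c) * Re w)" by (simp add: left_diff_distrib exp_diff exp_minus field_simps)
    also have "\<dots> \<le> B * exp (real m * \<bar>Re w\<bar>)"
      using c1(2) c2(2) B(1) by (auto intro!: mult_left_mono)
    finally have 2: "norm (exp w * fz (- w)) \<le> B * exp (real m * \<bar>Re w\<bar>)" .
    have "norm (hl w) \<le> norm (fz w) + norm (exp w * fz (- w))" unfolding hl_def by (rule norm_triangle_ineq4)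
    also have "\<dots> \<le> (B + B) * exp (real m * \<bar>Re w\<bar>)" using 1 2 by (simp add: distrib_right)
    finally show ?thesis .
  qed
  moreover have "m \<ge> 1" using m by linarith
  ultimately show ?thesis using B(1) by (intro exI[of _ "B + B"] conjI exI[of _ m]) auto
qed

lemma mellin_integrand_exp: "mellin_integrand Z c (exp (- r)) t = \<i> * (Z (Complex c t) * exp (Complex c t * of_real r))"
  by (simp add: mellin_integrand_def powr_def Ln_of_real mult_ac)

lemma mellin_integrand_integrable:
  assumes "x > 0"
  shows "integrable lborel (mellin_integrand Z c x)"
proof -
  have x: "x = exp (- (- ln x))" using assms by simp
  have [measurable]: "(\<lambda>t. Complex c t) \<in> borel_measurable borel"
    by (intro borel_measurable_continuous_onI) (simp add: Complex_eq, intro continuous_intros)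
  have "integrable lborel (\<lambda>t. Z (Complex c t) * exp (Complex c t * of_real (- ln x)))"
    by (rule Bochner_Integration.integrable_bound[of _ "\<lambda>t. exp (- c * ln x) * Z (Complex c t)"])
       (use Z_integrable in \<open>auto simp: norm_mult\<close>)
  hence "integrable lborel (mellin_integrand Z c (exp (- (- ln x))))"
    unfolding mellin_integrand_exp[abs_def] by simp
  thus ?thesis using x by (simp only:)
qed

lemma inverse_mellin_exp: "inverse_mellin Z c (exp (- r)) = fz (of_real r)"
  by (simp add: inverse_mellin_def mellin_integrand_exp fz_def)

lemma boundary_fun_exp: "boundary_fun Z c (exp (- r)) = hl (of_real r)"
proof -
  have "inverse (exp (- r)) = exp (- (- r))" by (simp add: exp_minus)
  hence "inverse_mellin Z c (inverse (exp (- r))) = fz (of_real (- r))" by (simp only: inverse_mellin_exp)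
  moreover have "inverse (complex_of_real (exp (- r))) = exp (of_real r)"
    by (simp add: exp_minus flip: exp_of_real)
  ultimately show ?thesis by (simp only: boundary_fun_def inverse_mellin_exp hl_def of_real_minus)
qed

lemma boundary_fun_ln: "x > 0 \<Longrightarrow> boundary_fun Z c x = hl (of_real (- ln x))"
  using boundary_fun_exp[of "- ln x"] by simp

end

section \<open>Mean-periodicity of boundary terms\<close>

lemma nth_deriv_zero: "nth_deriv n (\<lambda>x. 0) = (\<lambda>x. 0)"
  by (induction n) (auto simp: nth_deriv_Suc)

lemma continuous_on_smooth_fun:
  assumes "smooth_fun_on U f"
  shows "continuous_on U f"
proof (rule continuous_at_imp_continuous_on, rule ballI)
  fix x assume "x \<in> U"
  hence "nth_deriv 0 f differentiable at x" using assms unfolding smooth_fun_on_def by blast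
  thus "isCont f x" using differentiable_imp_continuous_within by (metis nth_deriv_0)
qed

lemma F_space_bound:
  assumes "f \<in> F_space m"
  obtains K where "\<And>t. norm (f t) \<le> K * exp (real m * \<bar>t\<bar>)"
proof -
  have "bdd_above (range (\<lambda>x. cmod (nth_deriv 0 f x) * exp (- real m * \<bar>x\<bar>)))"
    using assms unfolding F_space_def mem_Collect_eq by (elim conjE) (erule spec)
  then obtain K where K: "\<And>x. cmod (f x) * exp (- real m * \<bar>x\<bar>) \<le> K"
    by (auto simp: bdd_above_def)
  have "norm (f t) \<le> K * exp (real m * \<bar>t\<bar>)" for t
    using K[of t] by (simp add: exp_minus field_simps)
  thus ?thesis by (rule that)
qed

lemma seminorm_on_diff_self:
  assumes "seminorm_on E p" "f \<in> E"
  shows "p (\<lambda>x. f x - f x) = 0"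
proof -
  have "p (\<lambda>x. 0 * f x) = cmod 0 * p f" using assms unfolding seminorm_on_def by blast
  thus ?thesis by simp
qed

lemma topspace_C_exp_topology: "topspace C_exp_topology = C_exp"
  unfolding C_exp_topology_def
  by (rule topspace_seminorm_topology[of "\<lambda>_. 0"]) (auto simp: seminorm_on_def)

lemma topspace_C_poly_topology: "topspace C_poly_topology = {h. (\<lambda>t. h (exp (- t))) \<in> C_exp}"
  unfolding C_poly_topology_def topspace_pullback_topology topspace_C_exp_topology by auto

text \<open>The modulus of the pairing is itself one of the seminorms that generate the inductive
  limit topology, once it is continuous on every \<open>F_space m\<close>. There the seminorm of
  order 0 suffices, since \<open>f\<close> outweighs \<open>exp (m * \<bar>t\<bar>)\<close> for each
  \<open>m\<close>. The argument \<open>- t\<close> stems from the coordinate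
  \<open>x = exp (- t)\<close> in \<open>C_poly_topology\<close>.\<close>

lemma C_exp_pairing_dual:
  fixes f :: "complex \<Rightarrow> complex"
  assumes f: "rapid_on_strip \<alpha> f" and \<alpha>: "\<alpha> > 0"
  shows "(\<lambda>g. LINT t|lborel. g t * f (of_real (- t))) \<in> dual_space C_exp_topology"
proof -
  define \<Psi> where "\<Psi> = (\<lambda>g. LINT t|lborel. g t * f (of_real (- t)))"
  have contf: "continuous_on UNIV (\<lambda>t. f (of_real (- t)))"
    by (rule continuous_on_compose2[OF rapid_on_strip_continuous[OF f \<alpha>]]) (auto intro!: continuous_intros)
  have mf [measurable]: "(\<lambda>t. f (of_real (- t))) \<in> borel_measurable borel"
    using contf by (rule borel_measurable_continuous_onI)
  have fb: "\<exists>K\<ge>0. \<forall>t. exp (real m * \<bar>t\<bar>) * norm (f (of_real (- t))) \<le> K * exp (- 1 * \<bar>t\<bar>)" for m :: nat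
  proof -
    obtain K where K: "K \<ge> 0" "\<And>w. \<bar>Im w\<bar> \<le> 0 \<Longrightarrow> norm (f w) \<le> K * exp (- real (Suc m) * \<bar>Re w\<bar>)"
      using rapid_on_stripD[OF f \<alpha>, of "Suc m"] by blast
    have "exp (real m * \<bar>t\<bar>) * norm (f (of_real (- t))) \<le> K * exp (- 1 * \<bar>t\<bar>)" for t
    proof -
      have "exp (real m * \<bar>t\<bar>) * norm (f (of_real (- t))) \<le> exp (real m * \<bar>t\<bar>) * (K * exp (- real (Suc m) * \<bar>t\<bar>))"
        using K(2)[of "of_real (- t)"] by (intro mult_left_mono) auto
      also have "\<dots> = K * (exp (real m * \<bar>t\<bar>) * exp (- real (Suc m) * \<bar>t\<bar>))" by (simp only: mult_ac)
      also have "exp (real m * \<bar>t\<bar>) * exp (- real (Suc m) * \<bar>t\<bar>) = exp (- 1 * \<bar>t\<bar>)"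
        by (simp add: algebra_simps flip: exp_add)
      finally show ?thesis .
    qed
    thus ?thesis using K(1) by blast
  qed
  have intw: "integrable lborel (\<lambda>t. exp (real m * \<bar>t\<bar>) * norm (f (of_real (- t))))" for m :: nat
  proof -
    obtain K where K: "\<And>t. exp (real m * \<bar>t\<bar>) * norm (f (of_real (- t))) \<le> K * exp (- 1 * \<bar>t\<bar>)"
      using fb[of m] by blast
    show ?thesis by (rule integrable_exp_bound[of _ 1 K], measurable) (use K in simp_all)
  qed
  have mg: "g \<in> borel_measurable borel" if "g \<in> F_space m" for g m
    using that continuous_on_smooth_fun[of UNIV g]
    by (intro borel_measurable_continuous_onI) (auto simp: F_space_def)
  have intg: "integrable lborel (\<lambda>t. g t * f (of_real (- t)))" if g: "g \<in> F_space m" for g m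
  proof -
    obtain K where K: "\<And>t. norm (g t) \<le> K * exp (real m * \<bar>t\<bar>)" using F_space_bound[OF g] by blast
    have [measurable]: "g \<in> borel_measurable borel" by (rule mg[OF g])
    show ?thesis
    proof (rule Bochner_Integration.integrable_bound)
      show "integrable lborel (\<lambda>t. K * (exp (real m * \<bar>t\<bar>) * norm (f (of_real (- t)))))" using intw[of m] by simp
      show "AE t in lborel. norm (g t * f (of_real (- t))) \<le> norm (K * (exp (real m * \<bar>t\<bar>) * norm (f (of_real (- t)))))"
      proof (rule AE_I2)
        fix t
        have "norm (g t * f (of_real (- t))) \<le> (K * exp (real m * \<bar>t\<bar>)) * norm (f (of_real (- t)))"
          unfolding norm_mult by (intro mult_right_mono K) auto
        also have "\<dots> \<le> norm (K * (exp (real m * \<bar>t\<bar>) * norm (f (of_real (- t)))))"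
          unfolding real_norm_def mult.assoc by (rule abs_ge_self)
        finally show "norm (g t * f (of_real (- t))) \<le> norm (K * (exp (real m * \<bar>t\<bar>) * norm (f (of_real (- t)))))" .
      qed
      show "(\<lambda>t. g t * f (of_real (- t))) \<in> borel_measurable lborel" by measurable
    qed
  qed
  have intC: "integrable lborel (\<lambda>t. g t * f (of_real (- t)))" if "g \<in> C_exp" for g
    using that intg unfolding C_exp_def by blast
  have lin: "\<Psi> (\<lambda>x. a * g x + b * k x) = a * \<Psi> g + b * \<Psi> k" if g: "g \<in> C_exp" and k: "k \<in> C_exp" for g k a b
  proof -
    have "\<Psi> (\<lambda>x. a * g x + b * k x) = (LINT t|lborel. a * (g t * f (of_real (- t))) + b * (k t * f (of_real (- t))))"
      unfolding \<Psi>_def by (intro Bochner_Integration.integral_cong) (auto simp: algebra_simps)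
    also have "\<dots> = a * \<Psi> g + b * \<Psi> k"
      unfolding \<Psi>_def using intC[OF g] intC[OF k] by (subst Bochner_Integration.integral_add) auto
    finally show ?thesis .
  qed
  have diff: "\<Psi> (\<lambda>x. g x - k x) = \<Psi> g - \<Psi> k" if "g \<in> C_exp" "k \<in> C_exp" for g k
    using lin[OF that, of 1 "-1"] by simp
  have contF: "continuous_map (F_topology m) euclideanreal (\<lambda>g. cmod (\<Psi> g))" if m: "m \<ge> 1" for m
    unfolding F_topology_def
  proof (rule continuous_map_seminorm_topology)
    fix p g assume "p \<in> {\<lambda>f. SUP x. cmod (nth_deriv n f x) * exp (- real m * \<bar>x\<bar>) | n. True}"
    thus "p (\<lambda>x. g x - g x) = (0::real)" by (auto simp: nth_deriv_zero)
  next
    fix g :: "real \<Rightarrow> complex" and \<epsilon> :: real assume g: "g \<in> F_space m" and \<epsilon>: "\<epsilon> > 0"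
    define I where "I = (LINT t|lborel. exp (real m * \<bar>t\<bar>) * norm (f (of_real (- t))))"
    have I: "I \<ge> 0" unfolding I_def by (intro integral_nonneg_AE) auto
    define p0 where "p0 = (\<lambda>f. SUP x. cmod (nth_deriv 0 f x) * exp (- real m * \<bar>x\<bar>))"
    have "dist (cmod (\<Psi> k)) (cmod (\<Psi> g)) < \<epsilon>" if k: "k \<in> F_space m" and lt: "p0 (\<lambda>x. k x - g x) < \<epsilon> / (I + 1)" for k
    proof -
      have kgC: "k \<in> C_exp" "g \<in> C_exp" using k g m by (auto simp: C_exp_def)
      obtain K1 where K1: "\<And>t. norm (k t) \<le> K1 * exp (real m * \<bar>t\<bar>)" using F_space_bound[OF k] by blast
      obtain K2 where K2: "\<And>t. norm (g t) \<le> K2 * exp (real m * \<bar>t\<bar>)" using F_space_bound[OF g] by blast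
      have bdd: "bdd_above (range (\<lambda>x. cmod (nth_deriv 0 (\<lambda>x. k x - g x) x) * exp (- real m * \<bar>x\<bar>)))"
      proof (rule bdd_aboveI2)
        fix x
        have "norm (k x - g x) \<le> (K1 + K2) * exp (real m * \<bar>x\<bar>)"
          using norm_triangle_ineq4[of "k x" "g x"] K1[of x] K2[of x] by (simp add: distrib_right)
        hence "norm (k x - g x) * exp (- real m * \<bar>x\<bar>) \<le> (K1 + K2) * exp (real m * \<bar>x\<bar>) * exp (- real m * \<bar>x\<bar>)"
          by (rule mult_right_mono) auto
        thus "cmod (nth_deriv 0 (\<lambda>x. k x - g x) x) * exp (- real m * \<bar>x\<bar>) \<le> K1 + K2"
          by (simp add: exp_minus field_simps)
      qed
      have pt: "norm (k t - g t) \<le> p0 (\<lambda>x. k x - g x) * exp (real m * \<bar>t\<bar>)" for t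
        using cSUP_upper[OF UNIV_I bdd, of t] by (simp add: p0_def exp_minus field_simps)
      have "\<bar>cmod (\<Psi> k) - cmod (\<Psi> g)\<bar> \<le> cmod (\<Psi> k - \<Psi> g)" by (rule norm_triangle_ineq3)
      also have "\<Psi> k - \<Psi> g = \<Psi> (\<lambda>x. k x - g x)" by (rule diff[OF kgC, symmetric])
      also have "cmod \<dots> \<le> (LINT t|lborel. p0 (\<lambda>x. k x - g x) * (exp (real m * \<bar>t\<bar>) * norm (f (of_real (- t)))))"
        unfolding \<Psi>_def
      proof (rule Bochner_Integration.integral_norm_bound_integral)
        show "integrable lborel (\<lambda>t. (k t - g t) * f (of_real (- t)))"
          using intg[OF k] intg[OF g] by (simp add: left_diff_distrib)
        show "integrable lborel (\<lambda>t. p0 (\<lambda>x. k x - g x) * (exp (real m * \<bar>t\<bar>) * norm (f (of_real (- t)))))"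
          using intw[of m] by simp
        fix t
        show "norm ((k t - g t) * f (of_real (- t))) \<le> p0 (\<lambda>x. k x - g x) * (exp (real m * \<bar>t\<bar>) * norm (f (of_real (- t))))"
          unfolding norm_mult mult.assoc[symmetric] by (intro mult_right_mono pt) auto
      qed
      also have "\<dots> = p0 (\<lambda>x. k x - g x) * I" by (simp add: I_def)
      also have "\<dots> \<le> \<epsilon> / (I + 1) * I" using lt I by (intro mult_right_mono) auto
      also have "\<dots> < \<epsilon>" using \<epsilon> I by (simp add: field_simps)
      finally show ?thesis by (simp add: dist_real_def)
    qed
    moreover have "p0 \<in> {\<lambda>f. SUP x. cmod (nth_deriv n f x) * exp (- real m * \<bar>x\<bar>) | n. True}"
      unfolding p0_def by (intro CollectI exI[of _ "0::nat"] conjI refl TrueI)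
    moreover have "\<epsilon> / (I + 1) > 0" using \<epsilon> I by simp
    ultimately show "\<exists>Q\<subseteq>{\<lambda>f. SUP x. cmod (nth_deriv n f x) * exp (- real m * \<bar>x\<bar>) | n. True}. finite Q \<and> Q \<noteq> {} \<and>
       (\<exists>\<delta>>0. \<forall>k\<in>F_space m. (\<forall>p\<in>Q. p (\<lambda>x. k x - g x) < \<delta>) \<longrightarrow> dist (cmod (\<Psi> k)) (cmod (\<Psi> g)) < \<epsilon>)"
      by (intro exI[of _ "{p0}"] conjI exI[of _ "\<epsilon> / (I + 1)"] ballI impI; (blast | simp))
  qed
  define q where "q = (\<lambda>g. cmod (\<Psi> g))"
  have semi: "seminorm_on C_exp q"
    unfolding seminorm_on_def
  proof (intro conjI ballI allI)
    fix g k assume gk: "g \<in> C_exp" "k \<in> C_exp"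
    show "q (\<lambda>x. g x + k x) \<le> q g + q k"
      using lin[OF gk, of 1 1] by (simp add: q_def norm_triangle_ineq)
  next
    fix g a assume g: "g \<in> C_exp"
    show "q (\<lambda>x. a * g x) = cmod a * q g"
      using lin[OF g g, of a 0] by (simp add: q_def norm_mult)
  qed
  have "continuous_map C_exp_topology euclidean \<Psi>"
    unfolding C_exp_topology_def
  proof (rule continuous_map_seminorm_topology)
    fix p g assume "p \<in> {q. seminorm_on C_exp q \<and> (\<forall>m\<ge>1. continuous_map (F_topology m) euclideanreal q)}" "g \<in> C_exp"
    thus "p (\<lambda>x. g x - g x) = 0" using seminorm_on_diff_self by blast
  next
    fix g :: "real \<Rightarrow> complex" and \<epsilon> :: real assume g: "g \<in> C_exp" and \<epsilon>: "\<epsilon> > 0"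
    have "q \<in> {q. seminorm_on C_exp q \<and> (\<forall>m\<ge>1. continuous_map (F_topology m) euclideanreal q)}"
      using semi contF by (simp add: q_def)
    moreover have "dist (\<Psi> k) (\<Psi> g) < \<epsilon>" if "k \<in> C_exp" "q (\<lambda>x. k x - g x) < \<epsilon>" for k
      using that diff[OF that(1) g] by (simp add: q_def dist_norm)
    ultimately show "\<exists>Q\<subseteq>{q. seminorm_on C_exp q \<and> (\<forall>m\<ge>1. continuous_map (F_topology m) euclideanreal q)}. finite Q \<and> Q \<noteq> {} \<and>
       (\<exists>\<delta>>0. \<forall>k\<in>C_exp. (\<forall>p\<in>Q. p (\<lambda>x. k x - g x) < \<delta>) \<longrightarrow> dist (\<Psi> k) (\<Psi> g) < \<epsilon>)"
      using \<epsilon> by (intro exI[of _ "{q}"]) auto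
  qed
  thus ?thesis using lin unfolding dual_space_def topspace_C_exp_topology \<Psi>_def by blast
qed

section \<open>Functionals on \<open>S_space\<close>\<close>

lemma topspace_S_topology: "topspace S_topology = S_space"
  unfolding S_topology_def
proof (rule topspace_seminorm_topology)
  show "(\<lambda>f. SUP x\<in>{0<..}. cmod (of_real x powi 0 * nth_deriv 0 f x)) \<in>
      {\<lambda>f. SUP x\<in>{0<..}. cmod (of_real x powi m * nth_deriv n f x) | (m::int) n. True}"
    by (intro CollectI exI[of _ 0] exI[of _ "0::nat"] conjI refl TrueI)
qed (auto simp: nth_deriv_zero)

lemma S_spaceD:
  assumes "g \<in> S_space"
  shows "bdd_above ((\<lambda>x. cmod (of_real x powi m * nth_deriv n g x)) ` {0<..})"
  using assms unfolding S_space_def mem_Collect_eq by (elim conjE) (drule spec[of _ m], erule spec)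

lemma S_topology_zero:
  assumes "p \<in> {\<lambda>f. SUP x\<in>{0<..}. cmod (of_real x powi m * nth_deriv n f x) | (m::int) n. True}"
  shows "p (\<lambda>x. g x - g x) = (0::real)"
  using assms by (auto simp: nth_deriv_zero)

lemma S_space_diff_le:
  assumes "g \<in> S_space" "k \<in> S_space" "x > 0"
  shows "x powi m * norm (k x - g x) \<le> (SUP x\<in>{0<..}. cmod (of_real x powi m * nth_deriv 0 (\<lambda>x. k x - g x) x))"
proof -
  have "bdd_above ((\<lambda>x. cmod (of_real x powi m * nth_deriv 0 k x)) ` {0<..})"
    "bdd_above ((\<lambda>x. cmod (of_real x powi m * nth_deriv 0 g x)) ` {0<..})"
    using assms by (simp_all only: S_spaceD)
  then obtain K1 K2 where K: "\<And>x. x > 0 \<Longrightarrow> cmod (of_real x powi m * k x) \<le> K1" "\<And>x. x > 0 \<Longrightarrow> cmod (of_real x powi m * g x) \<le> K2"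
    by (auto simp: bdd_above_def)
  have "bdd_above ((\<lambda>x. cmod (of_real x powi m * nth_deriv 0 (\<lambda>x. k x - g x) x)) ` {0<..})"
  proof (rule bdd_aboveI2)
    fix x :: real assume "x \<in> {0<..}"
    thus "cmod (of_real x powi m * nth_deriv 0 (\<lambda>x. k x - g x) x) \<le> K1 + K2"
      using norm_triangle_ineq4[of "of_real x powi m * k x" "of_real x powi m * g x"] K[of x]
      by (simp add: right_diff_distrib)
  qed
  from cSUP_upper[OF _ this, of x] assms(3) show ?thesis
    by (simp add: norm_mult norm_power_int)
qed

lemma eval_dual_S: 
  assumes "x0 > 0"
  shows "(\<lambda>g. g x0) \<in> dual_space S_topology"
proof -
  have "continuous_map S_topology euclidean (\<lambda>g. g x0)"
    unfolding S_topology_def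
  proof (rule continuous_map_seminorm_topology, erule S_topology_zero)
    fix g :: "real \<Rightarrow> complex" and \<epsilon> :: real assume g: "g \<in> S_space" and \<epsilon>: "\<epsilon> > 0"
    define p where "p = (\<lambda>f. SUP x\<in>{0<..}. cmod (of_real x powi 0 * nth_deriv 0 f x))"
    have "dist (k x0) (g x0) < \<epsilon>" if "k \<in> S_space" "p (\<lambda>x. k x - g x) < \<epsilon>" for k
      using S_space_diff_le[OF g that(1) assms, of 0] that(2) by (simp add: p_def dist_norm)
    moreover have "p \<in> {\<lambda>f. SUP x\<in>{0<..}. cmod (of_real x powi m * nth_deriv n f x) | (m::int) n. True}"
      unfolding p_def by (intro CollectI exI[of _ 0] exI[of _ "0::nat"] conjI refl TrueI)
    ultimately show "\<exists>Q\<subseteq>{\<lambda>f. SUP x\<in>{0<..}. cmod (of_real x powi m * nth_deriv n f x) | (m::int) n. True}. finite Q \<and> Q \<noteq> {} \<and>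
       (\<exists>\<delta>>0. \<forall>k\<in>S_space. (\<forall>p\<in>Q. p (\<lambda>x. k x - g x) < \<delta>) \<longrightarrow> dist (k x0) (g x0) < \<epsilon>)"
      using \<epsilon> by (intro exI[of _ "{p}"] conjI exI[of _ \<epsilon>] ballI impI; (blast | simp))
  qed
  thus ?thesis by (simp add: dual_space_def)
qed

lemma set_integrable_inverse_1_plus_square:
  "set_integrable lborel {0<..} (\<lambda>x::real. inverse (1 + x\<^sup>2))"
proof -
  have "set_integrable lborel UNIV (\<lambda>x::real. inverse (1 + x\<^sup>2))"
    using integrable_inverse_1_plus_square by simp
  thus ?thesis by (rule set_integrable_subset) auto
qed

lemma dist_of_fun_dual_S:
  fixes h :: "real \<Rightarrow> complex"
  assumes cont: "continuous_on {0<..} h"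
    and bd: "\<And>x. x > 0 \<Longrightarrow> norm (h x) \<le> B * (x ^ m + inverse (x ^ m))"
  shows "dist_of_fun h \<in> dual_space S_topology"
proof -
  have B: "B \<ge> 0" using order_trans[OF norm_ge_zero bd[of 1]] by simp
  \<comment> \<open>Multiplying \<open>(x ^ m + inverse (x ^ m)) / x\<close> by
    \<open>1 + x\<^sup>2\<close> gives exactly these four powers. Four seminorms of order 0 thus
    bound the integrand by a multiple of the integrable function
    \<open>inverse (1 + x\<^sup>2)\<close>.\<close>
  define W where "W = (\<lambda>g::real \<Rightarrow> complex. \<lambda>x. B * ((x powi (int m - 1) + x powi (int m + 1) + x powi (- int m - 1) + x powi (1 - int m)) * norm (g x)))"
  have pw: "norm (g x * h x / of_real x) \<le> W g x * inverse (1 + x\<^sup>2)" if x: "x > 0" for g x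
  proof -
    have e: "(x ^ m + inverse (x ^ m)) / x * (1 + x\<^sup>2) = x powi (int m - 1) + x powi (int m + 1) + x powi (- int m - 1) + x powi (1 - int m)"
      using x by (simp add: power_int_diff power_int_add power_int_minus field_simps power2_eq_square)
    have p: "1 + x\<^sup>2 > 0" by (simp add: add_pos_nonneg)
    have "norm (g x * h x / of_real x) * (1 + x\<^sup>2) = norm (h x) / x * (1 + x\<^sup>2) * norm (g x)"
      using x by (simp add: norm_mult norm_divide)
    also have "\<dots> \<le> B * (x ^ m + inverse (x ^ m)) / x * (1 + x\<^sup>2) * norm (g x)"
      using x p by (intro mult_right_mono divide_right_mono bd) auto
    also have "\<dots> = B * (((x ^ m + inverse (x ^ m)) / x * (1 + x\<^sup>2)) * norm (g x))" by simp
    also have "\<dots> = W g x" unfolding e W_def ..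
    finally show ?thesis using p by (simp add: field_simps)
  qed
  have Wb: "\<exists>K. \<forall>x>0. W g x \<le> K" if g: "g \<in> S_space" for g
  proof -
    have "\<exists>K. \<forall>x>0. x powi k * norm (g x) \<le> K" for k
    proof -
      have "bdd_above ((\<lambda>x. cmod (of_real x powi k * nth_deriv 0 g x)) ` {0<..})" by (rule S_spaceD[OF g])
      then obtain K where "\<forall>x>0. cmod (of_real x powi k * g x) \<le> K" by (auto simp: bdd_above_def)
      thus ?thesis by (intro exI[of _ K]) (simp add: norm_mult norm_power_int)
    qed
    then obtain K where K: "\<And>k x. x > 0 \<Longrightarrow> x powi k * norm (g x) \<le> K k" by metis
    have "W g x \<le> B * (K (int m - 1) + K (int m + 1) + K (- int m - 1) + K (1 - int m))" if "x > 0" for x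
      unfolding W_def distrib_right using that B by (intro mult_left_mono add_mono K) auto
    thus ?thesis by blast
  qed
  have meas: "(\<lambda>x. indicat_real {0<..} x *\<^sub>R (g x * h x / of_real x)) \<in> borel_measurable borel" if "continuous_on {0<..} g" for g
    using that by (intro borel_measurable_continuous_on_indicator) (auto intro!: continuous_intros cont)
  have cS: "continuous_on {0<..} g" if "g \<in> S_space" for g
    using that continuous_on_smooth_fun[of "{0<..}" g] unfolding S_space_def by blast
  have si: "set_integrable lborel {0<..} (\<lambda>x. g x * h x / of_real x)" and
    bound: "norm (dist_of_fun h g) \<le> K * (LINT x:{0<..}|lborel. inverse (1 + x\<^sup>2))"
    if g: "continuous_on {0<..} g" and K: "\<And>x. x > 0 \<Longrightarrow> W g x \<le> K" for g K
  proof -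
    have le: "norm (indicat_real {0<..} x *\<^sub>R (g x * h x / of_real x)) \<le> K * (indicat_real {0<..} x *\<^sub>R inverse (1 + x\<^sup>2))" for x
    proof (cases "x > 0")
      case True
      have "W g x * inverse (1 + x\<^sup>2) \<le> K * inverse (1 + x\<^sup>2)"
        using K[OF True] by (intro mult_right_mono) auto
      thus ?thesis using pw[OF True, of g] True by (simp add: indicator_def)
    qed (auto simp: indicator_def)
    have i: "integrable lborel (\<lambda>x. K * (indicat_real {0<..} x *\<^sub>R inverse (1 + x\<^sup>2)))"
      using set_integrable_inverse_1_plus_square unfolding set_integrable_def by (rule integrable_mult_right)
    show s: "set_integrable lborel {0<..} (\<lambda>x. g x * h x / of_real x)"
      unfolding set_integrable_def
    proof (rule Bochner_Integration.integrable_bound[OF i])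
      show "(\<lambda>x. indicat_real {0<..} x *\<^sub>R (g x * h x / of_real x)) \<in> borel_measurable lborel"
        using meas[OF g] by simp
      show "AE x in lborel. norm (indicat_real {0<..} x *\<^sub>R (g x * h x / of_real x)) \<le> norm (K * (indicat_real {0<..} x *\<^sub>R inverse (1 + x\<^sup>2)))"
        by (rule AE_I2) (rule order_trans[OF le], simp only: real_norm_def abs_ge_self)
    qed
    have "norm (dist_of_fun h g) \<le> (LINT x|lborel. K * (indicat_real {0<..} x *\<^sub>R inverse (1 + x\<^sup>2)))"
      unfolding dist_of_fun_def set_lebesgue_integral_def
      by (rule Bochner_Integration.integral_norm_bound_integral[OF _ i le]) (use s in \<open>simp only: set_integrable_def\<close>)
    thus "norm (dist_of_fun h g) \<le> K * (LINT x:{0<..}|lborel. inverse (1 + x\<^sup>2))"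
      by (simp add: set_lebesgue_integral_def)
  qed
  have siS: "set_integrable lborel {0<..} (\<lambda>x. g x * h x / of_real x)" if "g \<in> S_space" for g
    using si[OF cS[OF that]] Wb[OF that] by blast
  have lin: "dist_of_fun h (\<lambda>x. a * g x + b * k x) = a * dist_of_fun h g + b * dist_of_fun h k"
    if "g \<in> S_space" "k \<in> S_space" for g k a b
  proof -
    have "dist_of_fun h (\<lambda>x. a * g x + b * k x) = (LINT x:{0<..}|lborel. a * (g x * h x / of_real x) + b * (k x * h x / of_real x))"
      unfolding dist_of_fun_def by (rule set_lebesgue_integral_cong) (auto simp: add_divide_distrib algebra_simps)
    also have "\<dots> = a * dist_of_fun h g + b * dist_of_fun h k"
    proof -
      have 1: "set_integrable lborel {0<..} (\<lambda>x. a * (g x * h x / of_real x))"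
        by (rule set_integrable_mult_right) (rule siS[OF that(1)])
      have 2: "set_integrable lborel {0<..} (\<lambda>x. b * (k x * h x / of_real x))"
        by (rule set_integrable_mult_right) (rule siS[OF that(2)])
      show ?thesis unfolding dist_of_fun_def by (simp only: set_integral_add(2)[OF 1 2] set_integral_mult_right)
    qed
    finally show ?thesis .
  qed
  define I where "I = (LINT x:{0<..}|lborel. inverse (1 + x\<^sup>2 :: real))"
  have I: "I \<ge> 0" unfolding I_def set_lebesgue_integral_def by (intro integral_nonneg_AE) auto
  have "continuous_map S_topology euclidean (dist_of_fun h)"
    unfolding S_topology_def
  proof (rule continuous_map_seminorm_topology, erule S_topology_zero)
    fix g :: "real \<Rightarrow> complex" and \<epsilon> :: real assume g: "g \<in> S_space" and \<epsilon>: "\<epsilon> > 0"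
    define p where "p = (\<lambda>k f. SUP x\<in>{0<..}. cmod (of_real x powi k * nth_deriv 0 f x))"
    \<comment> \<open>Four seminorms below \<open>\<delta>\<close> give the bound
      \<open>4 * B * \<delta> * I\<close>; the 1 in the denominator covers
      \<open>B * I = 0\<close>.\<close>
    define \<delta> where "\<delta> = \<epsilon> / (4 * B * I + 1)"
    have \<delta>: "\<delta> > 0" using \<epsilon> B I by (simp add: \<delta>_def add_nonneg_pos)
    define Q where "Q = {p (int m - 1), p (int m + 1), p (- int m - 1), p (1 - int m)}"
    have "p k \<in> {\<lambda>f. SUP x\<in>{0<..}. cmod (of_real x powi m * nth_deriv n f x) | (m::int) n. True}" for k
      unfolding p_def by (intro CollectI exI[of _ k] exI[of _ "0::nat"] conjI refl TrueI)
    hence Qsub: "Q \<subseteq> {\<lambda>f. SUP x\<in>{0<..}. cmod (of_real x powi m * nth_deriv n f x) | (m::int) n. True}"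
      unfolding Q_def by blast
    have d: "dist (dist_of_fun h k) (dist_of_fun h g) < \<epsilon>" if k: "k \<in> S_space" and lt: "\<forall>p\<in>Q. p (\<lambda>x. k x - g x) < \<delta>" for k
    proof -
      have kg: "continuous_on {0<..} (\<lambda>x. k x - g x)"
        by (intro continuous_intros cS k g)
      have "W (\<lambda>x. k x - g x) x \<le> B * (4 * \<delta>)" if x: "x > 0" for x
      proof -
        have *: "x powi j * norm (k x - g x) \<le> \<delta>" if "p j \<in> Q" for j
          using S_space_diff_le[OF g k x, of j] lt that by (force simp: p_def)
        show ?thesis
          using *[of "int m - 1"] *[of "int m + 1"] *[of "- int m - 1"] *[of "1 - int m"] B
          unfolding W_def distrib_right Q_def by (intro mult_left_mono) auto
      qed
      hence "norm (dist_of_fun h (\<lambda>x. k x - g x)) \<le> B * (4 * \<delta>) * I"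
        unfolding I_def by (rule bound[OF kg])
      also have "dist_of_fun h (\<lambda>x. k x - g x) = dist_of_fun h k - dist_of_fun h g"
        using lin[OF k g, of 1 "-1"] by simp
      also have "B * (4 * \<delta>) * I < \<epsilon>"
      proof -
        have p: "0 < 4 * B * I + 1" using B I by (simp add: add_nonneg_pos)
        have "B * (4 * \<delta>) * I = \<epsilon> * (4 * B * I) / (4 * B * I + 1)" by (simp add: \<delta>_def)
        also have "\<dots> < \<epsilon>" unfolding pos_divide_less_eq[OF p] using \<epsilon> by (simp add: algebra_simps)
        finally show ?thesis .
      qed
      finally show ?thesis by (simp add: dist_norm)
    qed
    show "\<exists>Q\<subseteq>{\<lambda>f. SUP x\<in>{0<..}. cmod (of_real x powi m * nth_deriv n f x) | (m::int) n. True}. finite Q \<and> Q \<noteq> {} \<and>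
       (\<exists>\<delta>>0. \<forall>k\<in>S_space. (\<forall>p\<in>Q. p (\<lambda>x. k x - g x) < \<delta>) \<longrightarrow> dist (dist_of_fun h k) (dist_of_fun h g) < \<epsilon>)"
      by (intro exI[of _ Q] conjI exI[of _ \<delta>] ballI impI Qsub \<delta> d) (auto simp: Q_def)
  qed
  thus ?thesis using lin unfolding dual_space_def topspace_S_topology by blast
qed

text \<open>The equation \<open>Z * V = P\<close> is asked for on the line \<open>Re s = c\<close>
  only, so that \<open>Z\<close> may have any singularities off the line; the contour is shifted for
  the entire function \<open>P\<close> instead.\<close>

locale mean_periodic_core = mellin_line +
  fixes \<alpha> :: real and f P :: "complex \<Rightarrow> complex"
  assumes f: "rapid_on_strip \<alpha> f" and \<alpha>: "\<alpha> > 0" and c: "c > 1 / 2"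
    and V_sym: "\<And>s. laplace (\<lambda>t. f (of_real t)) (1 - s) = laplace (\<lambda>t. f (of_real t)) s"
    and V_nz: "\<exists>s. laplace (\<lambda>t. f (of_real t)) s \<noteq> 0"
    and P_holo: "P holomorphic_on UNIV" and P_sym: "\<And>s. P (1 - s) = P s"
    and P_decay: "\<And>M. \<exists>C. \<exists>\<delta>>0. \<forall>s. \<bar>Re s\<bar> \<le> M \<longrightarrow> norm (P s) \<le> C * exp (- \<delta> * \<bar>Im s\<bar>)"
    and ZV: "\<And>t. Z (Complex c t) * laplace (\<lambda>t. f (of_real t)) (Complex c t) = P (Complex c t)"
begin

abbreviation V :: "complex \<Rightarrow> complex" where "V \<equiv> laplace (\<lambda>t. f (of_real t))"

lemma P_shift:
  "(LINT t|lborel. P (Complex c t) * exp (Complex c t * of_real r)) =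
   (LINT t|lborel. P (Complex (1 - c) t) * exp (Complex (1 - c) t * of_real r))"
proof -
  define M where "M = \<bar>c\<bar> + 1"
  obtain C \<delta> where C: "\<delta> > 0" "\<And>s. \<bar>Re s\<bar> \<le> M \<Longrightarrow> norm (P s) \<le> C * exp (- \<delta> * \<bar>Im s\<bar>)"
    using P_decay[of M] by blast
  show ?thesis
  proof (rule strip_shift[where F = "\<lambda>z. P z * exp (z * of_real r)" and d = \<delta> and C = "C * exp (M * \<bar>r\<bar>)"])
    show "(\<lambda>z. P z * exp (z * of_real r)) holomorphic_on {z. 1 - c \<le> Re z \<and> Re z \<le> c}"
      by (intro holomorphic_intros holomorphic_on_subset[OF P_holo]) auto
    fix z assume z: "1 - c \<le> Re z" "Re z \<le> c"
    hence M: "\<bar>Re z\<bar> \<le> M" using c by (auto simp: M_def)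
    have "Re z * r \<le> \<bar>Re z\<bar> * \<bar>r\<bar>" by (simp add: abs_mult[symmetric])
    also have "\<dots> \<le> M * \<bar>r\<bar>" using M by (intro mult_right_mono) auto
    finally have "norm (P z * exp (z * of_real r)) \<le> (C * exp (- \<delta> * \<bar>Im z\<bar>)) * exp (M * \<bar>r\<bar>)"
      unfolding norm_mult using order_trans[OF norm_ge_zero C(2)[OF M]]
      by (intro mult_mono C M) auto
    thus "norm (P z * exp (z * of_real r)) \<le> C * exp (M * \<bar>r\<bar>) * exp (- \<delta> * \<bar>Im z\<bar>)" by (simp only: mult_ac)
  qed (use c C in auto)
qed

lemma conv_zero:
  "integrable lborel (\<lambda>t. hl (of_real (r + t)) * f (of_real t))"
  "(LINT t|lborel. hl (of_real (r + t)) * f (of_real t)) = 0"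
proof -
  define A where "A = (\<lambda>\<tau>. Z (Complex c \<tau>))"
  \<comment> \<open>The factor \<open>exp w\<close> in \<open>hl\<close> turns
    \<open>exp (- s * w)\<close> into \<open>exp ((1 - s) * w)\<close>: the second half of the
    boundary term is an integral over the reflected line, where the symmetries of \<open>V\<close>
    and \<open>P\<close> apply.\<close>
  define \<kappa> where "\<kappa> = (\<lambda>\<tau>. 1 - Complex c \<tau>)"
  have mC [measurable]: "(\<lambda>t. Complex c t) \<in> borel_measurable borel"
    by (intro borel_measurable_continuous_onI) (simp add: Complex_eq, intro continuous_intros)
  have m\<kappa>: "\<kappa> \<in> borel_measurable borel" unfolding \<kappa>_def by measurable
  have mA: "A \<in> borel_measurable borel" unfolding A_def by measurable
  have iA: "integrable lborel A" unfolding A_def by (rule Z_integrable)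
  have mf: "(\<lambda>t. f (of_real t)) \<in> borel_measurable borel" by (rule rapid_on_strip_measurable[OF f \<alpha>])
  note F1 = fubini_kernel[OF mA mC mf _ iA rapid_on_strip_integrable(2)[OF f \<alpha>], of c r]
  note F2 = fubini_kernel[OF mA m\<kappa> mf _ iA rapid_on_strip_integrable(2)[OF f \<alpha>], of "1 - c" r]
  define G1 where "G1 = (\<lambda>t. (LINT \<tau>|lborel. A \<tau> * exp (Complex c \<tau> * of_real (r + t))) * f (of_real t))"
  define G2 where "G2 = (\<lambda>t. (LINT \<tau>|lborel. A \<tau> * exp (\<kappa> \<tau> * of_real (r + t))) * f (of_real t))"
  have hl_eq: "hl (of_real (r + t)) * f (of_real t) = 1 / (2 * of_real pi) * (G1 t - G2 t)" for t
  proof -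
    have "exp (of_real (r + t)) * (Z (Complex c \<tau>) * exp (Complex c \<tau> * - of_real (r + t))) = A \<tau> * exp (\<kappa> \<tau> * of_real (r + t))" for \<tau>
    proof -
      have "exp (of_real (r + t)) * exp (Complex c \<tau> * - of_real (r + t)) = exp (\<kappa> \<tau> * of_real (r + t))"
      proof -
        have "of_real (r + t) + Complex c \<tau> * - of_real (r + t) = \<kappa> \<tau> * of_real (r + t)"
          by (simp add: \<kappa>_def algebra_simps)
        thus ?thesis by (simp only: exp_add[symmetric])
      qed
      thus ?thesis by (simp only: A_def mult.left_commute)
    qed
    hence "exp (of_real (r + t)) * fz (- of_real (r + t)) = 1 / (2 * of_real pi) * (LINT \<tau>|lborel. A \<tau> * exp (\<kappa> \<tau> * of_real (r + t)))"
      unfolding fz_def by (subst mult.left_commute, subst integral_mult_right_zero[symmetric]) (simp only:)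
    thus ?thesis unfolding hl_def G1_def G2_def A_def[symmetric]
      by (simp only: fz_def A_def left_diff_distrib right_diff_distrib mult.assoc)
  qed
  have i1: "integrable lborel G1" unfolding G1_def by (rule F1(2)) simp
  have i2: "integrable lborel G2" unfolding G2_def by (rule F2(2)) (simp add: \<kappa>_def)
  show "integrable lborel (\<lambda>t. hl (of_real (r + t)) * f (of_real t))"
    unfolding hl_eq by (intro integrable_mult_right Bochner_Integration.integrable_diff i1 i2)
  have "integral\<^sup>L lborel G1 = (LINT \<tau>|lborel. A \<tau> * exp (Complex c \<tau> * of_real r) * V (Complex c \<tau>))"
    unfolding G1_def by (rule F1(1)) simp
  also have "\<dots> = (LINT t|lborel. P (Complex c t) * exp (Complex c t * of_real r))"
    by (intro Bochner_Integration.integral_cong) (auto simp: A_def ZV[symmetric])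
  finally have e1: "integral\<^sup>L lborel G1 = \<dots>" .
  \<comment> \<open>The reflected line is traversed downwards; replacing \<open>\<tau>\<close> by
    \<open>- \<tau>\<close> restores the orientation used in \<open>P_shift\<close>.\<close>
  have \<kappa>': "\<kappa> \<tau> = Complex (1 - c) (- \<tau>)" for \<tau> by (simp add: \<kappa>_def complex_eq_iff)
  have "integral\<^sup>L lborel G2 = (LINT \<tau>|lborel. A \<tau> * exp (\<kappa> \<tau> * of_real r) * V (\<kappa> \<tau>))"
    unfolding G2_def by (rule F2(1)) (simp add: \<kappa>_def)
  also have "\<dots> = (LINT \<tau>|lborel. P (\<kappa> \<tau>) * exp (\<kappa> \<tau> * of_real r))"
    by (intro Bochner_Integration.integral_cong) (auto simp: A_def \<kappa>_def V_sym P_sym ZV[symmetric])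
  also have "\<dots> = (LINT \<tau>|lborel. P (Complex (1 - c) \<tau>) * exp (Complex (1 - c) \<tau> * of_real r))"
    unfolding \<kappa>' by (subst (2) lborel_integral_real_affine[where c = "-1" and t = 0]) auto
  finally have e2: "integral\<^sup>L lborel G2 = \<dots>" .
  show "(LINT t|lborel. hl (of_real (r + t)) * f (of_real t)) = 0"
    unfolding hl_eq using i1 i2 by (simp add: e1 e2 P_shift)
qed

lemma hl_F_space: "\<exists>m\<ge>1. (\<lambda>t. hl (of_real t)) \<in> F_space m"
proof -
  obtain B m where "m \<ge> 1" and B: "\<And>w. \<bar>Im w\<bar> \<le> d / 2 \<Longrightarrow> norm (hl w) \<le> B * exp (real m * \<bar>Re w\<bar>)"
    using hl_bound by blast
  moreover have "(\<lambda>t. hl (of_real t)) \<in> F_space m"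
    by (rule holomorphic_strip_F_space[of _ "d / 2" B])
       (use d B in \<open>auto intro!: holomorphic_on_subset[OF hl_holomorphic]\<close>)
  ultimately show ?thesis by blast
qed

theorem C_poly_mean_periodic_boundary: "C_poly_mean_periodic (boundary_fun Z c)"
  unfolding C_poly_mean_periodic_def mean_periodic_def
proof (intro conjI)
  show "boundary_fun Z c \<in> topspace C_poly_topology"
    using hl_F_space by (auto simp: topspace_C_poly_topology boundary_fun_exp C_exp_def)
  define \<Psi> where "\<Psi> = (\<lambda>g. LINT t|lborel. g t * f (of_real (- t)))"
  have \<Psi>: "\<Psi> \<in> dual_space C_exp_topology" unfolding \<Psi>_def by (rule C_exp_pairing_dual[OF f \<alpha>])
  define \<phi> where "\<phi> = (\<lambda>h. \<Psi> (\<lambda>t. h (exp (- t))))"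
  have "\<phi> \<in> dual_space C_poly_topology"
    unfolding dual_space_def
  proof (intro CollectI conjI ballI allI)
    fix g k :: "real \<Rightarrow> complex" and a b
    assume "g \<in> topspace C_poly_topology" "k \<in> topspace C_poly_topology"
    thus "\<phi> (\<lambda>x. a * g x + b * k x) = a * \<phi> g + b * \<phi> k"
      using \<Psi> by (auto simp: dual_space_def \<phi>_def topspace_C_poly_topology topspace_C_exp_topology)
  next
    have "continuous_map C_poly_topology euclidean (\<Psi> \<circ> (\<lambda>h t. h (exp (- t))))"
      unfolding C_poly_topology_def
      by (rule continuous_map_pullback) (use \<Psi> in \<open>auto simp: dual_space_def\<close>)
    thus "continuous_map C_poly_topology euclidean \<phi>" by (simp add: \<phi>_def o_def)
  qed
  moreover have "\<exists>g\<in>topspace C_poly_topology. \<phi> g \<noteq> 0"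
  proof -
    obtain s where s: "V s \<noteq> 0" using V_nz by blast
    \<comment> \<open>The power \<open>x powr s\<close>, on which the functional takes the value
      \<open>V s\<close>.\<close>
    define g where "g = (\<lambda>x::real. exp (s * of_real (ln x)))"
    have g: "g (exp (- t)) = exp (- s * of_real t)" for t by (simp add: g_def)
    obtain m :: nat where m: "real m \<ge> \<bar>Re s\<bar> + 1" using real_arch_simple by blast
    have "(\<lambda>t. exp (- s * of_real t)) \<in> F_space m"
    proof (rule holomorphic_strip_F_space[of "\<lambda>w. exp (- s * w)" 1 "exp \<bar>Im s\<bar>"])
      fix w assume w: "\<bar>Im w\<bar> < 1"
      have "Re (- s * w) = - Re s * Re w + Im s * Im w" by simp
      also have "\<dots> \<le> \<bar>Re s\<bar> * \<bar>Re w\<bar> + \<bar>Im s\<bar> * \<bar>Im w\<bar>"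
        using abs_ge_self[of "- Re s * Re w"] abs_ge_self[of "Im s * Im w"] by (simp add: abs_mult)
      also have "\<dots> \<le> real m * \<bar>Re w\<bar> + \<bar>Im s\<bar> * 1"
        using m w by (intro add_mono mult_right_mono mult_left_mono) auto
      finally have "exp (Re (- s * w)) \<le> exp (real m * \<bar>Re w\<bar> + \<bar>Im s\<bar>)" by (simp only: exp_le_cancel_iff mult_1_right)
      thus "norm (exp (- s * w)) \<le> exp \<bar>Im s\<bar> * exp (real m * \<bar>Re w\<bar>)"
        by (simp only: norm_exp_eq_Re exp_add mult.commute)
    qed (auto intro!: holomorphic_intros)
    moreover have "m \<ge> 1" using m by linarith
    ultimately have "g \<in> topspace C_poly_topology"
      by (auto simp: topspace_C_poly_topology g C_exp_def)
    moreover have "\<phi> g = V s"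
    proof -
      have "\<phi> g = (LINT t|lborel. exp (- s * of_real t) * f (of_real (- t)))" by (simp add: \<phi>_def \<Psi>_def g)
      also have "\<dots> = V s"
        unfolding laplace_def
        by (subst (2) lborel_integral_real_affine[where c = "-1" and t = 0]) (auto simp: mult.commute)
      finally show ?thesis .
    qed
    ultimately show ?thesis using s by metis
  qed
  moreover have "\<phi> (flip_fun x (boundary_fun Z c)) = 0" if x: "x > 0" for x
  proof -
    define r where "r = - ln x"
    have "boundary_fun Z c (x / exp (- t)) = hl (of_real (r + - t))" for t
    proof -
      have "x / exp (- t) = exp (- (r + - t))" using x by (simp add: r_def exp_minus exp_add exp_diff field_simps)
      thus ?thesis by (simp only: boundary_fun_exp)
    qed
    hence "\<phi> (flip_fun x (boundary_fun Z c)) = (LINT t|lborel. hl (of_real (r + - t)) * f (of_real (- t)))"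
      by (simp only: \<phi>_def \<Psi>_def flip_fun_def)
    also have "\<dots> = (LINT t|lborel. hl (of_real (r + t)) * f (of_real t))"
      by (subst (2) lborel_integral_real_affine[where c = "-1" and t = 0]) auto
    finally show ?thesis using conv_zero(2) by simp
  qed
  ultimately show "\<exists>\<phi>\<in>dual_space C_poly_topology. (\<exists>g\<in>topspace C_poly_topology. \<phi> g \<noteq> 0) \<and> (\<forall>x>0. \<phi> (flip_fun x (boundary_fun Z c)) = 0)"
    by blast
qed

theorem S_dual_mean_periodic_boundary: "S_dual_mean_periodic (boundary_fun Z c)"
  unfolding S_dual_mean_periodic_def
proof (intro conjI allI impI)
  define h where "h = boundary_fun Z c"
  have h: "h x = hl (of_real (- ln x))" if "x > 0" for x using boundary_fun_ln[OF that] by (simp add: h_def)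
  have cont_hl: "continuous_on UNIV (\<lambda>t. hl (complex_of_real t))"
    by (rule continuous_on_compose2[OF holomorphic_on_imp_continuous_on[OF hl_holomorphic]])
       (use d in \<open>auto intro!: continuous_intros\<close>)
  have cont: "continuous_on {0<..} h"
  proof -
    have "continuous_on {0<..} (\<lambda>x. hl (complex_of_real (- ln x)))"
      by (rule continuous_on_compose2[OF cont_hl]) (auto intro!: continuous_intros)
    thus ?thesis using h by (metis (no_types, lifting) continuous_on_cong greaterThan_iff)
  qed
  obtain B m where B: "B \<ge> 0" "\<And>w. \<bar>Im w\<bar> \<le> d / 2 \<Longrightarrow> norm (hl w) \<le> B * exp (real m * \<bar>Re w\<bar>)"
    using hl_bound by blast
  have hb: "norm (h x) \<le> B * (x ^ m + inverse (x ^ m))" if x: "x > 0" for x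
  proof -
    have "norm (h x) \<le> B * exp (real m * \<bar>ln x\<bar>)"
      using B(2)[of "of_real (- ln x)"] d by (simp add: h[OF x])
    also have "exp (real m * \<bar>ln x\<bar>) \<le> x ^ m + inverse (x ^ m)"
    proof -
      have e: "exp (real m * ln x) = x ^ m" using x by (simp add: exp_of_nat_mult)
      have "exp (real m * \<bar>ln x\<bar>) = x ^ m \<or> exp (real m * \<bar>ln x\<bar>) = inverse (x ^ m)"
        using e by (cases "ln x \<ge> 0") (auto simp: exp_minus)
      moreover have "x ^ m > 0" "inverse (x ^ m) > 0" using x by auto
      ultimately show ?thesis by linarith
    qed
    finally show ?thesis using B(1) by (simp add: mult_left_mono)
  qed
  show "set_integrable lborel K (boundary_fun Z c)" if K: "compact K \<and> K \<subseteq> {0<..}" for K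
    unfolding set_integrable_def h_def[symmetric]
    by (rule borel_integrable_compact) (use K in \<open>auto intro: continuous_on_subset[OF cont]\<close>)
  show "\<exists>N. boundary_fun Z c \<in> O(\<lambda>x. of_real x ^ N) \<and> boundary_fun Z c \<in> O[at_right 0](\<lambda>x. inverse (of_real x) ^ N)"
  proof (intro exI[of _ m] conjI)
    show "boundary_fun Z c \<in> O(\<lambda>x. of_real x ^ m)"
      unfolding h_def[symmetric]
    proof (rule bigoI[of _ "2 * B"], rule eventually_mono[OF eventually_ge_at_top[of 1]])
      fix x :: real assume x: "1 \<le> x"
      hence "1 \<le> x ^ m" by (rule one_le_power)
      moreover from this have "inverse (x ^ m) \<le> 1" by (simp add: inverse_le_1_iff)
      ultimately have "inverse (x ^ m) \<le> x ^ m" by linarith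
      hence "B * (x ^ m + inverse (x ^ m)) \<le> B * (x ^ m + x ^ m)" using B(1) by (intro mult_left_mono add_mono) auto
      thus "norm (h x) \<le> 2 * B * norm (complex_of_real x ^ m)"
        using hb[of x] x by (simp add: norm_power)
    qed
    show "boundary_fun Z c \<in> O[at_right 0](\<lambda>x. inverse (of_real x) ^ m)"
      unfolding h_def[symmetric]
    proof (rule bigoI[of _ "2 * B"], rule eventually_mono[OF eventually_at_right_real[of 0 1]])
      fix x :: real assume "x \<in> {0<..<1}"
      hence x: "0 < x" "x < 1" by auto
      have "x ^ m \<le> 1" using x by (intro power_le_one) auto
      moreover have "1 \<le> inverse (x ^ m)" using x \<open>x ^ m \<le> 1\<close> by (simp add: one_le_inverse_iff)
      ultimately have "x ^ m \<le> inverse (x ^ m)" by linarith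
      hence "B * (x ^ m + inverse (x ^ m)) \<le> B * (inverse (x ^ m) + inverse (x ^ m))"
        using B(1) by (intro mult_left_mono add_mono) auto
      thus "norm (h x) \<le> 2 * B * norm (inverse (complex_of_real x) ^ m)"
        using hb[of x] x by (simp add: norm_power norm_inverse power_inverse)
    qed simp
  qed
  define T where "T = weak_star_topology S_topology"
  \<comment> \<open>The kernel of \<open>V\<close> as a function of \<open>x\<close>; the
    annihilating functional on distributions is evaluation at it.\<close>
  define v where "v = (\<lambda>x::real. f (of_real (ln x)))"
  have v: "v \<in> S_space" unfolding v_def by (rule rapid_log_S_space[OF f \<alpha>])
  have topT: "topspace T = dual_space S_topology"
    unfolding T_def weak_star_topology_def
    by (rule topspace_seminorm_topology[of "\<lambda>H. cmod (H v)"]) (use v in \<open>auto simp: topspace_S_topology\<close>)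
  have "(\<lambda>H. H v) \<in> dual_space T"
  proof -
    have "continuous_map T euclidean (\<lambda>H. H v)"
      unfolding T_def weak_star_topology_def
    proof (rule continuous_map_seminorm_topology)
      fix p H assume "p \<in> {\<lambda>H. cmod (H g) |g. g \<in> topspace S_topology}"
      thus "p (\<lambda>x. H x - H x) = (0::real)" by auto
    next
      fix H :: "(real \<Rightarrow> complex) \<Rightarrow> complex" and \<epsilon> :: real assume "\<epsilon> > 0"
      define p where "p = (\<lambda>H. cmod (H v))"
      have "p \<in> {\<lambda>H. cmod (H g) |g. g \<in> topspace S_topology}" using v unfolding p_def topspace_S_topology by blast
      moreover have "dist (K v) (H v) < \<epsilon>" if "p (\<lambda>x. K x - H x) < \<epsilon>" for K
        using that by (simp add: p_def dist_norm)
      ultimately show "\<exists>Q\<subseteq>{\<lambda>H. cmod (H g) |g. g \<in> topspace S_topology}. finite Q \<and> Q \<noteq> {} \<and>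
          (\<exists>\<delta>>0. \<forall>g\<in>dual_space S_topology. (\<forall>p\<in>Q. p (\<lambda>x. g x - H x) < \<delta>) \<longrightarrow> dist (g v) (H v) < \<epsilon>)"
        using \<open>\<epsilon> > 0\<close> by (intro exI[of _ "{p}"] conjI exI[of _ \<epsilon>] ballI impI; (blast | simp))
    qed
    thus ?thesis by (simp add: dual_space_def)
  qed
  moreover have "\<exists>H\<in>topspace T. H v \<noteq> 0"
  proof -
    obtain s where s: "V s \<noteq> 0" using V_nz by blast
    have "\<exists>r::real. f (of_real r) \<noteq> 0"
    proof (rule ccontr)
      assume "\<not> ?thesis"
      hence "V s = 0" by (simp add: laplace_def)
      thus False using s by simp
    qed
    then obtain r :: real where "f (of_real r) \<noteq> 0" by blast
    hence "v (exp r) \<noteq> 0" by (simp add: v_def)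
    thus ?thesis using eval_dual_S[of "exp r"] unfolding topT by (intro bexI[of _ "\<lambda>g. g (exp r)"]) auto
  qed
  moreover have "flip_dist x (dist_of_fun h) v = 0" if x: "x > 0" for x
  proof -
    define F where "F = (\<lambda>y. v (x / y) * h y)"
    have F: "F (exp t) = hl (of_real (- t)) * f (of_real (ln x - t))" for t
      using x by (simp add: F_def v_def h ln_div mult.commute)
    \<comment> \<open>Replacing \<open>t\<close> by \<open>ln x - t\<close> brings the convolution
      into the form of \<open>conv_zero\<close> with \<open>r = - ln x\<close>.\<close>
    have shift: "F (exp (ln x + (-1) * t)) = hl (of_real (- ln x + t)) * f (of_real t)" for t
      unfolding F by (simp add: algebra_simps)
    have iF: "integrable lborel (\<lambda>t. F (exp t))"
      using conv_zero(1)[of "- ln x"] unfolding shift[symmetric]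
      using lborel_integrable_real_affine_iff[of "-1" "\<lambda>t. F (exp t)" "ln x"] by simp
    have cF: "continuous_on {0<..} F"
    proof -
      have "continuous_on {0<..} v" using continuous_on_smooth_fun[of "{0<..}" v] v unfolding S_space_def by blast
      hence "continuous_on {0<..} (\<lambda>y. v (x / y))"
        by (rule continuous_on_compose2) (use x in \<open>auto intro!: continuous_intros\<close>)
      thus ?thesis unfolding F_def by (intro continuous_intros cont)
    qed
    have "flip_dist x (dist_of_fun h) v = (LINT y:{0<..}|lborel. F y / of_real y)"
      by (simp add: flip_dist_def dist_of_fun_def flip_fun_def F_def)
    also have "\<dots> = (LINT t|lborel. F (exp t))" by (rule log_substitution(2)[OF cF iF])
    also have "\<dots> = (LINT t|lborel. F (exp (ln x + (-1) * t)))"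
      by (subst lborel_integral_real_affine[where c = "-1" and t = "ln x"]) auto
    also have "\<dots> = 0" unfolding shift by (rule conv_zero(2))
    finally show ?thesis .
  qed
  moreover have "dist_of_fun h \<in> topspace T"
    unfolding topT by (rule dist_of_fun_dual_S[OF cont hb])
  ultimately show "mean_periodic (weak_star_topology S_topology) flip_dist (dist_of_fun (boundary_fun Z c))"
    unfolding mean_periodic_def T_def[symmetric] h_def[symmetric] by (intro conjI bexI[of _ "\<lambda>H. H v"]) auto
qed

end

section \<open>Boundary terms of constant sign\<close>

lemma half_line_exp_measurable:
  "(\<lambda>t. indicator {0..} t *\<^sub>R exp (s * complex_of_real t)) \<in> borel_measurable borel"
proof -
  have "(\<lambda>t. exp (s * complex_of_real t)) \<in> borel_measurable borel"
    by (intro borel_measurable_continuous_onI continuous_intros)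
  thus ?thesis by (intro borel_measurable_scaleR borel_measurable_indicator) auto
qed

lemma laplace_half_line_exp:
  assumes "Re \<kappa> < Re s"
  shows "laplace (\<lambda>t. indicator {0..} t *\<^sub>R exp (- s * of_real t)) \<kappa> = 1 / (s - \<kappa>)"
    and "integrable lborel (\<lambda>t. norm (indicator {0..} t *\<^sub>R exp (- s * of_real t)) * exp (Re \<kappa> * t))"
proof -
  define w where "w = s - \<kappa>"
  have w: "Re w > 0" using assms by (simp add: w_def)
  have bd: "norm (indicator {0..} t *\<^sub>R exp (- w * complex_of_real t)) \<le> 1 * exp (- Re w * \<bar>t\<bar>)" for t
    by (auto simp: indicator_def)
  have int: "integrable lborel (\<lambda>t. indicator {0..} t *\<^sub>R exp (- w * complex_of_real t))"
    by (rule integrable_exp_bound[OF _ w bd]) measurable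
  have n: "norm (indicator {0..} t *\<^sub>R exp (- s * of_real t)) * exp (Re \<kappa> * t) = norm (indicator {0..} t *\<^sub>R exp (- w * of_real t))" for t
    by (auto simp: indicator_def w_def algebra_simps simp flip: exp_add)
  show "integrable lborel (\<lambda>t. norm (indicator {0..} t *\<^sub>R exp (- s * of_real t)) * exp (Re \<kappa> * t))"
    unfolding n by (rule integrable_norm[OF int])
  have "((\<lambda>T. LINT t|lborel. indicator {0..T} t *\<^sub>R exp (- w * complex_of_real t)) \<longlongrightarrow>
     (LINT t|lborel. indicator {0..} t *\<^sub>R exp (- w * complex_of_real t))) at_top"
  proof (rule integral_dominated_convergence_at_top[where w = "\<lambda>t. norm (indicator {0..} t *\<^sub>R exp (- w * complex_of_real t))"])
    show "integrable lborel (\<lambda>t. norm (indicator {0..} t *\<^sub>R exp (- w * complex_of_real t)))" using int by (rule integrable_norm)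
    show "AE t in lborel. ((\<lambda>T. indicator {0..T} t *\<^sub>R exp (- w * complex_of_real t)) \<longlongrightarrow> indicator {0..} t *\<^sub>R exp (- w * complex_of_real t)) at_top"
    proof (rule AE_I2)
      fix t :: real
      have "\<forall>\<^sub>F T in at_top. T \<ge> t" by (rule eventually_ge_at_top)
      hence "\<forall>\<^sub>F T in at_top. indicator {0..T} t *\<^sub>R exp (- w * complex_of_real t) = indicator {0..} t *\<^sub>R exp (- w * complex_of_real t)"
        by eventually_elim (auto simp: indicator_def)
      thus "((\<lambda>T. indicator {0..T} t *\<^sub>R exp (- w * complex_of_real t)) \<longlongrightarrow> indicator {0..} t *\<^sub>R exp (- w * complex_of_real t)) at_top"
        by (rule tendsto_eventually)
    qed
  qed (auto simp: indicator_def)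
  moreover have "\<forall>\<^sub>F T in at_top. (LINT t|lborel. indicator {0..T} t *\<^sub>R exp (- w * complex_of_real t)) = 1 / w - exp (- w * of_real T) / w"
  proof (rule eventually_mono[OF eventually_ge_at_top[of 0]])
    fix T :: real assume T: "0 \<le> T"
    have "(LINT t|lborel. indicator {0..T} t *\<^sub>R exp (- w * complex_of_real t)) = - exp (- w * of_real T) / w - (- exp (- w * of_real 0) / w)"
    proof (rule integral_FTC_atLeastAtMost[OF T])
      fix x
      have "((\<lambda>z. - exp (- w * z) / w) has_field_derivative exp (- w * of_real x)) (at (of_real x))"
        using w by (auto intro!: derivative_eq_intros)
      thus "((\<lambda>x. - exp (- w * of_real x) / w) has_vector_derivative exp (- w * complex_of_real x)) (at x within {0..T})"
        using has_vector_derivative_real_field has_vector_derivative_at_within by blast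
    qed (intro continuous_intros)
    thus "(LINT t|lborel. indicator {0..T} t *\<^sub>R exp (- w * complex_of_real t)) = 1 / w - exp (- w * of_real T) / w" by simp
  qed
  ultimately have "((\<lambda>T. 1 / w - exp (- w * of_real T) / w) \<longlongrightarrow> (LINT t|lborel. indicator {0..} t *\<^sub>R exp (- w * complex_of_real t))) at_top"
    by (rule Lim_transform_eventually)
  moreover have "((\<lambda>T. 1 / w - exp (- w * of_real T) / w) \<longlongrightarrow> 1 / w - 0 / w) at_top"
  proof (intro tendsto_intros)
    show "((\<lambda>T. exp (- w * complex_of_real T)) \<longlongrightarrow> 0) at_top"
    proof (rule Lim_null_comparison)
      show "\<forall>\<^sub>F T in at_top. norm (exp (- w * complex_of_real T)) \<le> exp (- Re w * T)" by simp
      show "((\<lambda>T. exp (- Re w * T)) \<longlongrightarrow> 0) at_top" using w by real_asymp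
    qed
  qed (use w in auto)
  ultimately have "(LINT t|lborel. indicator {0..} t *\<^sub>R exp (- w * complex_of_real t)) = 1 / w"
    using tendsto_unique[OF trivial_limit_at_top_linorder] by fastforce
  moreover have "(indicator {0..} t *\<^sub>R exp (- s * of_real t)) * exp (\<kappa> * of_real t) = indicator {0..} t *\<^sub>R exp (- w * complex_of_real t)" for t
    by (auto simp: indicator_def w_def algebra_simps simp flip: exp_add)
  ultimately show "laplace (\<lambda>t. indicator {0..} t *\<^sub>R exp (- s * of_real t)) \<kappa> = 1 / (s - \<kappa>)"
    unfolding laplace_def by (simp only: w_def)
qed

context mellin_line
begin

lemma Complex_measurable: "(\<lambda>t. Complex a t) \<in> borel_measurable borel"
  by (intro borel_measurable_continuous_onI) (simp add: Complex_eq, intro continuous_intros)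

lemma fz_real_measurable [measurable]: "(\<lambda>t. fz (of_real t)) \<in> borel_measurable borel"
proof (rule borel_measurable_continuous_onI)
  show "continuous_on UNIV (\<lambda>t. fz (complex_of_real t))"
    by (rule continuous_on_compose2[OF holomorphic_on_imp_continuous_on[OF fz_holomorphic]])
       (use d in \<open>auto intro!: continuous_intros\<close>)
qed

text \<open>Fubini turns the two halves of the Mellin transform of the inverse Mellin transform into
  Cauchy integrals along the line.\<close>
lemma fz_half_transform_pos:
  assumes s: "Re s > c"
  shows "laplace (\<lambda>t. indicator {0..} t *\<^sub>R fz (of_real t)) (- s) =
         - (1 / (2 * of_real pi) * (LINT t|lborel. Z (Complex c t) / (Complex c t - s)))"
    and "integrable lborel (\<lambda>t. indicator {0..} t *\<^sub>R fz (of_real t) * exp (- s * of_real t))"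
proof -
  note K = fubini_kernel[of "\<lambda>t. Z (Complex c t)" "\<lambda>t. Complex c t" "\<lambda>t. indicator {0..} t *\<^sub>R exp (- s * of_real t)" c 0,
      OF Z_measurable Complex_measurable _ _ Z_integrable]
  have i: "integrable lborel (\<lambda>t. norm (indicator {0..} t *\<^sub>R exp (- s * complex_of_real t)) * exp (c * t))"
    using laplace_half_line_exp(2)[of "of_real c" s] s by simp
  have e: "(indicator {0..} t *\<^sub>R fz (of_real t)) * exp (- s * of_real t) =
      1 / (2 * of_real pi) * ((LINT \<tau>|lborel. Z (Complex c \<tau>) * exp (Complex c \<tau> * of_real (0 + t))) * (indicator {0..} t *\<^sub>R exp (- s * of_real t)))" for t
    by (simp add: fz_def)
  have "integrable lborel (\<lambda>t. (LINT \<tau>|lborel. Z (Complex c \<tau>) * exp (Complex c \<tau> * of_real (0 + t))) * (indicator {0..} t *\<^sub>R exp (- s * of_real t)))"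
    by (rule K(2)[OF _ _ i]) (rule half_line_exp_measurable, simp)
  thus "integrable lborel (\<lambda>t. indicator {0..} t *\<^sub>R fz (of_real t) * exp (- s * of_real t))"
    unfolding e by (rule integrable_mult_right)
  have "laplace (\<lambda>t. indicator {0..} t *\<^sub>R fz (of_real t)) (- s) = 1 / (2 * of_real pi) *
      (LINT t|lborel. ((LINT \<tau>|lborel. Z (Complex c \<tau>) * exp (Complex c \<tau> * of_real (0 + t))) * (indicator {0..} t *\<^sub>R exp (- s * of_real t))))"
    unfolding laplace_def e by (rule integral_mult_right_zero)
  also have "(LINT t|lborel. ((LINT \<tau>|lborel. Z (Complex c \<tau>) * exp (Complex c \<tau> * of_real (0 + t))) * (indicator {0..} t *\<^sub>R exp (- s * of_real t)))) =
      (LINT \<tau>|lborel. Z (Complex c \<tau>) * exp (Complex c \<tau> * of_real 0) * laplace (\<lambda>t. indicator {0..} t *\<^sub>R exp (- s * of_real t)) (Complex c \<tau>))"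
    by (rule K(1)[OF _ _ i]) (rule half_line_exp_measurable, simp)
  also have "\<dots> = (LINT t|lborel. - (Z (Complex c t) / (Complex c t - s)))"
  proof -
    have l: "laplace (\<lambda>t. indicator {0..} t *\<^sub>R exp (- s * of_real t)) (Complex c t) = 1 / (s - Complex c t)" for t
      by (rule laplace_half_line_exp(1)) (use s in simp)
    show ?thesis unfolding l by (intro Bochner_Integration.integral_cong) (auto simp: minus_divide_right)
  qed
  finally show "laplace (\<lambda>t. indicator {0..} t *\<^sub>R fz (of_real t)) (- s) =
         - (1 / (2 * of_real pi) * (LINT t|lborel. Z (Complex c t) / (Complex c t - s)))" by simp
qed

lemma fz_half_transform_neg:
  assumes s: "Re s < c"
  shows "laplace (\<lambda>t. indicator {0..} t *\<^sub>R fz (of_real (- t))) s =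
         1 / (2 * of_real pi) * (LINT t|lborel. Z (Complex c t) / (Complex c t - s))"
proof -
  note K = fubini_kernel[of "\<lambda>t. Z (Complex c t)" "\<lambda>t. - Complex c t" "\<lambda>t. indicator {0..} t *\<^sub>R exp (- (- s) * of_real t)" "- c" 0,
      OF Z_measurable _ _ _ Z_integrable]
  have i: "integrable lborel (\<lambda>t. norm (indicator {0..} t *\<^sub>R exp (- (- s) * complex_of_real t)) * exp (- c * t))"
    using laplace_half_line_exp(2)[of "of_real (- c)" "- s"] s by simp
  have e: "(indicator {0..} t *\<^sub>R fz (of_real (- t))) * exp (s * of_real t) =
      1 / (2 * of_real pi) * ((LINT \<tau>|lborel. Z (Complex c \<tau>) * exp (- Complex c \<tau> * of_real (0 + t))) * (indicator {0..} t *\<^sub>R exp (- (- s) * of_real t)))" for t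
    by (simp add: fz_def)
  note [measurable] = Complex_measurable
  have "laplace (\<lambda>t. indicator {0..} t *\<^sub>R fz (of_real (- t))) s = 1 / (2 * of_real pi) *
      (LINT t|lborel. ((LINT \<tau>|lborel. Z (Complex c \<tau>) * exp (- Complex c \<tau> * of_real (0 + t))) * (indicator {0..} t *\<^sub>R exp (- (- s) * of_real t))))"
    unfolding laplace_def e by (rule integral_mult_right_zero)
  also have "(LINT t|lborel. ((LINT \<tau>|lborel. Z (Complex c \<tau>) * exp (- Complex c \<tau> * of_real (0 + t))) * (indicator {0..} t *\<^sub>R exp (- (- s) * of_real t)))) =
      (LINT \<tau>|lborel. Z (Complex c \<tau>) * exp (- Complex c \<tau> * of_real 0) * laplace (\<lambda>t. indicator {0..} t *\<^sub>R exp (- (- s) * of_real t)) (- Complex c \<tau>))"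
    by (rule K(1)[OF _ _ _ i]) (intro borel_measurable_uminus Complex_measurable, rule half_line_exp_measurable, simp)
  also have "\<dots> = (LINT t|lborel. Z (Complex c t) / (Complex c t - s))"
  proof -
    have l: "laplace (\<lambda>t. indicator {0..} t *\<^sub>R exp (- (- s) * of_real t)) (- Complex c t) = 1 / (- s - (- Complex c t))" for t
      by (rule laplace_half_line_exp(1)) (use s in simp)
    show ?thesis unfolding l by (intro Bochner_Integration.integral_cong) auto
  qed
  finally show ?thesis .
qed

lemma fz_neg_integrable:
  assumes "r < c"
  shows "integrable lborel (\<lambda>t. norm (indicator {0..} t *\<^sub>R fz (of_real (- t))) * exp (r * t))"
proof -
  obtain B where B: "B \<ge> 0" "\<And>w. \<bar>Im w\<bar> \<le> d / 2 \<Longrightarrow> norm (fz w) \<le> B * exp (c * Re w)" using fz_bound by auto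
  have m: "(\<lambda>t. fz (of_real (- t))) \<in> borel_measurable borel"
    using measurable_compose[OF _ fz_real_measurable, of uminus borel] by simp
  show ?thesis
  proof (rule integrable_exp_bound)
    show "norm (norm (indicator {0..} t *\<^sub>R fz (of_real (- t))) * exp (r * t)) \<le> B * exp (- (c - r) * \<bar>t\<bar>)" for t
    proof (cases "t \<ge> 0")
      case True
      have "norm (fz (of_real (- t))) * exp (r * t) \<le> B * exp (c * (- t)) * exp (r * t)"
        using B(2)[of "of_real (- t)"] d by (intro mult_right_mono) auto
      also have "\<dots> = B * exp (- (c - r) * t)" by (simp add: algebra_simps flip: exp_add)
      finally show ?thesis using True by simp
    qed (use B(1) in \<open>auto simp: indicator_def\<close>)
  qed (use m assms in \<open>auto intro!: borel_measurable_times borel_measurable_norm borel_measurable_scaleR borel_measurable_indicator\<close>)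
qed

end

context mean_periodic_core
begin

text \<open>For \<open>c < Re s < c'\<close> the Mellin transform of the boundary term over
  \<open>x < 1\<close> is \<open>Z s - A s - A (1 - s)\<close>, where \<open>A\<close> is the
  transform over \<open>x > 1\<close> of the inverse Mellin transform of \<open>Z\<close>. Landau's
  theorem continues the former to \<open>1 - c' < Re s\<close>, and solving for \<open>Z\<close>
  gives \<open>Y\<close>.\<close>

lemma single_sign_imp_entire_quotient:
  assumes c': "c < c'"
    and Zh: "Z holomorphic_on {s. c \<le> Re s \<and> Re s \<le> c'}"
    and Zb: "\<And>s. c \<le> Re s \<Longrightarrow> Re s \<le> c' \<Longrightarrow> norm (Z s) \<le> C * exp (- d * \<bar>Im s\<bar>)"
    and ZVs: "\<And>s. c \<le> Re s \<Longrightarrow> Re s \<le> c' \<Longrightarrow> Z s * V s = P s"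
    and Vreal: "\<And>x. V (of_real x) \<noteq> 0"
    and ss: "single_sign (boundary_fun Z c)"
  shows "\<exists>Y. Y holomorphic_on {s. 1 - c' < Re s \<and> Re s < c'} \<and> (\<forall>s. 1 - c' < Re s \<and> Re s < c' \<longrightarrow> Y s * V s = P s)"
proof -
  interpret L': mellin_line Z c' d C
  proof
    show "continuous_on UNIV (\<lambda>t. Z (Complex c' t))"
      by (rule continuous_on_compose2[OF holomorphic_on_imp_continuous_on[OF Zh]])
         (use c' in \<open>auto simp: Complex_eq intro!: continuous_intros\<close>)
    show "norm (Z (Complex c' t)) \<le> C * exp (- d * \<bar>t\<bar>)" for t
      using Zb[of "Complex c' t"] c' by simp
  qed (rule d)
  \<comment> \<open>Computing \<open>fz\<close> on the line \<open>Re s = c'\<close> improves its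
    decay for large \<open>x\<close>, so that \<open>A\<close> is holomorphic up to
    \<open>Re s < c'\<close> and not merely up to \<open>c\<close>.\<close>
  have fz_eq: "fz (of_real r) = L'.fz (of_real r)" for r
  proof -
    define M where "M = \<bar>c\<bar> + \<bar>c'\<bar>"
    have "(LINT t|lborel. Z (Complex c' t) * exp (Complex c' t * of_real r)) = (LINT t|lborel. Z (Complex c t) * exp (Complex c t * of_real r))"
    proof (rule strip_shift[where F = "\<lambda>z. Z z * exp (z * of_real r)" and d = d and C = "C * exp (M * \<bar>r\<bar>)"])
      show "(\<lambda>z. Z z * exp (z * of_real r)) holomorphic_on {z. c \<le> Re z \<and> Re z \<le> c'}"
        by (intro holomorphic_intros Zh)
      fix z assume z: "c \<le> Re z" "Re z \<le> c'"
      have "Re z * r \<le> \<bar>Re z\<bar> * \<bar>r\<bar>" by (simp add: abs_mult[symmetric])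
      also have "\<dots> \<le> M * \<bar>r\<bar>" using z by (intro mult_right_mono) (auto simp: M_def)
      finally have "norm (Z z * exp (z * of_real r)) \<le> (C * exp (- d * \<bar>Im z\<bar>)) * exp (M * \<bar>r\<bar>)"
        unfolding norm_mult using order_trans[OF norm_ge_zero Zb[OF z]] by (intro mult_mono Zb z) auto
      thus "norm (Z z * exp (z * of_real r)) \<le> C * exp (M * \<bar>r\<bar>) * exp (- d * \<bar>Im z\<bar>)" by (simp only: mult_ac)
    qed (use c' d in auto)
    thus ?thesis by (simp add: fz_def L'.fz_def)
  qed
  define A where "A = laplace (\<lambda>t. indicator {0..} t *\<^sub>R fz (of_real (- t)))"
  have mneg: "(\<lambda>t. indicator {0..} t *\<^sub>R fz (of_real (- t))) \<in> borel_measurable borel"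
  proof -
    have "(\<lambda>t. fz (of_real (- t))) \<in> borel_measurable borel"
      using measurable_compose[OF _ fz_real_measurable, of uminus borel] by simp
    thus ?thesis by (intro borel_measurable_scaleR borel_measurable_indicator) auto
  qed
  have Aint: "integrable lborel (\<lambda>t. norm (indicator {0..} t *\<^sub>R fz (of_real (- t))) * exp (r * t))" if "r < c'" for r
    unfolding fz_eq by (rule L'.fz_neg_integrable[OF that])
  have Ah: "A holomorphic_on {s. Re s < c'}"
    unfolding A_def using laplace_holomorphic[OF mneg, of "{..<c'}"] Aint by simp
  have A1h: "(\<lambda>s. A (1 - s)) holomorphic_on {s. 1 - c' < Re s}"
  proof -
    have "A \<circ> (\<lambda>s. 1 - s) holomorphic_on {s. 1 - c' < Re s}"
      by (rule holomorphic_on_compose_gen[OF _ Ah]) (auto intro!: holomorphic_intros)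
    thus ?thesis by (simp add: o_def)
  qed
  have mellin_inv: "laplace (\<lambda>t. indicator {0..} t *\<^sub>R fz (of_real t)) (- s) = Z s - A s"
    if s: "c < Re s" "Re s < c'" for s
  proof -
    \<comment> \<open>Cauchy's formula expresses \<open>Z s\<close> by the integrals over both
      lines. Up to constants, the one over \<open>Re s = c\<close> is the transform of
      \<open>fz\<close> over \<open>x < 1\<close> and the one over \<open>Re s = c'\<close> is the
      transform over \<open>x > 1\<close>.\<close>
    have "(LINT t|lborel. Z (Complex c' t) / (Complex c' t - s)) - (LINT t|lborel. Z (Complex c t) / (Complex c t - s)) = 2 * of_real pi * Z s"
      by (rule strip_cauchy[OF Zh d Zb s]) auto
    moreover have "A s = 1 / (2 * of_real pi) * (LINT t|lborel. Z (Complex c' t) / (Complex c' t - s))"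
      unfolding A_def fz_eq by (rule L'.fz_half_transform_neg[OF s(2)])
    ultimately show ?thesis
      unfolding fz_half_transform_pos(1)[OF s(1)] by (simp add: field_simps)
  qed
  have hlap: "laplace (\<lambda>t. indicator {0..} t *\<^sub>R hl (of_real t)) (- s) = Z s - A s - A (1 - s)"
    and hint: "integrable lborel (\<lambda>t. indicator {0..} t *\<^sub>R hl (of_real t) * exp (- s * of_real t))"
    if s: "c < Re s" "Re s < c'" for s
  proof -
    have e: "indicator {0..} t *\<^sub>R hl (of_real t) * exp (- s * of_real t) =
       indicator {0..} t *\<^sub>R fz (of_real t) * exp (- s * of_real t) - indicator {0..} t *\<^sub>R fz (of_real (- t)) * exp ((1 - s) * of_real t)" for t
    proof -
      have "exp (of_real t) * exp (- s * of_real t) = exp ((1 - s) * complex_of_real t)" by (simp add: algebra_simps flip: exp_add)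
      thus ?thesis by (simp add: hl_def indicator_def algebra_simps)
    qed
    have i1: "integrable lborel (\<lambda>t. indicator {0..} t *\<^sub>R fz (of_real t) * exp (- s * of_real t))"
      by (rule fz_half_transform_pos(2)[OF s(1)])
    have i2: "integrable lborel (\<lambda>t. indicator {0..} t *\<^sub>R fz (of_real (- t)) * exp ((1 - s) * of_real t))"
    proof (rule Bochner_Integration.integrable_bound)
      show "integrable lborel (\<lambda>t. norm (indicator {0..} t *\<^sub>R fz (of_real (- t))) * exp (Re (1 - s) * t))"
        by (rule Aint) (use s c in auto)
      have "(\<lambda>t. exp ((1 - s) * complex_of_real t)) \<in> borel_measurable borel"
        by (intro borel_measurable_continuous_onI continuous_intros)
      from borel_measurable_times[OF mneg this]
      show "(\<lambda>t. indicator {0..} t *\<^sub>R fz (of_real (- t)) * exp ((1 - s) * of_real t)) \<in> borel_measurable lborel"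
        unfolding measurable_lborel2 .
    qed (simp add: norm_mult)
    show "integrable lborel (\<lambda>t. indicator {0..} t *\<^sub>R hl (of_real t) * exp (- s * of_real t))"
      unfolding e by (rule Bochner_Integration.integrable_diff[OF i1 i2])
    have "laplace (\<lambda>t. indicator {0..} t *\<^sub>R hl (of_real t)) (- s) =
        laplace (\<lambda>t. indicator {0..} t *\<^sub>R fz (of_real t)) (- s) - A (1 - s)"
      unfolding laplace_def A_def e by (rule Bochner_Integration.integral_diff[OF i1 i2])
    thus "laplace (\<lambda>t. indicator {0..} t *\<^sub>R hl (of_real t)) (- s) = Z s - A s - A (1 - s)"
      by (simp add: mellin_inv[OF s])
  qed
  obtain t0 \<epsilon> where \<epsilon>: "\<epsilon> = 1 \<or> \<epsilon> = (-1::real)" and t0: "\<And>t. t > t0 \<Longrightarrow> of_real \<epsilon> * hl (of_real t) \<in> \<real>\<^sub>\<ge>\<^sub>0"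
  proof -
    obtain t0 where "(\<forall>t>t0. hl (of_real t) \<in> \<real>\<^sub>\<ge>\<^sub>0) \<or> (\<forall>t>t0. hl (of_real t) \<in> \<real>\<^sub>\<le>\<^sub>0)"
      using ss by (auto simp: single_sign_def boundary_fun_exp)
    thus ?thesis
    proof
      assume "\<forall>t>t0. hl (of_real t) \<in> \<real>\<^sub>\<ge>\<^sub>0"
      thus ?thesis using that[of 1 t0] by simp
    next
      assume "\<forall>t>t0. hl (of_real t) \<in> \<real>\<^sub>\<le>\<^sub>0"
      thus ?thesis using that[of "-1" t0] by (simp add: complex_nonneg_Reals_iff complex_nonpos_Reals_iff)
    qed
  qed
  have \<epsilon>2: "of_real \<epsilon> * of_real \<epsilon> = (1::complex)" using \<epsilon> by auto
  \<comment> \<open>The sign is known only beyond \<open>t0\<close>. The part of the transform over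
    \<open>{0..T}\<close> is entire and is split off as \<open>E\<close>.\<close>
  define T where "T = max t0 0"
  define \<phi> where "\<phi> = (\<lambda>t. indicator {T<..} t * Re (of_real \<epsilon> * hl (of_real t)))"
  have chl: "continuous_on UNIV (\<lambda>t. hl (complex_of_real t))"
    by (rule continuous_on_compose2[OF holomorphic_on_imp_continuous_on[OF hl_holomorphic]])
       (use d in \<open>auto intro!: continuous_intros\<close>)
  have mhl [measurable]: "(\<lambda>t. hl (complex_of_real t)) \<in> borel_measurable borel"
    using chl by (rule borel_measurable_continuous_onI)
  have m\<phi> [measurable]: "\<phi> \<in> borel_measurable borel" unfolding \<phi>_def by measurable
  have \<phi>c: "complex_of_real (\<phi> t) = indicator {T<..} t *\<^sub>R (of_real \<epsilon> * hl (of_real t))" for t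
    using t0[of t] by (auto simp: \<phi>_def T_def indicator_def complex_nonneg_Reals_iff complex_eq_iff)
  have \<phi>nn: "\<phi> t \<ge> 0" for t
    using t0[of t] by (auto simp: \<phi>_def T_def indicator_def complex_nonneg_Reals_iff)
  define E where "E = laplace (\<lambda>t. indicator {0..T} t *\<^sub>R hl (of_real t))"
  have mE [measurable]: "(\<lambda>t. indicator {0..T} t *\<^sub>R hl (of_real t)) \<in> borel_measurable borel" by measurable
  have Eint: "integrable lborel (\<lambda>t. norm (indicator {0..T} t *\<^sub>R hl (of_real t)) * exp (r * t))" for r
  proof -
    have "integrable lborel (\<lambda>t. indicator {0..T} t *\<^sub>R (norm (hl (of_real t)) * exp (r * t)))"
      by (rule borel_integrable_compact) (auto intro!: continuous_intros continuous_on_subset[OF chl])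
    moreover have "norm (indicator {0..T} t *\<^sub>R hl (of_real t)) * exp (r * t) = indicator {0..T} t *\<^sub>R (norm (hl (of_real t)) * exp (r * t))" for t
      by (auto simp: indicator_def)
    ultimately show ?thesis by (simp only:)
  qed
  have Eh: "E holomorphic_on UNIV"
    unfolding E_def using laplace_holomorphic[OF mE open_UNIV Eint] by simp
  have Emh: "(\<lambda>s. E (- s)) holomorphic_on S" for S
  proof -
    have "E \<circ> uminus holomorphic_on S"
      by (rule holomorphic_on_compose_gen[OF _ Eh]) (auto intro!: holomorphic_intros)
    thus ?thesis by (simp add: o_def)
  qed
  have \<phi>lap: "laplace (\<lambda>t. of_real (\<phi> t)) (- s) = of_real \<epsilon> * (Z s - A s - A (1 - s) - E (- s))"
    and \<phi>int: "integrable lborel (\<lambda>t. of_real (\<phi> t) * exp (- s * complex_of_real t))"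
    if s: "c < Re s" "Re s < c'" for s
  proof -
    have iE: "integrable lborel (\<lambda>t. indicator {0..T} t *\<^sub>R hl (of_real t) * exp (- s * of_real t))"
    proof (rule Bochner_Integration.integrable_bound[OF Eint[of "- Re s"]])
      show "(\<lambda>t. indicator {0..T} t *\<^sub>R hl (of_real t) * exp (- s * of_real t)) \<in> borel_measurable lborel" by measurable
    qed (auto simp: norm_mult)
    have e: "of_real (\<phi> t) * exp (- s * of_real t) = of_real \<epsilon> * (indicator {0..} t *\<^sub>R hl (of_real t) * exp (- s * of_real t)
        - indicator {0..T} t *\<^sub>R hl (of_real t) * exp (- s * of_real t))" for t
      unfolding \<phi>c by (auto simp: indicator_def T_def)
    show "integrable lborel (\<lambda>t. of_real (\<phi> t) * exp (- s * complex_of_real t))"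
      unfolding e by (intro integrable_mult_right Bochner_Integration.integrable_diff hint s iE)
    have "laplace (\<lambda>t. of_real (\<phi> t)) (- s) = of_real \<epsilon> * (laplace (\<lambda>t. indicator {0..} t *\<^sub>R hl (of_real t)) (- s) - E (- s))"
      unfolding laplace_def E_def e
      by (simp only: integral_mult_right_zero Bochner_Integration.integral_diff[OF hint[OF s] iE])
    thus "laplace (\<lambda>t. of_real (\<phi> t)) (- s) = of_real \<epsilon> * (Z s - A s - A (1 - s) - E (- s))"
      by (simp only: hlap[OF s])
  qed
  have Vh: "V holomorphic_on UNIV" by (rule laplace_rapid_entire[OF f \<alpha>])
  \<comment> \<open>\<open>V\<close> has no zero on the real segment, hence by compactness none in a
    thin rectangle around it. This is all the room that \<open>landau_laplace\<close> asks for,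
    whatever complex zeros \<open>V\<close> has.\<close>
  obtain \<delta> where \<delta>: "\<delta> > 0" "\<And>s. 1 - c' < Re s \<Longrightarrow> Re s < c' \<Longrightarrow> \<bar>Im s\<bar> < \<delta> \<Longrightarrow> V s \<noteq> 0"
  proof -
    define K where "K = complex_of_real ` {1 - c'..c'}"
    have "compact K" unfolding K_def by (intro compact_continuous_image continuous_intros) auto
    moreover have "open {s. V s \<noteq> 0}"
      using holomorphic_on_imp_continuous_on[OF Vh] by (intro open_Collect_neq) (auto intro: continuous_intros)
    moreover have "K \<subseteq> {s. V s \<noteq> 0}" using Vreal by (auto simp: K_def)
    ultimately obtain e where e: "e > 0" "(\<Union>x\<in>K. ball x e) \<subseteq> {s. V s \<noteq> 0}"
      by (rule compact_subset_open_imp_ball_epsilon_subset)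
    have "V s \<noteq> 0" if s: "1 - c' < Re s" "Re s < c'" "\<bar>Im s\<bar> < e" for s
    proof -
      have "of_real (Re s) - s = - \<i> * of_real (Im s)" by (simp add: complex_eq_iff)
      hence "norm (of_real (Re s) - s) < e" using s by (simp add: norm_mult)
      hence "s \<in> ball (of_real (Re s)) e" by (simp add: dist_norm)
      moreover have "of_real (Re s) \<in> K" using s by (auto simp: K_def)
      ultimately show ?thesis using e(2) by blast
    qed
    thus ?thesis using e(1) that by blast
  qed
  define G where "G = (\<lambda>s. of_real \<epsilon> * (P s / V s - A s - A (1 - s) - E (- s)))"
  have \<phi>ir: "integrable lborel (\<lambda>t. \<phi> t * exp (- \<sigma> * t))" if \<sigma>: "1 - c' < \<sigma>" for \<sigma>
  proof (rule landau_laplace[OF m\<phi> \<phi>nn _ _ _ \<delta>(1), where G = G and b = "1 - c'" and c = c and d = c'])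
    show "\<phi> t = 0" if "t < 0" for t using that by (auto simp: \<phi>_def T_def indicator_def)
    show "1 - c' < c" "c < c'" using c c' by auto
    show "G holomorphic_on {s. 1 - c' < Re s \<and> Re s < c' \<and> \<bar>Im s\<bar> < \<delta>}"
      unfolding G_def using \<delta>(2)
      by (intro holomorphic_intros Emh holomorphic_on_subset[OF P_holo] holomorphic_on_subset[OF Vh]
            holomorphic_on_subset[OF Ah] holomorphic_on_subset[OF A1h]) auto
    show "G s = laplace (\<lambda>t. of_real (\<phi> t)) (- s)" if s: "c < Re s" "Re s < c'" "\<bar>Im s\<bar> < \<delta>" for s
    proof -
      have "V s \<noteq> 0" using \<delta>(2)[of s] s c by auto
      hence "P s / V s = Z s" using ZVs[of s] s by (simp add: field_simps)
      thus ?thesis unfolding G_def \<phi>lap[OF s(1,2)] by simp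
    qed
    show "integrable lborel (\<lambda>t. \<phi> t * exp (- \<sigma> * t))" if "c < \<sigma>" for \<sigma>
    proof -
      \<comment> \<open>A point of the strip \<open>c < Re s < c'\<close>, where
        \<open>\<phi>int\<close> applies, that does not exceed \<open>\<sigma>\<close>. As
        \<open>\<phi>\<close> vanishes for negative \<open>t\<close>, integrability passes on to
        larger exponents.\<close>
      define \<sigma>' where "\<sigma>' = min \<sigma> ((c + c') / 2)"
      have \<sigma>': "c < \<sigma>'" "\<sigma>' < c'" "\<sigma>' \<le> \<sigma>" using that c' by (auto simp: \<sigma>'_def min_def)
      have "integrable lborel (\<lambda>t. norm (of_real (\<phi> t) * exp (- of_real \<sigma>' * complex_of_real t)))"
        using \<sigma>' by (intro integrable_norm \<phi>int) auto
      thus ?thesis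
      proof (rule Bochner_Integration.integrable_bound)
        show "AE t in lborel. norm (\<phi> t * exp (- \<sigma> * t)) \<le> norm (norm (of_real (\<phi> t) * exp (- of_real \<sigma>' * complex_of_real t)))"
        proof (rule AE_I2)
          fix t
          show "norm (\<phi> t * exp (- \<sigma> * t)) \<le> norm (norm (of_real (\<phi> t) * exp (- of_real \<sigma>' * complex_of_real t)))"
          proof (cases "t < 0")
            case True thus ?thesis by (auto simp: \<phi>_def T_def indicator_def)
          next
            case False
            hence "\<sigma>' * t \<le> \<sigma> * t" using \<sigma>' by (intro mult_right_mono) auto
            thus ?thesis by (simp add: norm_mult abs_mult mult_left_mono)
          qed
        qed
      qed simp
    qed
    show "1 - c' < \<sigma>" by (rule \<sigma>)
  qed
  define Y where "Y = (\<lambda>s. of_real \<epsilon> * laplace (\<lambda>t. of_real (\<phi> t)) (- s) + A s + A (1 - s) + E (- s))"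
  have \<phi>h: "(\<lambda>s. laplace (\<lambda>t. of_real (\<phi> t)) (- s)) holomorphic_on {s. 1 - c' < Re s}"
  proof -
    have "laplace (\<lambda>t. of_real (\<phi> t)) holomorphic_on {s. Re s \<in> {..<c' - 1}}"
    proof (rule laplace_holomorphic)
      fix r assume "r \<in> {..<c' - 1}"
      hence "integrable lborel (\<lambda>t. \<phi> t * exp (- (- r) * t))" by (intro \<phi>ir) auto
      thus "integrable lborel (\<lambda>t. norm (complex_of_real (\<phi> t)) * exp (r * t))" using \<phi>nn by simp
    qed auto
    hence "laplace (\<lambda>t. of_real (\<phi> t)) \<circ> uminus holomorphic_on {s. 1 - c' < Re s}"
      by (intro holomorphic_on_compose_gen[of uminus _ _ "{s. Re s \<in> {..<c' - 1}}"]) (auto intro!: holomorphic_intros)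
    thus ?thesis by (simp add: o_def)
  qed
  have Yh: "Y holomorphic_on {s. 1 - c' < Re s \<and> Re s < c'}"
    unfolding Y_def
    by (intro holomorphic_intros Emh holomorphic_on_subset[OF \<phi>h] holomorphic_on_subset[OF Ah] holomorphic_on_subset[OF A1h]) auto
  have "Y s * V s = P s" if s: "1 - c' < Re s" "Re s < c'" for s
  proof (rule analytic_continuation_open[where f = "\<lambda>s. Y s * V s" and g = P and s = "{s. c < Re s} \<inter> {s. Re s < c'}" and s' = "{s. 1 - c' < Re s} \<inter> {s. Re s < c'}"])
    show "open ({s. c < Re s} \<inter> {s. Re s < c'})" "open ({s. 1 - c' < Re s} \<inter> {s. Re s < c'})"
      by (intro open_Int open_halfspace_Re_gt open_halfspace_Re_lt)+
    have "of_real ((c + c') / 2) \<in> {s. c < Re s} \<inter> {s. Re s < c'}" using c' by auto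
    thus "{s. c < Re s} \<inter> {s. Re s < c'} \<noteq> {}" by blast
    show "connected ({s. 1 - c' < Re s} \<inter> {s. Re s < c'})"
      by (intro convex_connected convex_Int convex_halfspace_Re_gt convex_halfspace_Re_lt)
    show "{s. c < Re s} \<inter> {s. Re s < c'} \<subseteq> {s. 1 - c' < Re s} \<inter> {s. Re s < c'}" using c c' by auto
    show "(\<lambda>s. Y s * V s) holomorphic_on {s. 1 - c' < Re s} \<inter> {s. Re s < c'}"
      by (intro holomorphic_intros holomorphic_on_subset[OF Yh] holomorphic_on_subset[OF Vh]) auto
    show "P holomorphic_on {s. 1 - c' < Re s} \<inter> {s. Re s < c'}" by (rule holomorphic_on_subset[OF P_holo]) auto
    fix z assume z: "z \<in> {s. c < Re s} \<inter> {s. Re s < c'}"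
    have "Y z = Z z"
      using \<phi>lap[of z] z \<epsilon>2 by (simp add: Y_def mult.assoc[symmetric])
    thus "Y z * V z = P z" using ZVs[of z] z by simp
  qed (use s in auto)
  thus ?thesis using Yh by blast
qed

end

section \<open>Poisson summation for Gaussians\<close>

lemma gaussian_fourier:
  fixes t \<xi> :: real
  assumes t: "t > 0"
  shows "(LINT x|lborel. of_real (exp (- pi * t * x\<^sup>2)) * exp (\<i> * of_real (\<xi> * x))) =
         complex_of_real (t powr (-1/2) * exp (- \<xi>\<^sup>2 / (4 * pi * t)))"
    and "integrable lborel (\<lambda>x. complex_of_real (exp (- pi * t * x\<^sup>2)) * exp (\<i> * of_real (\<xi> * x)))"
proof -
  \<comment> \<open>The Gaussian is a rescaled standard normal density, whose characteristic
    function is available: \<open>\<sigma>\<close> is chosen so that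
    \<open>(\<sigma> * x)\<^sup>2 / 2 = pi * t * x\<^sup>2\<close>.\<close>
  define \<sigma> where "\<sigma> = sqrt (2 * pi * t)"
  have \<sigma>: "\<sigma> > 0" using t by (simp add: \<sigma>_def)
  have \<sigma>2: "\<sigma>\<^sup>2 = 2 * pi * t" using t by (simp add: \<sigma>_def)
  define g where "g = (\<lambda>y. complex_of_real (exp (- y\<^sup>2 / 2)) * exp (\<i> * of_real (\<xi> / \<sigma> * y)))"
  have nd: "of_real (std_normal_density y) * iexp (\<xi> / \<sigma> * y) = of_real (1 / sqrt (2 * pi)) * g y" for y
    by (simp add: std_normal_density_def g_def)
  have gi: "integrable lborel g"
  proof -
    have "integrable lborel (\<lambda>y. std_normal_density y * 1)"
      using integrable_std_normal_moment[of 0] by simp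
    hence i: "integrable lborel (\<lambda>y. sqrt (2 * pi) * std_normal_density y)" by simp
    show ?thesis
    proof (rule Bochner_Integration.integrable_bound[OF i])
      show "g \<in> borel_measurable lborel" unfolding g_def by measurable
      show "AE y in lborel. norm (g y) \<le> norm (sqrt (2 * pi) * std_normal_density y)"
        by (rule AE_I2) (simp add: g_def norm_mult std_normal_density_def)
    qed
  qed
  have "char std_normal_distribution (\<xi> / \<sigma>) = complex_of_real (exp (- (\<xi> / \<sigma>)\<^sup>2 / 2))"
    using char_std_normal_distribution by (metis)
  moreover have "char std_normal_distribution (\<xi> / \<sigma>) = (LINT y|lborel. of_real (1 / sqrt (2 * pi)) * g y)"
    unfolding char_def nd[symmetric] by (subst integral_density) (auto simp: scaleR_conv_of_real)
  ultimately have G: "(LINT y|lborel. g y) = of_real (sqrt (2 * pi) * exp (- (\<xi> / \<sigma>)\<^sup>2 / 2))"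
    by (simp add: field_simps)
  have gx: "g (0 + \<sigma> * x) = of_real (exp (- pi * t * x\<^sup>2)) * exp (\<i> * of_real (\<xi> * x))" for x
    using \<sigma> by (simp add: g_def power_mult_distrib \<sigma>2)
  show "integrable lborel (\<lambda>x. complex_of_real (exp (- pi * t * x\<^sup>2)) * exp (\<i> * of_real (\<xi> * x)))"
    using lborel_integrable_real_affine[OF gi, of \<sigma> 0] \<sigma> unfolding gx by simp
  have "(LINT y|lborel. g y) = \<sigma> *\<^sub>R (LINT x|lborel. of_real (exp (- pi * t * x\<^sup>2)) * exp (\<i> * of_real (\<xi> * x)))"
    using lborel_integral_real_affine[of \<sigma> g 0] \<sigma> unfolding gx by simp
  hence "(LINT x|lborel. of_real (exp (- pi * t * x\<^sup>2)) * exp (\<i> * of_real (\<xi> * x))) =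
     of_real (sqrt (2 * pi) * exp (- (\<xi> / \<sigma>)\<^sup>2 / 2) / \<sigma>)"
    using \<sigma> unfolding G by (simp add: scaleR_conv_of_real field_simps)
  also have "sqrt (2 * pi) * exp (- (\<xi> / \<sigma>)\<^sup>2 / 2) / \<sigma> = t powr (-1/2) * exp (- \<xi>\<^sup>2 / (4 * pi * t))"
  proof -
    have "sqrt (2 * pi) / \<sigma> = t powr (-1/2)"
      using t by (simp add: \<sigma>_def real_sqrt_mult powr_minus powr_half_sqrt field_simps)
    moreover have "- (\<xi> / \<sigma>)\<^sup>2 / 2 = - \<xi>\<^sup>2 / (4 * pi * t)" by (simp add: power_divide \<sigma>2)
    ultimately show ?thesis by (simp only: times_divide_eq_left[symmetric])
  qed
  finally show "(LINT x|lborel. of_real (exp (- pi * t * x\<^sup>2)) * exp (\<i> * of_real (\<xi> * x))) =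
         complex_of_real (t powr (-1/2) * exp (- \<xi>\<^sup>2 / (4 * pi * t)))" .
qed

lemma exp_2pi_int: "exp (2 * of_real pi * \<i> * of_int n) = 1"
  unfolding exp_eq_1 by (intro conjI exI[of _ n]) simp_all

definition fourier_coeff :: "(complex \<Rightarrow> complex) \<Rightarrow> int \<Rightarrow> complex" where
  "fourier_coeff F k = integral {0..1} (\<lambda>x. F (of_real x) * exp (- (2 * of_real pi * \<i> * of_int k * of_real x)))"

text \<open>One integration by parts; its boundary terms cancel because \<open>g 1 = g 0\<close> and
  the exponential is 1 at both ends. Decay like 1 / |k| is enough, since after telescoping only two
  single coefficients of \<open>g\<close> have to tend to 0.\<close>

lemma fourier_coeff_bound:
  assumes g: "g holomorphic_on UNIV" and per: "g 1 = g 0"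
  shows "\<exists>B. \<forall>k. k \<noteq> 0 \<longrightarrow> norm (fourier_coeff g k) \<le> B / \<bar>real_of_int k\<bar>"
proof -
  have g': "deriv g holomorphic_on UNIV" by (intro holomorphic_deriv g) auto
  have cont: "continuous_on {0..1} (\<lambda>x. deriv g (complex_of_real x))" "continuous_on {0..1} (\<lambda>x. g (complex_of_real x))"
    by (rule continuous_on_compose2[OF holomorphic_on_imp_continuous_on[OF g']],
        auto intro!: continuous_intros,
        rule continuous_on_compose2[OF holomorphic_on_imp_continuous_on[OF g]], auto intro!: continuous_intros)
  obtain B where B: "\<And>x. x \<in> {0..1} \<Longrightarrow> norm (deriv g (complex_of_real x)) \<le> B"
    using compact_imp_bounded[OF compact_continuous_image[OF cont(1) compact_Icc]] unfolding bounded_iff by blast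
  have B0: "B \<ge> 0" using order_trans[OF norm_ge_zero B[of 0]] by simp
  have "norm (fourier_coeff g k) \<le> B / \<bar>real_of_int k\<bar>" if k: "k \<noteq> 0" for k
  proof -
    define q where "q = 2 * of_real pi * \<i> * of_int k"
    have q: "q \<noteq> 0" "norm q = 2 * pi * \<bar>real_of_int k\<bar>" using k by (auto simp: q_def norm_mult)
    have I: "((\<lambda>x. deriv g (of_real x) * exp (- (q * of_real x)) - q * (g (of_real x) * exp (- (q * of_real x)))) has_integral
        g (of_real 1) * exp (- (q * of_real 1)) - g (of_real 0) * exp (- (q * of_real 0))) {0..1}"
    proof (rule fundamental_theorem_of_calculus)
      fix x :: real
      have "(g has_field_derivative deriv g (of_real x)) (at (of_real x))"
        using g by (intro holomorphic_derivI[of _ UNIV]) auto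
      hence "((\<lambda>z. g z * exp (- (q * z))) has_field_derivative
          (deriv g (of_real x) * exp (- (q * of_real x)) - q * (g (of_real x) * exp (- (q * of_real x))))) (at (of_real x))"
        by (auto intro!: derivative_eq_intros simp: algebra_simps)
      thus "((\<lambda>x. g (of_real x) * exp (- (q * of_real x))) has_vector_derivative
          (deriv g (of_real x) * exp (- (q * of_real x)) - q * (g (of_real x) * exp (- (q * of_real x))))) (at x within {0..1})"
        by (rule has_vector_derivative_at_within[OF has_vector_derivative_real_field])
    qed simp
    have "exp (- q) = 1" using exp_2pi_int[of "- k"] by (simp add: q_def)
    hence "integral {0..1} (\<lambda>x. deriv g (of_real x) * exp (- (q * of_real x)) - q * (g (of_real x) * exp (- (q * of_real x)))) = 0"
      using per by (subst integral_unique[OF I]) simp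
    moreover have "integral {0..1} (\<lambda>x. deriv g (of_real x) * exp (- (q * of_real x)) - q * (g (of_real x) * exp (- (q * of_real x)))) =
        integral {0..1} (\<lambda>x. deriv g (of_real x) * exp (- (q * of_real x))) - integral {0..1} (\<lambda>x. q * (g (of_real x) * exp (- (q * of_real x))))"
      by (intro integral_diff integrable_continuous_real continuous_intros cont)
    ultimately have e: "integral {0..1} (\<lambda>x. deriv g (of_real x) * exp (- (q * of_real x))) = q * fourier_coeff g k"
      by (simp add: fourier_coeff_def q_def[symmetric])
    have "norm (integral {0..1} (\<lambda>x. deriv g (of_real x) * exp (- (q * of_real x)))) \<le> B * (1 - 0)"
    proof (rule integral_bound)
      show "continuous_on {0..1} (\<lambda>x. deriv g (of_real x) * exp (- (q * of_real x)))" by (intro continuous_intros cont)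
      fix x :: real assume x: "x \<in> {0..1}"
      have "norm (exp (- (q * of_real x))) = 1" by (simp add: q_def)
      thus "norm (deriv g (of_real x) * exp (- (q * of_real x))) \<le> B" using B[OF x] by (simp only: norm_mult mult_1_right)
    qed simp
    hence "2 * pi * \<bar>real_of_int k\<bar> * norm (fourier_coeff g k) \<le> B" unfolding e norm_mult q(2) by simp
    hence "norm (fourier_coeff g k) * \<bar>real_of_int k\<bar> \<le> B / (2 * pi)" by (simp add: field_simps)
    also have "\<dots> \<le> B / 1" using B0 pi_ge_two by (intro divide_left_mono) auto
    finally show ?thesis using k by (simp add: field_simps)
  qed
  thus ?thesis by blast
qed

text \<open>Chernoff's proof of Fourier inversion: \<open>F - F 0\<close> is divisible by \<open>exp (2 \<pi> i z) - 1\<close> in the ring of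
  entire periodic functions, so that the partial sums of its Fourier coefficients telescope.\<close>
lemma periodic_fourier_at_0:
  assumes F: "F holomorphic_on UNIV" and per: "\<And>z. F (z + 1) = F z"
  shows "(\<lambda>N. \<Sum>k\<in>{- int N..int N}. fourier_coeff F k) \<longlonglongrightarrow> F 0"
proof -
  define e where "e = (\<lambda>z::complex. exp (2 * of_real pi * \<i> * z) - 1)"
  define q where "q = (\<lambda>z. (F z - F 0) / e z)"
  define g where "g = remove_sings q"
  have eh: "e holomorphic_on UNIV" unfolding e_def by (intro holomorphic_intros)
  have e0: "e z = 0 \<longleftrightarrow> z \<in> \<int>" for z
  proof
    assume "e z = 0"
    hence "exp (2 * of_real pi * \<i> * z) = 1" by (simp add: e_def)
    then obtain n :: int where "2 * of_real pi * \<i> * z = of_int (2 * n) * of_real pi * \<i>"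
      unfolding exp_eq_1 by (auto simp: complex_eq_iff)
    hence "z = of_int n" by simp
    thus "z \<in> \<int>" by simp
  next
    assume "z \<in> \<int>" thus "e z = 0" by (auto elim!: Ints_cases simp: e_def exp_2pi_int)
  qed
  have Fint: "F (of_int n) = F 0" for n
  proof -
    have nat: "F (of_nat m) = F 0" for m by (induction m) (auto simp: per add.commute[of 1])
    have neg: "F (- of_nat m) = F 0" for m
    proof (induction m)
      case (Suc m)
      thus ?case using per[of "- of_nat (Suc m)"] by simp
    qed simp
    show ?thesis by (cases n) (use nat neg[of "Suc _"] in auto)
  qed
  have g_an: "g analytic_on {z}" for z
  proof (cases "z \<in> \<int>")
    case False
    have "q analytic_on {z}" unfolding q_def
      by (intro analytic_intros analytic_on_subset[OF analytic_on_open[THEN iffD2, OF open_UNIV F]]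
          analytic_on_subset[OF analytic_on_open[THEN iffD2, OF open_UNIV eh]]) (use e0 False in auto)
    thus ?thesis unfolding g_def by (rule remove_sings_analytic_on)
  next
    case True
    then obtain n where n: "z = of_int n" by (auto elim: Ints_cases)
    \<comment> \<open>Near an integer \<open>z\<close> both \<open>F w - F 0\<close> and
      \<open>e w\<close> are divisible by \<open>w - z\<close>, and the zero of \<open>e\<close> is
      simple. The quotient of the reduced functions \<open>F1\<close> and \<open>e1\<close>
      therefore shows that the singularity is removable.\<close>
    define F1 where "F1 = (\<lambda>w. if w = z then deriv F z else (F w - F z) / (w - z))"
    define e1 where "e1 = (\<lambda>w. if w = z then deriv e z else (e w - e z) / (w - z))"
    have F1: "F1 holomorphic_on UNIV" unfolding F1_def by (rule pole_lemma_open[OF F]) auto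
    have e1: "e1 holomorphic_on UNIV" unfolding e1_def by (rule pole_lemma_open[OF eh]) auto
    have "deriv e z = 2 * of_real pi * \<i> * exp (2 * of_real pi * \<i> * z)"
      unfolding e_def by (rule DERIV_imp_deriv) (auto intro!: derivative_eq_intros)
    hence e1z: "e1 z \<noteq> 0" by (simp add: e1_def)
    have isC: "isCont F1 z" "isCont e1 z"
      using F1 e1 holomorphic_on_imp_continuous_on continuous_on_eq_continuous_at open_UNIV UNIV_I by blast+
    have "((\<lambda>w. F1 w / e1 w) \<longlongrightarrow> F1 z / e1 z) (at z)"
      by (intro tendsto_divide isContD isC e1z)
    moreover have "\<forall>\<^sub>F w in at z. F1 w / e1 w = q w"
    proof -
      have "e z = 0" using e0 True by simp
      thus ?thesis
        by (auto simp: eventually_at_filter F1_def e1_def q_def n Fint)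
    qed
    ultimately have lim: "(q \<longlongrightarrow> F1 z / e1 z) (at z)" by (rule Lim_transform_eventually)
    have "isolated_singularity_at q z"
    proof -
      have "q holomorphic_on ball z 1 - {z}"
        unfolding q_def
      proof (intro holomorphic_intros holomorphic_on_subset[OF F] holomorphic_on_subset[OF eh])
        fix w assume w: "w \<in> ball z 1 - {z}"
        show "e w \<noteq> 0"
        proof
          assume "e w = 0"
          then obtain m where m: "w = of_int m" using e0 by (auto elim: Ints_cases)
          have "norm (z - w) = real_of_int \<bar>n - m\<bar>" unfolding n m by (metis norm_of_int of_int_diff of_int_abs)
          moreover have "norm (z - w) < 1" using w by (simp add: dist_norm)
          ultimately have "\<bar>n - m\<bar> < 1" by linarith
          thus False using w n m by auto
        qed
      qed auto
      thus ?thesis by (intro isolated_singularity_at_holomorphic[of _ "ball z 1"]) auto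
    qed
    thus ?thesis unfolding g_def using lim by (rule remove_sings_analytic_at)
  qed
  have gh: "g holomorphic_on UNIV"
    using g_an analytic_on_analytic_at analytic_imp_holomorphic by blast
  have eper: "e (1 + w) = e w" for w
    by (simp add: e_def distrib_left exp_add exp_two_pi_i' mult.assoc) (simp add: exp_add exp_eq_polar)
  have eper': "e (w + 1) = e w" for w using eper[of w] by (simp add: add.commute)
  have gper: "g 1 = g 0"
  proof -
    have "remove_sings q 1 = remove_sings (\<lambda>w. q (1 + w)) 0" by (rule remove_sings_shift_0)
    also have "(\<lambda>w. q (1 + w)) = q" using per by (auto simp: q_def eper' add.commute[of 1])
    finally show ?thesis by (simp add: g_def)
  qed
  have ge: "g z * e z = F z - F 0" for z
  proof (cases "z \<in> \<int>")
    case True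
    thus ?thesis using e0 Fint by (auto elim: Ints_cases)
  next
    case False
    have "q analytic_on {z}" unfolding q_def
      by (intro analytic_intros analytic_on_subset[OF analytic_on_open[THEN iffD2, OF open_UNIV F]]
          analytic_on_subset[OF analytic_on_open[THEN iffD2, OF open_UNIV eh]]) (use e0 False in auto)
    hence "g z = q z" by (simp add: g_def)
    thus ?thesis using e0 False by (simp add: q_def)
  qed
  have contg: "continuous_on {0..1} (\<lambda>x. g (complex_of_real x))"
    by (rule continuous_on_compose2[OF holomorphic_on_imp_continuous_on[OF gh]]) (auto intro!: continuous_intros)
  \<comment> \<open>Multiplication by \<open>e\<close> shifts the Fourier index and subtracts the
    original, so \<open>F = g * e + F 0\<close> makes each coefficient of \<open>F\<close> a
    difference of neighbouring coefficients of \<open>g\<close>, apart from the constant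
    term.\<close>
  have coeff: "fourier_coeff F k = fourier_coeff g (k - 1) - fourier_coeff g k + (if k = 0 then F 0 else 0)" for k
  proof -
    have c0: "integral {0..1} (\<lambda>x. exp (- (2 * of_real pi * \<i> * of_int k * complex_of_real x))) = (if k = 0 then 1 else 0)"
    proof (cases "k = 0")
      case False
      define p where "p = 2 * of_real pi * \<i> * complex_of_int k"
      have p: "p \<noteq> 0" using False by (simp add: p_def)
      have I: "((\<lambda>x. exp (- (p * complex_of_real x))) has_integral (- exp (- (p * of_real 1)) / p - (- exp (- (p * of_real 0)) / p))) {0..1}"
      proof (rule fundamental_theorem_of_calculus)
        fix x :: real
        have "((\<lambda>z. - exp (- (p * z)) / p) has_field_derivative exp (- (p * of_real x))) (at (of_real x))"
          using p by (auto intro!: derivative_eq_intros)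
        thus "((\<lambda>x. - exp (- (p * complex_of_real x)) / p) has_vector_derivative exp (- (p * of_real x))) (at x within {0..1})"
          by (rule has_vector_derivative_at_within[OF has_vector_derivative_real_field])
      qed simp
      have "exp (- p) = 1" using exp_2pi_int[of "- k"] by (simp add: p_def)
      hence "integral {0..1} (\<lambda>x. exp (- (p * complex_of_real x))) = 0" by (subst integral_unique[OF I]) simp
      thus ?thesis using False by (simp add: p_def)
    qed simp
    have "F (of_real x) * exp (- (2 * of_real pi * \<i> * of_int k * of_real x)) =
        (g (of_real x) * exp (- (2 * of_real pi * \<i> * of_int (k - 1) * of_real x))
        - g (of_real x) * exp (- (2 * of_real pi * \<i> * of_int k * of_real x))) + F 0 * exp (- (2 * of_real pi * \<i> * of_int k * of_real x))" for x
    proof -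
      have "exp (- (2 * of_real pi * \<i> * of_int (k - 1) * complex_of_real x)) =
          exp (- (2 * of_real pi * \<i> * of_int k * of_real x)) * (e (of_real x) + 1)"
        by (simp add: e_def algebra_simps flip: exp_add)
      moreover have "F (of_real x) = g (of_real x) * e (of_real x) + F 0" using ge[of "of_real x"] by simp
      ultimately show ?thesis by (simp add: algebra_simps)
    qed
    hence "fourier_coeff F k = integral {0..1} (\<lambda>x. (g (of_real x) * exp (- (2 * of_real pi * \<i> * of_int (k - 1) * of_real x))
        - g (of_real x) * exp (- (2 * of_real pi * \<i> * of_int k * of_real x))) + F 0 * exp (- (2 * of_real pi * \<i> * of_int k * of_real x)))"
      by (simp only: fourier_coeff_def)
    also have "\<dots> = (integral {0..1} (\<lambda>x. g (of_real x) * exp (- (2 * of_real pi * \<i> * of_int (k - 1) * of_real x)))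
        - integral {0..1} (\<lambda>x. g (of_real x) * exp (- (2 * of_real pi * \<i> * of_int k * of_real x))))
        + integral {0..1} (\<lambda>x. F 0 * exp (- (2 * of_real pi * \<i> * of_int k * of_real x)))"
      by (subst integral_add, (intro integrable_continuous_real continuous_intros contg)+)
         (subst integral_diff, (intro integrable_continuous_real continuous_intros contg)+, rule refl)
    finally show ?thesis by (simp only: fourier_coeff_def integral_mult_right c0) simp
  qed
  have psum: "(\<Sum>k\<in>{- int N..int N}. fourier_coeff F k) = fourier_coeff g (- int N - 1) - fourier_coeff g (int N) + F 0" for N
  proof (induction N)
    case 0 show ?case by (simp add: coeff)
  next
    case (Suc N)
    have "{- int (Suc N)..int (Suc N)} = insert (- int N - 1) (insert (int N + 1) {- int N..int N})" by auto
    hence "(\<Sum>k\<in>{- int (Suc N)..int (Suc N)}. fourier_coeff F k) =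
       fourier_coeff F (- int N - 1) + (fourier_coeff F (int N + 1) + (\<Sum>k\<in>{- int N..int N}. fourier_coeff F k))"
      by simp
    also have "\<dots> = fourier_coeff g (- int (Suc N) - 1) - fourier_coeff g (int (Suc N)) + F 0"
      unfolding Suc by (simp add: coeff algebra_simps)
    finally show ?case .
  qed
  obtain B where B: "\<And>k. k \<noteq> 0 \<Longrightarrow> norm (fourier_coeff g k) \<le> B / \<bar>real_of_int k\<bar>"
    using fourier_coeff_bound[OF gh gper] by blast
  have "(\<lambda>N. fourier_coeff g (- int N - 1)) \<longlonglongrightarrow> 0"
  proof (rule Lim_null_comparison)
    show "\<forall>\<^sub>F N in sequentially. norm (fourier_coeff g (- int N - 1)) \<le> B / (real N + 1)"
      using B[of "- int _ - 1"] by (auto simp: add.commute)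
    show "(\<lambda>N. B / (real N + 1)) \<longlonglongrightarrow> 0" by real_asymp
  qed
  moreover have "(\<lambda>N. fourier_coeff g (int N)) \<longlonglongrightarrow> 0"
  proof (rule Lim_null_comparison)
    show "\<forall>\<^sub>F N in sequentially. norm (fourier_coeff g (int N)) \<le> B / real N"
      using B[of "int _"] by (intro eventually_mono[OF eventually_gt_at_top[of 0]]) auto
    show "(\<lambda>N. B / real N) \<longlonglongrightarrow> 0" by real_asymp
  qed
  ultimately have "(\<lambda>N. fourier_coeff g (- int N - 1) - fourier_coeff g (int N) + F 0) \<longlonglongrightarrow> 0 - 0 + F 0"
    by (intro tendsto_intros)
  thus ?thesis by (simp add: psum)
qed

section \<open>Summation over the integers\<close>

lemma summable_on_int_powr:
  fixes \<sigma> :: real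
  assumes "\<sigma> > 1"
  shows "(\<lambda>n::int. (1 + \<bar>real_of_int n\<bar>) powr (- \<sigma>)) summable_on UNIV"
proof -
  have "summable (\<lambda>n. real n powr (- \<sigma>))" using assms by (simp add: summable_real_powr_iff)
  hence "summable (\<lambda>n. (1 + real n) powr (- \<sigma>))"
    by (subst (asm) summable_Suc_iff[symmetric]) (simp add: add.commute)
  hence nat: "(\<lambda>n::nat. (1 + real n) powr (- \<sigma>)) summable_on UNIV"
    by (subst summable_on_UNIV_nonneg_real_iff) auto
  have "(\<lambda>n::int. (1 + \<bar>real_of_int n\<bar>) powr (- \<sigma>)) summable_on (range int)"
    using nat by (subst summable_on_reindex) (auto simp: o_def)
  moreover have "(\<lambda>n::int. (1 + \<bar>real_of_int n\<bar>) powr (- \<sigma>)) summable_on (range (\<lambda>n. - int n))"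
    using nat by (subst summable_on_reindex) (auto simp: o_def inj_def)
  moreover have "(UNIV :: int set) = range int \<union> range (\<lambda>n. - int n)"
  proof (intro subset_antisym subsetI)
    fix n :: int
    show "n \<in> range int \<union> range (\<lambda>n. - int n)"
      by (cases n rule: int_cases2) auto
  qed simp
  ultimately show ?thesis by (metis summable_on_union)
qed

text \<open>The shift \<open>a\<close> enters the constant only through its absolute value, which
  makes the bound uniform for bounded shifts, as the M-test in \<open>poisson_gaussian\<close>
  requires. The source is \<open>1 + \<bar>n\<bar> \<le> (1 + \<bar>a\<bar>) * (1 + \<bar>n +
  a\<bar>)\<close>.\<close>

lemma gaussian_le_powr:
  fixes b a :: real and n :: int
  assumes b: "b > 0"
  shows "exp (- b * (real_of_int n + a)\<^sup>2) \<le> (1 + \<bar>a\<bar>)\<^sup>2 * (2 * (1 + 1 / b)) * (1 + \<bar>real_of_int n\<bar>) powr (- 2)"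
proof -
  define u where "u = real_of_int n + a"
  have "(1 + \<bar>real_of_int n\<bar>) \<le> (1 + \<bar>a\<bar>) * (1 + \<bar>u\<bar>)"
  proof -
    have "\<bar>real_of_int n\<bar> \<le> \<bar>u\<bar> + \<bar>a\<bar>" by (simp add: u_def)
    moreover have "0 \<le> \<bar>a\<bar> * \<bar>u\<bar>" by simp
    ultimately have "1 + \<bar>real_of_int n\<bar> \<le> 1 + \<bar>a\<bar> + \<bar>u\<bar> + \<bar>a\<bar> * \<bar>u\<bar>" by linarith
    also have "\<dots> = (1 + \<bar>a\<bar>) * (1 + \<bar>u\<bar>)" by (simp add: algebra_simps)
    finally show ?thesis .
  qed
  hence "(1 + \<bar>real_of_int n\<bar>)\<^sup>2 \<le> ((1 + \<bar>a\<bar>) * (1 + \<bar>u\<bar>))\<^sup>2" by (intro power_mono) auto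
  also have "\<dots> = (1 + \<bar>a\<bar>)\<^sup>2 * (1 + \<bar>u\<bar>)\<^sup>2" by (simp add: power_mult_distrib)
  also have "(1 + \<bar>u\<bar>)\<^sup>2 \<le> 2 * (1 + u\<^sup>2)"
    using zero_le_power2[of "1 - \<bar>u\<bar>"] by (simp add: power2_eq_square algebra_simps)
  also have "1 + u\<^sup>2 \<le> (1 + 1 / b) * exp (b * u\<^sup>2)"
  proof -
    have "b * u\<^sup>2 \<le> exp (b * u\<^sup>2)" using exp_ge_add_one_self[of "b * u\<^sup>2"] by linarith
    hence h1: "u\<^sup>2 \<le> exp (b * u\<^sup>2) / b" using b by (simp add: field_simps)
    have h2: "1 \<le> exp (b * u\<^sup>2)" using b by simp
    show ?thesis using add_mono[OF h2 h1] by (simp only: distrib_right mult_1_left times_divide_eq_left)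
  qed
  finally have "(1 + \<bar>real_of_int n\<bar>)\<^sup>2 \<le> (1 + \<bar>a\<bar>)\<^sup>2 * (2 * ((1 + 1 / b) * exp (b * u\<^sup>2)))"
    by (simp add: mult_left_mono)
  hence "(1 + \<bar>real_of_int n\<bar>)\<^sup>2 * exp (- b * u\<^sup>2) \<le> (1 + \<bar>a\<bar>)\<^sup>2 * (2 * ((1 + 1 / b) * exp (b * u\<^sup>2))) * exp (- b * u\<^sup>2)"
    by (rule mult_right_mono) auto
  also have "\<dots> = (1 + \<bar>a\<bar>)\<^sup>2 * (2 * (1 + 1 / b)) * (exp (b * u\<^sup>2) * exp (- b * u\<^sup>2))" by (simp only: mult_ac)
  also have "exp (b * u\<^sup>2) * exp (- b * u\<^sup>2) = 1" by (simp flip: exp_add)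
  finally have "(1 + \<bar>real_of_int n\<bar>)\<^sup>2 * exp (- b * u\<^sup>2) \<le> (1 + \<bar>a\<bar>)\<^sup>2 * (2 * (1 + 1 / b))" by simp
  moreover have p: "(1 + \<bar>real_of_int n\<bar>)\<^sup>2 > 0" by (simp add: add_pos_nonneg)
  ultimately have "exp (- b * u\<^sup>2) \<le> (1 + \<bar>a\<bar>)\<^sup>2 * (2 * (1 + 1 / b)) / (1 + \<bar>real_of_int n\<bar>)\<^sup>2"
    by (subst pos_le_divide_eq[OF p]) (simp only: mult.commute)
  also have "\<dots> = (1 + \<bar>a\<bar>)\<^sup>2 * (2 * (1 + 1 / b)) * (1 + \<bar>real_of_int n\<bar>) powr (- 2)"
    by (simp add: powr_minus powr_numeral divide_inverse)
  finally show ?thesis by (simp add: u_def)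
qed

lemma gaussian_summable_on:
  assumes "b > 0"
  shows "(\<lambda>n::int. exp (- b * (real_of_int n + a)\<^sup>2)) summable_on UNIV"
proof (rule summable_on_comparison_test)
  show "(\<lambda>n::int. (1 + \<bar>a\<bar>)\<^sup>2 * (2 * (1 + 1 / b)) * (1 + \<bar>real_of_int n\<bar>) powr (- 2)) summable_on UNIV"
    by (intro summable_on_cmult_right summable_on_int_powr) auto
qed (use gaussian_le_powr[OF assms] in auto)

text \<open>The half-open ranges index the unit intervals that tile \<open>{- N..N}\<close>, the
  closed ones the symmetric partial sums of a Fourier series.\<close>

lemma filterlim_int_intervals:
  "filterlim (\<lambda>N. {- int N..<int N}) (finite_subsets_at_top UNIV) sequentially"
  "filterlim (\<lambda>N. {- int N..int N}) (finite_subsets_at_top UNIV) sequentially"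
proof -
  have "\<forall>\<^sub>F N in sequentially. X \<subseteq> {- int N..<int N}" if "finite X" for X
  proof -
    define B where "B = Max (insert 0 (abs ` X))"
    have B: "\<bar>x\<bar> \<le> B" if "x \<in> X" for x
      unfolding B_def using that \<open>finite X\<close> by (intro Max_ge) auto
    show ?thesis
    proof (rule eventually_mono[OF eventually_gt_at_top[of "nat \<bar>B\<bar>"]], rule subsetI)
      fix N x assume "nat \<bar>B\<bar> < N" "x \<in> X"
      thus "x \<in> {- int N..<int N}" using B[of x] by auto
    qed
  qed
  note * = this
  show "filterlim (\<lambda>N. {- int N..<int N}) (finite_subsets_at_top UNIV) sequentially"
    unfolding filterlim_finite_subsets_at_top using * by (auto elim: eventually_mono)
  show "filterlim (\<lambda>N. {- int N..int N}) (finite_subsets_at_top UNIV) sequentially"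
    unfolding filterlim_finite_subsets_at_top using * by (fastforce elim: eventually_mono)
qed

text \<open>The periodised Gaussian \<open>F\<close> is entire, so
  \<open>periodic_fourier_at_0\<close> recovers \<open>F 0\<close> from its Fourier coefficients.
  Unfolding the sum over \<open>n\<close> against the unit interval turns the coefficient of index
  \<open>k\<close> into a Fourier integral over the whole line, which
  \<open>gaussian_fourier\<close> evaluates.\<close>

lemma poisson_gaussian:
  fixes t a :: real
  assumes t: "t > 0"
  shows "(\<Sum>\<^sub>\<infinity>n::int. complex_of_real (exp (- (pi * t) * (of_int n + a)\<^sup>2))) =
         of_real (t powr (-1/2)) * (\<Sum>\<^sub>\<infinity>k::int. of_real (exp (- (pi / t) * (of_int k)\<^sup>2)) * exp (2 * of_real pi * \<i> * of_int k * of_real a))"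
proof -
  define b where "b = pi * t"
  have b: "b > 0" using t by (simp add: b_def)
  define f where "f = (\<lambda>n z. exp (- of_real b * (of_int n + of_real a + z)\<^sup>2 :: complex))"
  define F where "F = (\<lambda>z. \<Sum>\<^sub>\<infinity>n::int. f n z)"
  have fh: "f n holomorphic_on S" for n S unfolding f_def by (intro holomorphic_intros)
  have unif: "uniform_limit S (\<lambda>X z. \<Sum>n\<in>X. f n z) F (finite_subsets_at_top UNIV)"
    if S: "S \<subseteq> cball 0 r" "r \<ge> 0" for S r
    unfolding F_def
  proof (rule Weierstrass_m_test_general)
    fix n z assume z: "z \<in> S"
    hence nz: "\<bar>Re z\<bar> \<le> r" "\<bar>Im z\<bar> \<le> r"
      using S abs_Re_le_cmod[of z] abs_Im_le_cmod[of z] by (force simp: dist_norm)+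
    have "norm (f n z) = exp (- b * ((of_int n + (a + Re z))\<^sup>2 - (Im z)\<^sup>2))"
      by (simp add: f_def power2_eq_square algebra_simps)
    also have "\<dots> = exp (b * (Im z)\<^sup>2) * exp (- b * (of_int n + (a + Re z))\<^sup>2)" by (simp add: algebra_simps flip: exp_add)
    also have "\<dots> \<le> exp (b * r\<^sup>2) * ((1 + \<bar>a + Re z\<bar>)\<^sup>2 * (2 * (1 + 1 / b)) * (1 + \<bar>real_of_int n\<bar>) powr (- 2))"
    proof (intro mult_mono gaussian_le_powr b)
      have "(Im z)\<^sup>2 \<le> r\<^sup>2" using power_mono[OF nz(2), of 2] by simp
      thus "exp (b * (Im z)\<^sup>2) \<le> exp (b * r\<^sup>2)" using b by simp
    qed auto
    also have "\<dots> \<le> exp (b * r\<^sup>2) * ((1 + (\<bar>a\<bar> + r))\<^sup>2 * (2 * (1 + 1 / b)) * (1 + \<bar>real_of_int n\<bar>) powr (- 2))"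
      using nz b by (intro mult_left_mono mult_right_mono power_mono) auto
    finally show "norm (f n z) \<le> exp (b * r\<^sup>2) * ((1 + (\<bar>a\<bar> + r))\<^sup>2 * (2 * (1 + 1 / b)) * (1 + \<bar>real_of_int n\<bar>) powr (- 2))" .
  next
    show "(\<lambda>n. exp (b * r\<^sup>2) * ((1 + (\<bar>a\<bar> + r))\<^sup>2 * (2 * (1 + 1 / b)) * (1 + \<bar>real_of_int n\<bar>) powr (- 2))) summable_on UNIV"
      by (intro summable_on_cmult_right summable_on_int_powr) auto
  qed
  have Fh: "F holomorphic_on UNIV"
  proof (rule analytic_imp_holomorphic, subst analytic_on_analytic_at, safe)
    fix z :: complex
    have sub: "cball z 1 \<subseteq> cball 0 (norm z + 1)"
    proof
      fix w assume "w \<in> cball z 1"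
      thus "w \<in> cball 0 (norm z + 1)"
        using norm_triangle_sub[of w z] by (auto simp: dist_norm norm_minus_commute)
    qed
    have "F holomorphic_on ball z 1"
    proof (rule holomorphic_uniform_limit[OF _ unif[OF sub]])
      show "\<forall>\<^sub>F X in finite_subsets_at_top UNIV. continuous_on (cball z 1) (\<lambda>z. \<Sum>n\<in>X. f n z) \<and> (\<lambda>z. \<Sum>n\<in>X. f n z) holomorphic_on ball z 1"
        by (intro always_eventually allI conjI holomorphic_on_imp_continuous_on holomorphic_on_sum fh)
    qed auto
    thus "F analytic_on {z}" by (meson analytic_at centre_in_ball open_ball zero_less_one)
  qed
  have per: "F (z + 1) = F z" for z
  proof -
    have "F (z + 1) = (\<Sum>\<^sub>\<infinity>n::int. f (n + 1) z)" unfolding F_def f_def by (intro infsum_cong) (simp add: algebra_simps)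
    also have "\<dots> = F z" unfolding F_def
      by (rule infsum_reindex_bij_betw) (rule bij_betwI[of _ _ _ "\<lambda>n. n - 1"], auto)
    finally show ?thesis .
  qed
  have coeff: "fourier_coeff F k = of_real (t powr (-1/2)) * (of_real (exp (- (pi / t) * (of_int k)\<^sup>2)) * exp (2 * of_real pi * \<i> * of_int k * of_real a))" for k
  proof -
    define ek where "ek = (\<lambda>x. exp (- (2 * of_real pi * \<i> * of_int k * complex_of_real x)))"
    define u where "u = (\<lambda>x. f 0 (of_real x) * ek x)"
    have ek1: "norm (ek x) = 1" for x by (simp add: ek_def)
    have cek: "continuous_on S ek" for S unfolding ek_def by (intro continuous_intros)
    have cf: "continuous_on S (\<lambda>x. f n (complex_of_real x))" for S n unfolding f_def by (intro continuous_intros)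
    have cu: "continuous_on S u" for S unfolding u_def by (intro continuous_intros cf cek)
    have ul: "uniform_limit {0..1} (\<lambda>X x. (\<Sum>n\<in>X. f n (of_real x)) * ek x) (\<lambda>x. F (of_real x) * ek x) (finite_subsets_at_top UNIV)"
    proof (rule uniform_limitI)
      fix e :: real assume e: "e > 0"
      have "\<forall>\<^sub>F X in finite_subsets_at_top UNIV. \<forall>z\<in>cball 0 1. dist (\<Sum>n\<in>X. f n z) (F z) < e"
        using uniform_limitD[OF unif[of "cball 0 1" 1] e] by simp
      thus "\<forall>\<^sub>F X in finite_subsets_at_top UNIV. \<forall>x\<in>{0..1}. dist ((\<Sum>n\<in>X. f n (of_real x)) * ek x) (F (of_real x) * ek x) < e"
      proof eventually_elim
        case (elim X)
        show ?case
        proof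
          fix x :: real assume x: "x \<in> {0..1}"
          have "dist ((\<Sum>n\<in>X. f n (of_real x)) * ek x) (F (of_real x) * ek x) = dist (\<Sum>n\<in>X. f n (of_real x)) (F (of_real x))"
            by (simp add: dist_norm ek1 norm_mult flip: left_diff_distrib)
          thus "dist ((\<Sum>n\<in>X. f n (of_real x)) * ek x) (F (of_real x) * ek x) < e" using elim x by simp
        qed
      qed
    qed
    obtain I J where IJ: "\<And>X. ((\<lambda>x. (\<Sum>n\<in>X. f n (of_real x)) * ek x) has_integral I X) {0..1}"
        "((\<lambda>x. F (of_real x) * ek x) has_integral J) {0..1}" "(I \<longlongrightarrow> J) (finite_subsets_at_top UNIV)"
      by (rule uniform_limit_integral[OF ul]) (auto intro!: continuous_intros cf cek)
    have J: "J = fourier_coeff F k" using integral_unique[OF IJ(2)] by (simp add: fourier_coeff_def ek_def)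
    have fi: "integral {0..1} (\<lambda>x. f n (of_real x) * ek x) = integral {of_int n..of_int n + 1} u" for n
    proof -
      have "f n (of_real x) * ek x = u (of_int n + x)" for x
      proof -
        have "ek (of_int n + x) = ek x"
        proof -
          have "ek (of_int n + x) = exp (2 * of_real pi * \<i> * of_int (- k * n)) * ek x"
            by (simp add: ek_def algebra_simps flip: exp_add)
          thus ?thesis by (simp only: exp_2pi_int) simp
        qed
        thus ?thesis by (simp add: u_def f_def algebra_simps)
      qed
      hence "(\<lambda>x. f n (of_real x) * ek x) = u \<circ> (+) (of_int n)" by (auto simp: o_def)
      thus ?thesis using integral_shift_Icc_real[of 0 1 u "of_int n"] by (simp add: add.commute)
    qed
    have IX: "I X = (\<Sum>n\<in>X. integral {of_int n..of_int n + 1} u)" if "finite X" for X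
    proof -
      have "((\<lambda>x. \<Sum>n\<in>X. f n (of_real x) * ek x) has_integral (\<Sum>n\<in>X. integral {0..1} (\<lambda>x. f n (of_real x) * ek x))) {0..1}"
        using that by (intro has_integral_sum integrable_integral integrable_continuous_real continuous_intros cf cek)
      moreover have "(\<lambda>x. (\<Sum>n\<in>X. f n (of_real x)) * ek x) = (\<lambda>x. \<Sum>n\<in>X. f n (of_real x) * ek x)"
        by (simp only: sum_distrib_right)
      ultimately show ?thesis using IJ(1)[of X] unfolding fi by (auto intro: has_integral_unique)
    qed
    have IN: "I {- int N..<int N} = integral {- real N..real N} u" for N
    proof (induction N)
      case 0 show ?case by (simp add: IX)
    next
      case (Suc N)
      have "{- int (Suc N)..<int (Suc N)} = insert (- int N - 1) (insert (int N) {- int N..<int N})" by auto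
      hence "I {- int (Suc N)..<int (Suc N)} = integral {- real N - 1..- real N} u + (integral {real N..real N + 1} u + integral {- real N..real N} u)"
        using Suc by (simp add: IX)
      also have "\<dots> = integral {- real N - 1..- real N} u + (integral {- real N..real N} u + integral {real N..real N + 1} u)" by simp
      also have "integral {- real N..real N} u + integral {real N..real N + 1} u = integral {- real N..real N + 1} u"
        by (rule Henstock_Kurzweil_Integration.integral_combine) (auto intro!: integrable_continuous_real cu)
      also have "integral {- real N - 1..- real N} u + integral {- real N..real N + 1} u = integral {- real N - 1..real N + 1} u"
        by (rule Henstock_Kurzweil_Integration.integral_combine) (auto intro!: integrable_continuous_real cu)
      finally have "I {- int (Suc N)..<int (Suc N)} = integral {- real N - 1..real N + 1} u" .
      moreover have "- real (Suc N) = - real N - 1" "real (Suc N) = real N + 1" by simp_all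
      ultimately show ?case by (simp only:)
    qed
    have l1: "(\<lambda>N. integral {- real N..real N} u) \<longlonglongrightarrow> fourier_coeff F k"
      using filterlim_compose[OF IJ(3) filterlim_int_intervals(1)] unfolding IN J .
    have ub: "norm (u x) \<le> exp (\<bar>a\<bar> + 1 / (4 * b)) * exp (- 1 * \<bar>x\<bar>)" for x
    proof -
      \<comment> \<open>Expanding this square trades the Gaussian for
        \<open>exp (- \<bar>x\<bar>)\<close>, the form of bound that
        \<open>integral_symmetric_interval_tendsto\<close> takes.\<close>
      have "0 \<le> (2 * b * \<bar>x + a\<bar> - 1)\<^sup>2" by simp
      hence "4 * b * \<bar>x + a\<bar> \<le> 4 * b\<^sup>2 * (x + a)\<^sup>2 + 1" by (simp add: power2_eq_square algebra_simps abs_mult_self_eq)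
      hence "\<bar>x + a\<bar> \<le> b * (x + a)\<^sup>2 + 1 / (4 * b)" using b by (simp add: field_simps power2_eq_square)
      moreover have "\<bar>x\<bar> \<le> \<bar>x + a\<bar> + \<bar>a\<bar>" by simp
      ultimately have "- b * (x + a)\<^sup>2 \<le> \<bar>a\<bar> + 1 / (4 * b) + - 1 * \<bar>x\<bar>" by simp
      hence "exp (- b * (x + a)\<^sup>2) \<le> exp (\<bar>a\<bar> + 1 / (4 * b) + - 1 * \<bar>x\<bar>)" by (simp only: exp_le_cancel_iff)
      moreover have "norm (u x) = exp (- b * (x + a)\<^sup>2)"
        by (simp add: u_def f_def norm_mult ek1 power2_eq_square algebra_simps)
      ultimately show ?thesis by (simp only: exp_add)
    qed
    have "((\<lambda>T. integral {-T..T} u) \<longlongrightarrow> (LINT x|lborel. u x)) at_top"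
      by (rule integral_symmetric_interval_tendsto[OF cu _ ub]) simp
    hence l2: "(\<lambda>N. integral {- real N..real N} u) \<longlonglongrightarrow> (LINT x|lborel. u x)"
      by (rule filterlim_compose) (rule filterlim_real_sequentially)
    have "fourier_coeff F k = (LINT x|lborel. u x)" by (rule LIMSEQ_unique[OF l1 l2])
    also have "\<dots> = (LINT x|lborel. u (- a + 1 * x))" by (subst lborel_integral_real_affine[where c = 1 and t = "- a"]) auto
    also have "\<dots> = (LINT x|lborel. exp (2 * of_real pi * \<i> * of_int k * of_real a) * (of_real (exp (- pi * t * x\<^sup>2)) * exp (\<i> * of_real ((- 2 * pi * of_int k) * x))))"
    proof (intro Bochner_Integration.integral_cong refl)
      fix x
      have "ek (- a + 1 * x) = exp (2 * of_real pi * \<i> * of_int k * of_real a) * exp (\<i> * of_real ((- 2 * pi * of_int k) * x))"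
        by (simp add: ek_def algebra_simps flip: exp_add)
      moreover have "f 0 (of_real (- a + 1 * x)) = of_real (exp (- pi * t * x\<^sup>2))"
        by (simp add: f_def b_def flip: exp_of_real)
      ultimately show "u (- a + 1 * x) = exp (2 * of_real pi * \<i> * of_int k * of_real a) * (of_real (exp (- pi * t * x\<^sup>2)) * exp (\<i> * of_real ((- 2 * pi * of_int k) * x)))"
        by (simp only: u_def mult.left_commute)
    qed
    also have "\<dots> = exp (2 * of_real pi * \<i> * of_int k * of_real a) * of_real (t powr (-1/2) * exp (- (- 2 * pi * of_int k)\<^sup>2 / (4 * pi * t)))"
      by (simp only: integral_mult_right_zero gaussian_fourier(1)[OF t])
    also have "- (- 2 * pi * of_int k)\<^sup>2 / (4 * pi * t) = - (pi / t) * (of_int k)\<^sup>2"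
      using t by (simp add: power2_eq_square field_simps)
    finally show ?thesis by (simp add: mult_ac)
  qed
  have "(\<lambda>k. norm (of_real (exp (- (pi / t) * (of_int k)\<^sup>2)) * exp (2 * of_real pi * \<i> * of_int k * complex_of_real a))) summable_on UNIV"
    using gaussian_summable_on[of "pi / t" 0] t by (simp add: norm_mult)
  hence "(\<lambda>k. fourier_coeff F k) summable_on UNIV"
    unfolding coeff by (intro summable_on_cmult_right) (rule abs_summable_summable)
  hence "((\<lambda>X. \<Sum>k\<in>X. fourier_coeff F k) \<longlongrightarrow> (\<Sum>\<^sub>\<infinity>k. fourier_coeff F k)) (finite_subsets_at_top UNIV)"
    using has_sum_infsum unfolding has_sum_def by blast
  hence "(\<lambda>N. \<Sum>k\<in>{- int N..int N}. fourier_coeff F k) \<longlonglongrightarrow> (\<Sum>\<^sub>\<infinity>k. fourier_coeff F k)"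
    by (rule filterlim_compose) (rule filterlim_int_intervals)
  hence "F 0 = (\<Sum>\<^sub>\<infinity>k. fourier_coeff F k)"
    using periodic_fourier_at_0[OF Fh per] LIMSEQ_unique by blast
  moreover have "F 0 = (\<Sum>\<^sub>\<infinity>n::int. complex_of_real (exp (- (pi * t) * (of_int n + a)\<^sup>2)))"
    unfolding F_def by (intro infsum_cong) (simp add: f_def b_def flip: exp_of_real)
  ultimately show ?thesis unfolding coeff by (simp only: infsum_cmult_right')
qed

section \<open>Mellin transforms of theta series\<close>

lemma exp_ge_power_div_fact:
  assumes "x \<ge> (0::real)"
  shows "x ^ N / fact N \<le> exp x"
proof -
  have e: "(\<lambda>n. x ^ n /\<^sub>R fact n) sums exp x" by (rule exp_converges)
  have "sum (\<lambda>n. x ^ n /\<^sub>R fact n) {N} \<le> (\<Sum>n. x ^ n /\<^sub>R fact n)"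
    using assms by (intro sum_le_suminf sums_summable[OF e]) auto
  also have "\<dots> = exp x" using e by (rule sums_unique[symmetric])
  finally show ?thesis by (simp add: divide_inverse_commute)
qed

section \<open>The Gamma integral and a lower bound on vertical lines\<close>

lemma log_gamma:
  assumes s: "Re s > 0"
  shows "integrable lborel (\<lambda>t. exp (s * of_real t) * exp (- of_real (exp t)))"
    "(LINT t|lborel. exp (s * of_real t) * exp (- of_real (exp t))) = Gamma s"
proof -
  define F where "F = (\<lambda>x::real. complex_of_real x powr s * exp (- of_real x))"
  have Fe: "F (exp t) = exp (s * of_real t) * exp (- of_real (exp t))" for t
    by (simp add: F_def powr_def Ln_of_real)
  obtain N :: nat where N: "real N \<ge> Re s + 1" using real_arch_simple by blast
  define \<delta> where "\<delta> = min 1 (Re s)"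
  have \<delta>: "\<delta> > 0" "\<delta> \<le> 1" "\<delta> \<le> Re s" using s by (auto simp: \<delta>_def)
  have bd: "norm (F (exp t)) \<le> fact N * exp (- \<delta> * \<bar>t\<bar>)" for t
  proof (cases "t \<ge> 0")
    case True
    have "(exp t) ^ N / fact N \<le> exp (exp t)" by (rule exp_ge_power_div_fact) simp
    moreover have "exp (real N * t) = exp t ^ N" by (rule exp_of_nat_mult)
    ultimately have "exp (real N * t) \<le> fact N * exp (exp t)" by (simp add: field_simps)
    hence "exp (- exp t) \<le> fact N * exp (- real N * t)" by (simp add: exp_minus field_simps)
    hence "exp (Re s * t) * exp (- exp t) \<le> exp (Re s * t) * (fact N * exp (- real N * t))" by (rule mult_left_mono) simp
    also have "\<dots> = fact N * exp ((Re s - real N) * t)" by (simp add: algebra_simps flip: exp_add)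
    also have "\<dots> \<le> fact N * exp (- \<delta> * \<bar>t\<bar>)"
    proof -
      have "(Re s - real N) * t \<le> (- \<delta>) * t" using True N \<delta> by (intro mult_right_mono) auto
      thus ?thesis using True by simp
    qed
    finally show ?thesis unfolding Fe norm_mult by simp
  next
    case False
    have "exp (Re s * t) * exp (- exp t) \<le> exp (Re s * t) * 1" by (intro mult_left_mono) auto
    also have "\<dots> \<le> 1 * exp (- \<delta> * \<bar>t\<bar>)"
    proof -
      have "Re s * t \<le> \<delta> * t" using False \<delta> by (intro mult_right_mono_neg) auto
      thus ?thesis using False by simp
    qed
    also have "\<dots> \<le> fact N * exp (- \<delta> * \<bar>t\<bar>)" by (intro mult_right_mono) auto
    finally show ?thesis unfolding Fe norm_mult by simp
  qed
  have int: "integrable lborel (\<lambda>t. F (exp t))"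
    by (rule integrable_exp_bound[OF _ \<delta>(1) bd]) (simp add: Fe)
  thus "integrable lborel (\<lambda>t. exp (s * of_real t) * exp (- of_real (exp t)))" by (simp only: Fe)
  have cont: "continuous_on {0<..} F" unfolding F_def by (auto intro!: continuous_intros)
  have "(LINT t|lborel. F (exp t)) = (LINT x:{0<..}|lborel. F x / of_real x)"
    by (rule log_substitution(2)[OF cont int, symmetric])
  also have "\<dots> = integral {0<..} (\<lambda>x. F x / of_real x)"
    by (rule set_borel_integral_eq_integral(2)) (rule log_substitution(1)[OF cont int])
  also have "\<dots> = integral {0<..} (\<lambda>t. of_real t powr (s - 1) / of_real (exp t))"
    by (intro Henstock_Kurzweil_Integration.integral_cong) (simp add: F_def powr_diff exp_minus field_simps exp_of_real flip: of_real_inverse)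
  also have "\<dots> = Gamma s" using Gamma_integral_complex'[OF s] by (rule integral_unique)
  finally show "(LINT t|lborel. exp (s * of_real t) * exp (- of_real (exp t))) = Gamma s" by (simp only: Fe)
qed

lemma log_gamma_scaled:
  assumes s: "Re s > 0" and l: "l > 0"
  shows "integrable lborel (\<lambda>t. exp (s * of_real t) * exp (- of_real (l * exp t)))"
    "(LINT t|lborel. exp (s * of_real t) * exp (- of_real (l * exp t))) = of_real l powr (- s) * Gamma s"
proof -
  define f where "f = (\<lambda>t. exp (s * of_real t) * exp (- complex_of_real (l * exp t)))"
  have e: "f (- ln l + 1 * t) = of_real l powr (- s) * (exp (s * of_real t) * exp (- of_real (exp t)))" for t
  proof -
    have "exp (s * of_real (- ln l + 1 * t)) = of_real l powr (- s) * exp (s * of_real t)"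
      using l by (simp add: powr_def Ln_of_real algebra_simps flip: exp_add)
    moreover have "l * exp (- ln l + 1 * t) = exp t" using l by (simp add: exp_diff)
    ultimately show ?thesis by (simp only: f_def mult.assoc)
  qed
  have "integrable lborel (\<lambda>t. f (- ln l + 1 * t))"
    unfolding e by (intro integrable_mult_right log_gamma(1)[OF s])
  thus "integrable lborel f"
    using lborel_integrable_real_affine_iff[of 1 f "- ln l"] by simp
  have "(LINT t|lborel. f t) = (LINT t|lborel. f (- ln l + 1 * t))"
    using lborel_integral_real_affine[of 1 f "- ln l"] by simp
  also have "\<dots> = of_real l powr (- s) * Gamma s"
    unfolding e by (simp only: integral_mult_right_zero log_gamma(2)[OF s])
  finally show "(LINT t|lborel. f t) = of_real l powr (- s) * Gamma s" .
qed

text \<open>For real part 1 the reflection formula gives |Gamma (1 + it)|^2 = pi |t| / |sin (pi i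
  t)|, and |sin (pi i t)| is at most pi |t| exp (pi |t|). Raising the real part by 1 multiplies
  Gamma by a number of modulus at least 1. Integer abscissas suffice because the discs in
  \<open>quotient_decay\<close> may be centred on suitable lines arbitrarily far to the
  right.\<close>

lemma norm_Gamma_lower_bound:
  "norm (Gamma (Complex (real (Suc n)) t)) \<ge> exp (- (pi / 2) * \<bar>t\<bar>)"
proof (induction n)
  case 0
  show ?case
  proof (cases "t = 0")
    case False
    define s where "s = \<i> * complex_of_real t"
    have s1: "Complex (real (Suc 0)) t = s + 1" by (simp add: s_def complex_eq_iff)
    have nz: "s \<noteq> 0" using False by (simp add: s_def)
    have "Gamma (s + 1) = s * Gamma s"
      by (rule Gamma_plus1) (use False in \<open>auto simp: s_def nonpos_Ints_def complex_eq_iff\<close>)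
    moreover have "Gamma s * Gamma (1 - s) = of_real pi / sin (of_real pi * s)"
      by (rule Gamma_reflection_complex)
    moreover have "1 - s = cnj (s + 1)" by (simp add: s_def)
    hence "norm (Gamma (1 - s)) = norm (Gamma (s + 1))" by (simp only: cnj_Gamma[symmetric] complex_mod_cnj)
    moreover have "norm (Gamma s) * norm (Gamma (1 - s)) = pi / norm (sin (of_real pi * s))"
      using \<open>Gamma s * Gamma (1 - s) = of_real pi / sin (of_real pi * s)\<close>
      by (metis abs_of_nonneg norm_divide norm_mult norm_of_real pi_ge_zero)
    ultimately have sq: "(norm (Gamma (s + 1)))\<^sup>2 = norm s * pi / norm (sin (of_real pi * s))"
      by (simp only: power2_eq_square norm_mult) (simp add: mult.assoc)
    have ns: "norm s = \<bar>t\<bar>" by (simp add: s_def norm_mult)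
    have sinb: "norm (sin (of_real pi * s)) \<le> pi * \<bar>t\<bar> * exp (pi * \<bar>t\<bar>)"
    proof -
      have "sin (of_real pi * s) = (exp (\<i> * (of_real pi * s)) - exp (- (\<i> * (of_real pi * s)))) / (2 * \<i>)"
        by (rule sin_exp_eq)
      also have "\<i> * (of_real pi * s) = of_real (- (pi * t))" by (simp add: s_def complex_eq_iff)
      also have "(exp (of_real (- (pi * t))) - exp (- of_real (- (pi * t)))) / (2 * \<i>) = complex_of_real (exp (- (pi * t)) - exp (pi * t)) / (2 * \<i>)"
        by (simp only: of_real_minus[symmetric] exp_of_real minus_minus of_real_diff)
      finally have "norm (sin (of_real pi * s)) = \<bar>exp (- (pi * t)) - exp (pi * t)\<bar> / 2"
        by (simp only: norm_divide norm_of_real) (simp add: norm_mult)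
      moreover have "\<bar>exp (- y) - exp y\<bar> \<le> 2 * \<bar>y\<bar> * exp \<bar>y\<bar>" for y :: real
      proof -
        have 1: "exp \<bar>y\<bar> - exp (- \<bar>y\<bar>) = exp \<bar>y\<bar> * (1 - exp (- (2 * \<bar>y\<bar>)))"
          by (simp add: right_diff_distrib flip: exp_add)
        have "1 - exp (- (2 * \<bar>y\<bar>)) \<le> 2 * \<bar>y\<bar>" using exp_ge_add_one_self[of "- (2 * \<bar>y\<bar>)"] by linarith
        hence "exp \<bar>y\<bar> - exp (- \<bar>y\<bar>) \<le> exp \<bar>y\<bar> * (2 * \<bar>y\<bar>)" unfolding 1 by (intro mult_left_mono) auto
        moreover have "\<bar>exp (- y) - exp y\<bar> = exp \<bar>y\<bar> - exp (- \<bar>y\<bar>)" by (cases "y \<ge> 0") auto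
        ultimately show ?thesis by (simp add: mult_ac)
      qed
      from this[of "pi * t"] have "\<bar>exp (- (pi * t)) - exp (pi * t)\<bar> \<le> 2 * (pi * \<bar>t\<bar>) * exp (pi * \<bar>t\<bar>)"
        by (simp add: abs_mult)
      ultimately show ?thesis by simp
    qed
    have sin0: "norm (sin (of_real pi * s)) > 0"
    proof -
      have "Gamma (s + 1) \<noteq> 0" by (rule Gamma_nonzero) (auto simp: s_def nonpos_Ints_def complex_eq_iff)
      hence "norm s * pi / norm (sin (of_real pi * s)) \<noteq> 0" using sq by auto
      thus ?thesis by auto
    qed
    have "exp (- (pi * \<bar>t\<bar>)) = \<bar>t\<bar> * pi / (pi * \<bar>t\<bar> * exp (pi * \<bar>t\<bar>))" using False by (simp add: exp_minus field_simps)
    also have "\<dots> \<le> \<bar>t\<bar> * pi / norm (sin (of_real pi * s))"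
      using sinb sin0 False by (intro divide_left_mono mult_pos_pos) auto
    also have "\<dots> = (norm (Gamma (s + 1)))\<^sup>2" unfolding sq ns ..
    finally have "(exp (- (pi / 2) * \<bar>t\<bar>))\<^sup>2 \<le> (norm (Gamma (s + 1)))\<^sup>2"
      by (simp add: power2_eq_square flip: exp_add)
    thus ?thesis unfolding s1 by (rule power2_le_imp_le) simp
  next
    case True
    have "Complex (real (Suc 0)) t = 1" using True by (simp add: complex_eq_iff)
    thus ?thesis using True by simp
  qed
next
  case (Suc n)
  have e: "Complex (real (Suc (Suc n))) t = Complex (real (Suc n)) t + 1" by (simp add: complex_eq_iff)
  have "Gamma (Complex (real (Suc n)) t + 1) = Complex (real (Suc n)) t * Gamma (Complex (real (Suc n)) t)"
    by (rule Gamma_plus1) (auto simp: nonpos_Ints_def complex_eq_iff)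
  moreover have "1 \<le> norm (Complex (real (Suc n)) t)"
    using abs_Re_le_cmod[of "Complex (real (Suc n)) t"] by simp
  ultimately have "1 * norm (Gamma (Complex (real (Suc n)) t)) \<le> norm (Gamma (Complex (real (Suc (Suc n))) t))"
    unfolding e by (simp only: norm_mult) (intro mult_right_mono, auto)
  thus ?case using Suc by simp
qed

text \<open>With \<open>k = 1/2\<close>, \<open>A = 2\<close> and the numbers pi n^2 this is the
  Jacobi theta series; with \<open>k = 1\<close>, \<open>A = 1\<close> and pi times the values of a
  binary quadratic form it is the series behind \<open>E_hat\<close>. Both \<open>Z_Q\<close> and
  \<open>Z_Q_dual\<close> are built from the transforms of these two.\<close>

locale theta_series =
  fixes lam :: "nat \<Rightarrow> real" and k A :: real
  assumes lam_pos: "\<And>n. lam n > 0" and k_pos: "k > 0" and A_pos: "A > 0"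
    and lam_summable: "\<And>\<sigma>. \<sigma> > k \<Longrightarrow> summable (\<lambda>n. lam n powr (- \<sigma>))"
    and inversion: "\<And>x. x > 0 \<Longrightarrow>
      1 + A * (\<Sum>n. exp (- (lam n / x))) = x powr k * (1 + A * (\<Sum>n. exp (- (lam n * x))))"
begin

text \<open>Up to the sign (-1)^j this is the derivative of order \<open>j\<close> of the theta
  series without its constant term and without the factor \<open>A\<close>.\<close>

definition E :: "nat \<Rightarrow> complex \<Rightarrow> complex" where
  "E j z = (\<Sum>n. of_real (lam n) ^ j * exp (- (of_real (lam n) * z)))"

definition lser :: "real \<Rightarrow> real" where "lser \<sigma> = (\<Sum>n. lam n powr (- \<sigma>))"

definition D :: "complex \<Rightarrow> complex" where "D s = (\<Sum>n. of_real (lam n) powr (- s))"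

text \<open>From \<open>y ^ N / fact N \<le> exp y\<close> with \<open>N = M + j\<close>: the power
  \<open>j\<close> absorbs \<open>lam n ^ j\<close>, the power \<open>M\<close> leaves the term of a
  convergent series.\<close>

lemma term_norm_le:
  assumes x: "x > 0" "x \<le> Re z"
  shows "norm (of_real (lam n) ^ j * exp (- (of_real (lam n) * z))) \<le> fact (M + j) / x ^ (M + j) * lam n powr (- real M)"
proof -
  have l: "lam n > 0" by (rule lam_pos)
  have "norm (of_real (lam n) ^ j * exp (- (of_real (lam n) * z))) = lam n ^ j * exp (- (lam n * Re z))"
    using l by (simp add: norm_mult norm_power)
  also have "\<dots> \<le> lam n ^ j * exp (- (lam n * x))"
    using l x by (intro mult_left_mono) auto
  also have "\<dots> \<le> lam n ^ j * (fact (M + j) / (lam n * x) ^ (M + j))"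
  proof (intro mult_left_mono)
    have p: "(lam n * x) ^ (M + j) > 0" using l x by simp
    have "(lam n * x) ^ (M + j) / fact (M + j) \<le> exp (lam n * x)"
      by (rule exp_ge_power_div_fact) (use l x in auto)
    thus "exp (- (lam n * x)) \<le> fact (M + j) / (lam n * x) ^ (M + j)"
      using p by (simp add: exp_minus field_simps)
  qed (use l in auto)
  also have "\<dots> = fact (M + j) / x ^ (M + j) * lam n powr (- real M)"
    using l by (simp add: power_mult_distrib power_add powr_minus powr_realpow field_simps)
  finally show ?thesis .
qed

lemma summable_lam_nat: "\<exists>M::nat. real M > k \<and> real M \<ge> b \<and> summable (\<lambda>n. lam n powr (- real M))"
proof -
  obtain M :: nat where "real M > max k b" using reals_Archimedean2 by blast
  thus ?thesis using lam_summable[of "real M"] by (intro exI[of _ M]) auto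
qed

lemma E_summable:
  assumes "Re z > 0"
  shows "summable (\<lambda>n. norm (of_real (lam n) ^ j * exp (- (of_real (lam n) * z))))"
proof -
  obtain M :: nat where M: "summable (\<lambda>n. lam n powr (- real M))" using summable_lam_nat by blast
  show ?thesis
    by (rule summable_comparison_test'[of "\<lambda>n. fact (M + j) / Re z ^ (M + j) * lam n powr (- real M)" 0])
       (use term_norm_le[of "Re z" z] assms M in \<open>auto intro: summable_mult\<close>)
qed

lemma norm_E_le:
  assumes "x > 0" "x \<le> Re z" and M: "real M > k"
  shows "norm (E j z) \<le> fact (M + j) / x ^ (M + j) * lser (real M)"
proof -
  have s: "summable (\<lambda>n. norm (of_real (lam n) ^ j * exp (- (of_real (lam n) * z))))"
    by (rule E_summable) (use assms in auto)
  have "norm (E j z) \<le> (\<Sum>n. norm (of_real (lam n) ^ j * exp (- (of_real (lam n) * z))))"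
    unfolding E_def by (rule summable_norm[OF s])
  also have "\<dots> \<le> (\<Sum>n. fact (M + j) / x ^ (M + j) * lam n powr (- real M))"
    by (intro suminf_le s summable_mult lam_summable M term_norm_le assms)
  also have "\<dots> = fact (M + j) / x ^ (M + j) * lser (real M)"
    unfolding lser_def by (intro suminf_mult lam_summable M)
  finally show ?thesis .
qed

lemma E_deriv:
  assumes z: "Re z > 0"
  shows "(E j has_field_derivative - E (Suc j) z) (at z)"
proof -
  define S where "S = {w. Re w > Re z / 2}"
  have opS: "open S" unfolding S_def by (rule open_halfspace_Re_gt)
  obtain M :: nat where M: "summable (\<lambda>n. lam n powr (- real M))" using summable_lam_nat by blast
  have "((\<lambda>w. \<Sum>n. of_real (lam n) ^ j * exp (- (of_real (lam n) * w))) has_field_derivative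
      (\<Sum>n. - (of_real (lam n) ^ Suc j * exp (- (of_real (lam n) * z))))) (at z)"
  proof (rule has_field_derivative_series'(2)[where S = S and ?x0.0 = z and f' = "\<lambda>n w. - (of_real (lam n) ^ Suc j * exp (- (of_real (lam n) * w)))"])
    show "convex S" unfolding S_def by (rule convex_halfspace_Re_gt)
    show "uniformly_convergent_on S (\<lambda>n x. \<Sum>i<n. - (of_real (lam i) ^ Suc j * exp (- (of_real (lam i) * x))))"
    proof (rule Weierstrass_m_test')
      show "summable (\<lambda>n. fact (M + Suc j) / (Re z / 2) ^ (M + Suc j) * lam n powr (- real M))" by (rule summable_mult[OF M])
      fix n w assume "w \<in> S"
      thus "norm (- (of_real (lam n) ^ Suc j * exp (- (of_real (lam n) * w)))) \<le> fact (M + Suc j) / (Re z / 2) ^ (M + Suc j) * lam n powr (- real M)"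
        unfolding norm_minus_cancel using z by (intro term_norm_le) (auto simp: S_def)
    qed
    show "((\<lambda>w. of_real (lam n) ^ j * exp (- (of_real (lam n) * w))) has_field_derivative - (of_real (lam n) ^ Suc j * exp (- (of_real (lam n) * w)))) (at w within S)" for n w
      by (auto intro!: derivative_eq_intros)
    show "summable (\<lambda>n. of_real (lam n) ^ j * exp (- (of_real (lam n) * z)))"
      by (rule summable_norm_cancel[OF E_summable[OF z]])
    show "z \<in> S" "z \<in> interior S" using z opS by (auto simp: S_def interior_open)
  qed
  moreover have "(\<Sum>n. - (of_real (lam n) ^ Suc j * exp (- (of_real (lam n) * z)))) = - E (Suc j) z"
    unfolding E_def by (rule suminf_minus[OF summable_norm_cancel[OF E_summable[OF z]]])
  ultimately show ?thesis by (simp add: E_def[abs_def])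
qed

text \<open>
  In the coordinate \<open>x = exp w\<close> the operator \<open>d\<^sup>2/dw\<^sup>2 + k d/dw\<close> kills the two terms \<open>1\<close> and \<open>exp (- k w)\<close> that keep
  the theta series \<open>T\<close> from decaying; on the transform it is multiplication by \<open>s (s - k)\<close>.
\<close>
definition T :: "complex \<Rightarrow> complex" where "T w = 1 + of_real A * E 0 (exp w)"
definition T1 :: "complex \<Rightarrow> complex" where "T1 w = - of_real A * (exp w * E 1 (exp w))"
definition T2 :: "complex \<Rightarrow> complex" where "T2 w = of_real A * ((exp w)\<^sup>2 * E 2 (exp w) - exp w * E 1 (exp w))"
definition u :: "complex \<Rightarrow> complex" where "u w = T2 w + of_real k * T1 w"

lemma strip_Re_exp_pos: "\<bar>Im w\<bar> < pi / 2 \<Longrightarrow> Re (exp w) > 0"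
  by (simp add: Re_exp cos_gt_zero_pi)

lemma T_deriv: "\<bar>Im w\<bar> < pi / 2 \<Longrightarrow> (T has_field_derivative T1 w) (at w)"
  and T1_deriv: "\<bar>Im w\<bar> < pi / 2 \<Longrightarrow> (T1 has_field_derivative T2 w) (at w)"
proof -
  assume w: "\<bar>Im w\<bar> < pi / 2"
  have E: "((\<lambda>w. E j (exp w)) has_field_derivative - E (Suc j) (exp w) * exp w) (at w)" for j
    by (rule DERIV_chain2[where f = "E j" and g = exp, OF E_deriv[OF strip_Re_exp_pos[OF w]] DERIV_exp])
  show "(T has_field_derivative T1 w) (at w)"
    unfolding T_def[abs_def] T1_def by (rule derivative_eq_intros E refl | simp)+
  show "(T1 has_field_derivative T2 w) (at w)"
    unfolding T1_def[abs_def] T2_def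
    by (rule derivative_eq_intros E refl | simp)+ (simp add: power2_eq_square numeral_2_eq_2 algebra_simps)
qed

lemma T_holomorphic: "T holomorphic_on {w. \<bar>Im w\<bar> < pi / 2}"
  unfolding holomorphic_on_open[OF open_Im_strip] using T_deriv by blast

lemma E_deriv_holomorphic: "E j holomorphic_on {z. Re z > 0}"
  unfolding holomorphic_on_open[OF open_halfspace_Re_gt] using E_deriv by blast

lemma u_holomorphic: "u holomorphic_on {w. \<bar>Im w\<bar> < pi / 2}"
proof -
  have "E j \<circ> exp holomorphic_on {w. \<bar>Im w\<bar> < pi / 2}" for j
    by (rule holomorphic_on_compose_gen[OF _ E_deriv_holomorphic]) (use strip_Re_exp_pos in \<open>auto intro!: holomorphic_intros\<close>)
  hence "(\<lambda>w. E j (exp w)) holomorphic_on {w. \<bar>Im w\<bar> < pi / 2}" for j by (simp add: o_def)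
  thus ?thesis unfolding u_def[abs_def] T1_def T2_def by (intro holomorphic_intros)
qed

lemma E_of_real: "x > 0 \<Longrightarrow> E 0 (of_real x) = of_real (\<Sum>n. exp (- (lam n * x)))"
  unfolding E_def using summable_norm[OF E_summable[of "of_real x" 0]] E_summable[of "of_real x" 0]
  by (subst suminf_of_real) (simp_all flip: exp_of_real)

text \<open>The assumption \<open>inversion\<close> is the case of real \<open>w\<close>. The
  identity theorem carries it to the strip, where its consequence for \<open>u\<close> transports
  bounds from \<open>Re w \<ge> 0\<close> to \<open>Re w < 0\<close>.\<close>

lemma T_inversion:
  assumes w: "\<bar>Im w\<bar> < pi / 2"
  shows "T (- w) = exp (of_real k * w) * T w"
proof -
  have "T (- w) - exp (of_real k * w) * T w = 0"
  proof (rule analytic_continuation[of "\<lambda>w. T (- w) - exp (of_real k * w) * T w" "{w. \<bar>Im w\<bar> < pi / 2}" "range complex_of_real" 0])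
    have "T \<circ> uminus holomorphic_on {w. \<bar>Im w\<bar> < pi / 2}"
      by (rule holomorphic_on_compose_gen[OF _ T_holomorphic]) (auto intro!: holomorphic_intros)
    thus "(\<lambda>w. T (- w) - exp (of_real k * w) * T w) holomorphic_on {w. \<bar>Im w\<bar> < pi / 2}"
      unfolding o_def by (intro holomorphic_intros T_holomorphic)
    show "open {w. \<bar>Im w\<bar> < pi / 2}" by (rule open_Im_strip)
    have "{w. \<bar>Im w\<bar> < pi / 2} = {w. Im w < pi / 2} \<inter> {w. Im w > - (pi / 2)}" by auto
    thus "connected {w. \<bar>Im w\<bar> < pi / 2}"
      by (simp only:) (intro convex_connected convex_Int convex_halfspace_Im_lt convex_halfspace_Im_gt)
    show "(0::complex) islimpt range complex_of_real"
    proof (rule islimptI)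
      fix U :: "complex set" assume "0 \<in> U" "open U"
      then obtain e where e: "e > 0" "ball 0 e \<subseteq> U" using open_contains_ball by blast
      have "complex_of_real (e / 2) \<in> ball 0 e" using e by (simp add: norm_divide)
      thus "\<exists>y\<in>range complex_of_real. y \<in> U \<and> y \<noteq> 0" using e by (intro bexI[of _ "complex_of_real (e / 2)"] conjI rangeI) auto
    qed
    fix z assume "z \<in> range complex_of_real"
    then obtain r where r: "z = of_real r" by blast
    have x: "exp r > 0" by simp
    have e1: "T (of_real r) = of_real (1 + A * (\<Sum>n. exp (- (lam n * exp r))))"
      using E_of_real[OF x] by (simp add: T_def exp_of_real)
    have e2: "T (- of_real r) = of_real (1 + A * (\<Sum>n. exp (- (lam n / exp r))))"
      using E_of_real[of "exp (- r)"] by (simp add: T_def exp_of_real exp_minus divide_inverse flip: of_real_minus)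
    have "exp r powr k = exp (k * r)" by (simp add: powr_def)
    hence "exp (of_real k * of_real r) = complex_of_real (exp r powr k)" by (simp flip: exp_of_real)
    thus "T (- z) - exp (of_real k * z) * T z = 0"
      unfolding r e1 e2 inversion[OF x] by simp
  qed (use w in auto)
  thus ?thesis by simp
qed

text \<open>By \<open>T_inversion\<close>, differentiated twice, \<open>T2 (- w)\<close> is
  \<open>exp (k * w)\<close> times \<open>k\<^sup>2 * T + 2 * k * T1 + T2\<close>. Adding
  \<open>k * T1 (- w)\<close> cancels the term with \<open>k\<^sup>2\<close> and reduces
  \<open>2 * k\<close> to \<open>k\<close>, so \<open>u\<close> inherits the twist.\<close>

lemma u_inversion:
  assumes w: "\<bar>Im w\<bar> < pi / 2"
  shows "u (- w) = exp (of_real k * w) * u w"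
proof -
  have op: "open {w. \<bar>Im w\<bar> < pi / 2}" by (rule open_Im_strip)
  have m: "((uminus :: complex \<Rightarrow> complex) has_field_derivative - 1) (at w)" for w by (auto intro!: derivative_eq_intros)
  have d1: "- T1 (- w) = exp (of_real k * w) * (of_real k * T w + T1 w)" if w: "\<bar>Im w\<bar> < pi / 2" for w
  proof (rule DERIV_unique)
    have "(T has_field_derivative T1 (- w)) (at (- w))" by (rule T_deriv) (use w in auto)
    from DERIV_chain2[where f = T and g = uminus, OF this m]
    show "((\<lambda>w. T (- w)) has_field_derivative - T1 (- w)) (at w)" by simp
    have "((\<lambda>w. exp (of_real k * w) * T w) has_field_derivative exp (of_real k * w) * (of_real k * T w + T1 w)) (at w)"
      by (rule derivative_eq_intros T_deriv[OF w] refl | simp)+ (simp add: algebra_simps)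
    thus "((\<lambda>w. T (- w)) has_field_derivative exp (of_real k * w) * (of_real k * T w + T1 w)) (at w)"
      by (rule has_field_derivative_transform_within_open[OF _ op]) (use w T_inversion in auto)
  qed
  have d2: "- (- T2 (- w)) = exp (of_real k * w) * (of_real k * (of_real k * T w + T1 w) + (of_real k * T1 w + T2 w))"
  proof (rule DERIV_unique)
    have "(T1 has_field_derivative T2 (- w)) (at (- w))" by (rule T1_deriv) (use w in auto)
    from DERIV_minus[OF DERIV_chain2[where f = T1 and g = uminus, OF this m]]
    show "((\<lambda>w. - T1 (- w)) has_field_derivative - (- T2 (- w))) (at w)" by simp
    have "((\<lambda>w. exp (of_real k * w) * (of_real k * T w + T1 w)) has_field_derivative
        exp (of_real k * w) * (of_real k * (of_real k * T w + T1 w) + (of_real k * T1 w + T2 w))) (at w)"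
      by (rule derivative_eq_intros T_deriv[OF w] T1_deriv[OF w] refl | simp)+ (simp add: algebra_simps)
    thus "((\<lambda>w. - T1 (- w)) has_field_derivative
        exp (of_real k * w) * (of_real k * (of_real k * T w + T1 w) + (of_real k * T1 w + T2 w))) (at w)"
      by (rule has_field_derivative_transform_within_open[OF _ op]) (use w d1 in auto)
  qed
  have "u (- w) = T2 (- w) + of_real k * (- (- T1 (- w)))" by (simp add: u_def)
  also have "\<dots> = exp (of_real k * w) * u w"
    unfolding d1[OF w] using d2 by (simp add: u_def algebra_simps)
  finally show ?thesis .
qed

lemma u_rapid: "rapid_on_strip (pi / 2) u"
  unfolding rapid_on_strip_def
proof (intro conjI allI impI u_holomorphic)
  fix \<beta> :: real and N :: nat assume \<beta>: "\<beta> < pi / 2"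
  \<comment> \<open>\<open>M \<ge> N + k\<close> because passing from \<open>w\<close> to
    \<open>- w\<close> costs a factor \<open>exp (k * \<bar>Re w\<bar>)\<close>.\<close>
  obtain M :: nat where M: "real M > k" "real M \<ge> real N + k" using summable_lam_nat by blast
  \<comment> \<open>\<open>Re (exp w)\<close> is at least \<open>q\<close> times
    \<open>exp (Re w)\<close>, and this is positive as long as the strip stays inside |Im w| < pi /
    2. The maximum with 0 covers negative \<beta>.\<close>
  define q where "q = cos (max 0 \<beta>)"
  have q: "q > 0" unfolding q_def using \<beta> pi_gt_zero by (intro cos_gt_zero_pi) (simp_all only: max_def split: if_split, auto)
  define K where "K = (\<lambda>j. fact (M + j) / q ^ (M + j) * lser (real M))"
  define C where "C = A * (K 2 + (k + 1) * K 1)"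
  have lser0: "lser (real M) \<ge> 0" unfolding lser_def by (intro suminf_nonneg lam_summable M) auto
  have K0: "K j \<ge> 0" for j unfolding K_def using q lser0 by (intro mult_nonneg_nonneg) auto
  have C0: "C \<ge> 0" unfolding C_def using A_pos k_pos K0 by (intro mult_nonneg_nonneg add_nonneg_nonneg) auto
  have main: "norm (u w) \<le> C * exp (- real M * Re w)" if w: "\<bar>Im w\<bar> \<le> \<beta>" for w
  proof -
    have "cos (Im w) = cos \<bar>Im w\<bar>" by simp
    also have "\<dots> \<ge> q" unfolding q_def using w \<beta> by (intro cos_monotone_0_pi_le) auto
    finally have "Re (exp w) \<ge> exp (Re w) * q" by (simp add: Re_exp)
    hence Ej: "norm (E j (exp w)) \<le> fact (M + j) / (exp (Re w) * q) ^ (M + j) * lser (real M)" for j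
      using q M by (intro norm_E_le) auto
    have Ej': "norm ((exp w) ^ j * E j (exp w)) \<le> K j * exp (- real M * Re w)" for j
    proof -
      have "norm ((exp w) ^ j * E j (exp w)) \<le> exp (Re w) ^ j * (fact (M + j) / (exp (Re w) * q) ^ (M + j) * lser (real M))"
        unfolding norm_mult norm_power norm_exp_eq_Re by (intro mult_left_mono Ej) auto
      also have "\<dots> = K j * inverse (exp (Re w) ^ M)"
        by (simp add: K_def power_mult_distrib power_add field_simps)
      also have "inverse (exp (Re w) ^ M) = exp (- real M * Re w)"
        by (simp add: exp_of_nat_mult exp_minus)
      finally show ?thesis .
    qed
    have ue: "u w = of_real A * ((exp w) ^ 2 * E 2 (exp w) - of_real (k + 1) * ((exp w) ^ 1 * E 1 (exp w)))"
      by (simp add: u_def T1_def T2_def algebra_simps)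
    have "norm (u w) \<le> A * (norm ((exp w) ^ 2 * E 2 (exp w)) + (k + 1) * norm ((exp w) ^ 1 * E 1 (exp w)))"
      unfolding ue norm_mult[of "of_real A"] using A_pos k_pos
      by (intro mult_mono order_trans[OF norm_triangle_ineq4] add_mono) (auto simp: norm_mult simp del: of_real_add)
    also have "\<dots> \<le> A * (K 2 * exp (- real M * Re w) + (k + 1) * (K 1 * exp (- real M * Re w)))"
      using A_pos k_pos by (intro mult_left_mono add_mono Ej') auto
    also have "\<dots> = C * exp (- real M * Re w)" by (simp add: C_def algebra_simps)
    finally show ?thesis .
  qed
  have "norm (u w) \<le> C * exp (- real N * \<bar>Re w\<bar>)" if w: "\<bar>Im w\<bar> \<le> \<beta>" for w
  proof (cases "Re w \<ge> 0")
    case True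
    have "real N * Re w \<le> real M * Re w" using True M k_pos by (intro mult_right_mono) auto
    hence "C * exp (- real M * Re w) \<le> C * exp (- real N * \<bar>Re w\<bar>)" using True C0 by (intro mult_left_mono) auto
    thus ?thesis using main[OF w] by linarith
  next
    case False
    have "u w = exp (of_real k * - w) * u (- w)" using u_inversion[of "- w"] w \<beta> by simp
    hence "norm (u w) = exp (- (k * Re w)) * norm (u (- w))" by (simp add: norm_mult)
    also have "\<dots> \<le> exp (- (k * Re w)) * (C * exp (- real M * Re (- w)))"
      using w by (intro mult_left_mono main) auto
    also have "\<dots> = C * (exp (- (k * Re w)) * exp (- real M * Re (- w)))" by simp
    also have "exp (- (k * Re w)) * exp (- real M * Re (- w)) = exp ((real M - k) * Re w)"
      by (simp add: algebra_simps flip: exp_add)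
    also have "C * exp ((real M - k) * Re w) \<le> C * exp (- real N * \<bar>Re w\<bar>)"
    proof -
      have "(real M - k) * Re w \<le> real N * Re w" using False M by (intro mult_right_mono_neg) auto
      thus ?thesis using False C0 by (intro mult_left_mono) auto
    qed
    finally show ?thesis .
  qed
  thus "\<exists>C. \<forall>w. \<bar>Im w\<bar> \<le> \<beta> \<longrightarrow> norm (u w) \<le> C * exp (- real N * \<bar>Re w\<bar>)" by blast
qed

definition U :: "complex \<Rightarrow> complex" where "U = laplace (\<lambda>t. u (of_real t))"

lemma U_symmetric: "U (of_real k - s) = U s"
proof -
  have "U (of_real k - s) = (LINT t|lborel. u (of_real t) * exp ((of_real k - s) * of_real t))" by (simp add: U_def laplace_def)
  also have "\<dots> = (LINT t|lborel. u (- of_real t) * exp ((of_real k - s) * - of_real t))"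
    by (subst lborel_integral_real_affine[where c = "-1" and t = 0]) auto
  also have "\<dots> = (LINT t|lborel. u (of_real t) * exp (s * of_real t))"
  proof (intro Bochner_Integration.integral_cong refl)
    fix t
    have "u (- of_real t) * exp ((of_real k - s) * - of_real t) = u (of_real t) * (exp (of_real k * of_real t) * exp ((of_real k - s) * - of_real t))"
      using u_inversion[of "of_real t"] by simp
    also have "exp (of_real k * of_real t) * exp ((of_real k - s) * - of_real t) = exp (s * complex_of_real t)"
      by (simp add: algebra_simps flip: exp_add)
    finally show "u (- of_real t) * exp ((of_real k - s) * - of_real t) = u (of_real t) * exp (s * of_real t)" .
  qed
  finally show ?thesis by (simp add: U_def laplace_def)
qed

lemma mellin_E:
  assumes s: "Re s > k"
  shows "integrable lborel (\<lambda>t. (exp (of_real t)) ^ j * E j (exp (of_real t)) * exp (s * of_real t))"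
    "(LINT t|lborel. (exp (of_real t)) ^ j * E j (exp (of_real t)) * exp (s * of_real t)) = Gamma (s + of_nat j) * D s"
proof -
  define f where "f = (\<lambda>n t. of_real (lam n) ^ j * (exp ((s + of_nat j) * of_real t) * exp (- complex_of_real (lam n * exp t))))"
  have sj: "Re (s + of_nat j) > 0" using s k_pos by simp
  have fi: "integrable lborel (f n)" for n unfolding f_def by (intro integrable_mult_right log_gamma_scaled(1)[OF sj lam_pos])
  have fv: "integral\<^sup>L lborel (f n) = of_real (lam n) powr (- s) * Gamma (s + of_nat j)" for n
  proof -
    have l: "lam n > 0" by (rule lam_pos)
    have "integral\<^sup>L lborel (f n) = of_real (lam n) ^ j * (of_real (lam n) powr (- (s + of_nat j)) * Gamma (s + of_nat j))"
      unfolding f_def by (simp only: integral_mult_right_zero log_gamma_scaled(2)[OF sj l])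
    also have "of_real (lam n) powr (- (s + of_nat j)) = of_real (lam n) powr (- s) / of_real (lam n) ^ j"
      using l by (simp add: powr_diff powr_minus powr_add powr_nat' field_simps flip: powr_nat)
    finally show ?thesis using l by simp
  qed
  \<comment> \<open>The norm of \<open>f n t\<close> is the same expression with \<open>Re s\<close>
    in place of \<open>s\<close>, so its integral is again a Gamma value and the norms are summable
    for \<open>Re s > k\<close>.\<close>
  have nf: "(LINT t|lborel. norm (f n t)) = Re (Gamma (of_real (Re s) + of_nat j)) * lam n powr (- Re s)" for n
  proof -
    have l: "lam n > 0" by (rule lam_pos)
    have rj: "Re (of_real (Re s) + of_nat j) > 0" using s k_pos by simp
    have n: "complex_of_real (norm (f n t)) = of_real (lam n) ^ j * (exp ((of_real (Re s) + of_nat j) * of_real t) * exp (- complex_of_real (lam n * exp t)))" for t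
    proof -
      have "norm (f n t) = lam n ^ j * (exp ((Re s + real j) * t) * exp (- (lam n * exp t)))"
        using l by (simp add: f_def norm_mult norm_power)
      thus ?thesis by (simp flip: exp_of_real)
    qed
    have "complex_of_real (LINT t|lborel. norm (f n t)) = (LINT t|lborel. complex_of_real (norm (f n t)))" by simp
    also have "\<dots> = of_real (lam n) ^ j * (of_real (lam n) powr (- (of_real (Re s) + of_nat j)) * Gamma (of_real (Re s) + of_nat j))"
      unfolding n by (simp only: integral_mult_right_zero log_gamma_scaled(2)[OF rj l])
    also have "of_real (lam n) powr (- (of_real (Re s) + of_nat j)) = complex_of_real (lam n powr (- (Re s + real j)))"
      using l by (simp flip: powr_of_real)
    also have "lam n powr (- (Re s + real j)) = lam n powr (- Re s) / lam n ^ j"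
      using l by (simp add: powr_diff powr_minus powr_add powr_realpow field_simps)
    finally have "complex_of_real (LINT t|lborel. norm (f n t)) = of_real (lam n powr (- Re s)) * Gamma (of_real (Re s) + of_nat j)"
      using l by simp
    hence "Re (complex_of_real (LINT t|lborel. norm (f n t))) = Re (of_real (lam n powr (- Re s)) * Gamma (of_real (Re s) + of_nat j))" by (simp only:)
    thus ?thesis by simp
  qed
  have sumf: "(\<lambda>n. f n t) sums ((exp (of_real t)) ^ j * E j (exp (of_real t)) * exp (s * of_real t))"
    and sumn: "summable (\<lambda>n. norm (f n t))" for t
  proof -
    have fe: "f n t = (exp (of_real t)) ^ j * exp (s * of_real t) * (of_real (lam n) ^ j * exp (- (of_real (lam n) * exp (of_real t))))" for n
    proof -
      have "exp ((s + of_nat j) * of_real t) = exp (of_real t) ^ j * exp (s * complex_of_real t)"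
        by (simp only: distrib_right exp_add exp_of_nat_mult) (rule mult.commute)
      thus ?thesis by (simp add: f_def exp_of_real mult_ac)
    qed
    have r: "Re (exp (complex_of_real t)) > 0" by (simp add: Re_exp)
    have "(\<lambda>n. f n t) sums ((exp (of_real t)) ^ j * exp (s * of_real t) * E j (exp (of_real t)))"
      unfolding fe E_def by (intro sums_mult summable_sums summable_norm_cancel[OF E_summable[OF r]])
    thus "(\<lambda>n. f n t) sums ((exp (of_real t)) ^ j * E j (exp (of_real t)) * exp (s * of_real t))" by (simp only: mult_ac)
    show "summable (\<lambda>n. norm (f n t))"
      unfolding fe norm_mult[of "_ * _" "_ * _"] by (intro summable_mult E_summable[OF r])
  qed
  have se: "(\<lambda>t. \<Sum>n. f n t) = (\<lambda>t. (exp (of_real t)) ^ j * E j (exp (of_real t)) * exp (s * of_real t))"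
    by (rule ext, rule sums_unique[OF sumf, symmetric])
  have sm: "summable (\<lambda>n. LINT t|lborel. norm (f n t))" unfolding nf by (intro summable_mult lam_summable s)
  have AEs: "AE t in lborel. summable (\<lambda>n. norm (f n t))" using sumn by (intro AE_I2)
  show "integrable lborel (\<lambda>t. (exp (of_real t)) ^ j * E j (exp (of_real t)) * exp (s * of_real t))"
    using integrable_suminf[OF fi AEs sm] unfolding se .
  have "(\<lambda>n. integral\<^sup>L lborel (f n)) sums (LINT t|lborel. (exp (of_real t)) ^ j * E j (exp (of_real t)) * exp (s * of_real t))"
    using sums_integral[OF fi AEs sm] unfolding se .
  moreover have "summable (\<lambda>n. of_real (lam n) powr (- s) :: complex)"
  proof (rule summable_norm_cancel)
    show "summable (\<lambda>n. norm (of_real (lam n) powr (- s) :: complex))"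
      using lam_summable[OF s] lam_pos by (simp add: norm_powr_real_powr less_imp_le)
  qed
  hence "(\<lambda>n. of_real (lam n) powr (- s) * Gamma (s + of_nat j)) sums (D s * Gamma (s + of_nat j))"
    unfolding D_def by (intro sums_mult2 summable_sums)
  ultimately have "(LINT t|lborel. (exp (of_real t)) ^ j * E j (exp (of_real t)) * exp (s * of_real t)) = D s * Gamma (s + of_nat j)"
    unfolding fv by (rule sums_unique2)
  thus "(LINT t|lborel. (exp (of_real t)) ^ j * E j (exp (of_real t)) * exp (s * of_real t)) = Gamma (s + of_nat j) * D s"
    by (simp only: mult.commute[of "Gamma _"])
qed

text \<open>The combination that defines \<open>u\<close> acts on the Gamma factor through
  \<open>Gamma (s + 2) - (k + 1) * Gamma (s + 1) = s * (s - k) * Gamma s\<close>.\<close>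

lemma U_eq:
  assumes s: "Re s > k"
  shows "U s = of_real A * s * (s - of_real k) * Gamma s * D s"
proof -
  have ue: "u (of_real t) * exp (s * of_real t) = of_real A * ((exp (of_real t)) ^ 2 * E 2 (exp (of_real t)) * exp (s * of_real t)
     - of_real (k + 1) * ((exp (of_real t)) ^ 1 * E 1 (exp (of_real t)) * exp (s * of_real t)))" for t
    by (simp add: u_def T1_def T2_def algebra_simps)
  have "U s = of_real A * (Gamma (s + of_nat 2) * D s - of_real (k + 1) * (Gamma (s + of_nat 1) * D s))"
    unfolding U_def laplace_def ue
    by (simp only: integral_mult_right_zero Bochner_Integration.integral_diff[OF mellin_E(1)[OF s] integrable_mult_right[OF mellin_E(1)[OF s]]] mellin_E(2)[OF s])
  moreover have ns: "s \<notin> \<int>\<^sub>\<le>\<^sub>0" "s + 1 \<notin> \<int>\<^sub>\<le>\<^sub>0" using s k_pos by (auto elim!: nonpos_Ints_cases simp: complex_eq_iff)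
  have "Gamma (s + of_nat 1) = s * Gamma s" using Gamma_plus1[OF ns(1)] by simp
  moreover have "Gamma (s + of_nat 2) = (s + 1) * (s * Gamma s)"
    using Gamma_plus1[OF ns(2)] Gamma_plus1[OF ns(1)] by (simp add: add.assoc)
  ultimately show ?thesis by (simp add: algebra_simps)
qed

section \<open>Lower bounds and nonvanishing of the transform \<open>U\<close>\<close>

lemma finite_lam_le: "finite {n. lam n \<le> B}"
proof (cases "B > 0")
  case True
  obtain M :: nat where M: "real M > k" "summable (\<lambda>n. lam n powr (- real M))" using summable_lam_nat by blast
  have "(\<lambda>n. lam n powr (- real M)) \<longlonglongrightarrow> 0" by (rule summable_LIMSEQ_zero[OF M(2)])
  hence "eventually (\<lambda>n. lam n powr (- real M) < B powr (- real M)) sequentially"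
    by (rule order_tendstoD) (use True in auto)
  then obtain N where N: "\<And>n. n \<ge> N \<Longrightarrow> lam n powr (- real M) < B powr (- real M)"
    by (auto simp: eventually_sequentially)
  have "{n. lam n \<le> B} \<subseteq> {..<N}"
  proof
    fix n assume "n \<in> {n. lam n \<le> B}"
    hence "B powr (- real M) \<le> lam n powr (- real M)" using lam_pos[of n] by (intro powr_mono2') auto
    thus "n \<in> {..<N}" using N[of n] by force
  qed
  thus ?thesis by (rule finite_subset) simp
next
  case False
  hence "{n. lam n \<le> B} = {}" using lam_pos by (auto simp: not_le intro: order.strict_trans1[of B 0])
  thus ?thesis by simp
qed

text \<open>Far to the right the terms with the smallest value \<mu> of \<open>lam\<close> dominate.
  There are finitely many of them and they are all equal, so they add up without
  cancellation.\<close>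

lemma D_lower_bound: "\<exists>a0>k. \<forall>a\<ge>a0. \<exists>c>0. \<forall>t. c \<le> norm (D (Complex a t))"
proof -
  define F where "F = {n. lam n \<le> lam 0}"
  define \<mu> where "\<mu> = Min (lam ` F)"
  have F: "finite F" "0 \<in> F" unfolding F_def using finite_lam_le by auto
  have "\<mu> \<in> lam ` F" unfolding \<mu>_def using F by (intro Min_in) auto
  then obtain n0 where n0: "lam n0 = \<mu>" by auto
  have \<mu>0: "\<mu> > 0" using lam_pos[of n0] n0 by simp
  have min: "\<mu> \<le> lam n" for n
  proof (cases "n \<in> F")
    case True thus ?thesis unfolding \<mu>_def using F by (intro Min_le) auto
  next
    case False
    have "\<mu> \<le> lam 0" unfolding \<mu>_def using F by (intro Min_le) auto
    thus ?thesis using False by (auto simp: F_def)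
  qed
  define S where "S = {n. lam n = \<mu>}"
  have "finite S" unfolding S_def by (rule finite_subset[OF _ finite_lam_le[of \<mu>]]) auto
  hence S: "finite S" "n0 \<in> S" using n0 by (auto simp: S_def)
  \<comment> \<open>The next value of \<open>lam\<close> after \<mu>, cut off at \<mu> + 1. The
    cut-off makes the set finite, and inserting \<open>\<mu> + 1\<close> makes it nonempty.\<close>
  define \<nu> where "\<nu> = Min (insert (\<mu> + 1) (lam ` ({n. lam n \<le> \<mu> + 1} - S)))"
  have fin: "finite (insert (\<mu> + 1) (lam ` ({n. lam n \<le> \<mu> + 1} - S)))" using finite_lam_le[of "\<mu> + 1"] by auto
  have "\<nu> \<in> insert (\<mu> + 1) (lam ` ({n. lam n \<le> \<mu> + 1} - S))" unfolding \<nu>_def using fin by (intro Min_in) auto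
  hence \<nu>: "\<nu> > \<mu>" using min by (auto simp: S_def less_le)
  have \<nu>le: "\<nu> \<le> lam n" if "n \<notin> S" for n
  proof (cases "lam n \<le> \<mu> + 1")
    case True thus ?thesis unfolding \<nu>_def using fin that by (intro Min_le) auto
  next
    case False
    have "\<nu> \<le> \<mu> + 1" unfolding \<nu>_def using fin by (intro Min_le) auto
    thus ?thesis using False by simp
  qed
  define p where "p = k + 1"
  define L where "L = lser p"
  have lp: "summable (\<lambda>n. lam n powr (- p))" by (rule lam_summable) (simp add: p_def)
  have L0: "L \<ge> 0" unfolding L_def lser_def by (intro suminf_nonneg lp) auto
  have "((\<lambda>a. (\<mu> / \<nu>) powr a) \<longlongrightarrow> 0) at_top"
  proof -
    have "ln (\<mu> / \<nu>) < 0" using \<mu>0 \<nu> by simp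
    hence "((\<lambda>a. exp (a * ln (\<mu> / \<nu>))) \<longlongrightarrow> 0) at_top" by real_asymp
    thus ?thesis using \<mu>0 \<nu> by (simp add: powr_def)
  qed
  hence "((\<lambda>a. \<nu> powr p * L * (\<mu> / \<nu>) powr a) \<longlongrightarrow> 0) at_top" by (rule tendsto_mult_right_zero)
  hence "eventually (\<lambda>a. \<nu> powr p * L * (\<mu> / \<nu>) powr a < 1 / 2) at_top" by (rule order_tendstoD) simp
  then obtain a1 where a1: "\<And>a. a \<ge> a1 \<Longrightarrow> \<nu> powr p * L * (\<mu> / \<nu>) powr a < 1 / 2"
    by (auto simp: eventually_at_top_linorder)
  have main: "\<mu> powr (- a) / 2 \<le> norm (D (Complex a t))" if a: "a \<ge> max a1 p" for a t
  proof -
    define s where "s = Complex a t"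
    have nt: "norm (of_real (lam n) powr (- s) :: complex) = lam n powr (- a)" for n
      using lam_pos[of n] by (simp add: s_def norm_powr_real_powr)
    have sa: "summable (\<lambda>n. lam n powr (- a))" by (rule lam_summable) (use a in \<open>auto simp: p_def\<close>)
    define r where "r = (\<lambda>n. if n \<in> S then 0 else of_real (lam n) powr (- s) :: complex)"
    define h where "h = (\<lambda>n. if n \<in> S then of_real (lam n) powr (- s) else 0 :: complex)"
    have hs: "h sums (\<Sum>n\<in>S. of_real (lam n) powr (- s))" unfolding h_def by (rule sums_If_finite_set[OF S(1)])
    have rle: "norm (r n) \<le> \<nu> powr (p - a) * lam n powr (- p)" for n
    proof (cases "n \<in> S")
      case False
      have "lam n powr (- a) = lam n powr (p - a) * lam n powr (- p)" by (simp flip: powr_add)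
      also have "\<dots> \<le> \<nu> powr (p - a) * lam n powr (- p)"
        using \<nu>le[OF False] \<nu> \<mu>0 a by (intro mult_right_mono powr_mono2') auto
      finally show ?thesis using False by (simp add: r_def nt)
    qed (simp add: r_def)
    have rn: "summable (\<lambda>n. norm (r n))"
      by (rule summable_comparison_test'[OF summable_mult[OF lp], of 0]) (use rle in auto)
    have "D s = (\<Sum>n. h n + r n)" unfolding D_def h_def r_def by (intro suminf_cong) auto
    also have "\<dots> = (\<Sum>n. h n) + (\<Sum>n. r n)"
      by (rule suminf_add[symmetric, OF sums_summable[OF hs] summable_norm_cancel[OF rn]])
    also have "(\<Sum>n. h n) = (\<Sum>n\<in>S. of_real (lam n) powr (- s))" using hs by (rule sums_unique[symmetric])
    also have "\<dots> = of_nat (card S) * of_real \<mu> powr (- s)" by (simp add: S_def)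
    finally have De: "D s = of_nat (card S) * of_real \<mu> powr (- s) + (\<Sum>n. r n)" .
    have "norm (\<Sum>n. r n) \<le> (\<Sum>n. norm (r n))" by (rule summable_norm[OF rn])
    also have "\<dots> \<le> (\<Sum>n. \<nu> powr (p - a) * lam n powr (- p))" by (intro suminf_le rle rn summable_mult lp)
    also have "\<dots> = \<nu> powr (p - a) * L" unfolding L_def lser_def by (rule suminf_mult[OF lp])
    also have "\<dots> = \<mu> powr (- a) * (\<nu> powr p * L * (\<mu> / \<nu>) powr a)"
      using \<mu>0 \<nu> by (simp add: powr_diff powr_divide powr_minus field_simps)
    also have "\<dots> \<le> \<mu> powr (- a) * (1 / 2)" using a1[of a] a by (intro mult_left_mono) auto
    finally have rest: "norm (\<Sum>n. r n) \<le> \<mu> powr (- a) * (1 / 2)" .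
    have "card S \<ge> 1" using S by (metis One_nat_def Suc_leI card_gt_0_iff empty_iff)
    hence "1 * \<mu> powr (- a) \<le> real (card S) * \<mu> powr (- a)" by (intro mult_right_mono) auto
    also have "\<dots> = norm (of_nat (card S) * of_real \<mu> powr (- s) :: complex)"
      using \<mu>0 by (simp add: norm_mult s_def norm_powr_real_powr)
    also have "of_nat (card S) * of_real \<mu> powr (- s) = D s - (\<Sum>n. r n)" using De by simp
    also have "norm (D s - (\<Sum>n. r n)) \<le> norm (D s) + norm (\<Sum>n. r n)" by (rule norm_triangle_ineq4)
    finally show ?thesis using rest by (simp add: s_def)
  qed
  show ?thesis
  proof (rule exI[of _ "max a1 p"], intro conjI allI impI)
    show "max a1 p > k" by (simp add: p_def)
    fix a assume "max a1 p \<le> a"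
    thus "\<exists>c>0. \<forall>t. c \<le> norm (D (Complex a t))"
      using main \<mu>0 by (intro exI[of _ "\<mu> powr (- a) / 2"]) auto
  qed
qed

lemma U_lower_bound: "\<exists>a\<ge>a0. \<exists>c>0. \<forall>t. c * exp (- (pi / 2) * \<bar>t\<bar>) \<le> norm (U (Complex a t))"
proof -
  obtain a1 where a1: "a1 > k" "\<And>a. a \<ge> a1 \<Longrightarrow> \<exists>c>0. \<forall>t. c \<le> norm (D (Complex a t))" using D_lower_bound by blast
  obtain n :: nat where n: "real n > max a0 a1" using reals_Archimedean2 by blast
  \<comment> \<open>An integer abscissa, so that \<open>norm_Gamma_lower_bound\<close>
    applies.\<close>
  define a where "a = real (Suc n)"
  have a: "a \<ge> a0" "a \<ge> a1" "a > k" using n a1 by (auto simp: a_def)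
  obtain c where c: "c > 0" "\<And>t. c \<le> norm (D (Complex a t))" using a1(2)[OF a(2)] by blast
  have "A * a * (a - k) * c * exp (- (pi / 2) * \<bar>t\<bar>) \<le> norm (U (Complex a t))" for t
  proof -
    define s where "s = Complex a t"
    have "Re s \<le> norm s" "Re (s - of_real k) \<le> norm (s - of_real k)" by (rule complex_Re_le_cmod)+
    hence 1: "a \<le> norm s" "a - k \<le> norm (s - of_real k)" by (simp_all add: s_def)
    have "A * a * (a - k) * exp (- (pi / 2) * \<bar>t\<bar>) * c \<le> A * norm s * norm (s - of_real k) * norm (Gamma s) * norm (D s)"
      using 1 c norm_Gamma_lower_bound[of t n, folded a_def] a a1 A_pos k_pos
      unfolding s_def by (intro mult_mono mult_nonneg_nonneg) auto
    also have "\<dots> = norm (U s)" using U_eq[of s] a A_pos by (simp add: norm_mult s_def)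
    finally show ?thesis by (simp add: s_def mult_ac)
  qed
  moreover have "A * a * (a - k) * c > 0" using a k_pos A_pos c by (intro mult_pos_pos) auto
  ultimately show ?thesis using a(1) by blast
qed

lemma U_nonzero: "\<exists>B>0. \<forall>s. \<bar>Re s\<bar> \<ge> B \<longrightarrow> U s \<noteq> 0"
proof -
  obtain a1 where a1: "a1 > k" "\<And>a. a \<ge> a1 \<Longrightarrow> \<exists>c>0. \<forall>t. c \<le> norm (D (Complex a t))" using D_lower_bound by blast
  have nz: "U s \<noteq> 0" if s: "Re s \<ge> a1" for s
  proof -
    obtain c where "c > 0" "\<And>t. c \<le> norm (D (Complex (Re s) t))" using a1(2)[OF s] by blast
    from this(1) this(2)[of "Im s"] have "D s \<noteq> 0" by auto
    moreover have "Gamma s \<noteq> 0" by (rule Gamma_nonzero) (use s a1 k_pos in \<open>auto elim!: nonpos_Ints_cases\<close>)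
    moreover have "s \<noteq> 0" "s \<noteq> of_real k" using s a1 k_pos by auto
    ultimately show ?thesis using U_eq[of s] s a1 A_pos by auto
  qed
  have "U s \<noteq> 0" if s: "\<bar>Re s\<bar> \<ge> a1" for s
  proof (cases "Re s \<ge> 0")
    case True thus ?thesis using nz[of s] s by simp
  next
    case False
    hence "U (of_real k - s) \<noteq> 0" using s k_pos by (intro nz) auto
    thus ?thesis by (simp add: U_symmetric)
  qed
  thus ?thesis using a1 k_pos by (intro exI[of _ a1]) auto
qed

lemma U_holomorphic: "U holomorphic_on UNIV"
  unfolding U_def by (rule laplace_rapid_entire[OF u_rapid]) simp

lemma U_decay:
  assumes "0 \<le> \<beta>" "\<beta> < pi / 2"
  shows "\<exists>C\<ge>0. \<forall>s. \<bar>Re s\<bar> \<le> M \<longrightarrow> norm (U s) \<le> C * exp (- \<beta> * \<bar>Im s\<bar>)"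
  unfolding U_def by (rule laplace_rapid_decay[OF u_rapid assms])

text \<open>For \<open>x \<ge> 1\<close> the terms of \<open>u\<close> are positive multiples of
  \<open>lam n * x * (lam n * x - (k + 1))\<close>, hence positive under \<open>big\<close>; the
  range \<open>x < 1\<close> follows by \<open>u_inversion\<close>.\<close>

lemma u_positive:
  assumes big: "\<And>n. lam n > k + 1"
  shows "\<exists>v>0. u (of_real r) = of_real v"
proof -
  have pos: "\<exists>v>0. u (of_real r) = of_real v" if r: "r \<ge> 0" for r
  proof -
    define x where "x = exp r"
    have x: "x \<ge> 1" using r by (simp add: x_def)
    have "Re (of_real x :: complex) > 0" using x by simp
    note sE = E_summable[OF this]
    define g where "g = (\<lambda>n. x\<^sup>2 * (lam n ^ 2 * exp (- (lam n * x))) - (k + 1) * x * (lam n ^ 1 * exp (- (lam n * x))))"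
    have E: "(\<lambda>n. lam n ^ j * exp (- (lam n * x))) sums (\<Sum>n. lam n ^ j * exp (- (lam n * x)))"
        and Ev: "E j (of_real x) = of_real (\<Sum>n. lam n ^ j * exp (- (lam n * x)))" for j
    proof -
      have eq: "of_real (lam n) ^ j * exp (- (of_real (lam n) * of_real x)) = complex_of_real (lam n ^ j * exp (- (lam n * x)))" for n
        by (simp flip: exp_of_real)
      have s: "summable (\<lambda>n. lam n ^ j * exp (- (lam n * x)))"
      proof (rule summable_norm_cancel)
        show "summable (\<lambda>n. norm (lam n ^ j * exp (- (lam n * x))))"
          using sE[of j] unfolding eq norm_of_real by simp
      qed
      thus "(\<lambda>n. lam n ^ j * exp (- (lam n * x))) sums (\<Sum>n. lam n ^ j * exp (- (lam n * x)))" by (rule summable_sums)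
      show "E j (of_real x) = of_real (\<Sum>n. lam n ^ j * exp (- (lam n * x)))"
        unfolding E_def eq using s by (rule suminf_of_real[symmetric])
    qed
    have gs: "g sums (x\<^sup>2 * (\<Sum>n. lam n ^ 2 * exp (- (lam n * x))) - (k + 1) * x * (\<Sum>n. lam n ^ 1 * exp (- (lam n * x))))"
      unfolding g_def by (intro sums_diff sums_mult E)
    have gpos: "g n > 0" for n
    proof -
      have "lam n * x > k + 1" using big[of n] x k_pos lam_pos[of n]
        by (intro less_le_trans[OF big[of n]]) simp
      hence "lam n * x * exp (- (lam n * x)) * (lam n * x - (k + 1)) > 0"
        using x lam_pos[of n] by (intro mult_pos_pos) auto
      thus ?thesis by (simp add: g_def algebra_simps power2_eq_square)
    qed
    have "u (of_real r) = of_real A * ((of_real x)\<^sup>2 * E 2 (of_real x) - (of_real k + 1) * of_real x * E 1 (of_real x))"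
      by (simp add: u_def T1_def T2_def x_def exp_of_real algebra_simps)
    also have "\<dots> = of_real (A * suminf g)"
      unfolding Ev sums_unique[OF gs, symmetric] by simp
    finally have "u (of_real r) = of_real (A * suminf g)" .
    moreover have "suminf g > 0" by (rule suminf_pos[OF sums_summable[OF gs] gpos])
    ultimately show ?thesis using A_pos by (intro exI[of _ "A * suminf g"]) auto
  qed
  show ?thesis
  proof (cases "r \<ge> 0")
    case True thus ?thesis by (rule pos)
  next
    case False
    then obtain v where v: "v > 0" "u (of_real (- r)) = of_real v" using pos[of "- r"] by auto
    have "u (of_real r) = exp (of_real k * of_real (- r)) * u (of_real (- r))"
      using u_inversion[of "of_real (- r)"] by simp
    moreover have "exp (of_real k * of_real (- r)) = complex_of_real (exp (k * - r))" by (simp only: of_real_mult[symmetric] exp_of_real)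
    ultimately have "u (of_real r) = of_real (exp (k * - r) * v)" by (simp only: v of_real_mult)
    thus ?thesis using v by (intro exI[of _ "exp (k * - r) * v"]) auto
  qed
qed

lemma U_real_nonzero:
  assumes big: "\<And>n. lam n > k + 1"
  shows "U (of_real x) \<noteq> 0"
proof
  assume U0: "U (of_real x) = 0"
  obtain v where v: "\<And>r. v r > 0" "\<And>r. u (of_real r) = of_real (v r)" using u_positive[OF big] by metis
  define g where "g = (\<lambda>t. v t * exp (x * t))"
  have ge: "u (of_real t) * exp (of_real x * of_real t) = complex_of_real (g t)" for t
    by (simp add: g_def v flip: exp_of_real)
  have "integrable lborel (\<lambda>t. u (of_real t) * exp (of_real x * of_real t))"
    by (rule rapid_on_strip_integrable(1)[OF u_rapid]) simp
  hence gi: "integrable lborel g" unfolding ge by (drule_tac integrable_Re) simp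
  have "complex_of_real (integral\<^sup>L lborel g) = 0" using U0 unfolding U_def laplace_def ge by simp
  hence "integral\<^sup>L lborel g = 0" by simp
  moreover have "AE t in lborel. 0 \<le> g t" using v(1) by (simp add: g_def less_imp_le)
  ultimately have "AE t in lborel. g t = 0" using integral_nonneg_eq_0_iff_AE[OF gi] by simp
  hence "AE t in (lborel :: real measure). False" 
    by (rule eventually_mono) (metis v(1) g_def exp_gt_zero mult_pos_pos less_irrefl)
  hence "emeasure lborel (space lborel :: real set) = 0"
    unfolding ae_filter_eq_bot_iff[symmetric] by (simp add: trivial_limit_def)
  thus False by simp
qed

end

section \<open>The Jacobi theta series and theta series of binary forms\<close>

lemma sums_infsum_bij:
  assumes "bij_betw e (UNIV :: nat set) L" "g summable_on L"
  shows "(\<lambda>n. g (e n)) sums infsum g L"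
proof (rule has_sum_imp_sums)
  have "(\<lambda>n. g (e n)) summable_on UNIV" using assms summable_on_reindex_bij_betw[OF assms(1)] by blast
  thus "((\<lambda>n. g (e n)) has_sum infsum g L) UNIV"
    unfolding infsum_reindex_bij_betw[OF assms(1), symmetric] by (rule has_sum_infsum)
qed

lemma summable_on_Times_nonneg:
  fixes f :: "'a \<Rightarrow> real" and g :: "'b \<Rightarrow> real"
  assumes "f summable_on A" "g summable_on B" "\<And>x. f x \<ge> 0" "\<And>x. g x \<ge> 0"
  shows "(\<lambda>(x, y). f x * g y) summable_on A \<times> B"
proof (rule summable_on_SigmaI[where g = "\<lambda>x. f x * infsum g B"])
  show "((\<lambda>y. case (x, y) of (x, y) \<Rightarrow> f x * g y) has_sum f x * infsum g B) B" for x
    unfolding prod.case by (intro has_sum_cmult_right has_sum_infsum assms)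
  show "(\<lambda>x. f x * infsum g B) summable_on A" by (intro summable_on_cmult_left assms)
qed (use assms in auto)

lemma infsum_int_even:
  fixes f :: "int \<Rightarrow> real"
  assumes f: "f summable_on UNIV" and ev: "\<And>n. f (- n) = f n"
  shows "infsum f UNIV = f 0 + 2 * (\<Sum>n. f (int (Suc n)))"
proof -
  define e1 e2 where "e1 = (\<lambda>n. int (Suc n))" and "e2 = (\<lambda>n. - int (Suc n))"
  have b1: "bij_betw e1 UNIV {1..}"
    by (rule bij_betwI[where g = "\<lambda>k. nat (k - 1)"]) (auto simp: e1_def)
  have b2: "bij_betw e2 UNIV {..-1}"
    by (rule bij_betwI[where g = "\<lambda>k. nat (- k - 1)"]) (auto simp: e2_def)
  have s: "f summable_on X" for X using summable_on_subset_banach[OF f] by blast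
  have i1: "infsum f {1..} = (\<Sum>n. f (int (Suc n)))"
    using sums_infsum_bij[OF b1 s] unfolding e1_def by (rule sums_unique)
  have i2: "infsum f {..-1} = (\<Sum>n. f (int (Suc n)))"
    using sums_infsum_bij[OF b2 s] unfolding e2_def ev by (rule sums_unique)
  have "(UNIV :: int set) = {0} \<union> ({1..} \<union> {..-1})" by auto
  hence "infsum f UNIV = infsum f ({0} \<union> ({1..} \<union> {..-1}))" by (rule arg_cong)
  also have "\<dots> = infsum f {0} + infsum f ({1..} \<union> {..-1})" by (rule infsum_Un_disjoint) (auto intro: s)
  also have "infsum f ({1..} \<union> {..-1}) = infsum f {1..} + infsum f {..-1}"
    by (rule infsum_Un_disjoint) (auto intro: s)
  finally show ?thesis unfolding i1 i2 by simp
qed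

lemma infsum_complex_of_real:
  assumes "f summable_on A"
  shows "(\<Sum>\<^sub>\<infinity>x\<in>A. complex_of_real (f x)) = of_real (infsum f A)"
  by (rule infsumI) (simp only: has_sum_of_real_iff has_sum_infsum[OF assms])

definition zeta_lam :: "nat \<Rightarrow> real" where "zeta_lam n = pi * (real (Suc n))\<^sup>2"

lemma zeta_lam_ge: "zeta_lam n \<ge> pi"
proof -
  have "1 \<le> (real (Suc n))\<^sup>2" by (rule one_le_power) simp
  thus ?thesis unfolding zeta_lam_def using mult_left_mono[of 1 "(real (Suc n))\<^sup>2" pi] by simp
qed

lemma zeta_lam_powr: "zeta_lam n powr (- \<sigma>) = pi powr (- \<sigma>) * real (Suc n) powr (- 2 * \<sigma>)"
proof -
  have "(real (Suc n))\<^sup>2 = real (Suc n) powr 2" by simp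
  hence "(real (Suc n))\<^sup>2 powr (- \<sigma>) = real (Suc n) powr (- 2 * \<sigma>)" by (simp only: powr_powr) simp
  thus ?thesis unfolding zeta_lam_def by (subst powr_mult) auto
qed

lemma theta_Z_inversion:
  assumes x: "x > 0"
  shows "1 + 2 * (\<Sum>n. exp (- (zeta_lam n / x))) = x powr (1/2) * (1 + 2 * (\<Sum>n. exp (- (zeta_lam n * x))))"
proof -
  define \<theta> where "\<theta> = (\<lambda>t. \<Sum>\<^sub>\<infinity>n::int. exp (- (pi * t) * (of_int n)\<^sup>2))"
  have s: "(\<lambda>n::int. exp (- (pi * t) * (real_of_int n)\<^sup>2)) summable_on UNIV" if "t > 0" for t
    using gaussian_summable_on[of "pi * t" 0] that by simp
  have th: "\<theta> t = 1 + 2 * (\<Sum>n. exp (- (zeta_lam n * t)))" if "t > 0" for t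
    unfolding \<theta>_def by (subst infsum_int_even[OF s[OF that]]) (simp_all add: zeta_lam_def mult_ac)
  have "complex_of_real (\<theta> (1 / x)) = of_real ((1 / x) powr (-1/2) * \<theta> x)"
    using poisson_gaussian[of "1 / x" 0] x s[of x] s[of "1 / x"]
    by (simp add: infsum_complex_of_real \<theta>_def)
  hence "\<theta> (1 / x) = (1 / x) powr (-1/2) * \<theta> x" unfolding of_real_eq_iff .
  also have "(1 / x) powr (-1/2) = x powr (1/2)" using x by (simp add: powr_divide powr_minus field_simps)
  finally show ?thesis using x by (simp add: th)
qed

interpretation theta1: theta_series zeta_lam "1/2" 2
proof
  show "zeta_lam n > 0" for n using zeta_lam_ge[of n] pi_gt_zero by linarith
  fix \<sigma> :: real assume "\<sigma> > 1 / 2"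
  hence "summable (\<lambda>n. real n powr (- 2 * \<sigma>))" by (simp add: summable_real_powr_iff)
  hence "summable (\<lambda>n. real (Suc n) powr (- 2 * \<sigma>))" by (subst summable_Suc_iff)
  thus "summable (\<lambda>n. zeta_lam n powr (- \<sigma>))" unfolding zeta_lam_powr by (rule summable_mult)
qed (use theta_Z_inversion in auto)

section \<open>Binary quadratic forms of determinant 1\<close>

definition lattice :: "(int \<times> int) set" where "lattice = UNIV - {(0, 0)}"

lemma lattice_bij: "bij_betw (from_nat_into lattice) UNIV lattice"
proof (rule bij_betw_from_nat_into)
  have "inj (\<lambda>n. (1::int, int n))" by (auto simp: inj_def)
  hence "infinite (range (\<lambda>n. (1::int, int n)))" by (simp add: finite_image_iff)
  thus "infinite lattice" by (rule contrapos_nn) (erule finite_subset[rotated], auto simp: lattice_def)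
qed auto

text \<open>Dividing by \<open>Im \<tau>\<close> normalises the determinant of the form to 1. Its
  dual form is then equivalent to it, and theta inversion relates the series to itself.\<close>

definition quad_form :: "complex \<Rightarrow> int \<times> int \<Rightarrow> real" where
  "quad_form \<tau> = (\<lambda>(m, n). (norm (of_int m * \<tau> + of_int n))\<^sup>2 / Im \<tau>)"

definition epstein_lam :: "complex \<Rightarrow> nat \<Rightarrow> real" where
  "epstein_lam \<tau> n = pi * quad_form \<tau> (from_nat_into lattice n)"

lemma quad_form_eq: "quad_form \<tau> (m, n) = ((of_int m * Re \<tau> + of_int n)\<^sup>2 + (of_int m * Im \<tau>)\<^sup>2) / Im \<tau>"
  by (simp add: quad_form_def cmod_power2)

context
  fixes \<tau> :: complex
  assumes \<tau>: "Im \<tau> > 0"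
begin

text \<open>A product bound rather than a sum of squares: summability over the lattice then splits
  into two sums over the integers, and this still covers every exponent above 1.\<close>

lemma quad_form_ge:
  "\<exists>c>0. \<forall>p\<in>lattice. c * ((1 + \<bar>real_of_int (fst p)\<bar>) * (1 + \<bar>real_of_int (snd p)\<bar>)) \<le> quad_form \<tau> p"
proof -
  define x y where "x = Re \<tau>" and "y = Im \<tau>"
  have y: "y > 0" using \<tau> by (simp add: y_def)
  \<comment> \<open>With \<open>z = m * x + n\<close> one has
    \<open>n\<^sup>2 \<le> 2 * z\<^sup>2 + 2 * (m * x)\<^sup>2\<close>; the division by
    \<open>y\<^sup>2\<close> converts \<open>m\<^sup>2\<close> into \<open>(m * y)\<^sup>2\<close>,
    the other square of the form.\<close>
  define K where "K = 2 + (1 + 2 * x\<^sup>2) / y\<^sup>2"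
  have K: "K > 0" unfolding K_def using y by (intro add_pos_nonneg) auto
  have "1 / (4 * K * y) * ((1 + \<bar>real_of_int m\<bar>) * (1 + \<bar>real_of_int n\<bar>)) \<le> quad_form \<tau> (m, n)" if p: "(m, n) \<in> lattice" for m n
  proof -
    define a b where "a = \<bar>real_of_int m\<bar>" and "b = \<bar>real_of_int n\<bar>"
    have sq: "z \<le> z\<^sup>2" if "z = 0 \<or> z \<ge> 1" for z :: real
      using that mult_right_mono[of 1 z z] by (auto simp: power2_eq_square)
    have ab: "a = 0 \<or> a \<ge> 1" "b = 0 \<or> b \<ge> 1" using p by (auto simp: a_def b_def lattice_def)
    moreover have "a \<noteq> 0 \<or> b \<noteq> 0" using p by (auto simp: a_def b_def lattice_def)
    ultimately have ab1: "1 \<le> a + b" by linarith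
    have lin: "1 + a + b + q \<le> 4 * S" if "1 \<le> a + b" "a + b \<le> S" "2 * q \<le> S" for q S using that by linarith
    have "1 + a + b + a * b \<le> 4 * (a\<^sup>2 + b\<^sup>2)"
      by (rule lin) (use ab1 sq[OF ab(1)] sq[OF ab(2)] sum_squares_bound[of a b] in \<open>auto simp: mult.assoc intro: add_mono\<close>)
    hence 1: "(1 + a) * (1 + b) \<le> 4 * (a\<^sup>2 + b\<^sup>2)" by (simp add: algebra_simps)
    define z where "z = of_int m * x + of_int n"
    have "(real_of_int n)\<^sup>2 = (z - of_int m * x)\<^sup>2" by (simp add: z_def)
    also have "\<dots> \<le> 2 * z\<^sup>2 + 2 * (of_int m * x)\<^sup>2"
      using zero_le_power2[of "z + of_int m * x"] by (simp add: power2_sum power2_diff)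
    finally have "a\<^sup>2 + b\<^sup>2 \<le> 2 * z\<^sup>2 + (1 + 2 * x\<^sup>2) * (of_int m)\<^sup>2"
      by (simp add: a_def b_def power_mult_distrib algebra_simps)
    also have "(1 + 2 * x\<^sup>2) * (of_int m)\<^sup>2 = (1 + 2 * x\<^sup>2) / y\<^sup>2 * (of_int m * y)\<^sup>2"
      using y by (simp add: power_mult_distrib)
    also have "2 * z\<^sup>2 + \<dots> \<le> K * z\<^sup>2 + K * (of_int m * y)\<^sup>2"
      unfolding K_def using y by (intro add_mono mult_right_mono) auto
    also have "\<dots> = K * y * quad_form \<tau> (m, n)"
      using y by (simp add: quad_form_eq z_def x_def y_def field_simps)
    finally have "(1 + a) * (1 + b) \<le> 4 * (K * y * quad_form \<tau> (m, n))" using 1 by simp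
    thus ?thesis using K y by (simp add: a_def b_def field_simps)
  qed
  moreover have "1 / (4 * K * y) > 0" using K y by simp
  ultimately show ?thesis by (intro exI[of _ "1 / (4 * K * y)"]) auto
qed

lemma quad_form_pos: "p \<in> lattice \<Longrightarrow> quad_form \<tau> p > 0"
proof -
  assume p: "p \<in> lattice"
  obtain c where c: "c > 0" "\<And>p. p \<in> lattice \<Longrightarrow> c * ((1 + \<bar>real_of_int (fst p)\<bar>) * (1 + \<bar>real_of_int (snd p)\<bar>)) \<le> quad_form \<tau> p"
    using quad_form_ge by blast
  have "0 < c * ((1 + \<bar>real_of_int (fst p)\<bar>) * (1 + \<bar>real_of_int (snd p)\<bar>))"
    using c(1) by (intro mult_pos_pos) auto
  thus ?thesis using c(2)[OF p] by linarith
qed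

lemma quad_form_summable:
  assumes "\<sigma> > 1"
  shows "(\<lambda>p. quad_form \<tau> p powr (- \<sigma>)) summable_on lattice"
proof -
  obtain c where c: "c > 0" "\<And>p. p \<in> lattice \<Longrightarrow> c * ((1 + \<bar>real_of_int (fst p)\<bar>) * (1 + \<bar>real_of_int (snd p)\<bar>)) \<le> quad_form \<tau> p"
    using quad_form_ge by blast
  define b where "b = (\<lambda>n::int. (1 + \<bar>real_of_int n\<bar>) powr (- \<sigma>))"
  have "(\<lambda>(m, n). b m * b n) summable_on UNIV \<times> UNIV"
    using summable_on_int_powr[OF assms] by (intro summable_on_Times_nonneg) (auto simp: b_def)
  hence "(\<lambda>(m, n). b m * b n) summable_on lattice" by (rule summable_on_subset_banach) auto
  hence "(\<lambda>p. c powr (- \<sigma>) * (case p of (m, n) \<Rightarrow> b m * b n)) summable_on lattice" by (rule summable_on_cmult_right)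
  thus ?thesis
  proof (rule summable_on_comparison_test)
    fix p assume p: "p \<in> lattice"
    have "quad_form \<tau> p powr (- \<sigma>) \<le> (c * ((1 + \<bar>real_of_int (fst p)\<bar>) * (1 + \<bar>real_of_int (snd p)\<bar>))) powr (- \<sigma>)"
      using assms c(1) by (intro powr_mono2' c(2)[OF p]) (auto intro!: mult_pos_pos)
    also have "\<dots> = c powr (- \<sigma>) * (case p of (m, n) \<Rightarrow> b m * b n)"
      using c(1) by (auto simp: b_def powr_mult split: prod.split)
    finally show "quad_form \<tau> p powr (- \<sigma>) \<le> c powr (- \<sigma>) * (case p of (m, n) \<Rightarrow> b m * b n)" .
  qed auto
qed

definition epstein_theta :: "real \<Rightarrow> real" where
  "epstein_theta t = (\<Sum>\<^sub>\<infinity>p. exp (- (pi * t) * quad_form \<tau> p))"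

lemma epstein_theta_summable:
  assumes "t > 0"
  shows "(\<lambda>p. exp (- (pi * t) * quad_form \<tau> p)) summable_on UNIV"
proof -
  have "(\<lambda>p. exp (- (pi * t) * quad_form \<tau> p)) summable_on lattice"
  proof (rule summable_on_comparison_test)
    show "(\<lambda>p. 2 / (pi * t) ^ 2 * quad_form \<tau> p powr (- 2)) summable_on lattice"
      by (intro summable_on_cmult_right quad_form_summable) simp
    fix p assume "p \<in> lattice"
    hence q: "quad_form \<tau> p > 0" by (rule quad_form_pos)
    have p: "(pi * t * quad_form \<tau> p)\<^sup>2 > 0" using q assms by simp
    have "(pi * t * quad_form \<tau> p)\<^sup>2 / fact 2 \<le> exp (pi * t * quad_form \<tau> p)"
      by (rule exp_ge_power_div_fact) (use q assms in auto)
    hence "exp (- (pi * t * quad_form \<tau> p)) \<le> 2 / (pi * t * quad_form \<tau> p)\<^sup>2"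
      using p by (simp add: exp_minus field_simps)
    also have "\<dots> = 2 / (pi * t) ^ 2 * quad_form \<tau> p powr (- 2)"
      using q by (simp add: powr_minus power_mult_distrib field_simps)
    finally show "exp (- (pi * t) * quad_form \<tau> p) \<le> 2 / (pi * t) ^ 2 * quad_form \<tau> p powr (- 2)" by simp
  qed auto
  hence "(\<lambda>p. exp (- (pi * t) * quad_form \<tau> p)) summable_on (lattice \<union> {(0, 0)})"
    by (rule summable_on_Un_disjoint) (auto simp: lattice_def)
  moreover have "lattice \<union> {(0, 0)} = UNIV" by (auto simp: lattice_def)
  ultimately show ?thesis by simp
qed

lemma epstein_theta_eq:
  assumes "t > 0"
  shows "epstein_theta t = 1 + (\<Sum>n. exp (- (epstein_lam \<tau> n * t)))"
proof -
  note s = summable_on_subset_banach[OF epstein_theta_summable[OF assms] subset_UNIV]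
  have "(UNIV :: (int \<times> int) set) = {(0, 0)} \<union> lattice" by (auto simp: lattice_def)
  hence "epstein_theta t = infsum (\<lambda>p. exp (- (pi * t) * quad_form \<tau> p)) ({(0, 0)} \<union> lattice)"
    unfolding epstein_theta_def by (rule arg_cong)
  also have "\<dots> = (\<Sum>\<^sub>\<infinity>p\<in>{(0, 0)}. exp (- (pi * t) * quad_form \<tau> p)) + (\<Sum>\<^sub>\<infinity>p\<in>lattice. exp (- (pi * t) * quad_form \<tau> p))"
    by (rule infsum_Un_disjoint[OF s s]) (auto simp: lattice_def)
  also have "(\<Sum>\<^sub>\<infinity>p\<in>{(0, 0)}. exp (- (pi * t) * quad_form \<tau> p)) = 1" by (simp add: quad_form_eq)
  also have "(\<Sum>\<^sub>\<infinity>p\<in>lattice. exp (- (pi * t) * quad_form \<tau> p)) = (\<Sum>n. exp (- (pi * t) * quad_form \<tau> (from_nat_into lattice n)))"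
    using sums_infsum_bij[OF lattice_bij s] by (rule sums_unique)
  finally show ?thesis by (simp add: epstein_lam_def mult_ac)
qed

text \<open>Poisson summation in the second variable, followed by Poisson summation, read backwards, in the first.\<close>
lemma epstein_theta_inversion:
  assumes t: "t > 0"
  shows "epstein_theta (1 / t) = t * epstein_theta t"
proof -
  define x y where "x = Re \<tau>" and "y = Im \<tau>"
  have y: "y > 0" using \<tau> by (simp add: y_def)
  define G where "G = (\<lambda>m. complex_of_real (exp (- (pi * t * y) * (of_int m)\<^sup>2)))"
  define H where "H = (\<lambda>k. complex_of_real (exp (- (pi / (t / y)) * (of_int k)\<^sup>2)))"
  define e where "e = (\<lambda>m k. exp (2 * of_real pi * \<i> * of_int k * of_real (of_int m * x)))"
  have theta: "complex_of_real (epstein_theta t) = (\<Sum>\<^sub>\<infinity>m. \<Sum>\<^sub>\<infinity>n. complex_of_real (exp (- (pi * t) * quad_form \<tau> (m, n))))" if "t > 0" for t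
  proof -
    have "complex_of_real (epstein_theta t) = (\<Sum>\<^sub>\<infinity>p. complex_of_real (exp (- (pi * t) * quad_form \<tau> p)))"
      unfolding epstein_theta_def by (rule infsum_complex_of_real[OF epstein_theta_summable[OF that], symmetric])
    also have "\<dots> = (\<Sum>\<^sub>\<infinity>(m, n)\<in>UNIV \<times> UNIV. complex_of_real (exp (- (pi * t) * quad_form \<tau> (m, n))))"
      by (intro infsum_cong_neutral) auto
    also have "\<dots> = (\<Sum>\<^sub>\<infinity>m. \<Sum>\<^sub>\<infinity>n. complex_of_real (exp (- (pi * t) * quad_form \<tau> (m, n))))"
    proof (rule infsum_Sigma'_banach[symmetric])
      show "(\<lambda>(m, n). complex_of_real (exp (- (pi * t) * quad_form \<tau> (m, n)))) summable_on UNIV \<times> UNIV"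
        using summable_on_of_real[OF epstein_theta_summable[OF that]] by (simp add: case_prod_unfold)
    qed
    finally show ?thesis .
  qed
  have GH: "(\<lambda>(m, k). G m * H k * e m k) summable_on UNIV \<times> UNIV"
  proof (rule abs_summable_summable)
    have "(\<lambda>(m::int, k::int). exp (- (pi * t * y) * (of_int m)\<^sup>2) * exp (- (pi / (t / y)) * (of_int k)\<^sup>2)) summable_on UNIV \<times> UNIV"
      using gaussian_summable_on[of "pi * t * y" 0] gaussian_summable_on[of "pi / (t / y)" 0] t y
      by (intro summable_on_Times_nonneg) auto
    moreover have "norm (e m k) = 1" for m k by (simp add: e_def)
    ultimately show "(\<lambda>p. norm (case p of (m, k) \<Rightarrow> G m * H k * e m k)) summable_on UNIV \<times> UNIV"
      by (simp add: G_def H_def norm_mult case_prod_unfold)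
  qed
  \<comment> \<open>The form is \<open>m\<^sup>2 * y + (n + m * x)\<^sup>2 / y\<close>; Poisson
    summation over \<open>n\<close> turns the shift \<open>m * x\<close> into the phase
    \<open>e m k\<close>.\<close>
  have inner: "(\<Sum>\<^sub>\<infinity>n. complex_of_real (exp (- (pi * t) * quad_form \<tau> (m, n)))) = of_real ((t / y) powr (-1/2)) * (\<Sum>\<^sub>\<infinity>k. G m * H k * e m k)" for m
  proof -
    have "- (pi * t) * quad_form \<tau> (m, n) = - (pi * t * y) * (of_int m)\<^sup>2 + - (pi * (t / y)) * (of_int n + of_int m * x)\<^sup>2" for n
      using y by (simp add: quad_form_eq x_def[symmetric] y_def[symmetric] field_simps power2_eq_square)
    hence "(\<Sum>\<^sub>\<infinity>n. complex_of_real (exp (- (pi * t) * quad_form \<tau> (m, n)))) = (\<Sum>\<^sub>\<infinity>n. G m * complex_of_real (exp (- (pi * (t / y)) * (of_int n + of_int m * x)\<^sup>2)))"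
      by (simp only: exp_add of_real_mult G_def)
    also have "\<dots> = G m * (of_real ((t / y) powr (-1/2)) * (\<Sum>\<^sub>\<infinity>k. H k * e m k))"
      using poisson_gaussian[of "t / y" "of_int m * x"] t y by (simp only: infsum_cmult_right' H_def e_def divide_pos_pos)
    finally show ?thesis by (simp only: infsum_cmult_right' mult.assoc mult.left_commute)
  qed
  \<comment> \<open>The phase is symmetric in \<open>m\<close> and \<open>k\<close>. For fixed
    \<open>k\<close> the sum over \<open>m\<close> is thus the Fourier side of a Gaussian sum with
    shift \<open>k * x\<close>, and \<open>k\<close> takes over the role of the first variable of
    the form.\<close>
  have outer: "(\<Sum>\<^sub>\<infinity>m. G m * H k * e m k) = of_real ((1 / (t * y)) powr (1/2)) * (\<Sum>\<^sub>\<infinity>n. complex_of_real (exp (- (pi * (1 / t)) * quad_form \<tau> (k, n))))" for k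
  proof -
    define S where "S = (\<Sum>\<^sub>\<infinity>n. complex_of_real (exp (- (pi * (1 / (t * y))) * (of_int n + of_int k * x)\<^sup>2)))"
    have "S = of_real ((1 / (t * y)) powr (-1/2)) * (\<Sum>\<^sub>\<infinity>m. of_real (exp (- (pi / (1 / (t * y))) * (of_int m)\<^sup>2)) * exp (2 * of_real pi * \<i> * of_int m * of_real (of_int k * x)))"
      unfolding S_def by (rule poisson_gaussian) (use t y in simp)
    also have "(\<Sum>\<^sub>\<infinity>m. of_real (exp (- (pi / (1 / (t * y))) * (of_int m)\<^sup>2)) * exp (2 * of_real pi * \<i> * of_int m * of_real (of_int k * x))) = (\<Sum>\<^sub>\<infinity>m. G m * e m k)"
      by (intro infsum_cong) (simp add: G_def e_def mult_ac)
    finally have "of_real ((1 / (t * y)) powr (1/2)) * S = (of_real ((1 / (t * y)) powr (1/2) * (1 / (t * y)) powr (-1/2))) * (\<Sum>\<^sub>\<infinity>m. G m * e m k)"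
      by (simp only: of_real_mult mult.assoc)
    also have "(1 / (t * y)) powr (1/2) * (1 / (t * y)) powr (-1/2) = 1"
      using t y by (simp add: powr_add[symmetric])
    finally have 1: "(\<Sum>\<^sub>\<infinity>m. G m * e m k) = of_real ((1 / (t * y)) powr (1/2)) * S" by simp
    have "- (pi * (1 / t)) * quad_form \<tau> (k, n) = - (pi / (t / y)) * (of_int k)\<^sup>2 + - (pi * (1 / (t * y))) * (of_int n + of_int k * x)\<^sup>2" for n
      using y t by (simp add: quad_form_eq x_def[symmetric] y_def[symmetric] field_simps power2_eq_square)
    hence "(\<Sum>\<^sub>\<infinity>n. complex_of_real (exp (- (pi * (1 / t)) * quad_form \<tau> (k, n)))) = H k * S"
      by (simp only: exp_add of_real_mult H_def infsum_cmult_right' S_def)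
    moreover have "(\<Sum>\<^sub>\<infinity>m. G m * H k * e m k) = H k * (\<Sum>\<^sub>\<infinity>m. G m * e m k)"
      unfolding infsum_cmult_right'[symmetric] by (intro infsum_cong) simp
    ultimately show ?thesis unfolding 1 by simp
  qed
  have "complex_of_real (epstein_theta t) = of_real ((t / y) powr (-1/2)) * (\<Sum>\<^sub>\<infinity>m. \<Sum>\<^sub>\<infinity>k. G m * H k * e m k)"
    unfolding theta[OF t] inner by (rule infsum_cmult_right')
  also have "(\<Sum>\<^sub>\<infinity>m. \<Sum>\<^sub>\<infinity>k. G m * H k * e m k) = (\<Sum>\<^sub>\<infinity>k. \<Sum>\<^sub>\<infinity>m. G m * H k * e m k)"
    by (rule infsum_swap_banach[OF GH])
  also have "\<dots> = of_real ((1 / (t * y)) powr (1/2)) * of_real (epstein_theta (1 / t))"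
    unfolding outer infsum_cmult_right' using theta[of "1 / t"] t by simp
  finally have "complex_of_real (epstein_theta t) = of_real ((t / y) powr (-1/2) * (1 / (t * y)) powr (1/2) * epstein_theta (1 / t))" by simp
  hence "epstein_theta t = (t / y) powr (-1/2) * (1 / (t * y)) powr (1/2) * epstein_theta (1 / t)" unfolding of_real_eq_iff .
  also have "(t / y) powr (-1/2) = (y / t) powr (1/2)" using t y by (simp add: powr_divide powr_minus field_simps)
  also have "(y / t) powr (1/2) * (1 / (t * y)) powr (1/2) = (1 / t ^ 2) powr (1/2)"
    using t y by (subst powr_mult[symmetric]) (simp_all add: power2_eq_square)
  also have "\<dots> = 1 / t" using t by (simp add: powr_half_sqrt real_sqrt_divide)
  finally show ?thesis using t by (simp add: field_simps)
qed

lemma theta_series_epstein: "theta_series (epstein_lam \<tau>) 1 1"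
proof
  have q: "quad_form \<tau> (from_nat_into lattice n) > 0" for n
    using bij_betw_apply[OF lattice_bij UNIV_I] by (rule quad_form_pos)
  show "epstein_lam \<tau> n > 0" for n using q by (simp add: epstein_lam_def)
  fix \<sigma> :: real assume \<sigma>: "\<sigma> > 1"
  have "summable (\<lambda>n. pi powr (- \<sigma>) * quad_form \<tau> (from_nat_into lattice n) powr (- \<sigma>))"
    by (rule summable_mult, rule sums_summable[OF sums_infsum_bij[OF lattice_bij quad_form_summable[OF \<sigma>]]])
  thus "summable (\<lambda>n. epstein_lam \<tau> n powr (- \<sigma>))" using q by (simp add: epstein_lam_def powr_mult less_imp_le)
next
  fix x :: real assume x: "x > 0"
  thus "1 + 1 * (\<Sum>n. exp (- (epstein_lam \<tau> n / x))) = x powr 1 * (1 + 1 * (\<Sum>n. exp (- (epstein_lam \<tau> n * x))))"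
    using epstein_theta_inversion[OF x] epstein_theta_eq[of x] epstein_theta_eq[of "1 / x"] by simp
qed auto

end

section \<open>The Eisenstein series as a lattice sum\<close>

definition bottom_row :: "int ^ 2 ^ 2 \<Rightarrow> int \<times> int" where
  "bottom_row A = (A $ 2 $ 1, A $ 2 $ 2)"

definition neg_pair :: "int \<times> int \<Rightarrow> int \<times> int" where
  "neg_pair = (\<lambda>(c, d). (- c, - d))"

lemma neg_pair_neg_pair [simp]: "neg_pair (neg_pair p) = p"
  by (simp add: neg_pair_def split: prod.split)

definition coprime_pairs :: "(int \<times> int) set" where
  "coprime_pairs = {(c, d). coprime c d}"

lemma coprime_pairs_lattice: "coprime_pairs \<subseteq> lattice"
  by (auto simp: coprime_pairs_def lattice_def)

lemma neg_pair_neq: "p \<in> coprime_pairs \<Longrightarrow> neg_pair p \<noteq> p"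
  by (auto simp: coprime_pairs_def neg_pair_def)

lemma bottom_row_coprime:
  assumes "A \<in> SL2Z"
  shows "bottom_row A \<in> coprime_pairs"
proof -
  have d: "A $ 1 $ 1 * A $ 2 $ 2 - A $ 1 $ 2 * A $ 2 $ 1 = 1" using assms by (simp add: SL2Z_def det_2)
  have "coprime (A $ 2 $ 1) (A $ 2 $ 2)"
  proof (rule coprimeI)
    fix c assume "c dvd A $ 2 $ 1" "c dvd A $ 2 $ 2"
    hence "c dvd A $ 1 $ 1 * A $ 2 $ 2 - A $ 1 $ 2 * A $ 2 $ 1" by (intro dvd_diff dvd_mult) auto
    thus "is_unit c" unfolding d .
  qed
  thus ?thesis by (simp add: bottom_row_def coprime_pairs_def)
qed

lemma ex_bottom_row:
  assumes "p \<in> coprime_pairs"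
  shows "\<exists>A\<in>SL2Z. bottom_row A = p"
proof -
  obtain c d where p: "p = (c, d)" "coprime c d" using assms by (auto simp: coprime_pairs_def)
  obtain a b where ab: "a * c + b * d = 1" using bezout_int[of c d] p by auto
  define A :: "int ^ 2 ^ 2" where "A = vector [vector [b, - a], vector [c, d]]"
  have "A \<in> SL2Z" using ab by (simp add: SL2Z_def A_def det_2 algebra_simps)
  moreover have "bottom_row A = p" by (simp add: A_def bottom_row_def p)
  ultimately show ?thesis by blast
qed

text \<open>An upper triangular integer matrix of determinant 1 has diagonal (1, 1) or (-1, -1), so
  it acts on the bottom row by a sign. Conversely, rows that agree up to sign make the lower left
  entry of B A^{-1} vanish.\<close>

lemma coset_relation_iff:
  assumes A: "A \<in> SL2Z" and B: "B \<in> SL2Z"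
  shows "(\<exists>P\<in>SL2Z_inf. B = P ** A) \<longleftrightarrow> bottom_row B = bottom_row A \<or> bottom_row B = neg_pair (bottom_row A)"
proof
  assume "\<exists>P\<in>SL2Z_inf. B = P ** A"
  then obtain P :: "int ^ 2 ^ 2" where P: "det P = 1" "P $ 2 $ 1 = 0" "B = P ** A" by (auto simp: SL2Z_inf_def SL2Z_def)
  have "P $ 1 $ 1 * P $ 2 $ 2 = 1" using P by (simp add: det_2)
  hence "P $ 2 $ 2 = 1 \<or> P $ 2 $ 2 = - 1" by (metis mult.commute zmult_eq_1_iff)
  moreover have "bottom_row B = (P $ 2 $ 2 * A $ 2 $ 1, P $ 2 $ 2 * A $ 2 $ 2)"
    using P by (simp add: bottom_row_def matrix_matrix_mult_def sum_2)
  ultimately show "bottom_row B = bottom_row A \<or> bottom_row B = neg_pair (bottom_row A)"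
    by (auto simp: bottom_row_def neg_pair_def)
next
  assume r: "bottom_row B = bottom_row A \<or> bottom_row B = neg_pair (bottom_row A)"
  \<comment> \<open>The adjugate, which is the inverse because the determinant is 1.\<close>
  define A' :: "int ^ 2 ^ 2" where "A' = vector [vector [A $ 2 $ 2, - A $ 1 $ 2], vector [- A $ 2 $ 1, A $ 1 $ 1]]"
  have dA: "A $ 1 $ 1 * A $ 2 $ 2 - A $ 1 $ 2 * A $ 2 $ 1 = 1" using A by (simp add: SL2Z_def det_2)
  hence dA': "det A' = 1" by (simp add: A'_def det_2 algebra_simps)
  have inv: "A' ** A = mat 1"
    using dA by (simp add: A'_def vec_eq_iff forall_2 matrix_matrix_mult_def sum_2 mat_def algebra_simps)
  have "B = (B ** A') ** A" unfolding matrix_mul_assoc[symmetric] inv by simp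
  moreover have "B ** A' \<in> SL2Z_inf"
  proof -
    have "det (B ** A') = 1" using dA' B by (simp add: det_mul SL2Z_def)
    moreover have "(B ** A') $ 2 $ 1 = 0"
      using r by (auto simp: matrix_matrix_mult_def sum_2 A'_def bottom_row_def neg_pair_def)
    ultimately show ?thesis by (simp add: SL2Z_inf_def SL2Z_def)
  qed
  ultimately show "\<exists>P\<in>SL2Z_inf. B = P ** A" by blast
qed

text \<open>It makes the same choice of a representative as \<open>eisenstein_series\<close>, so the
  summand there becomes a function of \<open>coset_row K\<close>.\<close>

definition coset_row :: "(int ^ 2 ^ 2) set \<Rightarrow> int \<times> int" where
  "coset_row K = bottom_row (SOME A. A \<in> K)"

lemma coset_eq:
  assumes "K \<in> cosets_inf"
  shows "coset_row K \<in> coprime_pairs"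
    "K = {B \<in> SL2Z. bottom_row B = coset_row K \<or> bottom_row B = neg_pair (coset_row K)}"
proof -
  obtain A where A: "A \<in> SL2Z" and K: "K = {(A, B). A \<in> SL2Z \<and> B \<in> SL2Z \<and> (\<exists>P\<in>SL2Z_inf. B = P ** A)} `` {A}"
    using assms unfolding cosets_inf_def by (rule quotientE)
  have K': "K = {B \<in> SL2Z. bottom_row B = bottom_row A \<or> bottom_row B = neg_pair (bottom_row A)}"
    unfolding K using A coset_relation_iff[OF A] by auto
  have "A \<in> K" unfolding K' using A by simp
  hence "(SOME A. A \<in> K) \<in> K" by (rule someI)
  hence S: "(SOME A. A \<in> K) \<in> SL2Z" "coset_row K = bottom_row A \<or> coset_row K = neg_pair (bottom_row A)"
    unfolding coset_row_def K' by auto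
  show "coset_row K \<in> coprime_pairs" unfolding coset_row_def by (rule bottom_row_coprime[OF S(1)])
  show "K = {B \<in> SL2Z. bottom_row B = coset_row K \<or> bottom_row B = neg_pair (coset_row K)}"
    using K' S(2) by (elim disjE) auto
qed

lemma coset_row_inj:
  assumes "K \<in> cosets_inf" "K' \<in> cosets_inf" "coset_row K = coset_row K' \<or> coset_row K = neg_pair (coset_row K')"
  shows "K = K'"
  using coset_eq(2)[OF assms(1)] coset_eq(2)[OF assms(2)] assms(3) by (elim disjE) auto

lemma coset_row_surj:
  assumes "p \<in> coprime_pairs"
  shows "\<exists>K\<in>cosets_inf. coset_row K = p \<or> coset_row K = neg_pair p"
proof -
  obtain A where A: "A \<in> SL2Z" "bottom_row A = p" using ex_bottom_row[OF assms] by blast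
  define K where "K = {(A, B). A \<in> SL2Z \<and> B \<in> SL2Z \<and> (\<exists>P\<in>SL2Z_inf. B = P ** A)} `` {A}"
  have K: "K \<in> cosets_inf" unfolding cosets_inf_def K_def using A(1) by (rule quotientI)
  have "A \<in> K" using coset_relation_iff[OF A(1) A(1)] A(1) by (auto simp: K_def)
  hence "bottom_row A = coset_row K \<or> bottom_row A = neg_pair (coset_row K)" using coset_eq(2)[OF K] by blast
  thus ?thesis using K A(2) by (intro bexI[of _ K]) auto
qed

text \<open>Each coset accounts for exactly two coprime pairs, a row and its negative, which differ
  because (0, 0) is not coprime. The chosen rows \<open>R\<close> pick one of the two, and
  \<open>neg_pair\<close> supplies the other.\<close>

lemma infsum_coprime_pairs:
  fixes g :: "int \<times> int \<Rightarrow> complex"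
  assumes g: "g summable_on coprime_pairs" and even: "\<And>p. g (neg_pair p) = g p"
  shows "infsum g coprime_pairs = 2 * (\<Sum>\<^sub>\<infinity>K\<in>cosets_inf. g (coset_row K))"
proof -
  define R where "R = coset_row ` cosets_inf"
  have inj: "inj_on coset_row cosets_inf" using coset_row_inj by (auto simp: inj_on_def)
  have np: "neg_pair p \<in> coprime_pairs" if "p \<in> coprime_pairs" for p using that by (auto simp: coprime_pairs_def neg_pair_def)
  have RC: "R \<subseteq> coprime_pairs" using coset_eq(1) by (auto simp: R_def)
  have eq: "coprime_pairs = R \<union> neg_pair ` R"
  proof
    show "coprime_pairs \<subseteq> R \<union> neg_pair ` R"
    proof
      fix p assume "p \<in> coprime_pairs"
      then obtain K where "K \<in> cosets_inf" "coset_row K = p \<or> coset_row K = neg_pair p" using coset_row_surj by blast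
      thus "p \<in> R \<union> neg_pair ` R" by (metis R_def UnI1 UnI2 imageI neg_pair_neg_pair)
    qed
    show "R \<union> neg_pair ` R \<subseteq> coprime_pairs" using RC np by auto
  qed
  have disj: "R \<inter> neg_pair ` R = {}"
  proof (rule ccontr)
    assume "R \<inter> neg_pair ` R \<noteq> {}"
    then obtain K K' where K: "K \<in> cosets_inf" "K' \<in> cosets_inf" "coset_row K = neg_pair (coset_row K')"
      unfolding R_def by blast
    hence "K = K'" using coset_row_inj by blast
    thus False using K coset_eq(1)[OF K(2)] neg_pair_neq by metis
  qed
  have injn: "inj_on neg_pair R" by (metis inj_onI neg_pair_neg_pair)
  have s: "g summable_on R" "g summable_on neg_pair ` R"
    using summable_on_subset_banach[OF g] eq by blast+
  have "infsum g coprime_pairs = infsum g R + infsum g (neg_pair ` R)"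
    unfolding eq by (rule infsum_Un_disjoint[OF s disj])
  also have "infsum g (neg_pair ` R) = infsum g R"
    by (simp add: infsum_reindex[OF injn] o_def even)
  also have "infsum g R = (\<Sum>\<^sub>\<infinity>K\<in>cosets_inf. g (coset_row K))"
    unfolding R_def by (simp add: infsum_reindex[OF inj] o_def)
  finally show ?thesis by simp
qed

text \<open>On coprime \<open>c\<close>, \<open>d\<close> the factor \<open>Suc k\<close> is the
  greatest common divisor of the result; indexing it by \<open>nat\<close> from 0 matches
  \<open>zeta_lam\<close>.\<close>

definition scale_pair :: "nat \<times> int \<times> int \<Rightarrow> int \<times> int" where
  "scale_pair = (\<lambda>(k, c, d). (int (Suc k) * c, int (Suc k) * d))"

lemma scale_pair_bij: "bij_betw scale_pair (UNIV \<times> coprime_pairs) lattice"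
proof (rule bij_betw_imageI)
  have gcd_scale: "gcd (int (Suc k) * c) (int (Suc k) * d) = int (Suc k)" if "coprime c d" for k c d
    using that by (simp add: gcd_mult_distrib_int[symmetric] del: of_nat_Suc)
  show "inj_on scale_pair (UNIV \<times> coprime_pairs)"
  proof (rule inj_onI)
    fix p p' assume p: "p \<in> UNIV \<times> coprime_pairs" "p' \<in> UNIV \<times> coprime_pairs" "scale_pair p = scale_pair p'"
    obtain k c d k' c' d' where pp: "p = (k, c, d)" "p' = (k', c', d')" by (metis prod_cases3)
    have cop: "coprime c d" "coprime c' d'" using p pp by (auto simp: coprime_pairs_def)
    have e: "int (Suc k) * c = int (Suc k') * c'" "int (Suc k) * d = int (Suc k') * d'"
      using p pp by (auto simp: scale_pair_def simp del: of_nat_Suc)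
    have "int (Suc k) = int (Suc k')" using gcd_scale[OF cop(1), of k] gcd_scale[OF cop(2), of k'] e by metis
    moreover from this e have "c = c'" "d = d'" by auto
    ultimately show "p = p'" by (simp add: pp)
  qed
  show "scale_pair ` (UNIV \<times> coprime_pairs) = lattice"
  proof
    show "scale_pair ` (UNIV \<times> coprime_pairs) \<subseteq> lattice"
      by (auto simp: scale_pair_def lattice_def coprime_pairs_def simp del: of_nat_Suc)
    show "lattice \<subseteq> scale_pair ` (UNIV \<times> coprime_pairs)"
    proof
      fix p assume "p \<in> lattice"
      then obtain m n where p: "p = (m, n)" "m \<noteq> 0 \<or> n \<noteq> 0" by (cases p) (auto simp: lattice_def)
      define g where "g = gcd m n"
      have g: "g > 0" unfolding g_def using p(2) by auto
      have "coprime (m div g) (n div g)" unfolding g_def using p(2) by (intro div_gcd_coprime) auto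
      moreover have "m = g * (m div g)" "n = g * (n div g)" by (simp_all add: g_def)
      moreover have "int (Suc (nat (g - 1))) = g" using g by simp
      ultimately show "p \<in> scale_pair ` (UNIV \<times> coprime_pairs)"
        by (intro image_eqI[of _ _ "(nat (g - 1), m div g, n div g)"])
           (auto simp: scale_pair_def p coprime_pairs_def simp del: of_nat_Suc)
    qed
  qed
qed

lemma quad_form_scale: "quad_form \<tau> (scale_pair (k, p)) = (real (Suc k))\<^sup>2 * quad_form \<tau> p"
proof (cases p)
  case (Pair c d)
  have "of_int (int (Suc k) * c) * \<tau> + of_int (int (Suc k) * d) = of_nat (Suc k) * (of_int c * \<tau> + of_int d)"
    by (simp add: distrib_left mult.assoc del: of_nat_Suc)
  thus ?thesis by (simp add: Pair scale_pair_def quad_form_def norm_mult power_mult_distrib del: of_nat_Suc)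
qed

context
  fixes \<tau> :: complex
  assumes \<tau>: "Im \<tau> > 0"
begin

lemma quad_form_powr_summable:
  assumes "Re s > 1"
  shows "(\<lambda>p. complex_of_real (quad_form \<tau> p) powr (- s)) summable_on lattice"
proof (rule abs_summable_summable)
  have "(\<lambda>p. quad_form \<tau> p powr (- Re s)) summable_on lattice" by (rule quad_form_summable[OF \<tau> assms])
  thus "(\<lambda>p. norm (complex_of_real (quad_form \<tau> p) powr (- s))) summable_on lattice"
    by (rule summable_on_cong[THEN iffD1, rotated]) (use quad_form_pos[OF \<tau>] in \<open>simp add: norm_powr_real_powr less_imp_le\<close>)
qed

lemma eisenstein_series_eq:
  "eisenstein_series \<tau> s = (\<Sum>\<^sub>\<infinity>K\<in>cosets_inf. of_real (quad_form \<tau> (coset_row K)) powr (- s))"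
  unfolding eisenstein_series_def
proof (rule infsum_cong)
  fix K assume K: "K \<in> cosets_inf"
  define A where "A = (SOME A. A \<in> K)"
  define r where "r = cmod (of_int (A $ 2 $ 1) * \<tau> + of_int (A $ 2 $ 2))"
  have q: "quad_form \<tau> (coset_row K) = r\<^sup>2 / Im \<tau>" by (simp add: quad_form_def coset_row_def bottom_row_def A_def r_def)
  have "quad_form \<tau> (coset_row K) > 0" using quad_form_pos[OF \<tau>] coset_eq(1)[OF K] coprime_pairs_lattice by blast
  hence "r \<noteq> 0" unfolding q by auto
  hence r: "r > 0" by (simp add: r_def)
  have "complex_of_real (r\<^sup>2 / Im \<tau>) powr (- s) = exp (- s * of_real (2 * ln r - ln (Im \<tau>)))"
    using r \<tau> by (simp add: powr_def ln_div ln_realpow Ln_of_real del: of_real_power of_real_divide)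
  also have "\<dots> = of_real (Im \<tau>) powr s / of_real r powr (2 * s)"
    using r \<tau> by (simp add: powr_def Ln_of_real algebra_simps flip: exp_diff)
  finally show "(let A = SOME A. A \<in> K in of_real (Im \<tau>) powr s /
        of_real (cmod (of_int (A $ 2 $ 1) * \<tau> + of_int (A $ 2 $ 2))) powr (2 * s)) = of_real (quad_form \<tau> (coset_row K)) powr (- s)"
    by (simp add: q Let_def flip: A_def r_def)
qed

text \<open>The classical splitting of the Epstein zeta function as 2 \<zeta>(2s) E(\<tau>, s):
  every nonzero lattice vector is a positive integer times a coprime pair. Both Dirichlet series
  carry the same power of pi, since pi is part of \<open>epstein_lam\<close> and of
  \<open>zeta_lam\<close>.\<close>

lemma epstein_eq_zeta_eisenstein:
  assumes s: "Re s > 1"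
  shows "theta_series.D (epstein_lam \<tau>) s = 2 * theta1.D s * eisenstein_series \<tau> s"
proof -
  interpret E: theta_series "epstein_lam \<tau>" 1 1 by (rule theta_series_epstein[OF \<tau>])
  define a where "a = (\<lambda>k. complex_of_real (zeta_lam k) powr (- s))"
  define b where "b = (\<lambda>p. complex_of_real (quad_form \<tau> p) powr (- s))"
  have bs: "b summable_on lattice" unfolding b_def by (rule quad_form_powr_summable[OF s])
  have "E.D s = (\<Sum>n. of_real pi powr (- s) * b (from_nat_into lattice n))"
    unfolding E.D_def by (intro suminf_cong) (simp add: epstein_lam_def b_def powr_times_real less_imp_le quad_form_pos[OF \<tau>] bij_betw_apply[OF lattice_bij])
  also have "\<dots> = (\<Sum>\<^sub>\<infinity>p\<in>lattice. of_real pi powr (- s) * b p)"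
    by (rule sums_unique[symmetric], rule sums_infsum_bij[OF lattice_bij]) (intro summable_on_cmult_right bs)
  finally have D2: "E.D s = (\<Sum>\<^sub>\<infinity>p\<in>lattice. of_real pi powr (- s) * b p)" .
  have ab: "of_real pi powr (- s) * b (scale_pair (k, p)) = a k * b p" if "p \<in> coprime_pairs" for k p
  proof -
    have "quad_form \<tau> p > 0" using quad_form_pos[OF \<tau>] that coprime_pairs_lattice by blast
    thus ?thesis
      by (simp add: a_def b_def quad_form_scale zeta_lam_def powr_times_real mult.assoc del: of_nat_Suc of_real_power)
  qed
  have sm: "(\<lambda>(k, p). a k * b p) summable_on UNIV \<times> coprime_pairs"
  proof -
    have "(\<lambda>x. of_real pi powr (- s) * b (scale_pair x)) summable_on UNIV \<times> coprime_pairs"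
      unfolding summable_on_reindex_bij_betw[OF scale_pair_bij, of "\<lambda>p. of_real pi powr (- s) * b p"]
      by (intro summable_on_cmult_right bs)
    thus ?thesis by (rule summable_on_cong[THEN iffD1, rotated]) (use ab in auto)
  qed
  have "E.D s = (\<Sum>\<^sub>\<infinity>x\<in>UNIV \<times> coprime_pairs. of_real pi powr (- s) * b (scale_pair x))"
    unfolding D2 by (rule infsum_reindex_bij_betw[OF scale_pair_bij, symmetric])
  also have "\<dots> = (\<Sum>\<^sub>\<infinity>(k, p)\<in>UNIV \<times> coprime_pairs. a k * b p)"
    by (intro infsum_cong) (use ab in auto)
  also have "\<dots> = (\<Sum>\<^sub>\<infinity>k. \<Sum>\<^sub>\<infinity>p\<in>coprime_pairs. a k * b p)"
    by (rule infsum_Sigma'_banach[OF sm, symmetric])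
  also have "\<dots> = (\<Sum>\<^sub>\<infinity>k. a k) * infsum b coprime_pairs"
    by (simp only: infsum_cmult_right' infsum_cmult_left')
  also have "(\<Sum>\<^sub>\<infinity>k. a k) = theta1.D s"
  proof -
    have "summable (\<lambda>n. norm (a n))"
      using theta1.lam_summable[of "Re s"] s theta1.lam_pos by (simp add: a_def norm_powr_real_powr less_imp_le)
    hence "a summable_on UNIV" by (rule norm_summable_imp_summable_on)
    hence "a sums (\<Sum>\<^sub>\<infinity>k. a k)" by (intro has_sum_imp_sums has_sum_infsum)
    thus ?thesis unfolding theta1.D_def a_def by (rule sums_unique)
  qed
  also have "infsum b coprime_pairs = 2 * (\<Sum>\<^sub>\<infinity>K\<in>cosets_inf. b (coset_row K))"
  proof (rule infsum_coprime_pairs)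
    show "b summable_on coprime_pairs" by (rule summable_on_subset_banach[OF bs coprime_pairs_lattice])
    show "b (neg_pair p) = b p" for p
    proof (cases p)
      case (Pair m n)
      have "of_int (- m) * \<tau> + of_int (- n) = - (of_int m * \<tau> + of_int n)" by simp
      hence "norm (of_int (- m) * \<tau> + of_int (- n)) = norm (of_int m * \<tau> + of_int n)" by (simp only: norm_minus_cancel)
      thus ?thesis by (simp only: b_def quad_form_def neg_pair_def Pair prod.case)
    qed
  qed
  also have "(\<Sum>\<^sub>\<infinity>K\<in>cosets_inf. b (coset_row K)) = eisenstein_series \<tau> s"
    unfolding eisenstein_series_eq b_def ..
  finally show ?thesis by (simp only: mult_ac)
qed

end

section \<open>Meromorphic continuations\<close>

lemma entire_eventually_nonzero:
  assumes "f holomorphic_on UNIV" "f b \<noteq> 0"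
  shows "eventually (\<lambda>s. f s \<noteq> 0) (at z)"
proof -
  have "eventually (\<lambda>s. f s \<noteq> 0 \<and> s \<in> UNIV) (at z)"
    by (rule non_zero_neighbour_alt[OF assms(1) open_UNIV connected_UNIV UNIV_I UNIV_I assms(2)])
  thus ?thesis by simp
qed

lemma nicely_meromorphic_remove_sings:
  assumes "g nicely_meromorphic_on UNIV"
  shows "remove_sings g z = g z"
proof -
  have "is_pole g z \<and> g z = 0 \<or> g \<midarrow>z\<rightarrow> g z" using assms by (auto simp: nicely_meromorphic_on_def)
  thus ?thesis by (elim disjE conjE) (simp_all add: remove_sings_at_pole remove_sings_eqI)
qed

text \<open>The identity theorem is applied to the difference with its singularities removed, since
  poles of \<open>f\<close> and \<open>g\<close> may cancel in it.\<close>

lemma nicely_meromorphic_eqI: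
  assumes "f nicely_meromorphic_on UNIV" "g nicely_meromorphic_on UNIV" "\<And>s. Re s > 1 \<Longrightarrow> f s = g s"
  shows "f = g"
proof
  fix z
  define d where "d = remove_sings (\<lambda>s. f s - g s)"
  have m: "(\<lambda>s. f s - g s) meromorphic_on UNIV"
    using assms by (intro meromorphic_intros) (auto simp: nicely_meromorphic_on_def)
  have nd: "d nicely_meromorphic_on UNIV" unfolding d_def by (rule remove_sings_nicely_meromorphic[OF m])
  have ed: "eventually (\<lambda>s. d s = f s - g s) (at z)" for z
    unfolding d_def using m by (intro eventually_remove_sings_eq_at) (auto simp: meromorphic_on_altdef)
  have "eventually (\<lambda>s. s \<in> {s. 1 < Re s}) (at (2::complex))"
    by (rule eventually_at_in_open') (auto simp: open_halfspace_Re_gt)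
  with ed[of 2] have "eventually (\<lambda>s. d s = 0) (at 2)" by eventually_elim (use assms(3) in auto)
  hence "frequently (\<lambda>s. d s = 0) (at 2)" by (rule eventually_frequently[rotated]) simp
  hence d0: "d s = 0" for s by (rule frequently_eq_meromorphic_imp_constant[OF _ nd]) auto
  have "remove_sings f z = remove_sings g z"
  proof (rule remove_sings_cong[OF _ refl])
    show "eventually (\<lambda>s. f s = g s) (at z)" using ed[of z] by eventually_elim (simp add: d0)
  qed
  thus "f z = g z" using assms by (simp add: nicely_meromorphic_remove_sings)
qed

lemma meromorphic_continuation_eqI:
  assumes "g nicely_meromorphic_on UNIV" "\<And>s. Re s > 1 \<Longrightarrow> g s = f s"
  shows "meromorphic_continuation f = g"
  unfolding meromorphic_continuation_def
proof (rule the_equality)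
  fix h assume h: "h nicely_meromorphic_on UNIV \<and> (\<forall>s. Re s > 1 \<longrightarrow> h s = f s)"
  show "h = g" by (rule nicely_meromorphic_eqI) (use h assms in simp_all)
qed (use assms in simp)

lemma eventually_notin_finite_at: "finite X \<Longrightarrow> eventually (\<lambda>s. s \<notin> X) (at (z :: complex))"
proof -
  assume "finite X"
  hence "open (- (X - {z}))" by (intro open_Compl finite_imp_closed) auto
  hence "eventually (\<lambda>s. s \<in> - (X - {z}) - {z}) (at z)" by (intro eventually_at_in_open) auto
  thus ?thesis by eventually_elim auto
qed

lemma entire_quotient_meromorphic:
  assumes "P holomorphic_on UNIV" "V holomorphic_on UNIV"
  shows "(\<lambda>s. P s / V s) meromorphic_on UNIV"
  by (intro meromorphic_on_divide analytic_on_imp_meromorphic_on) (use assms in \<open>simp_all add: analytic_on_open\<close>)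

lemma entire_quotient_analytic:
  assumes "P holomorphic_on UNIV" "V holomorphic_on UNIV" "V z \<noteq> 0"
  shows "(\<lambda>s. P s / V s) analytic_on {z}"
  by (rule analytic_on_divide[OF holomorphic_on_imp_analytic_at[OF assms(1) open_UNIV UNIV_I] holomorphic_on_imp_analytic_at[OF assms(2) open_UNIV UNIV_I]])
    (use assms(3) in simp)

lemma entire_quotient_remove_sings:
  assumes "P holomorphic_on UNIV" "V holomorphic_on UNIV" "V z \<noteq> 0"
  shows "remove_sings (\<lambda>s. P s / V s) z = P z / V z"
  by (rule remove_sings_at_analytic[OF entire_quotient_analytic[OF assms]])

lemma compose_entire:
  assumes "f holomorphic_on UNIV" "g holomorphic_on UNIV"
  shows "(\<lambda>s. f (g s)) holomorphic_on UNIV"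
  using holomorphic_on_compose_gen[OF assms(2,1)] by (simp add: o_def)

section \<open>The completed zeta function\<close>

lemma theta1_D_half:
  assumes s: "Re s > 1"
  shows "(\<Sum>n. 1 / of_nat (Suc n) powr s) = of_real pi powr (s / 2) * theta1.D (s / 2)"
proof -
  have t: "1 / of_nat (Suc n) powr s = of_real pi powr (s / 2) * of_real (zeta_lam n) powr (- (s / 2))" for n
  proof -
    have "complex_of_real (zeta_lam n) powr (- (s / 2)) = exp (- (s / 2) * of_real (ln pi + 2 * ln (real (Suc n))))"
      by (simp add: zeta_lam_def powr_def Ln_of_real ln_mult ln_realpow del: of_nat_Suc of_real_mult of_real_power)
    moreover have "of_nat (Suc n) powr s = exp (s * of_real (ln (real (Suc n))))"
      by (simp add: powr_def Ln_of_nat del: of_nat_Suc)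
    moreover have "of_real pi powr (s / 2) = exp (s / 2 * of_real (ln pi))" by (simp add: powr_def Ln_of_real)
    ultimately show ?thesis by (simp add: algebra_simps exp_minus field_simps flip: exp_add exp_diff)
  qed
  have "summable (\<lambda>n. norm (complex_of_real (zeta_lam n) powr (- (s / 2))))"
    using theta1.lam_summable[of "Re (s / 2)"] s theta1.lam_pos by (simp add: norm_powr_real_powr less_imp_le)
  hence "summable (\<lambda>n. complex_of_real (zeta_lam n) powr (- (s / 2)))" by (rule summable_norm_cancel)
  thus ?thesis unfolding t theta1.D_def by (rule suminf_mult)
qed

lemma theta1_half_holomorphic: "(\<lambda>s. theta1.U (s / 2)) holomorphic_on UNIV"
  by (rule compose_entire[OF theta1.U_holomorphic]) (intro holomorphic_intros, simp)

lemma theta1_U_half: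
  assumes "Re s > 1"
  shows "2 * theta1.U (s / 2) = s * (s - 1) * Gamma (s / 2) * theta1.D (s / 2)"
proof -
  have h: "s / 2 - complex_of_real (1 / 2) = (s - 1) / 2" by (simp add: diff_divide_distrib)
  have "theta1.U (s / 2) = of_real 2 * (s / 2) * (s / 2 - of_real (1 / 2)) * Gamma (s / 2) * theta1.D (s / 2)"
    by (rule theta1.U_eq) (use assms in simp)
  thus ?thesis unfolding h by (simp add: mult.commute[of _ 2])
qed

text \<open>Writing 1 / Gamma as the entire function \<open>rGamma\<close> leaves
  \<open>s * (s - 1)\<close> as the only denominator, so the right-hand side is a quotient of entire
  functions and continues the Dirichlet series.\<close>

lemma riemann_zeta_eq:
  assumes "s \<noteq> 0" "s \<noteq> 1"
  shows "riemann_zeta s = of_real pi powr (s / 2) * rGamma (s / 2) * (2 * theta1.U (s / 2)) / (s * (s - 1))"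
proof -
  define P where "P = (\<lambda>s. of_real pi powr (s / 2) * rGamma (s / 2) * (2 * theta1.U (s / 2)))"
  define V where "V = (\<lambda>s::complex. s * (s - 1))"
  have PV: "P holomorphic_on UNIV" "V holomorphic_on UNIV"
    unfolding P_def V_def by (auto intro!: holomorphic_intros theta1_half_holomorphic compose_entire[of rGamma])
  have "riemann_zeta = remove_sings (\<lambda>s. P s / V s)"
    unfolding riemann_zeta_def
  proof (rule meromorphic_continuation_eqI)
    show "remove_sings (\<lambda>s. P s / V s) nicely_meromorphic_on UNIV"
      by (intro remove_sings_nicely_meromorphic entire_quotient_meromorphic PV)
    fix s :: complex assume s: "Re s > 1"
    have nz: "s \<noteq> 0" "s \<noteq> 1" using s by auto
    have "Gamma (s / 2) \<noteq> 0" by (rule Gamma_nonzero) (use s in \<open>auto elim!: nonpos_Ints_cases simp: complex_eq_iff\<close>)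
    hence "P s / V s = of_real pi powr (s / 2) * theta1.D (s / 2)"
      unfolding P_def V_def theta1_U_half[OF s] using nz by (simp add: rGamma_inverse_Gamma)
    thus "remove_sings (\<lambda>s. P s / V s) s = (\<Sum>n. 1 / of_nat (Suc n) powr s)"
      using entire_quotient_remove_sings[OF PV, of s] nz theta1_D_half[OF s] by (simp add: V_def)
  qed
  thus ?thesis using entire_quotient_remove_sings[OF PV, of s] assms by (simp add: V_def P_def)
qed

lemma Lambda_Q_eq:
  assumes "s \<noteq> 0" "s \<noteq> 1"
  shows "Lambda_Q s = 2 * theta1.U (s / 2) / (s * (s - 1))"
proof -
  have r: "(\<lambda>s. rGamma (s / 2)) holomorphic_on (UNIV :: complex set)"
    by (rule compose_entire[of rGamma]) (auto intro!: holomorphic_intros)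
  have V: "(\<lambda>s::complex. s * (s - 1)) holomorphic_on UNIV" "(\<lambda>s. 2 * theta1.U (s / 2)) holomorphic_on UNIV"
    by (auto intro!: holomorphic_intros theta1_half_holomorphic)
  have "Lambda_Q s = remove_sings (\<lambda>s. 2 * theta1.U (s / 2) / (s * (s - 1))) s"
    unfolding Lambda_Q_def
  proof (rule remove_sings_cong[OF _ refl])
    have "eventually (\<lambda>s::complex. rGamma (s / 2) \<noteq> 0) (at s)"
      by (rule entire_eventually_nonzero[OF r, of 2]) (simp add: rGamma_inverse_Gamma)
    moreover have "eventually (\<lambda>s. s \<notin> {0, 1}) (at s)" by (rule eventually_notin_finite_at) simp
    ultimately show "eventually (\<lambda>s. of_real pi powr (- s / 2) * Gamma (s / 2) * riemann_zeta s = 2 * theta1.U (s / 2) / (s * (s - 1))) (at s)"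
    proof eventually_elim
      case (elim s)
      have "of_real pi powr (- s / 2) * of_real pi powr (s / 2) = (1::complex)" by (simp flip: powr_add)
      moreover have "Gamma (s / 2) * rGamma (s / 2) = 1" using elim by (simp add: rGamma_inverse_Gamma)
      ultimately have "(of_real pi powr (- s / 2) * of_real pi powr (s / 2)) * (Gamma (s / 2) * rGamma (s / 2)) = 1" by simp
      hence "of_real pi powr (- s / 2) * Gamma (s / 2) * (of_real pi powr (s / 2) * rGamma (s / 2) * (2 * theta1.U (s / 2)) / (s * (s - 1))) = 2 * theta1.U (s / 2) / (s * (s - 1))"
        by (simp add: mult_ac)
      thus ?case using elim by (simp add: riemann_zeta_eq)
    qed
  qed
  thus ?thesis using entire_quotient_remove_sings[OF V(2,1), of s] assms by simp
qed

section \<open>Quotients of symmetric entire functions\<close>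

text \<open>Covers \<open>Z_Q\<close> and \<open>Z_Q_dual\<close> at once. \<alpha> is both the
  half-width of the strip of \<open>f\<close>, hence the upper rate of \<open>V\<close>, and the
  rate in the lower bound \<open>V_low\<close>; \<gamma> is the larger rate of
  \<open>P\<close>.\<close>

locale meromorphic_quotient =
  fixes Z f P :: "complex \<Rightarrow> complex" and \<alpha> \<gamma> :: real
  assumes f: "rapid_on_strip \<alpha> f" and \<alpha>: "0 < \<alpha>" "\<alpha> < \<gamma>"
    and V_sym: "\<And>s. laplace (\<lambda>t. f (of_real t)) (1 - s) = laplace (\<lambda>t. f (of_real t)) s"
    and V_nz: "\<exists>B>0. \<forall>s. \<bar>Re s\<bar> \<ge> B \<longrightarrow> laplace (\<lambda>t. f (of_real t)) s \<noteq> 0"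
    and V_low: "\<And>a0. \<exists>a\<ge>a0. \<exists>c>0. \<forall>t. c * exp (- \<alpha> * \<bar>t\<bar>) \<le> norm (laplace (\<lambda>t. f (of_real t)) (Complex a t))"
    and P_holo: "P holomorphic_on UNIV" and P_sym: "\<And>s. P (1 - s) = P s"
    and P_decay: "\<And>M. \<exists>C\<ge>0. \<forall>s. \<bar>Re s\<bar> \<le> M \<longrightarrow> norm (P s) \<le> C * exp (- \<gamma> * \<bar>Im s\<bar>)"
    and Z: "Z = remove_sings (\<lambda>s. P s / laplace (\<lambda>t. f (of_real t)) s)"
begin

abbreviation V :: "complex \<Rightarrow> complex" where "V \<equiv> laplace (\<lambda>t. f (of_real t))"

lemma V_holo: "V holomorphic_on UNIV"
  by (rule laplace_rapid_entire[OF f \<alpha>(1)])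

lemma V_eventually: "eventually (\<lambda>s. V s \<noteq> 0) (at z)"
proof -
  obtain B where B: "B > 0" "\<And>s. \<bar>Re s\<bar> \<ge> B \<Longrightarrow> V s \<noteq> 0" using V_nz by blast
  show ?thesis by (rule entire_eventually_nonzero[OF V_holo B(2)[of "of_real B"]]) (use B in auto)
qed

lemma Z_eq: "V s \<noteq> 0 \<Longrightarrow> Z s = P s / V s"
  unfolding Z by (rule entire_quotient_remove_sings[OF P_holo V_holo])

lemma Z_analytic: "\<not> is_pole Z z \<Longrightarrow> Z analytic_on {z}"
  unfolding Z by (rule nicely_meromorphic_on_imp_analytic_at[of _ UNIV])
    (auto intro!: remove_sings_nicely_meromorphic entire_quotient_meromorphic P_holo V_holo)

lemma pole_imp_V_zero:
  assumes "is_pole Z z"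
  shows "V z = 0"
proof (rule ccontr)
  assume "V z \<noteq> 0"
  hence an: "(\<lambda>s. P s / V s) analytic_on {z}" by (rule entire_quotient_analytic[OF P_holo V_holo])
  have "Z analytic_on {z}"
    unfolding Z by (rule remove_sings_analytic_at[OF isolated_singularity_at_analytic[OF an] isContD[OF analytic_at_imp_isCont[OF an]]])
  thus False using assms analytic_at_imp_no_pole by blast
qed

text \<open>Where \<open>V\<close> does not vanish this is the definition of \<open>Z\<close>. At a
  zero of \<open>V\<close> that is no pole of \<open>Z\<close> it follows by continuity, and this is
  where \<open>remove_sings\<close> in \<open>Z\<close> matters.\<close>

lemma Z_times_V:
  assumes "\<not> is_pole Z z"
  shows "Z z * V z = P z"
proof -
  have "isCont V z" using holomorphic_on_imp_continuous_on[OF V_holo] by (simp add: continuous_on_eq_continuous_at)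
  moreover have "isCont P z" using holomorphic_on_imp_continuous_on[OF P_holo] by (simp add: continuous_on_eq_continuous_at)
  ultimately have lim: "((\<lambda>s. Z s * V s) \<longlongrightarrow> Z z * V z) (at z)" "(P \<longlongrightarrow> P z) (at z)"
    using analytic_at_imp_isCont[OF Z_analytic[OF assms]] by (auto intro!: tendsto_mult simp: isCont_def)
  have "eventually (\<lambda>s. Z s * V s = P s) (at z)"
    using V_eventually by eventually_elim (simp add: Z_eq)
  hence "((\<lambda>s. Z s * V s) \<longlongrightarrow> P z) (at z)" by (rule tendsto_cong[THEN iffD2]) (rule lim(2))
  with lim(1) show ?thesis by (rule tendsto_unique[OF at_neq_bot])
qed

lemma ex_poles_in_strip: "\<exists>w>0. poles_in_strip Z w"
proof -
  obtain B where B: "B > 0" "\<And>s. \<bar>Re s\<bar> \<ge> B \<Longrightarrow> V s \<noteq> 0" using V_nz by blast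
  have "\<bar>Re s - 1 / 2\<bar> \<le> B + 1 / 2" if "is_pole Z s" for s
  proof -
    have "\<bar>Re s\<bar> < B" using B(2)[of s] pole_imp_V_zero[OF that] by force
    thus ?thesis by (simp add: abs_if split: if_splits)
  qed
  thus ?thesis using B(1) by (intro exI[of _ "B + 1 / 2"]) (auto simp: poles_in_strip_def)
qed

context
  fixes w c :: real
  assumes w: "w > 0" "poles_in_strip Z w" and c: "c > 1 / 2 + w"
begin

lemma no_pole: "1 / 2 + w < Re z \<Longrightarrow> \<not> is_pole Z z"
proof
  assume "1 / 2 + w < Re z" "is_pole Z z"
  moreover from this have "\<bar>Re z - 1 / 2\<bar> \<le> w" using w(2) by (simp add: poles_in_strip_def)
  ultimately show False by (simp add: abs_le_iff)
qed

lemma Z_holo: "Z holomorphic_on {z. 1 / 2 + w < Re z}"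
proof -
  have "Z analytic_on {z. 1 / 2 + w < Re z}"
    using Z_analytic no_pole by (subst analytic_on_analytic_at) auto
  thus ?thesis by (rule analytic_imp_holomorphic)
qed

text \<open>The strip up to \<open>c + 1\<close>, and not just the line, provides the second line
  and the overlap that \<open>single_sign_imp_entire_quotient\<close> works with.\<close>

lemma Z_decay: "\<exists>C. \<exists>d>0. \<forall>z. c \<le> Re z \<and> Re z \<le> c + 1 \<longrightarrow> norm (Z z) \<le> C * exp (- d * \<bar>Im z\<bar>)"
proof (rule quotient_decay[OF Z_holo holomorphic_on_subset[OF V_holo] \<alpha> V_low laplace_rapid_decay[OF f] _ c])
  fix M
  obtain C where C: "C \<ge> 0" "\<And>s. \<bar>Re s\<bar> \<le> M \<Longrightarrow> norm (P s) \<le> C * exp (- \<gamma> * \<bar>Im s\<bar>)" using P_decay[of M] by blast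
  show "\<exists>C\<ge>0. \<forall>s. 1 / 2 + w < Re s \<longrightarrow> \<bar>Re s\<bar> \<le> M \<longrightarrow> norm (Z s * V s) \<le> C * exp (- \<gamma> * \<bar>Im s\<bar>)"
    using C Z_times_V[OF no_pole] by (intro exI[of _ C]) auto
qed auto

lemma ex_core: "\<exists>C d. mean_periodic_core Z c d C \<alpha> f P \<and> (\<forall>z. c \<le> Re z \<and> Re z \<le> c + 1 \<longrightarrow> norm (Z z) \<le> C * exp (- d * \<bar>Im z\<bar>))"
proof -
  obtain C d where C: "d > 0" "\<And>z. c \<le> Re z \<Longrightarrow> Re z \<le> c + 1 \<Longrightarrow> norm (Z z) \<le> C * exp (- d * \<bar>Im z\<bar>)"
    using Z_decay by blast
  have "mean_periodic_core Z c d C \<alpha> f P"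
  proof
    show "continuous_on UNIV (\<lambda>t. Z (Complex c t))"
      by (rule continuous_on_compose2[OF holomorphic_on_imp_continuous_on[OF Z_holo]])
         (use c in \<open>auto simp: Complex_eq intro!: continuous_intros\<close>)
    show "norm (Z (Complex c t)) \<le> C * exp (- d * \<bar>t\<bar>)" for t using C(2)[of "Complex c t"] by simp
    show "\<exists>s. V s \<noteq> 0" using eventually_happens[OF V_eventually] by auto
    show "Z (Complex c t) * V (Complex c t) = P (Complex c t)" for t
      by (rule Z_times_V[OF no_pole]) (use c in simp)
    show "\<exists>C. \<exists>\<delta>>0. \<forall>s. \<bar>Re s\<bar> \<le> M \<longrightarrow> norm (P s) \<le> C * exp (- \<delta> * \<bar>Im s\<bar>)" for M
    proof -
      have "\<gamma> > 0" using \<alpha> by simp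
      thus ?thesis using P_decay[of M] by blast
    qed
  qed (use C \<alpha> c w f V_sym P_holo P_sym in auto)
  thus ?thesis using C by blast
qed

lemma mean_periodic:
  "x > 0 \<Longrightarrow> integrable lborel (mellin_integrand Z c x)"
  "C_poly_mean_periodic (boundary_fun Z c)" "S_dual_mean_periodic (boundary_fun Z c)"
proof -
  obtain C d where "mean_periodic_core Z c d C \<alpha> f P" using ex_core by blast
  then interpret M: mean_periodic_core Z c d C \<alpha> f P .
  show "x > 0 \<Longrightarrow> integrable lborel (mellin_integrand Z c x)" by (rule M.mellin_integrand_integrable)
  show "C_poly_mean_periodic (boundary_fun Z c)" by (rule M.C_poly_mean_periodic_boundary)
  show "S_dual_mean_periodic (boundary_fun Z c)" by (rule M.S_dual_mean_periodic_boundary)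
qed

text \<open>All poles have real part within \<open>w\<close> of 1/2, hence lie in the strip
  \<open>1 - (c + 1) < Re s < c + 1\<close>. There the holomorphic function \<open>Y\<close> agrees
  with \<open>Z\<close> off the zeros of \<open>V\<close>.\<close>

lemma single_sign_no_poles:
  assumes real: "\<And>x. V (of_real x) \<noteq> 0" and ss: "single_sign (boundary_fun Z c)"
  shows "\<not> is_pole Z p"
proof
  assume p: "is_pole Z p"
  obtain C d where core: "mean_periodic_core Z c d C \<alpha> f P"
    and b: "\<And>z. c \<le> Re z \<Longrightarrow> Re z \<le> c + 1 \<Longrightarrow> norm (Z z) \<le> C * exp (- d * \<bar>Im z\<bar>)" using ex_core by blast
  interpret M: mean_periodic_core Z c d C \<alpha> f P by (rule core)
  define S where "S = {s. 1 - (c + 1) < Re s} \<inter> {s. Re s < c + 1}"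
  have oS: "open S" unfolding S_def by (intro open_Int open_halfspace_Re_gt open_halfspace_Re_lt)
  have "\<exists>Y. Y holomorphic_on {s. 1 - (c + 1) < Re s \<and> Re s < c + 1} \<and> (\<forall>s. 1 - (c + 1) < Re s \<and> Re s < c + 1 \<longrightarrow> Y s * V s = P s)"
  proof (rule M.single_sign_imp_entire_quotient[OF _ _ b _ real ss])
    show "Z holomorphic_on {s. c \<le> Re s \<and> Re s \<le> c + 1}"
      by (rule holomorphic_on_subset[OF Z_holo]) (use c in auto)
    show "Z s * V s = P s" if "c \<le> Re s" for s
      by (rule Z_times_V[OF no_pole]) (use c that in simp)
  qed auto
  then obtain Y where Y: "Y holomorphic_on S" "\<And>s. s \<in> S \<Longrightarrow> Y s * V s = P s" by (auto simp: S_def Int_def)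
  have pS: "p \<in> S" using p w c by (auto simp: S_def poles_in_strip_def abs_le_iff)
  have "eventually (\<lambda>s. s \<in> S) (at p)" by (rule eventually_at_in_open'[OF oS pS])
  with V_eventually[of p] have "eventually (\<lambda>s. Z s = Y s) (at p)"
    by eventually_elim (use Y(2) in \<open>auto simp: Z_eq field_simps\<close>)
  hence "is_pole Y p" using p by (subst (asm) is_pole_cong[OF _ refl]) auto
  thus False using not_is_pole_holomorphic[OF oS pS Y(1)] by blast
qed

end

end

section \<open>The quotients for the Eisenstein series\<close>

lemma zeta_half_quotient_low:
  "\<exists>a\<ge>a0. \<exists>c>0. \<forall>t. c * exp (- (pi / 4) * \<bar>t\<bar>) \<le> norm (4 * theta1.U (Complex a t / 2))"
proof -
  obtain a c where a: "a \<ge> \<bar>a0\<bar>" "c > 0" "\<And>t. c * exp (- (pi / 2) * \<bar>t\<bar>) \<le> norm (theta1.U (Complex a t))"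
    using theta1.U_lower_bound by blast
  have "4 * c * exp (- (pi / 4) * \<bar>t\<bar>) \<le> norm (4 * theta1.U (Complex (2 * a) t / 2))" for t
  proof -
    have e: "Complex (2 * a) t / 2 = Complex a (t / 2)" by (simp add: complex_eq_iff)
    have "c * exp (- (pi / 2) * \<bar>t / 2\<bar>) \<le> norm (theta1.U (Complex a (t / 2)))" by (rule a(3))
    moreover have "- (pi / 2) * \<bar>t / 2\<bar> = - (pi / 4) * \<bar>t\<bar>" by simp
    ultimately show ?thesis unfolding e norm_mult by simp
  qed
  moreover have "2 * a \<ge> a0" using a(1) by simp
  moreover have "4 * c > 0" using a(2) by simp
  ultimately show ?thesis by blast
qed

text \<open>The 4 is the constant in the denominator of \<open>Z_Q_eq\<close>; the other factor 2 of
  the 8 compensates the substitution of \<open>2 * t\<close> for \<open>t\<close>.\<close>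

lemma laplace_half:
  "laplace (\<lambda>t. 8 * theta1.u (2 * of_real t)) s = 4 * theta1.U (s / 2)"
proof -
  have "theta1.U (s / 2) = (LINT t|lborel. theta1.u (of_real t) * exp (s / 2 * of_real t))"
    by (simp add: theta1.U_def laplace_def)
  also have "\<dots> = 2 * (LINT t|lborel. theta1.u (2 * of_real t) * exp (s * of_real t))"
    by (subst lborel_integral_real_affine[where c = 2 and t = 0]) (simp_all add: scaleR_conv_of_real)
  finally have "4 * theta1.U (s / 2) = 8 * (LINT t|lborel. theta1.u (2 * of_real t) * exp (s * of_real t))" by simp
  thus ?thesis by (simp only: laplace_def mult.assoc integral_mult_right_zero)
qed

lemma rapid_laplace_one_minus:
  assumes g: "rapid_on_strip \<alpha> g" and \<alpha>: "\<alpha> > 0"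
  shows "rapid_on_strip \<alpha> (\<lambda>w. 2 * deriv g w + g w)"
    "laplace (\<lambda>t. 2 * deriv g (of_real t) + g (of_real t)) s = (1 - 2 * s) * laplace (\<lambda>t. g (of_real t)) s"
proof -
  have g': "rapid_on_strip \<alpha> (deriv g)" by (rule rapid_on_strip_deriv[OF g])
  show "rapid_on_strip \<alpha> (\<lambda>w. 2 * deriv g w + g w)"
    by (rule rapid_on_strip_add[OF rapid_on_strip_cmult[OF g'] g])
  have "laplace (\<lambda>t. 2 * deriv g (of_real t) + g (of_real t)) s =
      (LINT t|lborel. 2 * (deriv g (of_real t) * exp (s * of_real t)) + g (of_real t) * exp (s * of_real t))"
    by (simp add: laplace_def distrib_right mult.assoc)
  also have "\<dots> = 2 * laplace (\<lambda>t. deriv g (of_real t)) s + laplace (\<lambda>t. g (of_real t)) s"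
    unfolding laplace_def
    by (subst Bochner_Integration.integral_add)
       (simp_all add: rapid_on_strip_integrable(1)[OF g' \<alpha>] rapid_on_strip_integrable(1)[OF g \<alpha>])
  also have "\<dots> = (1 - 2 * s) * laplace (\<lambda>t. g (of_real t)) s"
    unfolding laplace_rapid_deriv[OF g \<alpha>] by (simp add: algebra_simps)
  finally show "laplace (\<lambda>t. 2 * deriv g (of_real t) + g (of_real t)) s = (1 - 2 * s) * laplace (\<lambda>t. g (of_real t)) s" .
qed

text \<open>Positivity of the Jacobi kernel comes down to \<open>lam n > k + 1\<close>, that is pi >
  3/2 for the smallest term.\<close>

lemma laplace_half_real_nonzero: "laplace (\<lambda>t. 8 * theta1.u (2 * of_real t)) (of_real x) \<noteq> 0"
proof -
  have "zeta_lam n > 1 / 2 + 1" for n using zeta_lam_ge[of n] pi_gt3 by simp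
  hence "theta1.U (of_real (x / 2)) \<noteq> 0" by (rule theta1.U_real_nonzero)
  thus ?thesis unfolding laplace_half by simp
qed

context
  fixes \<tau> :: complex
  assumes \<tau>: "Im \<tau> > 0"
begin

interpretation E: theta_series "epstein_lam \<tau>" 1 1 by (rule theta_series_epstein[OF \<tau>])

text \<open>The 2 in the denominator reflects the two coprime pairs per coset in
  \<open>epstein_eq_zeta_eisenstein\<close>.\<close>

lemma E_hat_eq:
  assumes "s \<noteq> 0" "s \<noteq> 1"
  shows "E_hat \<tau> s = E.U s / (2 * (s * (s - 1)))"
proof -
  define V where "V = (\<lambda>s::complex. 2 * (s * (s - 1)))"
  have V: "V holomorphic_on UNIV" unfolding V_def by (intro holomorphic_intros)
  have "E_hat \<tau> = remove_sings (\<lambda>s. E.U s / V s)"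
    unfolding E_hat_def
  proof (rule meromorphic_continuation_eqI)
    show "remove_sings (\<lambda>s. E.U s / V s) nicely_meromorphic_on UNIV"
      by (intro remove_sings_nicely_meromorphic entire_quotient_meromorphic V E.U_holomorphic)
    fix s :: complex assume s: "Re s > 1"
    have nz: "s \<noteq> 0" "s - 1 \<noteq> 0" "2 * s - 1 \<noteq> 0" "2 * s \<noteq> 0" "2 * s \<noteq> 1" using s by (auto simp: complex_eq_iff)
    have "Lambda_Q (2 * s) = 2 * theta1.U (2 * s / 2) / (2 * s * (2 * s - 1))" by (rule Lambda_Q_eq) (use nz in auto)
    also have "2 * theta1.U (2 * s / 2) = 2 * s * (2 * s - 1) * Gamma (2 * s / 2) * theta1.D (2 * s / 2)"
      by (rule theta1_U_half) (use s in simp)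
    also have "\<dots> / (2 * s * (2 * s - 1)) = Gamma s * theta1.D s" using nz by simp
    finally have L: "Lambda_Q (2 * s) = Gamma s * theta1.D s" .
    have "E.U s = of_real 1 * s * (s - of_real 1) * Gamma s * E.D s" by (rule E.U_eq) (use s in simp)
    also have "\<dots> = V s * (Gamma s * theta1.D s * eisenstein_series \<tau> s)"
      unfolding epstein_eq_zeta_eisenstein[OF \<tau> s] by (simp add: V_def)
    finally have "E.U s = V s * (Lambda_Q (2 * s) * eisenstein_series \<tau> s)" unfolding L .
    moreover have "V s \<noteq> 0" using nz by (simp add: V_def)
    ultimately show "remove_sings (\<lambda>s. E.U s / V s) s = Lambda_Q (2 * s) * eisenstein_series \<tau> s"
      using entire_quotient_remove_sings[OF E.U_holomorphic V, of s] by simp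
  qed
  thus ?thesis using entire_quotient_remove_sings[OF E.U_holomorphic V, of s] assms by (simp add: V_def)
qed

lemma Z_Q_eq: "Z_Q \<tau> = remove_sings (\<lambda>s. E.U s / (4 * theta1.U (s / 2)))"
  unfolding Z_Q_def
proof (rule ext, rule remove_sings_cong[OF _ refl])
  fix z :: complex
  have "eventually (\<lambda>s. s \<notin> {0, 1}) (at z)" by (rule eventually_notin_finite_at) simp
  thus "eventually (\<lambda>s. E_hat \<tau> s / Lambda_Q s = E.U s / (4 * theta1.U (s / 2))) (at z)"
    by eventually_elim (simp add: E_hat_eq Lambda_Q_eq)
qed

text \<open>\<open>Lambda_Q (2 * s)\<close> and \<open>Lambda_Q (2 * s - 1)\<close> each contribute
  a denominator \<open>2 * s - 1\<close>, while their factors \<open>s\<close> and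
  \<open>s - 1\<close> cancel against \<open>E_hat\<close>. What remains is a square, which is
  invariant under s \<mapsto> 1 - s and can therefore be joined to \<open>E.U\<close> in the
  denominator.\<close>

lemma Z_Q_dual_eq: "Z_Q_dual \<tau> = remove_sings (\<lambda>s. 2 * (theta1.U s * theta1.U (s - 1 / 2)) / ((1 - 2 * s)\<^sup>2 * E.U s))"
  unfolding Z_Q_dual_def
proof (rule ext, rule remove_sings_cong[OF _ refl])
  fix z :: complex
  have "eventually (\<lambda>s. s \<notin> {0, 1, 1 / 2}) (at z)" by (rule eventually_notin_finite_at) simp
  thus "eventually (\<lambda>s. Lambda_Q (2 * s) * Lambda_Q (2 * s - 1) / E_hat \<tau> s =
      2 * (theta1.U s * theta1.U (s - 1 / 2)) / ((1 - 2 * s)\<^sup>2 * E.U s)) (at z)"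
  proof eventually_elim
    case (elim s)
    define r where "r = 2 * s - 1"
    define q where "q = s - 1"
    have nz: "s \<noteq> 0" "q \<noteq> 0" "r \<noteq> 0" using elim by (auto simp: r_def q_def field_simps)
    have "Lambda_Q (2 * s) = 2 * theta1.U (2 * s / 2) / (2 * s * (2 * s - 1))"
      by (rule Lambda_Q_eq) (use elim in \<open>auto simp: field_simps\<close>)
    hence 1: "Lambda_Q (2 * s) = theta1.U s / (s * r)" by (simp add: r_def)
    have "Lambda_Q (2 * s - 1) = 2 * theta1.U ((2 * s - 1) / 2) / ((2 * s - 1) * (2 * s - 1 - 1))"
      by (rule Lambda_Q_eq) (use elim in \<open>auto simp: field_simps\<close>)
    moreover have e: "(2 * s - 1) / 2 = s - 1 / 2" "2 * s - 1 - 1 = 2 * (s - 1)" by (simp_all add: diff_divide_distrib)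
    ultimately have "Lambda_Q (2 * s - 1) = 2 * theta1.U (s - 1 / 2) / (r * (2 * (s - 1)))" by (simp only: e r_def)
    also have "r * (2 * (s - 1)) = 2 * (r * (s - 1))" by (rule mult.left_commute)
    finally have 2: "Lambda_Q (2 * s - 1) = theta1.U (s - 1 / 2) / (r * (s - 1))"
      by (simp only: mult_divide_mult_cancel_left[OF zero_neq_numeral[symmetric]])
    have 3: "E_hat \<tau> s = E.U s / (2 * (s * (s - 1)))" using elim by (intro E_hat_eq) auto
    have 4: "(1 - 2 * s)\<^sup>2 = r\<^sup>2" by (simp add: r_def power2_commute)
    show ?case unfolding 1 2 3 4 q_def[symmetric] using nz by (simp add: power2_eq_square)
  qed
qed

text \<open>\<open>theta1.u\<close> lives on the strip of half-width pi / 2, and the passage from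
  \<open>s\<close> to \<open>s / 2\<close> halves this to pi / 4. \<open>E.U\<close> decays at every
  rate below pi / 2; the midpoint 3 pi / 8 is taken.\<close>

lemma Z_Q_quotient: "meromorphic_quotient (Z_Q \<tau>) (\<lambda>w. 8 * theta1.u (2 * w)) E.U (pi / 4) (3 * pi / 8)"
proof
  show "rapid_on_strip (pi / 4) (\<lambda>w. 8 * theta1.u (2 * w))"
    using rapid_on_strip_cmult[OF rapid_on_strip_double[OF theta1.u_rapid], of 8] by simp
  show "0 < pi / 4" "pi / 4 < 3 * pi / 8" by simp_all
  have "theta1.U ((1 - s) / 2) = theta1.U (s / 2)" for s
    using theta1.U_symmetric[of "s / 2"] by (simp add: diff_divide_distrib)
  thus "laplace (\<lambda>t. 8 * theta1.u (2 * of_real t)) (1 - s) = laplace (\<lambda>t. 8 * theta1.u (2 * of_real t)) s" for s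
    unfolding laplace_half by simp
  show "\<exists>B>0. \<forall>s. \<bar>Re s\<bar> \<ge> B \<longrightarrow> laplace (\<lambda>t. 8 * theta1.u (2 * of_real t)) s \<noteq> 0"
  proof -
    obtain B where "B > 0" "\<And>s. \<bar>Re s\<bar> \<ge> B \<Longrightarrow> theta1.U s \<noteq> 0" using theta1.U_nonzero by blast
    thus ?thesis unfolding laplace_half by (intro exI[of _ "2 * B"]) auto
  qed
  show "\<exists>a\<ge>a0. \<exists>c>0. \<forall>t. c * exp (- (pi / 4) * \<bar>t\<bar>) \<le> norm (laplace (\<lambda>t. 8 * theta1.u (2 * of_real t)) (Complex a t))" for a0
    unfolding laplace_half by (rule zeta_half_quotient_low)
  show "E.U holomorphic_on UNIV" by (rule E.U_holomorphic)
  show "E.U (1 - s) = E.U s" for s using E.U_symmetric[of s] by simp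
  show "\<exists>C\<ge>0. \<forall>s. \<bar>Re s\<bar> \<le> M \<longrightarrow> norm (E.U s) \<le> C * exp (- (3 * pi / 8) * \<bar>Im s\<bar>)" for M
    by (rule E.U_decay) simp_all
  show "Z_Q \<tau> = remove_sings (\<lambda>s. E.U s / laplace (\<lambda>t. 8 * theta1.u (2 * of_real t)) s)"
    unfolding laplace_half by (rule Z_Q_eq)
qed

text \<open>\<open>2 d/dw + 1\<close> multiplies the transform by \<open>1 - 2 s\<close>.\<close>
definition dual_kernel_half :: "complex \<Rightarrow> complex" where
  "dual_kernel_half w = 2 * deriv E.u w + E.u w"

definition dual_kernel :: "complex \<Rightarrow> complex" where
  "dual_kernel w = 2 * deriv dual_kernel_half w + dual_kernel_half w"

lemma dual_kernel_rapid: "rapid_on_strip (pi / 2) dual_kernel"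
  and laplace_dual_kernel: "laplace (\<lambda>t. dual_kernel (of_real t)) s = (1 - 2 * s)\<^sup>2 * E.U s"
proof -
  have p: "pi / 2 > 0" by simp
  have h: "rapid_on_strip (pi / 2) dual_kernel_half"
    unfolding dual_kernel_half_def[abs_def] by (rule rapid_laplace_one_minus(1)[OF E.u_rapid p])
  show "rapid_on_strip (pi / 2) dual_kernel"
    unfolding dual_kernel_def[abs_def] by (rule rapid_laplace_one_minus(1)[OF h p])
  have "laplace (\<lambda>t. dual_kernel_half (of_real t)) s = (1 - 2 * s) * E.U s"
    unfolding dual_kernel_half_def E.U_def by (rule rapid_laplace_one_minus(2)[OF E.u_rapid p])
  thus "laplace (\<lambda>t. dual_kernel (of_real t)) s = (1 - 2 * s)\<^sup>2 * E.U s"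
    unfolding dual_kernel_def rapid_laplace_one_minus(2)[OF h p] by (simp add: power2_eq_square)
qed

text \<open>Each of the two factors \<open>theta1.U\<close> decays at the rate 3 pi / 8, together at
  3 pi / 4, which exceeds pi / 2. Since \<open>theta1.U\<close> is symmetric about 1/4, the map s
  \<mapsto> 1 - s exchanges the two factors.\<close>

lemma Z_Q_dual_quotient:
  "meromorphic_quotient (Z_Q_dual \<tau>) dual_kernel (\<lambda>s. 2 * (theta1.U s * theta1.U (s - 1 / 2))) (pi / 2) (3 * pi / 4)"
proof
  show "rapid_on_strip (pi / 2) dual_kernel" by (rule dual_kernel_rapid)
  show "0 < pi / 2" "pi / 2 < 3 * pi / 4" by simp_all
  show "laplace (\<lambda>t. dual_kernel (of_real t)) (1 - s) = laplace (\<lambda>t. dual_kernel (of_real t)) s" for s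
  proof -
    have "(1 - 2 * (1 - s))\<^sup>2 = (1 - 2 * s)\<^sup>2" by (simp add: power2_eq_square algebra_simps)
    moreover have "E.U (1 - s) = E.U s" using E.U_symmetric[of s] by simp
    ultimately show ?thesis unfolding laplace_dual_kernel by (simp only:)
  qed
  show "\<exists>B>0. \<forall>s. \<bar>Re s\<bar> \<ge> B \<longrightarrow> laplace (\<lambda>t. dual_kernel (of_real t)) s \<noteq> 0"
  proof -
    obtain B where B: "B > 0" "\<And>s. \<bar>Re s\<bar> \<ge> B \<Longrightarrow> E.U s \<noteq> 0" using E.U_nonzero by blast
    have "1 - 2 * s \<noteq> 0" if "\<bar>Re s\<bar> \<ge> 1" for s using that by (auto simp: complex_eq_iff)
    thus ?thesis unfolding laplace_dual_kernel using B by (intro exI[of _ "max B 1"]) auto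
  qed
  show "\<exists>a\<ge>a0. \<exists>c>0. \<forall>t. c * exp (- (pi / 2) * \<bar>t\<bar>) \<le> norm (laplace (\<lambda>t. dual_kernel (of_real t)) (Complex a t))" for a0
  proof -
    obtain a c where a: "a \<ge> max a0 1" "c > 0" "\<And>t. c * exp (- (pi / 2) * \<bar>t\<bar>) \<le> norm (E.U (Complex a t))"
      using E.U_lower_bound by blast
    have "c * exp (- (pi / 2) * \<bar>t\<bar>) \<le> norm ((1 - 2 * Complex a t)\<^sup>2 * E.U (Complex a t))" for t
    proof -
      have "1 \<le> \<bar>Re (1 - 2 * Complex a t)\<bar>" using a(1) by simp
      also have "\<dots> \<le> norm (1 - 2 * Complex a t)" by (rule abs_Re_le_cmod)
      finally have "1 \<le> norm ((1 - 2 * Complex a t)\<^sup>2)" unfolding norm_power by (rule one_le_power)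
      hence "1 * (c * exp (- (pi / 2) * \<bar>t\<bar>)) \<le> norm ((1 - 2 * Complex a t)\<^sup>2) * norm (E.U (Complex a t))"
        using a(2) by (intro mult_mono a(3)) auto
      thus ?thesis by (simp only: norm_mult mult_1)
    qed
    thus ?thesis unfolding laplace_dual_kernel using a by (intro exI[of _ a] conjI exI[of _ c]) auto
  qed
  have shift: "(\<lambda>s. theta1.U (s - 1 / 2)) holomorphic_on UNIV"
    by (rule compose_entire[OF theta1.U_holomorphic]) (intro holomorphic_intros)
  show "(\<lambda>s. 2 * (theta1.U s * theta1.U (s - 1 / 2))) holomorphic_on UNIV"
    by (intro holomorphic_intros theta1.U_holomorphic shift)
  show "2 * (theta1.U (1 - s) * theta1.U (1 - s - 1 / 2)) = 2 * (theta1.U s * theta1.U (s - 1 / 2))" for s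
  proof -
    have "theta1.U (1 - s) = theta1.U (s - 1 / 2)" using theta1.U_symmetric[of "s - 1 / 2"] by (simp add: algebra_simps)
    moreover have "theta1.U (1 - s - 1 / 2) = theta1.U s" using theta1.U_symmetric[of s] by (simp add: algebra_simps)
    ultimately show ?thesis by simp
  qed
  show "\<exists>C\<ge>0. \<forall>s. \<bar>Re s\<bar> \<le> M \<longrightarrow> norm (2 * (theta1.U s * theta1.U (s - 1 / 2))) \<le> C * exp (- (3 * pi / 4) * \<bar>Im s\<bar>)" for M
  proof -
    obtain C where C: "C \<ge> 0" "\<And>s. \<bar>Re s\<bar> \<le> M + 1 \<Longrightarrow> norm (theta1.U s) \<le> C * exp (- (3 * pi / 8) * \<bar>Im s\<bar>)"
      using theta1.U_decay[of "3 * pi / 8" "M + 1"] by auto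
    have "norm (2 * (theta1.U s * theta1.U (s - 1 / 2))) \<le> 2 * C\<^sup>2 * exp (- (3 * pi / 4) * \<bar>Im s\<bar>)" if s: "\<bar>Re s\<bar> \<le> M" for s
    proof -
      have "norm (theta1.U s) \<le> C * exp (- (3 * pi / 8) * \<bar>Im s\<bar>)" using s by (intro C(2)) simp
      moreover have "norm (theta1.U (s - 1 / 2)) \<le> C * exp (- (3 * pi / 8) * \<bar>Im (s - 1 / 2)\<bar>)"
        using s by (intro C(2)) (auto simp: abs_le_iff)
      ultimately have "norm (theta1.U s) * norm (theta1.U (s - 1 / 2)) \<le>
          (C * exp (- (3 * pi / 8) * \<bar>Im s\<bar>)) * (C * exp (- (3 * pi / 8) * \<bar>Im s\<bar>))"
        using C(1) by (intro mult_mono) auto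
      also have "\<dots> = C\<^sup>2 * exp (- (3 * pi / 4) * \<bar>Im s\<bar>)"
        by (simp add: power2_eq_square flip: exp_add)
      finally show ?thesis by (simp add: norm_mult)
    qed
    thus ?thesis by (intro exI[of _ "2 * C\<^sup>2"]) auto
  qed
  show "Z_Q_dual \<tau> = remove_sings (\<lambda>s. 2 * (theta1.U s * theta1.U (s - 1 / 2)) / laplace (\<lambda>t. dual_kernel (of_real t)) s)"
    unfolding laplace_dual_kernel by (rule Z_Q_dual_eq)
qed

end

theorem proposition6p9:
  fixes \<tau> :: complex
  assumes "Im \<tau> > 0"
  shows "(\<forall>Z \<in> {Z_Q \<tau>, Z_Q_dual \<tau>}.
            (\<exists>w>0. poles_in_strip Z w) \<and>
            (\<forall>w c. w > 0 \<and> poles_in_strip Z w \<and> c > 1 / 2 + w \<longrightarrow>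
               (\<forall>x>0. integrable lborel (mellin_integrand Z c x)) \<and>
               C_poly_mean_periodic (boundary_fun Z c) \<and>
               S_dual_mean_periodic (boundary_fun Z c))) \<and>
         (\<forall>w c. w > 0 \<and> poles_in_strip (Z_Q \<tau>) w \<and> c > 1 / 2 + w \<longrightarrow>
            (\<exists>x>0. boundary_fun (Z_Q \<tau>) c x \<noteq> 0) \<longrightarrow>
            single_sign (boundary_fun (Z_Q \<tau>) c) \<longrightarrow>
            (\<forall>s. is_pole (Z_Q \<tau>) s \<longrightarrow> Re s = 1 / 2))"
proof -
  note Q = Z_Q_quotient[OF assms] and D = Z_Q_dual_quotient[OF assms]
  have "(\<exists>w>0. poles_in_strip Z w) \<and>
            (\<forall>w c. w > 0 \<and> poles_in_strip Z w \<and> c > 1 / 2 + w \<longrightarrow>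
               (\<forall>x>0. integrable lborel (mellin_integrand Z c x)) \<and>
               C_poly_mean_periodic (boundary_fun Z c) \<and>
               S_dual_mean_periodic (boundary_fun Z c))" if "meromorphic_quotient Z f P \<alpha> \<gamma>" for Z f P \<alpha> \<gamma>
    using meromorphic_quotient.ex_poles_in_strip[OF that] meromorphic_quotient.mean_periodic[OF that] by blast
  from this[OF Q] this[OF D]
  have 1: "\<forall>Z \<in> {Z_Q \<tau>, Z_Q_dual \<tau>}.
            (\<exists>w>0. poles_in_strip Z w) \<and>
            (\<forall>w c. w > 0 \<and> poles_in_strip Z w \<and> c > 1 / 2 + w \<longrightarrow>
               (\<forall>x>0. integrable lborel (mellin_integrand Z c x)) \<and>
               C_poly_mean_periodic (boundary_fun Z c) \<and>
               S_dual_mean_periodic (boundary_fun Z c))" by simp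
  have "\<not> is_pole (Z_Q \<tau>) s" if "w > 0" "poles_in_strip (Z_Q \<tau>) w" "c > 1 / 2 + w" "single_sign (boundary_fun (Z_Q \<tau>) c)" for w c s
    by (rule meromorphic_quotient.single_sign_no_poles[OF Q that(1-3) laplace_half_real_nonzero that(4)])
  with 1 show ?thesis by blast
qed

end
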